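(* Let $k$ be a natural number. (1) Let $z\ne1$ be a positive real number and $H$ a positive real number. Then $$\sum_{p\le x}|c_{p-1}(k)|^z=A\prod_{q\mid k}\Big(1+\frac{(q^{\nu_q(k)(z-1)}-1)(q-1)\big[(q-1)^z+q^{z-1}-1\big]}{(q^2-q-1)(q^{z-1}-1)}\Big)\mathrm{Li}(x)+O\Big(\frac{x}{\log^Hx}\Big),$$ where $p$ runs over primes, $q$ over primes dividing $k$, and the implied constant depends at most on $k$ and $H$. (2) If Conjecture 1 (stated in the context) holds and $j$ is an odd natural number, then $\sum_{p\le x}c_{p-1}(k)^j=o(\pi(x))$, where the implied constant depends at most on $k$ and $j$.
   Context: $c_n(m)=\sum_{1\le j\le n,\,(j,n)=1}e^{2\pi ijm/n}$ is the Ramanujan sum; $\nu_q(n)$ is the exponent of the prime $q$ in $n$; $A=\prod_p(1-\frac1{p(p-1)})$; $\mathrm{Li}(x)=\int_2^xdt/\log t$; $\pi(x)$ is the number of primes $\le x$. For a finite (possibly empty) set $S=\{q_1<\dots<q_t\}$ of primes put $\nu_S(n)=(\nu_{q_1}(n),\dots,\nu_{q_t}(n))$; $n$ is $S$-squarefree if $q^2\nmid n$ for every prime $q\notin S$; $\mu_S(n)=(-1)^{\#\{q\mid n:\,q\notin S\}}$ if $n$ is $S$-squarefree, else $0$. Conjecture 1: for every such $S$ and every tuple $(e_1,\dots,e_t)$ of nonnegative integers, $\sum_{p\le x,\ \nu_S(p-1)=(e_1,\dots,e_t)}\mu_S(p-1)=o(\pi(x))$ as $x\to\infty$.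
   Formalization: In (1) the implied constant may depend on k, H and an upper bound Z for z (uniform for 0<z≤Z, z≠1); a constant depending only on k and H is impossible, e.g. for k=3, dividing by 3^z and letting z→∞ would force an integer count to equal (2/15)A Li(x). *)

theory Defs
  imports
    "HOL-Analysis.Analysis"
    "HOL-Computational_Algebra.Primes"
    "HOL-Library.Landau_Symbols"
begin

definition ramanujan_sum :: "nat \<Rightarrow> nat \<Rightarrow> complex" where
  "ramanujan_sum n m =
     (\<Sum>j | 1 \<le> j \<and> j \<le> n \<and> coprime j n.
        exp (2 * complex_of_real pi * \<i> * of_nat j * of_nat m / of_nat n))"

definition primes_upto :: "real \<Rightarrow> nat set" where
  "primes_upto x = {p. prime p \<and> real p \<le> x}"

definition prime_count :: "real \<Rightarrow> real" where
  "prime_count x = real (card (primes_upto x))"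

definition Li :: "real \<Rightarrow> real" where
  "Li x = integral {2..x} (\<lambda>t. 1 / ln t)"

definition artin_constant :: real where
  "artin_constant =
     (\<Prod>p. if prime p then 1 - 1 / (real p * (real p - 1)) else 1)"

definition nu_tuple :: "nat set \<Rightarrow> nat \<Rightarrow> nat list" where
  "nu_tuple S n = map (\<lambda>q. multiplicity q n) (sorted_list_of_set S)"

definition S_squarefree :: "nat set \<Rightarrow> nat \<Rightarrow> bool" where
  "S_squarefree S n \<longleftrightarrow> (\<forall>q. prime q \<and> q \<notin> S \<longrightarrow> \<not> q\<^sup>2 dvd n)"

definition mu_S :: "nat set \<Rightarrow> nat \<Rightarrow> real" where
  "mu_S S n =
     (if S_squarefree S n then (- 1) ^ card {q. prime q \<and> q dvd n \<and> q \<notin> S} else 0)"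

definition conjecture1 :: bool where
  "conjecture1 \<longleftrightarrow>
     (\<forall>S es. finite S \<and> (\<forall>q\<in>S. prime q) \<and> length es = card S \<longrightarrow>
        (\<lambda>x. \<Sum>p | p \<in> primes_upto x \<and> nu_tuple S (p - 1) = es. mu_S S (p - 1))
          \<in> o[at_top](prime_count))"

definition local_factor :: "nat \<Rightarrow> real \<Rightarrow> nat \<Rightarrow> real" where
  "local_factor k z q =
     1 + (real q powr (real (multiplicity q k) * (z - 1)) - 1) * (real q - 1)
           * ((real q - 1) powr z + real q powr (z - 1) - 1)
         / (((real q)\<^sup>2 - real q - 1) * (real q powr (z - 1) - 1))"

end

theory Submission
  imports
    Defs
    "HOL-Complex_Analysis.Complex_Analysis"
    "HOL-Computational_Algebra.Squarefree"
    "HOL-Number_Theory.Prime_Powers"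
    "HOL-Number_Theory.Residues"
begin

text \<open>
  The Ramanujan sum is multiplicative, and its local factor at \<open>q\<close> depends only on the exponents of \<open>q\<close> in the two
  arguments; it vanishes when the exponent in \<open>p - 1\<close> exceeds that in \<open>k\<close> by more than one. With \<open>S\<close> the set of primes
  dividing \<open>k\<close>, this writes \<open>c_(p-1)(k)\<close> as \<open>\<mu>_S(p - 1)\<close> times a function of the exponent vector \<open>\<nu>_S(p - 1)\<close> that is
  supported on finitely many vectors, and part (2) follows termwise from the conjecture. For part (1) one has to count
  the primes up to \<open>x\<close> for which \<open>p - 1\<close> is \<open>S\<close>-squarefree with prescribed exponents at \<open>S\<close>. Inclusion-exclusion reduces
  this to primes congruent to 1 modulo \<open>m d\<^sup>2\<close> with \<open>d\<close> at most a power of \<open>log x\<close>, the rest being bounded trivially.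

  The required Siegel-Walfisz estimate is obtained without zero-free regions or analytic continuation. Partial
  summation bounds the derivatives of the L-functions in \<open>Re s > 1\<close> by small powers of \<open>q(|t| + 2)\<close>; the 3-4-1 inequality
  and Siegel's theorem bound the L-functions from below in the same way. Since differentiation of a Dirichlet series
  multiplies its coefficients by logarithms, the coefficients \<open>\<chi>(n) \<Lambda>(n) (log n)^k\<close> then have a Dirichlet series bounded by
  \<open>(q(|t| + 2))^(1/2)\<close> up to the line \<open>Re s = 1\<close>. A smoothed Perron formula and removal of the weight \<open>(log n)^k\<close> save \<open>k/2\<close>
  powers of the logarithm.
\<close>

text \<open>Why this is strong enough: the moduli that occur are powers of \<open>log x\<close>, so
  a factor \<open>q\<close> in the error term is harmless, whereas any number of powers of
  \<open>log x\<close> must be saved. Perron's integral is taken on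
  \<open>Re s = 1 + 1/log x\<close>, where \<open>x^s\<close> has size \<open>e x\<close>; the
  integrand only has to be integrable along the whole line, uniformly as the line approaches 1. With
  the kernel \<open>1/s^2\<close> a growth of \<open>|t|^(1/2)\<close> is allowed. The
  \<open>k\<close>-th derivative of the logarithmic derivative is a polynomial of degree
  \<open>k + 1\<close> in the quotients \<open>L^(j)/L\<close>, so each factor may cost an exponent
  \<open>1/(4(k+1))\<close> twice, once for the derivatives and once for \<open>1/L\<close>; hence
  the preliminary estimates come with an arbitrary exponent \<open>ep\<close>. The weighted smoothed
  sums then carry no logarithm at all, while trivially they could be as large as
  \<open>x (log x)^(k+1)\<close>, and half of this gap survives the passage to sharp sums. The
  constants are not computable because of Siegel's bound for real characters near
  \<open>s = 1\<close>.\<close>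

section \<open>Logarithms against powers, sums of powers, summation by parts\<close>

lemma ln_power_le_powr:
  fixes de :: real and j :: nat
  assumes "de > 0"
  obtains C where "C \<ge> 1" "\<And>x::real. x \<ge> 1 \<Longrightarrow> ln x ^ j \<le> C * x powr de"
proof (cases "j = 0")
  case True
  show ?thesis
  proof (rule that[of 1])
    fix x :: real assume "x \<ge> 1"
    then show "ln x ^ j \<le> 1 * x powr de" using True assms by (simp add: ge_one_powr_ge_zero)
  qed simp
next
  case False
  show ?thesis
  proof (rule that[of "max 1 ((j / de) ^ j)"])
    fix x :: real assume x: "x \<ge> 1"
    have "ln x \<le> x powr (de / j) / (de / j)"
      using ln_powr_bound[of x "de / j"] x False assms by simp
    then have "ln x ^ j \<le> (x powr (de / j) / (de / j)) ^ j"
      using x by (intro power_mono) auto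
    also have "\<dots> = (j / de) ^ j * x powr de"
      using x False assms by (simp add: power_divide powr_power field_simps)
    also have "\<dots> \<le> max 1 ((j / de) ^ j) * x powr de"
      by (intro mult_right_mono) auto
    finally show "ln x ^ j \<le> max 1 ((j / de) ^ j) * x powr de" .
  qed simp
qed

lemma powr_diff_mvt:
  fixes x a :: real
  assumes "x > 0"
  obtains xi where "x < xi" "xi < x + 1" "(x + 1) powr a - x powr a = a * xi powr (a - 1)"
proof -
  have "\<exists>z>x. z < x + 1 \<and> (x + 1) powr a - x powr a = (x + 1 - x) * (a * z powr (a - 1))"
    using assms by (intro MVT2) (auto intro!: derivative_eq_intros)
  then show ?thesis using that by auto
qed

lemma sum_powr_head:
  fixes ep :: real
  assumes "0 < ep" "ep \<le> 1"
  shows "(\<Sum>n=1..N. real n powr (ep - 1)) \<le> real N powr ep / ep"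
proof (induction N)
  case 0
  then show ?case by simp
next
  case (Suc N)
  have "real (Suc N) powr (ep - 1) \<le> (real (Suc N) powr ep - real N powr ep) / ep"
  proof (cases "N = 0")
    case True
    then show ?thesis using assms by (simp add: field_simps)
  next
    case False
    then obtain xi where xi: "real N < xi" "xi < real N + 1"
      "(real N + 1) powr ep - real N powr ep = ep * xi powr (ep - 1)"
      using powr_diff_mvt[of "real N" ep] by auto
    have "(real N + 1) powr (ep - 1) \<le> xi powr (ep - 1)"
      using xi False assms by (intro powr_mono2') auto
    then show ?thesis using xi(3) assms by (simp add: field_simps add.commute)
  qed
  with Suc show ?case by (simp add: field_simps diff_divide_distrib)
qed

lemma sum_powr_tail:
  fixes th :: real
  assumes "0 < th" "1 \<le> M"
  shows "(\<Sum>n\<in>{M<..N}. real n powr (- 1 - th)) \<le> real M powr (- th) / th"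
proof -
  have "(\<Sum>n\<in>{M<..N}. real n powr (- 1 - th)) \<le> (real M powr (- th) - real N powr (-th)) / th" if "M \<le> N"
    using that
  proof (induction N rule: dec_induct)
    case base
    then show ?case by simp
  next
    case (step N)
    have N: "N > 0" using step assms by simp
    have "real (Suc N) powr (- 1 - th) \<le> (real N powr (-th) - real (Suc N) powr (-th)) / th"
    proof -
      obtain xi where xi: "real N < xi" "xi < real N + 1"
        "(real N + 1) powr (-th) - real N powr (-th) = (-th) * xi powr (-1 - th)"
        using powr_diff_mvt[of "real N" "-th"] N by (auto simp: minus_diff_commute[of _ 1] algebra_simps)
      have "(real N + 1) powr (-1-th) \<le> xi powr (-1-th)"
        using xi N assms powr_mono2'[of "-1-th" xi "real N + 1"] by simp
      then have "th * (real N + 1) powr (-1-th) \<le> th * xi powr (-1-th)"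
        using assms by (intro mult_left_mono) auto
      then have "real (Suc N) powr (- 1 - th) * th \<le> real N powr (-th) - real (Suc N) powr (-th)"
        using xi(3) by (simp only: of_nat_Suc add.commute[of 1] mult.commute[of _ th])
      then show ?thesis using assms by (simp only: pos_le_divide_eq)
    qed
    moreover have "{M<..Suc N} = insert (Suc N) {M<..N}" using step by auto
    ultimately show ?case using step.IH by (simp add: field_simps diff_divide_distrib)
  qed
  moreover have "(real M powr (- th) - real N powr (-th)) / th \<le> real M powr (- th) / th"
    using assms by (simp add: divide_right_mono)
  ultimately show ?thesis using assms by (cases "M \<le> N") force+
qed

lemma abel_sum_identity:
  fixes c g :: "nat \<Rightarrow> 'a::comm_ring"
  assumes "M \<le> N"
  shows "(\<Sum>n\<in>{M<..N}. c n * g n) =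
    (\<Sum>n\<in>{M<..N}. c n) * g N + (\<Sum>n\<in>{M<..<N}. (\<Sum>m\<in>{M<..n}. c m) * (g n - g (Suc n)))"
  using assms
proof (induction N rule: dec_induct)
  case base
  then show ?case by simp
next
  case (step N)
  have eq: "{M<..Suc N} = insert (Suc N) {M<..N}" using step by auto
  have greaterThanAtMost_Suc_same: "{N<..Suc N} = {Suc N}" by auto
  have eq2: "(\<Sum>n\<in>{M<..<Suc N}. f n) = (if M < N then f N else 0) + (\<Sum>n\<in>{M<..<N}. f n)"
    for f :: "nat \<Rightarrow> 'a"
  proof (cases "M < N")
    case True
    then have "{M<..<Suc N} = insert N {M<..<N}" by auto
    with True show ?thesis by simp
  next
    case False
    then have "{M<..<Suc N} = {}" "{M<..<N} = {}" by auto
    with False show ?thesis by simp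
  qed
  show ?case
  proof (cases "M < N")
    case False
    then have "M = N" using step by simp
    then show ?thesis by (simp add: eq2 greaterThanAtMost_Suc_same algebra_simps)
  qed (use step in \<open>simp_all add: eq eq2 algebra_simps\<close>)
qed

text \<open>The total variation of \<open>g\<close> takes the place of monotonicity, so that complex
  weights such as \<open>n powr (- s)\<close> are covered.\<close>

lemma abel_sum_bound:
  fixes c g :: "nat \<Rightarrow> 'a::{real_normed_field}"
  assumes B: "\<And>m. norm (\<Sum>n\<in>{M<..m}. c n) \<le> B"
  shows "norm (\<Sum>n\<in>{M<..N}. c n * g n) \<le> B * (norm (g N) + (\<Sum>n\<in>{M<..<N}. norm (g n - g (Suc n))))"
proof (cases "M \<le> N")
  case True
  have B0: "B \<ge> 0" using B[of 0] norm_ge_zero order_trans by blast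
  have "norm (\<Sum>n\<in>{M<..N}. c n * g n) \<le>
    norm ((\<Sum>n\<in>{M<..N}. c n) * g N) + norm (\<Sum>n\<in>{M<..<N}. (\<Sum>m\<in>{M<..n}. c m) * (g n - g (Suc n)))"
    unfolding abel_sum_identity[OF True] by (rule norm_triangle_ineq)
  also have "\<dots> \<le> B * norm (g N) + (\<Sum>n\<in>{M<..<N}. B * norm (g n - g (Suc n)))"
    by (intro add_mono order_trans[OF norm_sum] sum_mono)
       (auto simp: norm_mult intro!: mult_right_mono B)
  finally show ?thesis by (simp add: sum_distrib_left algebra_simps)
next
  case False
  have "B \<ge> 0" using B[of 0] norm_ge_zero order_trans by blast
  then show ?thesis using False by (simp add: sum_nonneg)
qed

lemma split_at_nat:
  fixes x :: real
  assumes "x \<ge> 1"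
  obtains N0 :: nat where "N0 \<ge> 1" "x \<le> real N0" "real N0 \<le> 2 * x"
proof -
  have "x \<le> real (nat \<lceil>x\<rceil>)" "real (nat \<lceil>x\<rceil>) \<le> x + 1" "nat \<lceil>x\<rceil> \<ge> 1"
    using assms by linarith+
  then show ?thesis using that[of "nat \<lceil>x\<rceil>"] assms by linarith
qed

lemma sum_split_at:
  fixes f :: "nat \<Rightarrow> 'a::comm_monoid_add"
  assumes "M \<le> N"
  shows "(\<Sum>n=1..N. f n) = (\<Sum>n=1..M. f n) + (\<Sum>n\<in>{M<..N}. f n)"
proof -
  have "{1..N} = {1..M} \<union> {M<..N}" using assms by auto
  then show ?thesis by (simp only:) (rule sum.union_disjoint, auto)
qed

lemma powr_head_bound:
  fixes ep x :: real
  assumes "0 < ep" "ep \<le> 1" "x \<ge> 1" "real N \<le> 2 * x"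
  shows "(\<Sum>n=1..N. real n powr (ep - 1)) \<le> 2 / ep * x powr ep"
proof -
  have "(\<Sum>n=1..N. real n powr (ep - 1)) \<le> real N powr ep / ep" by (rule sum_powr_head) (use assms in auto)
  also have "real N powr ep \<le> (2 * x) powr ep" using assms by (intro powr_mono2) auto
  also have "\<dots> = 2 powr ep * x powr ep" using assms by (simp add: powr_mult)
  also have "2 powr ep \<le> 2 powr (1::real)" using assms by (intro powr_mono) auto
  finally show ?thesis using assms by (simp add: divide_right_mono mult_right_mono)
qed

lemma powr_tail_bound:
  fixes ep x :: real
  assumes "0 < ep" "ep \<le> 1/2" "x \<ge> 1" "x \<le> real N0"
  shows "x * (\<Sum>n\<in>{N0<..N}. real n powr (ep - 2)) \<le> 2 * x powr ep"
proof -
  have N0: "N0 \<ge> 1" using assms by linarith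
  have "(\<Sum>n\<in>{N0<..N}. real n powr (ep - 2)) \<le> real N0 powr (ep - 1) / (1 - ep)"
    using sum_powr_tail[of "1 - ep" N0 N] N0 assms by simp
  also have "\<dots> \<le> real N0 powr (ep - 1) / (1/2)" using assms by (intro divide_left_mono) auto
  also have "real N0 powr (ep - 1) \<le> x powr (ep - 1)" using assms by (intro powr_mono2') auto
  finally have "x * (\<Sum>n\<in>{N0<..N}. real n powr (ep - 2)) \<le> x * (x powr (ep - 1) * 2)"
    using assms by (intro mult_left_mono) auto
  also have "\<dots> = 2 * x powr ep" using assms by (simp add: powr_diff)
  finally show ?thesis .
qed

text \<open>The cut-off is placed at \<^term>\<open>q * R\<close>, where the trivial bound and the bound by partial summation balance.\<close>

lemma partial_summation_bound:
  fixes c g :: "nat \<Rightarrow> complex" and ep q K R :: real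
  assumes ep: "0 < ep" "ep \<le> 1/2" and q: "q \<ge> 1" and R: "R \<ge> 1" and K: "K \<ge> 0"
    and c1: "\<And>n. norm (c n) \<le> 1" and cq: "\<And>M N. norm (\<Sum>n\<in>{M<..N}. c n) \<le> q"
    and g1: "\<And>n. n \<ge> 1 \<Longrightarrow> norm (g n) \<le> K * real n powr (ep - 1)"
    and g2: "\<And>n. n \<ge> 1 \<Longrightarrow> norm (g n - g (Suc n)) \<le> K * R * real n powr (ep - 2)"
  shows "norm (\<Sum>n=1..N. c n * g n) \<le> 5 / ep * K * (q * R) powr ep"
proof -
  have qR: "q * R \<ge> 1" using q R mult_mono[of 1 q 1 R] by simp
  obtain N0 :: nat where N0: "N0 \<ge> 1" "q * R \<le> real N0" "real N0 \<le> 2 * (q * R)"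
    using split_at_nat[OF qR] .
  have head: "norm (\<Sum>n=1..M. c n * g n) \<le> 2 / ep * K * (q * R) powr ep" if "M \<le> N0" for M
  proof -
    have "norm (\<Sum>n=1..M. c n * g n) \<le> (\<Sum>n=1..M. K * real n powr (ep - 1))"
    proof (rule sum_norm_le)
      fix n assume n: "n \<in> {1..M}"
      have "norm (c n) * norm (g n) \<le> 1 * (K * real n powr (ep - 1))"
        by (intro mult_mono c1 g1) (use n in auto)
      then show "norm (c n * g n) \<le> K * real n powr (ep - 1)" by (simp add: norm_mult)
    qed
    also have "\<dots> \<le> K * (2 / ep * (q * R) powr ep)"
      unfolding sum_distrib_left[symmetric]
      by (intro mult_left_mono powr_head_bound) (use ep qR N0 that K in auto)
    finally show ?thesis by (simp add: algebra_simps)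
  qed
  show ?thesis
  proof (cases "N \<le> N0")
    case True
    have "2 / ep * K * (q * R) powr ep \<le> 5 / ep * K * (q * R) powr ep"
      using K ep by (intro mult_right_mono divide_right_mono) auto
    with head[OF True] show ?thesis by simp
  next
    case False
    have "norm (\<Sum>n\<in>{N0<..N}. c n * g n) \<le>
        q * (norm (g N) + (\<Sum>n\<in>{N0<..<N}. norm (g n - g (Suc n))))"
      by (rule abel_sum_bound) (rule cq)
    also have "\<dots> \<le> q * (K * (q * R) powr (ep - 1) + (\<Sum>n\<in>{N0<..<N}. K * R * real n powr (ep - 2)))"
    proof (intro mult_left_mono add_mono sum_mono g2)
      have "norm (g N) \<le> K * real N powr (ep - 1)" using g1 False by simp
      also have "real N powr (ep - 1) \<le> (q * R) powr (ep - 1)"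
        using ep qR N0 False by (intro powr_mono2') auto
      finally show "norm (g N) \<le> K * (q * R) powr (ep - 1)" using K by (simp add: mult_left_mono)
    qed (use q in auto)
    also have "\<dots> \<le> q * R * (K * (q * R) powr (ep - 1)) + K * (q * R * (\<Sum>n\<in>{N0<..N}. real n powr (ep - 2)))"
    proof -
      have "(\<Sum>n\<in>{N0<..<N}. real n powr (ep - 2)) \<le> (\<Sum>n\<in>{N0<..N}. real n powr (ep - 2))"
        by (rule sum_mono2) auto
      then have a: "q * (\<Sum>n\<in>{N0<..<N}. K * R * real n powr (ep - 2)) \<le> K * (q * R * (\<Sum>n\<in>{N0<..N}. real n powr (ep - 2)))"
        using q R K by (simp add: sum_distrib_left[symmetric] mult_ac mult_left_mono)
      have "q * 1 \<le> q * R" using q R by (intro mult_left_mono) auto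
      then have "q * (K * (q * R) powr (ep - 1)) \<le> q * R * (K * (q * R) powr (ep - 1))"
        using K by (intro mult_right_mono) auto
      with a show ?thesis by (simp add: distrib_left)
    qed
    also have "\<dots> \<le> K * (q * R) powr ep + K * (2 * (q * R) powr ep)"
      by (intro add_mono mult_left_mono powr_tail_bound) (use ep qR N0 K in \<open>auto simp: powr_diff field_simps\<close>)
    finally have tail: "norm (\<Sum>n\<in>{N0<..N}. c n * g n) \<le> 3 * K * (q * R) powr ep" by simp
    have "norm (\<Sum>n=1..N. c n * g n) \<le> norm (\<Sum>n=1..N0. c n * g n) + norm (\<Sum>n\<in>{N0<..N}. c n * g n)"
      using sum_split_at[of N0 N "\<lambda>n. c n * g n"] False by (metis nat_le_linear norm_triangle_ineq)
    also have "\<dots> \<le> 2 / ep * K * (q * R) powr ep + 3 * K * (q * R) powr ep"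
      by (intro add_mono head tail) simp
    also have "\<dots> \<le> 5 / ep * K * (q * R) powr ep"
    proof -
      have "3 \<le> 3 / ep" using ep by (simp add: field_simps)
      then have "3 * (K * (q * R) powr ep) \<le> 3 / ep * (K * (q * R) powr ep)"
        using K by (intro mult_right_mono) auto
      moreover have "2 / ep * K * (q * R) powr ep + 3 / ep * (K * (q * R) powr ep) = 5 / ep * K * (q * R) powr ep"
        using ep by (simp add: divide_simps)
      ultimately show ?thesis by linarith
    qed
    finally show ?thesis .
  qed
qed

lemma two_range_sum_bound:
  fixes h :: "nat \<Rightarrow> complex" and ep K R :: real
  assumes ep: "0 < ep" "ep \<le> 1/2" and R: "R \<ge> 1" and K: "K \<ge> 0"
    and h1: "\<And>n. n \<ge> 1 \<Longrightarrow> norm (h n) \<le> 2 * K * real n powr (ep - 1)"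
    and h2: "\<And>n. n \<ge> 1 \<Longrightarrow> norm (h n) \<le> K * R * real n powr (ep - 2)"
  shows "norm (\<Sum>n=1..N. h n) \<le> 5 / ep * K * R powr ep"
proof -
  obtain N0 :: nat where N0: "N0 \<ge> 1" "R \<le> real N0" "real N0 \<le> 2 * R"
    using split_at_nat[OF R] .
  have 1: "norm (\<Sum>n=1..M. h n) \<le> 4 / ep * K * R powr ep" if "M \<le> N0" for M
  proof -
    have "norm (\<Sum>n=1..M. h n) \<le> (\<Sum>n=1..M. 2 * K * real n powr (ep - 1))"
      by (rule sum_norm_le) (use h1 in auto)
    also have "\<dots> \<le> 2 * K * (2 / ep * R powr ep)"
      unfolding sum_distrib_left[symmetric]
      by (intro mult_left_mono powr_head_bound) (use ep R N0 that K in auto)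
    finally show ?thesis by (simp add: algebra_simps)
  qed
  show ?thesis
  proof (cases "N \<le> N0")
    case True
    have "4 / ep * K * R powr ep \<le> 5 / ep * K * R powr ep"
      using K ep by (intro mult_right_mono divide_right_mono) auto
    with 1[OF True] show ?thesis by simp
  next
    case False
    have "norm (\<Sum>n\<in>{N0<..N}. h n) \<le> (\<Sum>n\<in>{N0<..N}. K * R * real n powr (ep - 2))"
      by (rule sum_norm_le) (use h2 in auto)
    also have "\<dots> = K * (R * (\<Sum>n\<in>{N0<..N}. real n powr (ep - 2)))" by (simp add: sum_distrib_left mult_ac)
    also have "\<dots> \<le> K * (2 * R powr ep)"
      by (intro mult_left_mono powr_tail_bound) (use ep R N0 K in auto)
    finally have tail: "norm (\<Sum>n\<in>{N0<..N}. h n) \<le> 2 * K * R powr ep" by simp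
    have "norm (\<Sum>n=1..N. h n) \<le> norm (\<Sum>n=1..N0. h n) + norm (\<Sum>n\<in>{N0<..N}. h n)"
      using sum_split_at[of N0 N h] False by (metis nat_le_linear norm_triangle_ineq)
    then have "norm (\<Sum>n=1..N. h n) \<le> 4 / ep * K * R powr ep + 2 * K * R powr ep"
      using 1[of N0] tail by simp
    moreover have "2 * (K * R powr ep) \<le> 1 / ep * (K * R powr ep)"
      using K ep by (intro mult_right_mono) (auto simp: field_simps)
    ultimately show ?thesis using ep by (simp add: field_simps)
  qed
qed

subsection \<open>Terms of Dirichlet series\<close>

text \<open>Up to sign the general term of the \<open>j\<close>-th derivative of zeta, as a function
  of the summation variable; \<open>z\<close> is complex so that the mean value inequality applies
  on the segments between consecutive integers.\<close>

definition log_term :: "nat \<Rightarrow> complex \<Rightarrow> complex \<Rightarrow> complex" where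
  "log_term j s z = Ln z ^ j * z powr (- s)"

lemma log_term_has_field_derivative:
  assumes "Re z > 0"
  shows "(log_term j s has_field_derivative
    (of_nat j * Ln z ^ (j - 1) - s * Ln z ^ j) * z powr (- s - 1)) (at z)"
proof -
  have z: "z \<notin> \<real>\<^sub>\<le>\<^sub>0" "z \<noteq> 0" using assms by (auto simp: complex_nonpos_Reals_iff)
  have "((\<lambda>z. Ln z ^ j * z powr (- s)) has_field_derivative
    of_nat j * (inverse z * Ln z ^ (j - 1)) * z powr (- s) + (- s * z powr (- s - 1)) * Ln z ^ j) (at z)"
    using z by (auto intro!: derivative_eq_intros)
  moreover have "inverse z * z powr (- s) = z powr (- s - 1)"
    using z by (simp add: powr_diff field_simps)
  then have "of_nat j * (inverse z * Ln z ^ (j - 1)) * z powr (- s) + (- s * z powr (- s - 1)) * Ln z ^ j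
     = (of_nat j * Ln z ^ (j - 1) - s * Ln z ^ j) * z powr (- s - 1)"
    by (simp add: algebra_simps)
  ultimately show ?thesis unfolding log_term_def[abs_def] by simp
qed

lemma closed_segment_of_realE:
  assumes "z \<in> closed_segment (complex_of_real u) (of_real v)" "u \<le> v"
  obtains x where "z = of_real x" "u \<le> x" "x \<le> v"
  using assms by (auto simp: closed_segment_of_real closed_segment_eq_real_ivl)

lemma norm_of_real_powr:
  assumes "x > 0"
  shows "norm (complex_of_real x powr z) = x powr Re z"
  using assms by (simp add: norm_powr_real_powr)

text \<open>These are the two hypotheses of the summation lemmas with
  \<open>R = \<bar>Im s\<bar> + 2\<close>: a power \<open>ep\<close> absorbs the logarithms, and
  differentiation brings down a factor \<open>s\<close>, whose norm is at most
  \<open>\<bar>Im s\<bar> + 2\<close> in the strip.\<close>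

lemma log_term_bounds:
  fixes ep :: real and j :: nat
  assumes "ep > 0" "ep \<le> 1/2"
  obtains K where "K \<ge> 1"
    "\<And>s u. \<lbrakk>1 \<le> Re s; Re s \<le> 2; u \<ge> 1\<rbrakk> \<Longrightarrow> norm (log_term j s (of_real u)) \<le> K * u powr (ep - 1)"
    "\<And>s u v. \<lbrakk>1 \<le> Re s; Re s \<le> 2; u \<ge> 1; u \<le> v; v \<le> u + 1\<rbrakk> \<Longrightarrow>
      norm (log_term j s (of_real u) - log_term j s (of_real v)) \<le> K * (\<bar>Im s\<bar> + 2) * u powr (ep - 2)"
proof -
  obtain C1 where C1: "C1 \<ge> 1" "\<And>x::real. x \<ge> 1 \<Longrightarrow> ln x ^ (j - 1) \<le> C1 * x powr ep"
    using ln_power_le_powr[OF assms(1)] by metis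
  obtain C2 where C2: "C2 \<ge> 1" "\<And>x::real. x \<ge> 1 \<Longrightarrow> ln x ^ j \<le> C2 * x powr ep"
    using ln_power_le_powr[OF assms(1)] by metis
  define K where "K = real j * C1 + C2"
  have nrm: "norm (log_term j s (of_real u)) = ln u ^ j * u powr (- Re s)" if "u \<ge> 1" for s u
    using that by (simp add: log_term_def norm_mult norm_power norm_of_real_powr Ln_of_real)
  show ?thesis
  proof (rule that[of K])
    show "K \<ge> 1" using C1 C2 unfolding K_def by (smt (verit) mult_nonneg_nonneg of_nat_0_le_iff)
    fix s :: complex and u :: real assume s: "1 \<le> Re s" "Re s \<le> 2" and u: "u \<ge> 1"
    have "ln u ^ j * u powr (- Re s) \<le> (C2 * u powr ep) * u powr (- 1)"
      using s u C2 by (intro mult_mono powr_mono) auto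
    also have "\<dots> = C2 * u powr (ep - 1)" using u by (simp add: powr_diff powr_minus field_simps)
    also have "\<dots> \<le> K * u powr (ep - 1)" using C1 by (intro mult_right_mono) (auto simp: K_def)
    finally show "norm (log_term j s (of_real u)) \<le> K * u powr (ep - 1)" using nrm u by simp
  next
    fix s :: complex and u v :: real
    assume s: "1 \<le> Re s" "Re s \<le> 2" and u: "u \<ge> 1" "u \<le> v" "v \<le> u + 1"
    let ?S = "closed_segment (complex_of_real u) (of_real v)"
    let ?d = "\<lambda>z. (of_nat j * Ln z ^ (j - 1) - s * Ln z ^ j) * z powr (- s - 1)"
    let ?B = "K * (\<bar>Im s\<bar> + 2) * u powr (ep - 2)"
    have d: "norm (?d z) \<le> ?B \<and> Re z > 0" if zS: "z \<in> ?S" for z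
    proof -
      obtain x where x: "z = of_real x" "u \<le> x" "x \<le> v" using zS u(2) by (rule closed_segment_of_realE)
      have x1: "x \<ge> 1" using x u by simp
      have "norm s \<le> \<bar>Im s\<bar> + 2" using cmod_le[of s] s by simp
      then have "norm (of_nat j * Ln z ^ (j - 1) - s * Ln z ^ j) \<le> real j * (C1 * x powr ep) + (\<bar>Im s\<bar> + 2) * (C2 * x powr ep)"
        using x x1 C1(2)[OF x1] C2(2)[OF x1]
        by (intro order_trans[OF norm_triangle_ineq4] add_mono)
           (auto simp: norm_mult norm_power Ln_of_real intro!: mult_mono mult_left_mono)
      also have "\<dots> \<le> K * (\<bar>Im s\<bar> + 2) * x powr ep"
      proof -
        have "real j * C1 * 1 \<le> real j * C1 * (\<bar>Im s\<bar> + 2)" using C1 by (intro mult_left_mono) auto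
        then have "real j * C1 + (\<bar>Im s\<bar> + 2) * C2 \<le> K * (\<bar>Im s\<bar> + 2)" by (simp add: K_def algebra_simps)
        then have "(real j * C1 + (\<bar>Im s\<bar> + 2) * C2) * x powr ep \<le> K * (\<bar>Im s\<bar> + 2) * x powr ep"
          by (intro mult_right_mono) auto
        then show ?thesis by (simp add: algebra_simps)
      qed
      finally have 1: "norm (of_nat j * Ln z ^ (j - 1) - s * Ln z ^ j) \<le> K * (\<bar>Im s\<bar> + 2) * x powr ep" .
      have 2: "norm (z powr (- s - 1)) \<le> x powr (- 2)"
        using x x1 s by (simp add: norm_of_real_powr powr_mono)
      have K0: "K \<ge> 0" using C1 C2 by (simp add: K_def)
      have "norm (?d z) \<le> K * (\<bar>Im s\<bar> + 2) * x powr ep * x powr (- 2)"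
        unfolding norm_mult by (intro mult_mono 1 2) (use K0 in auto)
      also have "\<dots> = K * (\<bar>Im s\<bar> + 2) * x powr (ep - 2)" using x1 by (simp add: powr_diff powr_minus field_simps)
      also have "\<dots> \<le> ?B"
        using x u assms K0 by (intro mult_left_mono powr_mono2') auto
      finally show ?thesis using x x1 by simp
    qed
    have "norm (log_term j s (of_real u) - log_term j s (of_real v)) \<le> ?B * norm (complex_of_real u - of_real v)"
      by (rule field_differentiable_bound[of ?S _ ?d])
         (use d in \<open>auto simp del: One_nat_def intro!: has_field_derivative_at_within[OF log_term_has_field_derivative]\<close>)
    moreover have "norm (complex_of_real u - of_real v) \<le> 1"
      using u by (simp flip: of_real_diff)
    moreover have "?B \<ge> 0" using C1 C2 by (simp add: K_def)
    ultimately show "norm (log_term j s (of_real u) - log_term j s (of_real v)) \<le> ?B"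
      using mult_left_le order_trans by blast
  qed
qed

text \<open>Integration by parts yields this primitive of \<open>log_term j (1 + w)\<close>. The
  constant of integration is chosen so that it vanishes at infinity for \<open>Re w > 0\<close>; its
  value at 1 is then minus the polar part \<open>fact j / w ^ Suc j\<close> of the Dirichlet
  series.\<close>

primrec log_prim :: "complex \<Rightarrow> nat \<Rightarrow> complex \<Rightarrow> complex" where
  "log_prim w 0 z = - (z powr (- w)) / w"
| "log_prim w (Suc j) z = - (z powr (- w)) * Ln z ^ Suc j / w + of_nat (Suc j) / w * log_prim w j z"

lemma log_prim_has_field_derivative:
  assumes "Re z > 0" "w \<noteq> 0"
  shows "(log_prim w j has_field_derivative log_term j (1 + w) z) (at z)"
proof (induction j)
  have z: "z \<notin> \<real>\<^sub>\<le>\<^sub>0" "z \<noteq> 0" using assms by (auto simp: complex_nonpos_Reals_iff)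
  {
    case 0
    have "((\<lambda>z. - (z powr (- w)) / w) has_field_derivative log_term 0 (1 + w) z) (at z)"
      using z assms by (auto intro!: derivative_eq_intros simp: log_term_def minus_diff_commute)
    then show ?case by (simp add: log_prim.simps[abs_def])
  next
    case (Suc j)
    have 1: "inverse z * z powr (- w) = z powr (- (1 + w))"
      using z by (simp add: powr_diff powr_minus powr_add field_simps)
    have "((\<lambda>z. - (z powr (- w)) * Ln z ^ Suc j / w + of_nat (Suc j) / w * log_prim w j z) has_field_derivative
      ((- (- w * z powr (- w - 1)) * Ln z ^ Suc j + - (z powr (- w)) * (of_nat (Suc j) * (inverse z * Ln z ^ j))) / w
        + of_nat (Suc j) / w * log_term j (1 + w) z)) (at z)"
      using z assms Suc
      by (auto intro!: derivative_eq_intros simp del: power_Suc of_nat_Suc simp: diff_divide_distrib algebra_simps)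
    also have "((- (- w * z powr (- w - 1)) * Ln z ^ Suc j + - (z powr (- w)) * (of_nat (Suc j) * (inverse z * Ln z ^ j))) / w
        + of_nat (Suc j) / w * log_term j (1 + w) z)
      = z powr (- w - 1) * Ln z ^ Suc j +
         of_nat (Suc j) / w * Ln z ^ j * (z powr (- (1 + w)) - inverse z * z powr (- w))"
      using assms by (simp add: log_term_def field_simps del: power_Suc of_nat_Suc)
    also have "\<dots> = log_term (Suc j) (1 + w) z" 
    proof -
      have "- w - 1 = - (1 + w)" by simp
      then show ?thesis unfolding 1 by (simp only: log_term_def mult.commute diff_self mult_zero_right mult_zero_left add_0_right)
    qed
    finally show ?case by (simp add: log_prim.simps[abs_def])
  }
qed

lemma log_prim_1: "w \<noteq> 0 \<Longrightarrow> log_prim w j 1 = - fact j / w ^ Suc j"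
  by (induction j) simp_all

lemma log_power_mult_powr_tendsto_0:
  assumes "Re w > 0"
  shows "(\<lambda>n. of_nat n powr (- w) * Ln (of_nat n) ^ j) \<longlonglongrightarrow> (0::complex)"
proof -
  obtain C where C: "C \<ge> 1" "\<And>x::real. x \<ge> 1 \<Longrightarrow> ln x ^ j \<le> C * x powr (Re w / 2)"
    using ln_power_le_powr[of "Re w / 2"] assms by auto
  have "(\<lambda>n. C * real n powr (- (Re w / 2))) \<longlonglongrightarrow> C * 0"
    using assms by (intro tendsto_mult tendsto_const tendsto_neg_powr filterlim_real_sequentially) auto
  then have lim: "(\<lambda>n. C * real n powr (- (Re w / 2))) \<longlonglongrightarrow> 0" by simp
  show ?thesis
  proof (rule Lim_null_comparison[OF _ lim])
    show "\<forall>\<^sub>F n in sequentially. norm (of_nat n powr (- w) * Ln (of_nat n) ^ j :: complex) \<le> C * real n powr (- (Re w / 2))"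
      using eventually_ge_at_top[of 1]
    proof eventually_elim
      case (elim n)
      have "norm (of_nat n powr (- w) * Ln (of_nat n) ^ j :: complex) = real n powr (- Re w) * ln (real n) ^ j"
        using elim norm_of_real_powr[of "real n" "- w"] Ln_of_real[of "real n"] by (simp add: norm_mult norm_power)
      also have "\<dots> \<le> real n powr (- Re w) * (C * real n powr (Re w / 2))"
        using C elim by (intro mult_left_mono) auto
      also have "\<dots> = C * (real n powr (- Re w) * real n powr (Re w / 2))" by simp
      also have "real n powr (- Re w) * real n powr (Re w / 2) = real n powr (- (Re w / 2))"
        by (simp flip: powr_add)
      finally show ?case .
    qed
  qed
qed

lemma log_prim_tendsto_0:
  assumes "Re w > 0"
  shows "(\<lambda>n. log_prim w j (of_nat n)) \<longlonglongrightarrow> 0"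
proof (induction j)
  case 0
  have "(\<lambda>n. - (of_nat n powr (- w) * Ln (of_nat n) ^ 0) / w) \<longlonglongrightarrow> - 0 / w"
    using assms by (intro tendsto_intros log_power_mult_powr_tendsto_0) auto
  then show ?case by simp
next
  case (Suc j)
  have "(\<lambda>n. - (of_nat n powr (- w) * Ln (of_nat n) ^ Suc j) / w + of_nat (Suc j) / w * log_prim w j (of_nat n))
    \<longlonglongrightarrow> - 0 / w + of_nat (Suc j) / w * 0"
    using assms Suc by (intro tendsto_intros log_power_mult_powr_tendsto_0) auto
  then show ?case by (simp add: algebra_simps)
qed

text \<open>Each summand is compared with the integral over \<open>[n, n + 1]\<close>, expressed
  through the primitive. The error is governed by the derivative beyond
  \<open>\<bar>Im w\<bar> + 2\<close> and by the size of the summand before.\<close>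

lemma log_term_minus_prim_sum_bound:
  fixes ep :: real and j :: nat
  assumes ep: "ep > 0" "ep \<le> 1/2"
  obtains C where "C \<ge> 1" "\<And>w N. \<lbrakk>0 < Re w; Re w \<le> 1\<rbrakk> \<Longrightarrow>
     norm (\<Sum>n=1..N. log_term j (1 + w) (of_nat n) - (log_prim w j (of_nat (Suc n)) - log_prim w j (of_nat n)))
       \<le> C * (\<bar>Im w\<bar> + 2) powr ep"
proof -
  obtain K where K: "K \<ge> 1"
    "\<And>s u. \<lbrakk>1 \<le> Re s; Re s \<le> 2; u \<ge> 1\<rbrakk> \<Longrightarrow> norm (log_term j s (of_real u)) \<le> K * u powr (ep - 1)"
    "\<And>s u v. \<lbrakk>1 \<le> Re s; Re s \<le> 2; u \<ge> 1; u \<le> v; v \<le> u + 1\<rbrakk> \<Longrightarrow>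
      norm (log_term j s (of_real u) - log_term j s (of_real v)) \<le> K * (\<bar>Im s\<bar> + 2) * u powr (ep - 2)"
    using log_term_bounds[OF ep, of j] by blast
  show ?thesis
  proof (rule that[of "5 / ep * K"])
    have "5 / ep \<ge> 1" using ep by (simp add: field_simps)
    then show "5 / ep * K \<ge> 1" using K(1) ep mult_mono[of 1 "5 / ep" 1 K] by simp
    fix w :: complex and N :: nat assume w: "0 < Re w" "Re w \<le> 1"
    have w0: "w \<noteq> 0" using w by auto
    let ?h = "\<lambda>n. log_term j (1 + w) (of_nat n) - (log_prim w j (of_nat (Suc n)) - log_prim w j (of_nat n))"
    have gen: "norm (?h n) \<le> B"
      if n: "n \<ge> 1" and B: "\<And>x. real n \<le> x \<Longrightarrow> x \<le> real n + 1 \<Longrightarrow> norm (log_term j (1 + w) (of_real x) - log_term j (1 + w) (of_real (real n))) \<le> B"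
      for n B
    proof -
      let ?S = "closed_segment (complex_of_real (real n)) (of_real (real n + 1))"
      \<comment> \<open>The derivative of \<open>?f\<close> is the oscillation of
        \<open>log_term\<close> on the segment, and \<open>?h n\<close> is the difference of the
        values of \<open>?f\<close> at the two ends.\<close>
      let ?f = "\<lambda>z. log_prim w j z - log_term j (1 + w) (of_nat n) * z"
      have "norm (?f (of_real (real n)) - ?f (of_real (real n + 1))) \<le> B * norm (complex_of_real (real n) - of_real (real n + 1))"
      proof (rule field_differentiable_bound[of ?S _ "\<lambda>z. log_term j (1 + w) z - log_term j (1 + w) (of_nat n)"])
        fix z assume "z \<in> ?S"
        then obtain x where x: "z = of_real x" "real n \<le> x" "x \<le> real n + 1"
          by (rule closed_segment_of_realE) simp
        show "(?f has_field_derivative log_term j (1 + w) z - log_term j (1 + w) (of_nat n)) (at z within ?S)"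
          using x n w0 by (auto intro!: derivative_eq_intros has_field_derivative_at_within[OF log_prim_has_field_derivative])
        show "norm (log_term j (1 + w) z - log_term j (1 + w) (of_nat n)) \<le> B" using B x by simp
      qed auto
      moreover have "norm (complex_of_real (real n) - of_real (real n + 1)) = 1"
        by (simp flip: of_real_diff)
      moreover have "?f (of_real (real n)) - ?f (of_real (real n + 1)) = ?h n"
        by (simp add: algebra_simps)
      ultimately show ?thesis by (simp only: mult_1_right)
    qed
    have "norm (\<Sum>n=1..N. ?h n) \<le> 5 / ep * K * (\<bar>Im w\<bar> + 2) powr ep"
    proof (rule two_range_sum_bound[OF ep])
      fix n :: nat assume n: "n \<ge> 1"
      show "norm (?h n) \<le> 2 * K * real n powr (ep - 1)"
      proof (rule gen[OF n])
        fix x assume x: "real n \<le> x" "x \<le> real n + 1"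
        have "norm (log_term j (1 + w) (of_real x) - log_term j (1 + w) (of_real (real n))) \<le> K * x powr (ep - 1) + K * real n powr (ep - 1)"
          by (intro order_trans[OF norm_triangle_ineq4] add_mono K) (use w x n in auto)
        also have "x powr (ep - 1) \<le> real n powr (ep - 1)" using x n ep by (intro powr_mono2') auto
        finally show "norm (log_term j (1 + w) (of_real x) - log_term j (1 + w) (of_real (real n))) \<le> 2 * K * real n powr (ep - 1)"
          using K(1) by (simp add: mult_left_mono)
      qed
      show "norm (?h n) \<le> K * (\<bar>Im w\<bar> + 2) * real n powr (ep - 2)"
      proof (rule gen[OF n])
        fix x assume x: "real n \<le> x" "x \<le> real n + 1"
        show "norm (log_term j (1 + w) (of_real x) - log_term j (1 + w) (of_real (real n))) \<le> K * (\<bar>Im w\<bar> + 2) * real n powr (ep - 2)"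
          using K(3)[of "1 + w" "real n" x] w x n by (simp add: norm_minus_commute)
      qed
    qed (use K in auto)
    then show "norm (\<Sum>n=1..N. ?h n) \<le> 5 / ep * K * (\<bar>Im w\<bar> + 2) powr ep" .
  qed
qed

section \<open>Dirichlet series in the half-plane \<open>Re s > 1\<close>\<close>

text \<open>The sum starts at 0 so that it is a plain \<open>suminf\<close>; its first term vanishes
  because \<open>0 powr (- s) = 0\<close>.\<close>

definition ds :: "(nat \<Rightarrow> complex) \<Rightarrow> complex \<Rightarrow> complex" where
  "ds a s = (\<Sum>n. a n * of_nat n powr (- s))"

abbreviation ht :: "complex \<Rightarrow> real" where
  "ht s \<equiv> \<bar>Im s\<bar> + 2"

abbreviation zeta :: "complex \<Rightarrow> complex" where
  "zeta \<equiv> ds (\<lambda>_. 1)"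

lemma norm_of_nat_powr: "norm (of_nat n powr (- s) :: complex) = real n powr (- Re s)"
  using norm_of_real_powr[of "real n" "- s"] by (cases "n = 0") auto

lemma ds_summable_norm:
  assumes a: "\<And>n. norm (a n) \<le> B * ln (real n) ^ j" and s: "Re s > 1"
  shows "summable (\<lambda>n. norm (a n * of_nat n powr (- s)))"
proof -
  define de where "de = (Re s - 1) / 2"
  obtain C where C: "C \<ge> 1" "\<And>x::real. x \<ge> 1 \<Longrightarrow> ln x ^ j \<le> C * x powr de"
    using ln_power_le_powr[of de] s by (auto simp: de_def)
  have "summable (\<lambda>n. \<bar>B\<bar> * C * real n powr (de - Re s))"
    using s by (intro summable_mult) (auto simp: summable_real_powr_iff de_def field_simps)
  then show ?thesis
  proof (rule summable_comparison_test'[where N = 1])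
    fix n :: nat assume n: "n \<ge> 1"
    have "norm (a n) \<le> \<bar>B\<bar> * (C * real n powr de)"
    proof -
      have "B * ln (real n) ^ j \<le> \<bar>B\<bar> * ln (real n) ^ j" using n by (intro mult_right_mono) auto
      also have "\<dots> \<le> \<bar>B\<bar> * (C * real n powr de)" using C n by (intro mult_left_mono) auto
      finally show ?thesis using a[of n] by linarith
    qed
    then have "norm (a n) * real n powr (- Re s) \<le> \<bar>B\<bar> * (C * real n powr de) * real n powr (- Re s)"
      by (intro mult_right_mono) auto
    also have "\<dots> = \<bar>B\<bar> * C * real n powr (de - Re s)" using n by (simp add: powr_diff powr_minus field_simps)
    finally show "norm (norm (a n * of_nat n powr (- s))) \<le> \<bar>B\<bar> * C * real n powr (de - Re s)"
      by (simp add: norm_mult norm_of_nat_powr)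
  qed
qed

lemma sums_from_1:
  fixes f :: "nat \<Rightarrow> 'a::real_normed_vector"
  assumes "f sums S" "f 0 = 0"
  shows "(\<lambda>N. \<Sum>n=1..N. f n) \<longlonglongrightarrow> S"
proof -
  have "(\<lambda>N. \<Sum>n<Suc N. f n) \<longlonglongrightarrow> S" using assms(1) unfolding sums_def by (rule LIMSEQ_Suc)
  moreover have "(\<Sum>n<Suc N. f n) = (\<Sum>n=1..N. f n)" for N
  proof -
    have "{..<Suc N} = insert 0 {1..N}" by auto
    then show ?thesis using assms(2) by simp
  qed
  ultimately show ?thesis by simp
qed

lemma ds_sums_from_1:
  assumes a: "\<And>n. norm (a n) \<le> B * ln (real n) ^ j" and s: "Re s > 1"
  shows "(\<lambda>N. \<Sum>n=1..N. a n * of_nat n powr (- s)) \<longlonglongrightarrow> ds a s"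
  unfolding ds_def
  by (intro sums_from_1 summable_sums summable_norm_cancel[OF ds_summable_norm[OF a s]]) auto

lemma log_term_of_nat: "log_term j s (of_nat n) = of_real (ln (real n) ^ j) * of_nat n powr (- s)"
  using Ln_of_real[of "real n"] by (cases "n = 0") (auto simp: log_term_def)

text \<open>The constant depends on \<open>j\<close> and \<open>ep\<close> alone, and nothing
  degenerates as \<open>Re s\<close> decreases to 1; this uniformity stands in for continuation to
  the line. The coefficients are arbitrary because the bound serves nonprincipal characters as well
  as the principal character minus its mean value.\<close>

theorem ds_log_bounded_sums:
  fixes ep :: real and j :: nat
  assumes ep: "ep > 0" "ep \<le> 1/2"
  obtains C where "C \<ge> 1"
    "\<And>c q s. \<lbrakk>q \<ge> 1; \<And>n. norm (c n) \<le> 1; \<And>M N. norm (\<Sum>n\<in>{M<..N}. c n) \<le> q; 1 < Re s; Re s \<le> 2\<rbrakk> \<Longrightarrow>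
     norm (ds (\<lambda>n. c n * of_real (ln (real n) ^ j)) s) \<le> C * (q * ht s) powr ep"
proof -
  obtain K where K: "K \<ge> 1"
    "\<And>s u. \<lbrakk>1 \<le> Re s; Re s \<le> 2; u \<ge> 1\<rbrakk> \<Longrightarrow> norm (log_term j s (of_real u)) \<le> K * u powr (ep - 1)"
    "\<And>s u v. \<lbrakk>1 \<le> Re s; Re s \<le> 2; u \<ge> 1; u \<le> v; v \<le> u + 1\<rbrakk> \<Longrightarrow>
      norm (log_term j s (of_real u) - log_term j s (of_real v)) \<le> K * ht s * u powr (ep - 2)"
    using log_term_bounds[OF ep, of j] by blast
  show ?thesis
  proof (rule that[of "5 / ep * K"])
    have "5 / ep \<ge> 1" using ep by (simp add: field_simps)
    then show "5 / ep * K \<ge> 1" using K(1) ep mult_mono[of 1 "5 / ep" 1 K] by simp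
    fix c :: "nat \<Rightarrow> complex" and q :: real and s :: complex
    assume q: "q \<ge> 1" and c1: "\<And>n. norm (c n) \<le> 1" and cq: "\<And>M N. norm (\<Sum>n\<in>{M<..N}. c n) \<le> q"
      and s: "1 < Re s" "Re s \<le> 2"
    have lim: "(\<lambda>N. \<Sum>n=1..N. (c n * of_real (ln (real n) ^ j)) * of_nat n powr (- s)) \<longlonglongrightarrow>
      ds (\<lambda>n. c n * of_real (ln (real n) ^ j)) s"
    proof (rule ds_sums_from_1[OF _ s(1)])
      fix n :: nat
      show "norm (c n * of_real (ln (real n) ^ j)) \<le> 1 * ln (real n) ^ j"
        using mult_right_mono[OF c1[of n], of "ln (real n) ^ j"] by (cases "n = 0") (auto simp: norm_mult norm_power)
    qed
    have "norm (\<Sum>n=1..N. c n * log_term j s (of_nat n)) \<le> 5 / ep * K * (q * ht s) powr ep" for N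
    proof (rule partial_summation_bound[OF ep q _ _ c1 cq])
      fix n :: nat assume n: "n \<ge> 1"
      show "norm (log_term j s (of_nat n)) \<le> K * real n powr (ep - 1)"
        using K(2)[of s "real n"] s n by simp
      show "norm (log_term j s (of_nat n) - log_term j s (of_nat (Suc n))) \<le> K * ht s * real n powr (ep - 2)"
        using K(3)[of s "real n" "real n + 1"] s n by (simp add: add.commute)
    qed (use K in auto)
    then have "norm (\<Sum>n=1..N. (c n * of_real (ln (real n) ^ j)) * of_nat n powr (- s)) \<le> 5 / ep * K * (q * ht s) powr ep" for N
      by (simp add: log_term_of_nat mult_ac)
    then show "norm (ds (\<lambda>n. c n * of_real (ln (real n) ^ j)) s) \<le> 5 / ep * K * (q * ht s) powr ep"
      by (intro Lim_bounded[OF tendsto_norm[OF lim]]) auto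
  qed
qed

text \<open>The increments of the primitive telescope to \<open>- log_prim w j 1\<close> in the
  limit, and this is exactly the polar part.\<close>

theorem ds_log_minus_pole:
  fixes ep :: real and j :: nat
  assumes ep: "ep > 0" "ep \<le> 1/2"
  obtains C where "C \<ge> 1"
    "\<And>s. \<lbrakk>1 < Re s; Re s \<le> 2\<rbrakk> \<Longrightarrow>
     norm (ds (\<lambda>n. of_real (ln (real n) ^ j)) s - fact j / (s - 1) ^ Suc j) \<le> C * ht s powr ep"
proof -
  obtain C where C: "C \<ge> 1" "\<And>w N. \<lbrakk>0 < Re w; Re w \<le> 1\<rbrakk> \<Longrightarrow>
     norm (\<Sum>n=1..N. log_term j (1 + w) (of_nat n) - (log_prim w j (of_nat (Suc n)) - log_prim w j (of_nat n)))
       \<le> C * (\<bar>Im w\<bar> + 2) powr ep"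
    using log_term_minus_prim_sum_bound[OF ep, of j] by blast
  show ?thesis
  proof (rule that[OF C(1)])
    fix s assume s: "1 < Re s" "Re s \<le> 2"
    define w where "w = s - 1"
    have w: "Re w > 0" "Re w \<le> 1" "w \<noteq> 0" "s = 1 + w" using s by (auto simp: w_def)
    have lim: "(\<lambda>N. \<Sum>n=1..N. of_real (ln (real n) ^ j) * of_nat n powr (- s)) \<longlonglongrightarrow>
      ds (\<lambda>n. of_real (ln (real n) ^ j)) s"
    proof (rule ds_sums_from_1[OF _ s(1)])
      fix n :: nat
      show "norm (of_real (ln (real n) ^ j) :: complex) \<le> 1 * ln (real n) ^ j"
        by (cases "n = 0") (auto simp: norm_power)
    qed
    have tel: "(\<Sum>n=1..N. log_term j (1 + w) (of_nat n) - (log_prim w j (of_nat (Suc n)) - log_prim w j (of_nat n)))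
       = (\<Sum>n=1..N. of_real (ln (real n) ^ j) * of_nat n powr (- s)) - (log_prim w j (of_nat (Suc N)) - log_prim w j 1)" for N
    proof -
      have "(\<Sum>n=1..N. log_prim w j (of_nat (Suc n)) - log_prim w j (of_nat n)) = log_prim w j (of_nat (Suc N)) - log_prim w j 1"
        by (induction N) auto
      then show ?thesis unfolding sum_subtractf by (simp add: log_term_of_nat w)
    qed
    have "(\<lambda>N. (\<Sum>n=1..N. of_real (ln (real n) ^ j) * of_nat n powr (- s)) - (log_prim w j (of_nat (Suc N)) - log_prim w j 1))
      \<longlonglongrightarrow> ds (\<lambda>n. of_real (ln (real n) ^ j)) s - (0 - log_prim w j 1)"
      by (intro tendsto_diff lim tendsto_const LIMSEQ_Suc[OF log_prim_tendsto_0] w)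
    then have lim2: "(\<lambda>N. \<Sum>n=1..N. log_term j (1 + w) (of_nat n) - (log_prim w j (of_nat (Suc n)) - log_prim w j (of_nat n)))
      \<longlonglongrightarrow> ds (\<lambda>n. of_real (ln (real n) ^ j)) s - fact j / (s - 1) ^ Suc j"
      unfolding tel log_prim_1[OF w(3)] by (simp add: w)
    show "norm (ds (\<lambda>n. of_real (ln (real n) ^ j)) s - fact j / (s - 1) ^ Suc j) \<le> C * ht s powr ep"
      using C(2)[OF w(1,2)] w by (intro Lim_bounded[OF tendsto_norm[OF lim2]]) (auto simp: w)
  qed
qed

subsection \<open>Dirichlet products\<close>

lemma summable_norm_imp_abs_summable_on:
  fixes f :: "nat \<Rightarrow> complex"
  assumes "summable (\<lambda>n. norm (f n))"
  shows "(\<lambda>n. norm (f n)) summable_on A"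
  using assms summable_on_subset_banach[OF _ subset_UNIV]
    summable_on_UNIV_nonneg_real_iff[of "\<lambda>n. norm (f n)"] by auto

text \<open>Absolute convergence allows summation over all pairs \<open>(d, e)\<close>, which are
  then regrouped by their product. The values at 0 have to vanish, as infinitely many pairs have
  product 0.\<close>

lemma dirichlet_product_sums:
  fixes f g :: "nat \<Rightarrow> complex"
  assumes f0: "f 0 = 0" and g0: "g 0 = 0"
    and f: "summable (\<lambda>n. norm (f n))" and g: "summable (\<lambda>n. norm (g n))"
  shows "(\<lambda>n. \<Sum>d | d dvd n. f d * g (n div d)) sums (suminf f * suminf g)"
proof -
  have F: "(f has_sum suminf f) {1..}"
    using norm_summable_imp_has_sum[OF f summable_sums[OF summable_norm_cancel[OF f]]] f0
    by (subst has_sum_cong_neutral[where T = UNIV and g = f]) (auto simp: not_less_eq_eq)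
  have G: "(g has_sum suminf g) {1..}"
    using norm_summable_imp_has_sum[OF g summable_sums[OF summable_norm_cancel[OF g]]] g0
    by (subst has_sum_cong_neutral[where T = UNIV and g = g]) (auto simp: not_less_eq_eq)
  have "((\<lambda>(d,e). f d * g e) has_sum (suminf f * suminf g)) ({1..} \<times> {1..})"
  proof (rule has_sum_SigmaI)
    show "((\<lambda>e. case (d, e) of (d, e) \<Rightarrow> f d * g e) has_sum (f d * suminf g)) {1..}" for d
      using has_sum_cmult_right[OF G, of "f d"] by simp
    show "((\<lambda>d. f d * suminf g) has_sum (suminf f * suminf g)) {1..}"
      using has_sum_cmult_left[OF F] by simp
    have "(\<lambda>x. norm (case x of (d,e) \<Rightarrow> f d * g e)) summable_on ({1..} \<times> {1..})"
      unfolding Infinite_Sum.abs_summable_on_Sigma_iff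
      by (auto simp: norm_mult infsum_cmult_right' abs_mult
          intro!: summable_on_cmult_right summable_on_cmult_left summable_norm_imp_abs_summable_on f g)
    then show "(\<lambda>(d,e). f d * g e) summable_on ({1..} \<times> {1..})" by (rule abs_summable_summable)
  qed
  also have "?this \<longleftrightarrow> ((\<lambda>(n,d). f d * g (n div d)) has_sum (suminf f * suminf g)) (Sigma {1..} (\<lambda>n. {d. d dvd n}))"
    by (rule has_sum_reindex_bij_witness[where i = "\<lambda>(n,d). (d, n div d)" and j = "\<lambda>(d,e). (d * e, d)"])
       (auto simp: Suc_le_eq elim!: dvdE)
  finally have "((\<lambda>n. \<Sum>d | d dvd n. f d * g (n div d)) has_sum (suminf f * suminf g)) {1..}"
    by (rule has_sum_SigmaD) (auto intro!: has_sum_finiteI finite_divisors_nat)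
  also have "?this \<longleftrightarrow> ((\<lambda>n. \<Sum>d | d dvd n. f d * g (n div d)) has_sum (suminf f * suminf g)) UNIV"
    by (rule has_sum_cong_neutral) (auto simp: not_less_eq_eq)
  finally show ?thesis by (rule has_sum_imp_sums)
qed

lemma of_nat_mult_powr: "of_nat (m * n) powr (z::complex) = of_nat m powr z * of_nat n powr z"
  using powr_times_real[of "of_nat m" "of_nat n" z] by simp

lemma ds_mult:
  assumes a: "\<And>n. norm (a n) \<le> A * ln (real n) ^ i" and b: "\<And>n. norm (b n) \<le> B * ln (real n) ^ j"
    and s: "Re s > 1"
  shows "ds a s * ds b s = ds (\<lambda>n. \<Sum>d | d dvd n. a d * b (n div d)) s"
proof -
  let ?f = "\<lambda>n. a n * of_nat n powr (- s)" and ?g = "\<lambda>n. b n * of_nat n powr (- s)"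
  have "(\<lambda>n. \<Sum>d | d dvd n. ?f d * ?g (n div d)) sums (ds a s * ds b s)"
    unfolding ds_def
    by (rule dirichlet_product_sums) (auto intro!: ds_summable_norm[OF a s] ds_summable_norm[OF b s])
  moreover have "(\<Sum>d | d dvd n. ?f d * ?g (n div d)) = (\<Sum>d | d dvd n. a d * b (n div d)) * of_nat n powr (- s)" for n
    unfolding sum_distrib_right
  proof (intro sum.cong refl)
    fix d assume "d \<in> {d. d dvd n}"
    then have "n = d * (n div d)" by simp
    then have "of_nat n powr (- s) = of_nat d powr (- s) * of_nat (n div d) powr (- s)"
      using of_nat_mult_powr by metis
    then show "?f d * ?g (n div d) = a d * b (n div d) * of_nat n powr (- s)" by simp
  qed
  ultimately show ?thesis unfolding ds_def by (simp add: sums_iff)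
qed

lemma sum_mangoldt_codivisor:
  assumes "n > 0"
  shows "(\<Sum>d | d dvd n. mangoldt (n div d) :: 'a :: real_algebra_1) = of_real (ln (real n))"
proof -
  have "(\<Sum>d | d dvd n. mangoldt (n div d) :: 'a) = (\<Sum>d | d dvd n. mangoldt d)"
    by (rule sum.reindex_bij_witness[of _ "\<lambda>d. n div d" "\<lambda>d. n div d"])
       (use assms in \<open>auto elim!: dvdE\<close>)
  then show ?thesis using mangoldt_sum[of n] assms by simp
qed

text \<open>The logarithm is a derivation for Dirichlet convolution, so the binomial theorem plays the role of the
  Leibniz rule for higher derivatives of a Dirichlet series.\<close>

lemma log_power_convolution:
  fixes X :: "nat \<Rightarrow> complex"
  assumes mult: "\<And>m n. X (m * n) = X m * X n" and n: "n > 0"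
  shows "X n * of_real (ln (real n) ^ Suc k) =
    (\<Sum>j\<le>k. of_nat (k choose j) * (\<Sum>d | d dvd n. (X d * of_real (ln (real d) ^ j)) *
       (X (n div d) * mangoldt (n div d) * of_real (ln (real (n div d)) ^ (k - j)))))"
proof -
  have "(\<Sum>j\<le>k. of_nat (k choose j) * (\<Sum>d | d dvd n. (X d * of_real (ln (real d) ^ j)) *
       (X (n div d) * mangoldt (n div d) * of_real (ln (real (n div d)) ^ (k - j)))))
    = (\<Sum>d | d dvd n. X d * X (n div d) * mangoldt (n div d) *
        (\<Sum>j\<le>k. of_nat (k choose j) * of_real (ln (real d)) ^ j * of_real (ln (real (n div d))) ^ (k - j)))"
    unfolding sum_distrib_left by (subst sum.swap) (simp add: mult_ac)
  also have "\<dots> = (\<Sum>d | d dvd n. X n * of_real (ln (real n) ^ k) * mangoldt (n div d))"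
  proof (intro sum.cong refl)
    fix d assume d: "d \<in> {d. d dvd n}"
    then have nd: "n = d * (n div d)" by simp
    obtain e where e: "n = d * e" using d by auto
    then have d0: "d > 0" "n div d > 0" using n by auto
    have "ln (real n) = ln (real d * real (n div d))"
      using nd by (metis of_nat_mult)
    also have "\<dots> = ln (real d) + ln (real (n div d))" using d0 by (simp add: ln_mult)
    finally have ln: "ln (real n) = ln (real d) + ln (real (n div d))" .
    have X: "X d * X (n div d) = X n" using mult nd by metis
    have "(\<Sum>j\<le>k. of_nat (k choose j) * of_real (ln (real d)) ^ j * of_real (ln (real (n div d))) ^ (k - j)) =
      (of_real (ln (real d)) + of_real (ln (real (n div d))) :: complex) ^ k"
      by (rule binomial_ring[symmetric])
    also have "\<dots> = of_real (ln (real n) ^ k)" unfolding ln by simp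
    finally show "X d * X (n div d) * mangoldt (n div d) *
        (\<Sum>j\<le>k. of_nat (k choose j) * of_real (ln (real d)) ^ j * of_real (ln (real (n div d))) ^ (k - j)) =
      X n * of_real (ln (real n) ^ k) * mangoldt (n div d)" unfolding X by simp
  qed
  also have "\<dots> = X n * of_real (ln (real n) ^ Suc k)"
    unfolding sum_distrib_left[symmetric] sum_mangoldt_codivisor[OF n] by simp
  finally show ?thesis by simp
qed

lemma norm_log_coeff_le:
  assumes "norm (X n) \<le> 1"
  shows "norm (X n * of_real (ln (real n) ^ j) :: complex) \<le> 1 * ln (real n) ^ j"
  using mult_right_mono[OF assms, of "ln (real n) ^ j"] by (cases "n = 0") (auto simp: norm_mult norm_power)

lemma norm_mangoldt_coeff_le:
  assumes "norm (X n) \<le> 1"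
  shows "norm (X n * mangoldt n * of_real (ln (real n) ^ j) :: complex) \<le> 1 * ln (real n) ^ Suc j"
proof (cases "n = 0")
  case False
  have "norm (X n) * mangoldt n \<le> 1 * ln (real n)"
    by (intro mult_mono assms mangoldt_le) (use False mangoldt_nonneg in auto)
  then have "norm (X n) * mangoldt n * ln (real n) ^ j \<le> ln (real n) * ln (real n) ^ j"
    using False by (intro mult_right_mono) auto
  then show ?thesis using False by (simp add: norm_mult norm_power)
qed simp

text \<open>In analytic terms this is \<open>L' = L * (L'/L)\<close>, differentiated
  \<open>k\<close> times. Formulated with coefficients it involves no division by \<open>L\<close>;
  nonvanishing enters through the lower bound that is inserted later.\<close>

theorem ds_log_recursion:
  fixes X :: "nat \<Rightarrow> complex"
  assumes mult: "\<And>m n. X (m * n) = X m * X n" and X1: "\<And>n. norm (X n) \<le> 1" and s: "Re s > 1"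
  shows "ds (\<lambda>n. X n * of_real (ln (real n) ^ Suc k)) s =
    (\<Sum>j\<le>k. of_nat (k choose j) * (ds (\<lambda>n. X n * of_real (ln (real n) ^ j)) s *
      ds (\<lambda>n. X n * mangoldt n * of_real (ln (real n) ^ (k - j))) s))"
proof -
  let ?c = "\<lambda>j n. \<Sum>d | d dvd n. (X d * of_real (ln (real d) ^ j)) *
       (X (n div d) * mangoldt (n div d) * of_real (ln (real (n div d)) ^ (k - j)))"
  have D: "ds (\<lambda>n. X n * of_real (ln (real n) ^ j)) s *
      ds (\<lambda>n. X n * mangoldt n * of_real (ln (real n) ^ (k - j))) s = ds (?c j) s" for j
    by (rule ds_mult[OF _ _ s]) (rule norm_log_coeff_le norm_mangoldt_coeff_le, rule X1)+
  have sums: "(\<lambda>n. ?c j n * of_nat n powr (- s)) sums ds (?c j) s" for j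
  proof -
    have "(\<lambda>n. \<Sum>d | d dvd n. (X d * of_real (ln (real d) ^ j)) * of_nat d powr (- s) *
       ((X (n div d) * mangoldt (n div d) * of_real (ln (real (n div d)) ^ (k - j))) * of_nat (n div d) powr (- s)))
      sums (ds (\<lambda>n. X n * of_real (ln (real n) ^ j)) s * ds (\<lambda>n. X n * mangoldt n * of_real (ln (real n) ^ (k - j))) s)"
      unfolding ds_def
      by (rule dirichlet_product_sums)
         (auto intro!: ds_summable_norm[OF norm_log_coeff_le[OF X1] s] ds_summable_norm[OF norm_mangoldt_coeff_le[OF X1] s]
          simp del: of_real_power)
    also have "(\<lambda>n. \<Sum>d | d dvd n. (X d * of_real (ln (real d) ^ j)) * of_nat d powr (- s) *
       ((X (n div d) * mangoldt (n div d) * of_real (ln (real (n div d)) ^ (k - j))) * of_nat (n div d) powr (- s)))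
      = (\<lambda>n. ?c j n * of_nat n powr (- s))"
    proof (rule ext)
      fix n
      show "(\<Sum>d | d dvd n. (X d * of_real (ln (real d) ^ j)) * of_nat d powr (- s) *
       ((X (n div d) * mangoldt (n div d) * of_real (ln (real (n div d)) ^ (k - j))) * of_nat (n div d) powr (- s))) = ?c j n * of_nat n powr (- s)"
        unfolding sum_distrib_right
      proof (intro sum.cong refl)
        fix d assume "d \<in> {d. d dvd n}"
        then have "n = d * (n div d)" by simp
        then have "of_nat n powr (- s) = of_nat d powr (- s) * of_nat (n div d) powr (- s)"
          using of_nat_mult_powr by metis
        then show "X d * of_real (ln (real d) ^ j) * of_nat d powr (- s) *
            (X (n div d) * mangoldt (n div d) * of_real (ln (real (n div d)) ^ (k - j)) * of_nat (n div d) powr (- s)) =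
          X d * of_real (ln (real d) ^ j) * (X (n div d) * mangoldt (n div d) * of_real (ln (real (n div d)) ^ (k - j))) *
            of_nat n powr (- s)" by (simp only: mult_ac)
      qed
    qed
    finally show ?thesis unfolding D .
  qed
  have "(\<lambda>n. \<Sum>j\<le>k. of_nat (k choose j) * (?c j n * of_nat n powr (- s))) sums (\<Sum>j\<le>k. of_nat (k choose j) * ds (?c j) s)"
    by (intro sums_sum sums_mult sums)
  moreover have "(\<Sum>j\<le>k. of_nat (k choose j) * (?c j n * of_nat n powr (- s))) =
    X n * of_real (ln (real n) ^ Suc k) * of_nat n powr (- s)" for n
  proof (cases "n = 0")
    case False
    then have "X n * of_real (ln (real n) ^ Suc k) = (\<Sum>j\<le>k. of_nat (k choose j) * ?c j n)"
      by (intro log_power_convolution mult) simp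
    then show ?thesis by (simp only: sum_distrib_right mult.assoc)
  qed simp
  ultimately have "ds (\<lambda>n. X n * of_real (ln (real n) ^ Suc k)) s = (\<Sum>j\<le>k. of_nat (k choose j) * ds (?c j) s)"
    unfolding ds_def by (simp add: sums_iff)
  then show ?thesis unfolding D .
qed

text \<open>The term \<open>j = 0\<close> of the recursion contains \<open>Y k\<close> with the
  factor \<open>E 0\<close>, so \<open>Y k\<close> is found by dividing by \<open>E 0\<close>; each
  level costs one factor \<open>U\<close> for the numerators and one factor \<open>V\<close> for the
  division. A common factor \<open>W\<close> of all \<open>E j\<close> cancels, which allows for the
  growth of \<open>(s - 1) * zeta s\<close>.\<close>

lemma log_recursion_bound:
  obtains c :: real where "c \<ge> 1"
    "\<And>(E :: nat \<Rightarrow> complex) Y W U V. \<lbrakk>\<And>k. k \<le> K \<Longrightarrow> E (Suc k) = (\<Sum>j\<le>k. of_nat (k choose j) * (E j * Y (k - j)));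
       \<And>j. j \<le> Suc K \<Longrightarrow> norm (E j) \<le> W * U; norm (E 0) \<ge> W / V; W > 0; U \<ge> 1; V \<ge> 1\<rbrakk>
      \<Longrightarrow> norm (Y K) \<le> c * (U * V) ^ Suc K"
proof -
  define hyp where "hyp = (\<lambda>K (E :: nat \<Rightarrow> complex) Y W U V.
      (\<forall>k\<le>K. E (Suc k) = (\<Sum>j\<le>k. of_nat (k choose j) * (E j * Y (k - j)))) \<and>
       (\<forall>j\<le>Suc K. norm (E j) \<le> W * U) \<and> norm (E 0) \<ge> W / V \<and> W > 0 \<and> U \<ge> 1 \<and> V \<ge> (1::real))"
  have "\<exists>c\<ge>1. \<forall>E Y W U V. hyp K E Y W U V \<longrightarrow> (\<forall>k\<le>K. norm (Y k) \<le> c * (U * V) ^ Suc k)"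
  proof (induction K)
    case 0
    show ?case
    proof (intro exI[of _ 1] conjI allI impI)
      fix E Y W U V and k :: nat assume h: "hyp 0 E Y W U V" and k: "k \<le> 0"
      then have E: "E (Suc 0) = E 0 * Y 0" "norm (E (Suc 0)) \<le> W * U" and r: "norm (E 0) \<ge> W / V" "W > 0" "U \<ge> 1" "V \<ge> 1"
        by (auto simp: hyp_def)
      have "W / V * norm (Y 0) \<le> norm (E 0) * norm (Y 0)" using r by (intro mult_right_mono) auto
      also have "\<dots> \<le> W * U" using E by (simp add: norm_mult)
      finally show "norm (Y k) \<le> 1 * (U * V) ^ Suc k" using r k by (simp add: field_simps)
    qed simp
  next
    case (Suc K)
    then obtain c where c: "c \<ge> 1" "\<And>E Y W U V k. hyp K E Y W U V \<Longrightarrow> k \<le> K \<Longrightarrow> norm (Y k) \<le> c * (U * V) ^ Suc k"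
      by blast
    show ?case
    \<comment> \<open>The binomial coefficients of the terms moved to the other side add up to at
      most \<open>2 ^ Suc K\<close>.\<close>
    proof (intro exI[of _ "1 + 2 ^ Suc K * c"] conjI allI impI)
      show "1 \<le> 1 + 2 ^ Suc K * c" using c by simp
      fix E Y W U V and k :: nat assume h: "hyp (Suc K) E Y W U V" and k: "k \<le> Suc K"
      then have r: "norm (E 0) \<ge> W / V" "W > 0" "U \<ge> 1" "V \<ge> 1" by (auto simp: hyp_def)
      have UV: "U * V \<ge> 1" using r mult_mono[of 1 U 1 V] by simp
      have hK: "hyp K E Y W U V" using h by (auto simp: hyp_def)
      have cc: "c \<le> 1 + 2 ^ Suc K * c" 
      proof -
        have "1 * c \<le> 2 ^ Suc K * c" using c(1) by (intro mult_right_mono one_le_power) auto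
        then show ?thesis by linarith
      qed
      show "norm (Y k) \<le> (1 + 2 ^ Suc K * c) * (U * V) ^ Suc k"
      proof (cases "k \<le> K")
        case True
        have "norm (Y k) \<le> c * (U * V) ^ Suc k" by (rule c(2)[OF hK True])
        also have "\<dots> \<le> (1 + 2 ^ Suc K * c) * (U * V) ^ Suc k" using cc UV by (intro mult_right_mono) auto
        finally show ?thesis .
      next
        case False
        then have k: "k = Suc K" using k by simp
        let ?S = "\<Sum>j<Suc K. of_nat (Suc K choose Suc j) * (E (Suc j) * Y (Suc K - Suc j))"
        have "E (Suc (Suc K)) = (\<Sum>j\<le>Suc K. of_nat (Suc K choose j) * (E j * Y (Suc K - j)))"
          using h unfolding hyp_def by blast
        also have "\<dots> = E 0 * Y (Suc K) + ?S"
          by (subst sum.atMost_shift) simp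
        finally have eq: "E 0 * Y (Suc K) = E (Suc (Suc K)) - ?S" by simp
        have "norm ?S \<le> (\<Sum>j<Suc K. real (Suc K choose Suc j) * (W * U * (c * (U * V) ^ Suc K)))"
        proof (rule sum_norm_le)
          fix j assume j: "j \<in> {..<Suc K}"
          have "norm (Y (Suc K - Suc j)) \<le> c * (U * V) ^ Suc (K - j)"
            using c(2)[OF hK, of "K - j"] by simp
          also have "\<dots> \<le> c * (U * V) ^ Suc K" using UV c by (intro mult_left_mono power_increasing) auto
          finally have "norm (Y (Suc K - Suc j)) \<le> c * (U * V) ^ Suc K" .
          moreover have "norm (E (Suc j)) \<le> W * U" 
          proof -
            have "\<forall>j\<le>Suc (Suc K). norm (E j) \<le> W * U" using h unfolding hyp_def by blast
            then show ?thesis using j by simp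
          qed
          ultimately show "norm (of_nat (Suc K choose Suc j) * (E (Suc j) * Y (Suc K - Suc j))) \<le> real (Suc K choose Suc j) * (W * U * (c * (U * V) ^ Suc K))"
            unfolding norm_mult norm_of_nat using r by (intro mult_left_mono mult_mono) auto
        qed
        also have "\<dots> = (\<Sum>j<Suc K. real (Suc K choose Suc j)) * (W * U * (c * (U * V) ^ Suc K))"
          by (simp only: sum_distrib_right)
        also have "\<dots> \<le> 2 ^ Suc K * (W * U * (c * (U * V) ^ Suc K))"
        proof (intro mult_right_mono)
          have "(\<Sum>j\<le>Suc K. real (Suc K choose j)) = 2 ^ Suc K"
            using choose_row_sum[of "Suc K"] by (metis of_nat_numeral of_nat_power of_nat_sum)
          then show "(\<Sum>j<Suc K. real (Suc K choose Suc j)) \<le> 2 ^ Suc K"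
            by (subst (asm) sum.atMost_shift) simp
        qed (use r c UV in auto)
        finally have S: "norm ?S \<le> 2 ^ Suc K * (W * U * (c * (U * V) ^ Suc K))" .
        have "W / V * norm (Y (Suc K)) \<le> norm (E 0 * Y (Suc K))"
          unfolding norm_mult using r by (intro mult_right_mono) auto
        also have "\<dots> \<le> W * U + 2 ^ Suc K * (W * U * (c * (U * V) ^ Suc K))"
          unfolding eq using h by (intro order_trans[OF norm_triangle_ineq4] add_mono S) (auto simp: hyp_def)
        also have "\<dots> \<le> W * U * (U * V) ^ Suc K + 2 ^ Suc K * (W * U * (c * (U * V) ^ Suc K))"
          using r UV one_le_power[OF UV, of "Suc K"] mult_left_mono[of 1 "(U * V) ^ Suc K" "W * U"] by simp
        also have "\<dots> = W * (U * (1 + 2 ^ Suc K * c) * (U * V) ^ Suc K)" by (simp add: algebra_simps)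
        finally have "norm (Y (Suc K)) * W \<le> (V * (U * (1 + 2 ^ Suc K * c) * (U * V) ^ Suc K)) * W"
          using r by (simp add: pos_divide_le_eq mult_ac)
        then have "norm (Y (Suc K)) \<le> V * (U * (1 + 2 ^ Suc K * c) * (U * V) ^ Suc K)"
          using r by (simp only: mult_le_cancel_right_pos)
        then show ?thesis unfolding k by (simp add: mult_ac)
      qed
    qed
  qed
  then obtain c where c: "c \<ge> 1" "\<forall>E Y W U V. hyp K E Y W U V \<longrightarrow> (\<forall>k\<le>K. norm (Y k) \<le> c * (U * V) ^ Suc k)" by blast
  show ?thesis
    by (rule that[OF c(1)]) (use c(2) in \<open>unfold hyp_def, blast\<close>)
qed

lemma ds_has_field_derivative:
  assumes a: "\<And>n. norm (a n) \<le> B * ln (real n) ^ j" and s: "Re s > 1"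
  shows "(ds a has_field_derivative - ds (\<lambda>n. a n * of_real (ln (real n))) s) (at s)"
proof -
  \<comment> \<open>Any line strictly between 1 and \<open>Re s\<close> will do: to its right the
    differentiated series is dominated by a convergent one.\<close>
  define sg where "sg = (1 + Re s) / 2"
  have sg: "1 < sg" "sg < Re s" using s by (auto simp: sg_def)
  let ?S = "{z. Re z > sg}"
  let ?f = "\<lambda>n z. a n * of_nat n powr (- z)"
  let ?f' = "\<lambda>n z. - (a n * of_real (ln (real n)) * of_nat n powr (- z))"
  have a': "norm (a n * of_real (ln (real n))) \<le> B * ln (real n) ^ Suc j" for n
  proof (cases "n = 0")
    case False
    then show ?thesis using mult_right_mono[OF a[of n], of "ln (real n)"] by (simp add: norm_mult mult_ac)
  qed simp
  have "((\<lambda>z. \<Sum>n. ?f n z) has_field_derivative (\<Sum>n. ?f' n s)) (at s)"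
  proof (rule has_field_derivative_series'(2)[where S = ?S and x0 = s])
    show "convex ?S" by (rule convex_halfspace_Re_gt)
    fix n :: nat and z assume z: "z \<in> ?S"
    show "(?f n has_field_derivative ?f' n z) (at z within ?S)"
    proof (cases "n = 0")
      case False
      then have "((powr) (of_nat n) has_field_derivative Ln (of_nat n) * of_nat n powr (- z)) (at (- z))"
        by (intro has_field_derivative_powr_right) simp
      from DERIV_cmult[OF DERIV_chain2[OF this DERIV_minus[OF DERIV_ident]], of "a n"] show ?thesis
        using False Ln_of_real[of "real n"]
        by (auto simp: mult_ac intro: has_field_derivative_at_within)
    qed simp
  next
    show "uniformly_convergent_on ?S (\<lambda>n z. \<Sum>i<n. ?f' i z)"
    proof (rule Weierstrass_m_test')
      show "summable (\<lambda>n. norm (a n * of_real (ln (real n)) * of_nat n powr (- of_real sg)))"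
        by (rule ds_summable_norm[OF a']) (use sg in auto)
      fix n :: nat and z assume z: "z \<in> ?S"
      have "real n powr (- Re z) \<le> real n powr (- sg)"
        by (cases "n = 0") (use z in \<open>auto intro!: powr_mono\<close>)
      then show "norm (?f' n z) \<le> norm (a n * of_real (ln (real n)) * of_nat n powr (- of_real sg))"
        by (auto simp: norm_mult norm_of_nat_powr intro!: mult_left_mono)
    qed
    show "summable (\<lambda>n. ?f n s)" by (rule summable_norm_cancel[OF ds_summable_norm[OF a s]])
    show "s \<in> interior ?S" using sg by (simp add: interior_open open_halfspace_Re_gt)
  qed (use sg in auto)
  moreover have "(\<Sum>n. ?f' n s) = - ds (\<lambda>n. a n * of_real (ln (real n))) s"
    unfolding ds_def
    by (rule suminf_minus) (rule summable_norm_cancel[OF ds_summable_norm[OF a' s]])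
  ultimately show ?thesis unfolding ds_def[abs_def] by simp
qed

subsection \<open>Euler products\<close>

definition sifted :: "nat set \<Rightarrow> nat set" where
  "sifted P = {n. \<forall>p\<in>P. \<not> p dvd n}"

text \<open>The numbers sifted by \<open>P\<close> split into those not divisible by
  \<open>p\<close> and \<open>p\<close> times all numbers sifted by \<open>P\<close>.\<close>

lemma infsum_sifted_insert:
  fixes f :: "nat \<Rightarrow> complex"
  assumes mult: "\<And>m n. f (m * n) = f m * f n" and f: "summable (\<lambda>n. norm (f n))"
    and p: "prime p" "p \<notin> P" and P: "\<And>r. r \<in> P \<Longrightarrow> prime r"
  shows "infsum f (sifted (insert p P)) = (1 - f p) * infsum f (sifted P)"
proof -
  have sm: "f summable_on A" for A
    using summable_norm_imp_abs_summable_on[OF f] abs_summable_summable by blast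
  have inj: "inj_on ((*) p) A" for A using p prime_gt_0_nat by (auto intro!: inj_onI)
  have dv: "r dvd p * m \<longleftrightarrow> r dvd m" if "r \<in> P" for r m
    using that P p by (metis prime_dvd_mult_iff primes_dvd_imp_eq dvd_mult)
  have U: "sifted P = sifted (insert p P) \<union> (*) p ` sifted P"
  proof (intro equalityI subsetI)
    fix x assume x: "x \<in> sifted P"
    show "x \<in> sifted (insert p P) \<union> (*) p ` sifted P"
    proof (cases "p dvd x")
      case True
      then obtain m where m: "x = p * m" by auto
      then have "m \<in> sifted P" using x by (auto simp: sifted_def)
      then show ?thesis using m by auto
    qed (use x in \<open>auto simp: sifted_def\<close>)
  qed (auto simp: sifted_def dv)
  have "infsum f (sifted P) = infsum f (sifted (insert p P)) + infsum f ((*) p ` sifted P)"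
    by (subst U, rule infsum_Un_disjoint) (auto simp: sifted_def sm)
  also have "infsum f ((*) p ` sifted P) = f p * infsum f (sifted P)"
    by (subst infsum_reindex[OF inj]) (simp add: o_def mult infsum_cmult_right')
  finally have "infsum f (sifted P) - f p * infsum f (sifted P) = infsum f (sifted (insert p P))"
    by (metis add_diff_cancel_right')
  then show ?thesis by (simp only: left_diff_distrib mult_1)
qed

lemma infsum_sifted:
  fixes f :: "nat \<Rightarrow> complex"
  assumes mult: "\<And>m n. f (m * n) = f m * f n" and f: "summable (\<lambda>n. norm (f n))"
    and "finite P" "\<And>r. r \<in> P \<Longrightarrow> prime r"
  shows "infsum f (sifted P) = (\<Prod>p\<in>P. 1 - f p) * suminf f"
  using assms(3,4)
proof (induction P rule: finite_induct)
  case empty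
  have "infsum f UNIV = suminf f"
    by (intro infsumI norm_summable_imp_has_sum f summable_sums summable_norm_cancel)
  then show ?case by (simp add: sifted_def)
next
  case (insert p P)
  then show ?case using infsum_sifted_insert[OF mult f, of p P] by (simp add: mult_ac)
qed

text \<open>The product is kept on the same side as the sum. Nothing is divided, and positivity or
  lower bounds for the sum can be read off in the limit.\<close>

theorem euler_product:
  fixes f :: "nat \<Rightarrow> complex"
  assumes mult: "\<And>m n. f (m * n) = f m * f n" and f: "summable (\<lambda>n. norm (f n))"
    and f1: "f 1 = 1" and f0: "f 0 = 0"
  shows "(\<lambda>N. (\<Prod>p | prime p \<and> p \<le> N. 1 - f p) * suminf f) \<longlonglongrightarrow> 1"
proof -
  have sm: "f summable_on A" and nsm: "(\<lambda>n. norm (f n)) summable_on A" for A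
    using summable_norm_imp_abs_summable_on[OF f] abs_summable_summable by blast+
  let ?P = "\<lambda>N::nat. {p. prime p \<and> p \<le> N}" and ?T = "infsum (\<lambda>n. norm (f n)) UNIV"
  have fin: "finite (?P N)" for N by (rule finite_subset[OF _ finite_atMost[of N]]) auto
  have b1: "norm (infsum f (sifted (?P N)) - 1) \<le> ?T - (\<Sum>n\<le>N. norm (f n))" for N
  proof -
    \<comment> \<open>A number \<open>n \<ge> 2\<close> has a prime factor at most \<open>n\<close>.
      After sifting by all primes up to \<open>N\<close> there remain, apart from 0, where
      \<open>f\<close> vanishes, only 1 and numbers above \<open>N\<close>.\<close>
    have "sifted (?P N) \<inter> {0..N} \<subseteq> {0, 1}"
    proof
      fix n assume n: "n \<in> sifted (?P N) \<inter> {0..N}"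
      show "n \<in> {0, 1}"
      proof (rule ccontr)
        assume "n \<notin> {0, 1}"
        then have "n \<noteq> 1" by auto
        then obtain p where p: "prime p" "p dvd n" using prime_factor_nat by blast
        moreover have "p \<le> N" using p n \<open>n \<notin> {0,1}\<close> dvd_imp_le[of p n] by auto
        ultimately show False using n by (auto simp: sifted_def)
      qed
    qed
    moreover have "1 \<in> sifted (?P N)" by (auto simp: sifted_def)
    ultimately have sub: "sifted (?P N) - {0,1} \<subseteq> UNIV - {..N}" by auto
    have "infsum f (sifted (?P N)) = infsum f (insert 1 (sifted (?P N) - {0,1}))"
      by (rule infsum_cong_neutral) (use f0 \<open>1 \<in> sifted (?P N)\<close> in auto)
    also have "\<dots> = 1 + infsum f (sifted (?P N) - {0,1})"
      using infsum_Un_disjoint[OF sm sm, of "{1}" "sifted (?P N) - {0,1}"] f1 by simp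
    finally have "norm (infsum f (sifted (?P N)) - 1) = norm (infsum f (sifted (?P N) - {0,1}))" by simp
    also have "\<dots> \<le> infsum (\<lambda>n. norm (f n)) (sifted (?P N) - {0,1})"
      by (rule norm_infsum_bound[OF nsm])
    also have "\<dots> \<le> infsum (\<lambda>n. norm (f n)) (UNIV - {..N})"
      by (rule infsum_mono_neutral[OF nsm nsm]) (use sub in auto)
    also have "\<dots> = ?T - (\<Sum>n\<le>N. norm (f n))"
      by (subst infsum_Diff[OF nsm nsm]) auto
    finally show ?thesis .
  qed
  have bound: "norm ((\<Prod>p\<in>?P N. 1 - f p) * suminf f - 1) \<le> ?T - (\<Sum>n\<le>N. norm (f n))" for N
    using b1[of N] infsum_sifted[OF mult f fin, of N] by simp
  have "(\<lambda>n. norm (f n)) sums ?T"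
    by (rule has_sum_imp_sums) (rule has_sum_infsum[OF nsm])
  then have "(\<lambda>N. \<Sum>n<Suc N. norm (f n)) \<longlonglongrightarrow> ?T" unfolding sums_def by (rule LIMSEQ_Suc)
  then have "(\<lambda>N. \<Sum>n\<le>N. norm (f n)) \<longlonglongrightarrow> ?T" by (simp add: lessThan_Suc_atMost)
  then have lim: "(\<lambda>N. ?T - (\<Sum>n\<le>N. norm (f n))) \<longlonglongrightarrow> 0"
    using tendsto_diff[OF tendsto_const[of ?T]] by fastforce
  have "(\<lambda>N. (\<Prod>p\<in>?P N. 1 - f p) * suminf f - 1) \<longlonglongrightarrow> 0"
    by (rule Lim_null_comparison[OF _ lim]) (use bound in auto)
  then show ?thesis by (simp add: LIM_zero_iff)
qed

text \<open>On taking logarithms and expanding, the coefficient of \<open>r ^ n / n\<close> is minus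
  \<open>3 + 4 cos \<theta> + cos 2\<theta> = 2 (1 + cos \<theta>)^2\<close>. The value
  \<open>w = 0\<close> occurs at primes dividing the modulus.\<close>

lemma three_four_one_local:
  fixes w :: complex and r :: real
  assumes r: "0 \<le> r" "r < 1" and w: "w = 0 \<or> norm w = 1"
  shows "(1 - r) ^ 3 * norm (1 - of_real r * w) ^ 4 * norm (1 - of_real r * w ^ 2) \<le> 1"
proof (cases "w = 0")
  case True
  then show ?thesis using r by (simp add: power_le_one)
next
  case False
  then have w1: "norm w = 1" using w by simp
  \<comment> \<open>At \<open>n = 0\<close> the term is 0 by division by zero, in agreement with the
    power series of the logarithm.\<close>
  have ser: "(\<lambda>n. - (Re (z ^ n) / real n)) sums ln (norm (1 - z))" if "norm z < 1" for z :: complex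
  proof -
    have z1: "1 - z \<noteq> 0" using that by auto
    have "(\<lambda>n. (-1) ^ Suc n / of_nat n * (- z) ^ n) sums ln (1 + - z)"
      using that by (intro Ln_series) simp
    then have "(\<lambda>n. Re ((-1) ^ Suc n / of_nat n * (- z) ^ n)) sums Re (ln (1 + - z))"
      by (rule sums_Re)
    moreover have "Re ((-1) ^ Suc n / of_nat n * (- z) ^ n) = - (Re (z ^ n) / real n)" for n
    proof -
      have "(-1) ^ Suc n / of_nat n * (- z) ^ n = - ((-1) ^ n * (-1) ^ n) * z ^ n / of_nat n"
        by (simp add: power_minus[of z])
      also have "(-1) ^ n * (-1) ^ n = (1::complex)" by (simp flip: power_mult_distrib)
      finally show ?thesis by (simp add: complex_eq_iff)
    qed
    moreover have "Re (ln (1 + - z)) = ln (norm (1 - z))" using z1 by simp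
    ultimately show ?thesis by (simp only:)
  qed
  let ?z1 = "of_real r :: complex" and ?z2 = "of_real r * w" and ?z3 = "of_real r * w ^ 2"
  have n: "norm ?z1 < 1" "norm ?z2 < 1" "norm ?z3 < 1" using r w1 by (auto simp: norm_mult norm_power)
  have pos: "norm (1 - ?z1) > 0" "norm (1 - ?z2) > 0" "norm (1 - ?z3) > 0" using n by auto
  have sm: "(\<lambda>n. 3 * - (Re (?z1 ^ n) / real n) + 4 * - (Re (?z2 ^ n) / real n) + - (Re (?z3 ^ n) / real n)) sums
    (3 * ln (norm (1 - ?z1)) + 4 * ln (norm (1 - ?z2)) + ln (norm (1 - ?z3)))"
    by (intro sums_add sums_mult ser n)
  have le: "3 * - (Re (?z1 ^ n) / real n) + 4 * - (Re (?z2 ^ n) / real n) + - (Re (?z3 ^ n) / real n) \<le> 0" for n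
  proof -
    define c where "c = Re (w ^ n)"
    have "norm (w ^ n) = 1" using w1 by (simp add: norm_power)
    then have "(Re (w ^ n))\<^sup>2 + (Im (w ^ n))\<^sup>2 = 1" by (simp add: cmod_power2[symmetric])
    moreover have "Re ((w ^ n) ^ 2) = (Re (w ^ n))\<^sup>2 - (Im (w ^ n))\<^sup>2" by (simp add: power2_eq_square)
    ultimately have "Re ((w ^ 2) ^ n) = 2 * c\<^sup>2 - 1"
      by (simp add: c_def flip: power_mult) (simp add: mult.commute power_mult)
    then have "3 * - (Re (?z1 ^ n) / real n) + 4 * - (Re (?z2 ^ n) / real n) + - (Re (?z3 ^ n) / real n)
      = - (2 * (1 + c)\<^sup>2 * r ^ n / real n)"
      by (simp add: power_mult_distrib c_def[symmetric] flip: of_real_power)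
         (simp add: algebra_simps power2_eq_square add_divide_distrib diff_divide_distrib)
    also have "\<dots> \<le> 0" using r by simp
    finally show ?thesis .
  qed
  have "3 * ln (norm (1 - ?z1)) + 4 * ln (norm (1 - ?z2)) + ln (norm (1 - ?z3)) \<le> 0"
    by (rule sums_le[OF le sm sums_zero])
  then have "ln (norm (1 - ?z1) ^ 3 * norm (1 - ?z2) ^ 4 * norm (1 - ?z3)) \<le> 0"
    using pos by (simp add: ln_mult ln_realpow)
  then have "norm (1 - ?z1) ^ 3 * norm (1 - ?z2) ^ 4 * norm (1 - ?z3) \<le> 1"
    using pos by (subst (asm) ln_le_zero_iff) auto
  moreover have "norm (1 - ?z1) = 1 - r" using r by (metis abs_of_nonneg diff_ge_0_iff_ge less_imp_le norm_of_real of_real_1 of_real_diff)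
  ultimately show ?thesis by simp
qed

lemma ds_euler:
  fixes X :: "nat \<Rightarrow> complex"
  assumes mult: "\<And>m n. X (m * n) = X m * X n" and X1: "X 1 = 1" and b: "\<And>n. norm (X n) \<le> 1" and s: "Re s > 1"
  shows "(\<lambda>N. (\<Prod>p | prime p \<and> p \<le> N. 1 - X p * of_nat p powr (- s)) * ds X s) \<longlonglongrightarrow> 1"
  unfolding ds_def
proof (rule euler_product)
  show "X (m * n) * of_nat (m * n) powr (- s) = X m * of_nat m powr (- s) * (X n * of_nat n powr (- s))" for m n
    by (simp only: mult of_nat_mult_powr mult_ac)
  show "summable (\<lambda>n. norm (X n * of_nat n powr (- s)))"
    by (rule ds_summable_norm[where B = 1 and j = 0]) (use b s in auto)
qed (use X1 in auto)

text \<open>The local inequality bounds the finite Euler products by 1 from above; since each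
  product times its series tends to 1, the series inherit the opposite bound.\<close>

theorem three_four_one:
  fixes X :: "nat \<Rightarrow> complex"
  assumes mult: "\<And>m n. X (m * n) = X m * X n" and X1: "X 1 = 1" and v: "\<And>n. X n = 0 \<or> norm (X n) = 1"
    and sg: "sg > 1"
  shows "1 \<le> norm (zeta (of_real sg)) ^ 3 * norm (ds X (Complex sg t)) ^ 4 * norm (ds (\<lambda>n. X n ^ 2) (Complex sg (2 * t)))"
proof -
  have b: "norm (X n) \<le> 1" for n using v[of n] by auto
  have b2: "norm (X n ^ 2) \<le> 1" for n using v[of n] by (auto simp: norm_power)
  define e0 where "e0 = (\<lambda>N::nat. (\<Prod>p | prime p \<and> p \<le> N. 1 - 1 * of_nat p powr (- complex_of_real sg)) * zeta (of_real sg))"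
  define e1 where "e1 = (\<lambda>N::nat. (\<Prod>p | prime p \<and> p \<le> N. 1 - X p * of_nat p powr (- Complex sg t)) * ds X (Complex sg t))"
  define e2 where "e2 = (\<lambda>N::nat. (\<Prod>p | prime p \<and> p \<le> N. 1 - X p ^ 2 * of_nat p powr (- Complex sg (2 * t))) * ds (\<lambda>n. X n ^ 2) (Complex sg (2 * t)))"
  have lims: "e0 \<longlonglongrightarrow> 1" "e1 \<longlonglongrightarrow> 1" "e2 \<longlonglongrightarrow> 1"
    unfolding e0_def e1_def e2_def using sg X1 b b2
    by (intro ds_euler; simp add: mult power_mult_distrib)+
  have "(\<lambda>N. norm (e0 N) ^ 3 * norm (e1 N) ^ 4 * norm (e2 N)) \<longlonglongrightarrow> norm (1::complex) ^ 3 * norm (1::complex) ^ 4 * norm (1::complex)"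
    by (intro tendsto_intros lims)
  then have lim: "(\<lambda>N. norm (e0 N) ^ 3 * norm (e1 N) ^ 4 * norm (e2 N)) \<longlonglongrightarrow> 1" by simp
  have loc: "norm (1 - 1 * of_nat p powr (- complex_of_real sg)) ^ 3 * norm (1 - X p * of_nat p powr (- Complex sg t)) ^ 4 *
      norm (1 - X p ^ 2 * of_nat p powr (- Complex sg (2 * t))) \<le> 1" if p: "prime p" for p
  proof -
    define r where "r = real p powr (- sg)"
    define w where "w = X p * of_nat p powr (- Complex 0 t)"
    have p0: "real p > 1" using prime_gt_1_nat[OF p] by simp
    have r: "0 \<le> r" "r < 1" using p0 sg by (auto simp: r_def powr_minus_divide)
    have c0: "complex_of_nat p \<noteq> 0" using p0 by auto
    have rc: "of_nat p powr (- complex_of_real sg) = of_real r"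
      using p0 by (simp add: r_def powr_of_real[symmetric])
    have e1: "- Complex sg t = - complex_of_real sg + - Complex 0 t"
      and e2: "- Complex sg (2 * t) = - complex_of_real sg + (- Complex 0 t + - Complex 0 t)"
      by (auto simp: complex_eq_iff)
    have "X p * of_nat p powr (- Complex sg t) = of_real r * w"
      unfolding e1 powr_add rc by (simp add: w_def)
    moreover have "X p ^ 2 * of_nat p powr (- Complex sg (2 * t)) = of_real r * w ^ 2"
      unfolding e2 powr_add rc by (simp add: w_def power2_eq_square)
    moreover have "norm (of_nat p powr (- Complex 0 t) :: complex) = 1"
      using p0 by (simp add: norm_of_nat_powr)
    then have "w = 0 \<or> norm w = 1" using v[of p] by (auto simp: w_def norm_mult)
    moreover have "norm (1 - 1 * of_nat p powr (- complex_of_real sg)) = 1 - r"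
      unfolding rc using r by (metis abs_of_nonneg diff_ge_0_iff_ge less_imp_le mult_1 norm_of_real of_real_1 of_real_diff)
    ultimately show ?thesis using three_four_one_local[OF r] by simp
  qed
  have "norm (e0 N) ^ 3 * norm (e1 N) ^ 4 * norm (e2 N) \<le>
     norm (zeta (of_real sg)) ^ 3 * norm (ds X (Complex sg t)) ^ 4 * norm (ds (\<lambda>n. X n ^ 2) (Complex sg (2 * t)))" for N
  proof -
    have "norm (e0 N) ^ 3 * norm (e1 N) ^ 4 * norm (e2 N) =
      (\<Prod>p | prime p \<and> p \<le> N. norm (1 - 1 * of_nat p powr (- complex_of_real sg)) ^ 3 * norm (1 - X p * of_nat p powr (- Complex sg t)) ^ 4 *
        norm (1 - X p ^ 2 * of_nat p powr (- Complex sg (2 * t)))) *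
      (norm (zeta (of_real sg)) ^ 3 * norm (ds X (Complex sg t)) ^ 4 * norm (ds (\<lambda>n. X n ^ 2) (Complex sg (2 * t))))"
      unfolding e0_def e1_def e2_def norm_mult prod_norm[symmetric] prod.distrib prod_power_distrib power_mult_distrib
      by (simp only: mult_ac)
    also have "\<dots> \<le> 1 * (norm (zeta (of_real sg)) ^ 3 * norm (ds X (Complex sg t)) ^ 4 * norm (ds (\<lambda>n. X n ^ 2) (Complex sg (2 * t))))"
      by (intro mult_right_mono prod_le_1) (use loc in auto)
    finally show ?thesis by simp
  qed
  then show ?thesis by (intro Lim_bounded[OF lim]) auto
qed

subsection \<open>Dirichlet characters\<close>

text \<open>A character of the units modulo \<open>q\<close>, extended by 0 to all naturals so that
  it is a coefficient sequence. As the values off the units are prescribed, characters may be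
  counted as functions.\<close>

definition dchar :: "nat \<Rightarrow> (nat \<Rightarrow> complex) \<Rightarrow> bool" where
  "dchar q X \<longleftrightarrow> X 1 = 1 \<and> (\<forall>m n. X (m * n) = X m * X n) \<and> (\<forall>m n. [m = n] (mod q) \<longrightarrow> X m = X n) \<and>
     (\<forall>n. X n \<noteq> 0 \<longleftrightarrow> coprime n q)"

definition pchar :: "nat \<Rightarrow> nat \<Rightarrow> complex" where
  "pchar q n = (if coprime n q then 1 else 0)"

text \<open>Characters of subgroups of the group of units, where a subgroup is a set of natural numbers that is
  closed under congruence.\<close>

definition unit_subgroup :: "nat \<Rightarrow> nat set \<Rightarrow> bool" where
  "unit_subgroup q H \<longleftrightarrow> 1 \<in> H \<and> (\<forall>m\<in>H. \<forall>n\<in>H. m * n \<in> H) \<and> (\<forall>m\<in>H. \<forall>n. [m = n] (mod q) \<longrightarrow> n \<in> H) \<and> (\<forall>n\<in>H. coprime n q)"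

definition subgroup_char :: "nat \<Rightarrow> nat set \<Rightarrow> (nat \<Rightarrow> complex) \<Rightarrow> bool" where
  "subgroup_char q H X \<longleftrightarrow> X 1 = 1 \<and> (\<forall>m\<in>H. \<forall>n\<in>H. X (m * n) = X m * X n) \<and> (\<forall>m\<in>H. \<forall>n. [m = n] (mod q) \<longrightarrow> X m = X n)"

lemma unit_subgroup_power: "unit_subgroup q H \<Longrightarrow> m \<in> H \<Longrightarrow> m ^ i \<in> H"
  by (induction i) (auto simp: unit_subgroup_def)

lemma unit_subgroup_cong: "unit_subgroup q H \<Longrightarrow> m \<in> H \<Longrightarrow> [m = n] (mod q) \<Longrightarrow> n \<in> H"
  by (auto simp: unit_subgroup_def)

lemma subgroup_char_power:
  "unit_subgroup q H \<Longrightarrow> subgroup_char q H X \<Longrightarrow> m \<in> H \<Longrightarrow> X (m ^ i) = X m ^ i"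
proof (induction i)
  case (Suc i)
  then show ?case using unit_subgroup_power[of q H m i] by (auto simp: subgroup_char_def)
qed (auto simp: subgroup_char_def)

text \<open>Euler's theorem provides the inverse of \<open>h\<close> inside \<open>H\<close>, as the
  power with exponent \<open>totient q - 1\<close>.\<close>

lemma unit_subgroup_cancel:
  assumes H: "unit_subgroup q H" and h: "h \<in> H" "h * b \<in> H"
  shows "b \<in> H"
proof -
  have "[h ^ totient q = 1] (mod q)" using H h by (intro euler_theorem) (auto simp: unit_subgroup_def)
  then have "[h ^ totient q * b = 1 * b] (mod q)" by (rule cong_scalar_right)
  moreover have "h ^ totient q * b \<in> H"
  proof (cases "totient q")
    case 0
    \<comment> \<open>Coprimality to 0 forces \<open>h = 1\<close>.\<close>
    then have "q = 0" by simp
    then show ?thesis using H h by (auto simp: unit_subgroup_def)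
  next
    case (Suc t)
    have "h ^ t * (h * b) \<in> H" using H h unit_subgroup_power[OF H h(1)] by (auto simp: unit_subgroup_def)
    then show ?thesis by (simp add: Suc mult_ac)
  qed
  ultimately show ?thesis using H by (auto simp: unit_subgroup_def)
qed

text \<open>With \<open>m\<close> the order of \<open>a\<close> modulo \<open>H\<close>, the value
  at \<open>a\<close> may be any \<open>m\<close>-th root of \<open>X (a ^ m)\<close>. Both the
  existence of an extension and the freedom in choosing \<open>w\<close> are used later.\<close>

lemma unit_subgroup_char_extend:
  assumes q: "q > 0" and H: "unit_subgroup q H" and X: "subgroup_char q H X" and a: "coprime a q"
    and m: "m > 0" "a ^ m \<in> H" "\<And>i. 0 < i \<Longrightarrow> i < m \<Longrightarrow> a ^ i \<notin> H" and w: "w ^ m = X (a ^ m)"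
  shows "\<exists>H' X'. unit_subgroup q H' \<and> subgroup_char q H' X' \<and> H \<subseteq> H' \<and> a \<in> H' \<and>
    (\<forall>n\<in>H. X' n = X n) \<and> X' a = w"
proof -
  \<comment> \<open>The exponent \<open>i\<close> is not reduced modulo \<open>m\<close>. Products
    of representations are then representations, and the price is paid once, in the proof that the
    value is well defined.\<close>
  define rep where "rep = (\<lambda>n h i. h \<in> H \<and> [n = h * a ^ i] (mod q))"
  define H' where "H' = {n. \<exists>h i. rep n h i}"
  define X' where "X' = (\<lambda>n. THE v. \<exists>h i. rep n h i \<and> v = X h * w ^ i)"
  have unit: "coprime (a ^ i) q" for i using a by simp
  have pow: "m dvd i \<and> X (a ^ i) = w ^ i" if "a ^ i \<in> H" for i
  proof -
    have "a ^ (m * (i div m)) \<in> H" using unit_subgroup_power[OF H m(2)] by (simp add: power_mult)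
    moreover have "a ^ (m * (i div m)) * a ^ (i mod m) = a ^ i" by (simp flip: power_add)
    ultimately have "a ^ (i mod m) \<in> H" using unit_subgroup_cancel[OF H] that by metis
    then have "i mod m = 0" using m(3)[of "i mod m"] m(1) by auto
    then have d: "m dvd i" by auto
    then obtain t where t: "i = m * t" by auto
    have "X (a ^ i) = X (a ^ m) ^ t" unfolding t power_mult by (rule subgroup_char_power[OF H X m(2)])
    then show ?thesis using d w t by (metis power_mult)
  qed
  \<comment> \<open>Cancelling the common power \<open>a ^ j\<close> leaves
    \<open>a ^ (i - j)\<close> in \<open>H\<close>, where the character is already known.\<close>
  have wd0: "X h * w ^ i = X h' * w ^ j" if r: "rep n h i" "rep n h' j" and ij: "j \<le> i" for n h i h' j
  proof -
    have hh: "h \<in> H" "h' \<in> H" using r by (auto simp: rep_def)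
    have "[h * a ^ i = h' * a ^ j] (mod q)" using r by (auto simp: rep_def cong_def)
    then have "[h * a ^ (i - j) * a ^ j = h' * a ^ j] (mod q)" using ij by (simp add: mult.assoc flip: power_add)
    then have c: "[h * a ^ (i - j) = h'] (mod q)" using unit[of j] by (simp add: cong_mult_rcancel_nat)
    then have in_H: "h * a ^ (i - j) \<in> H" by (intro unit_subgroup_cong[OF H hh(2)] cong_sym[OF c])
    then have a_H: "a ^ (i - j) \<in> H" by (rule unit_subgroup_cancel[OF H hh(1)])
    have "X h' = X (h * a ^ (i - j))" using X hh(2) cong_sym[OF c] unfolding subgroup_char_def by blast
    also have "\<dots> = X h * w ^ (i - j)" using X hh a_H pow[OF a_H] by (auto simp: subgroup_char_def)
    finally show ?thesis using ij by (simp add: mult.assoc flip: power_add)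
  qed
  have wd: "X h * w ^ i = X h' * w ^ j" if "rep n h i" "rep n h' j" for n h i h' j
    using wd0[OF that] wd0[OF that(2,1)] by (cases "j \<le> i") auto
  have X'I: "X' n = X h * w ^ i" if "rep n h i" for n h i
    unfolding X'_def by (rule the_equality) (use wd that in blast)+
  have repmult: "rep (n * n') (h * h') (i + i')" if "rep n h i" "rep n' h' i'" for n n' h h' i i'
  proof -
    have "[n * n' = (h * a ^ i) * (h' * a ^ i')] (mod q)" using that by (intro cong_mult) (auto simp: rep_def)
    moreover have "(h * a ^ i) * (h' * a ^ i') = h * h' * a ^ (i + i')" by (simp add: power_add mult_ac)
    ultimately show ?thesis using that H by (auto simp: rep_def unit_subgroup_def)
  qed
  have repcong: "rep n' h i" if "rep n h i" "[n = n'] (mod q)" for n n' h i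
    using that by (auto simp: rep_def cong_def)
  have rep0: "rep n n 0" if "n \<in> H" for n using that by (simp add: rep_def)
  have one: "1 \<in> H" using H by (auto simp: unit_subgroup_def)
  have repa: "rep a 1 1" using one by (simp add: rep_def)
  show ?thesis
  proof (intro exI[of _ H'] exI[of _ X'] conjI ballI)
    show "unit_subgroup q H'"
      unfolding unit_subgroup_def
    proof (intro conjI ballI allI impI)
      show "1 \<in> H'" using rep0[OF one] by (auto simp: H'_def)
      show "n * n' \<in> H'" if "n \<in> H'" "n' \<in> H'" for n n' using that repmult unfolding H'_def by blast
      show "n' \<in> H'" if "n \<in> H'" "[n = n'] (mod q)" for n n' using that repcong unfolding H'_def by blast
      show "coprime n q" if nH: "n \<in> H'" for n
      proof -
        obtain h i where "rep n h i" using nH by (auto simp: H'_def)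
        then have "coprime (h * a ^ i) q" "[n = h * a ^ i] (mod q)" using H a by (auto simp: rep_def unit_subgroup_def)
        then show ?thesis using cong_imp_coprime[OF cong_sym] by blast
      qed
    qed
    show "subgroup_char q H' X'"
      unfolding subgroup_char_def
    proof (intro conjI ballI allI impI)
      show "X' 1 = 1" using X'I[OF rep0[OF one]] X by (simp add: subgroup_char_def)
      show "X' (n * n') = X' n * X' n'" if n: "n \<in> H'" "n' \<in> H'" for n n'
      proof -
        obtain h i h' i' where r: "rep n h i" "rep n' h' i'" using n by (auto simp: H'_def)
        then have "X (h * h') = X h * X h'" using X by (auto simp: rep_def subgroup_char_def)
        then show ?thesis using X'I[OF r(1)] X'I[OF r(2)] X'I[OF repmult[OF r]] by (simp add: power_add mult_ac)
      qed
      show "X' n = X' n'" if n: "n \<in> H'" "[n = n'] (mod q)" for n n'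
      proof -
        obtain h i where r: "rep n h i" using n by (auto simp: H'_def)
        then show ?thesis using X'I[OF r] X'I[OF repcong[OF r n(2)]] by simp
      qed
    qed
    show "H \<subseteq> H'" using rep0 by (auto simp: H'_def)
    show "a \<in> H'" using repa by (auto simp: H'_def)
    show "X' n = X n" if "n \<in> H" for n using X'I[OF rep0[OF that]] by simp
    show "X' a = w" using X'I[OF repa] X by (simp add: subgroup_char_def)
  qed
qed

lemma least_power_in_subgroup:
  assumes H: "unit_subgroup q H" and a: "coprime a q" and q: "q > 0"
  obtains m where "m > 0" "a ^ m \<in> H" "\<And>i. 0 < i \<Longrightarrow> i < m \<Longrightarrow> a ^ i \<notin> H"
proof -
  let ?P = "\<lambda>m. m > 0 \<and> a ^ m \<in> H"
  have "[1 = a ^ totient q] (mod q)" using euler_theorem[OF a] by (rule cong_sym)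
  then have "?P (totient q)" using H q by (auto simp: unit_subgroup_def)
  then have "?P (LEAST m. ?P m)" by (rule LeastI)
  moreover have "\<not> ?P i" if "i < (LEAST m. ?P m)" for i using that by (rule not_less_Least)
  ultimately show ?thesis using that by blast
qed

text \<open>One unit is adjoined at a time until all are reached. This produces enough characters
  without decomposing the unit group into cyclic factors.\<close>

lemma subgroup_char_extend_all:
  assumes q: "q > 0" and H: "unit_subgroup q H" and X: "subgroup_char q H X"
  obtains X' where "dchar q X'" "\<And>n. n \<in> H \<Longrightarrow> X' n = X n"
proof -
  have "\<exists>X'. dchar q X' \<and> (\<forall>n\<in>H. X' n = X n)"
    using H X
  proof (induction "card ({n. n < q \<and> coprime n q} - H)" arbitrary: H X rule: less_induct)
    case less
    note H = less.prems(1) and X = less.prems(2)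
    show ?case
    proof (cases "\<exists>a. coprime a q \<and> a \<notin> H")
      case True
      then obtain a where a: "coprime a q" "a \<notin> H" by blast
      obtain m where m: "m > 0" "a ^ m \<in> H" "\<And>i. 0 < i \<Longrightarrow> i < m \<Longrightarrow> a ^ i \<notin> H"
        using least_power_in_subgroup[OF H a(1) q] by blast
      obtain w where w': "X (a ^ m) = w ^ m"
        by (rule exists_complex_root[of m "X (a ^ m)"]) (use m(1) in simp)
      note w = w'[symmetric]
      obtain H' X' where H': "unit_subgroup q H'" "subgroup_char q H' X'" "H \<subseteq> H'" "a \<in> H'"
        "\<And>n. n \<in> H \<Longrightarrow> X' n = X n"
        using unit_subgroup_char_extend[OF q H X a(1) m w] by blast
      have am: "[a = a mod q] (mod q)" by (simp add: cong_def)
      have "a mod q \<in> ({n. n < q \<and> coprime n q} - H) - ({n. n < q \<and> coprime n q} - H')"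
      proof -
        have "a mod q \<in> H'" using H' am by (auto simp: unit_subgroup_def)
        moreover have "a mod q \<notin> H" using unit_subgroup_cong[OF H _ cong_sym[OF am]] a(2) by blast
        ultimately show ?thesis using a q by simp
      qed
      then have "{n. n < q \<and> coprime n q} - H' \<subset> {n. n < q \<and> coprime n q} - H" using H'(3) by blast
      then have "card ({n. n < q \<and> coprime n q} - H') < card ({n. n < q \<and> coprime n q} - H)"
        by (intro psubset_card_mono) auto
      from less.hyps[OF this H'(1,2)] show ?thesis using H'(3,5) by (metis subsetD)
    next
      case False
      define Y where "Y = (\<lambda>n. if n \<in> H then X n else 0)"
      have HH: "n \<in> H \<longleftrightarrow> coprime n q" for n
      proof
        show "coprime n q" if "n \<in> H" using H that by (simp add: unit_subgroup_def)
      qed (use False in blast)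
      have nz: "X n \<noteq> 0" if "n \<in> H" for n
      proof -
        have "[n ^ totient q = 1] (mod q)" using that HH by (intro euler_theorem) simp
        then have "X (n ^ totient q) = 1"
          using X unit_subgroup_power[OF H that] unfolding subgroup_char_def by metis
        then have "X n ^ totient q = 1" using subgroup_char_power[OF H X that] by simp
        then show ?thesis using q by (metis power_0_left totient_gt_0_iff less_numeral_extra(3) zero_neq_one)
      qed
      have "dchar q Y"
        unfolding dchar_def
      proof (intro conjI allI impI)
        show "Y 1 = 1" using X HH by (simp add: Y_def subgroup_char_def)
        show "Y (m * n) = Y m * Y n" for m n using X HH by (simp add: Y_def subgroup_char_def)
        show "Y m = Y n" if "[m = n] (mod q)" for m n
          using that X HH cong_imp_coprime[OF that] cong_imp_coprime[OF cong_sym[OF that]]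
          by (auto simp: Y_def subgroup_char_def)
        show "Y n \<noteq> 0 \<longleftrightarrow> coprime n q" for n using nz HH by (auto simp: Y_def)
      qed
      then show ?thesis by (intro exI[of _ Y]) (auto simp: Y_def)
    qed
  qed
  then show ?thesis using that by blast
qed

text \<open>Starting from the trivial subgroup, the value at \<open>a\<close>, whose order
  \<open>m\<close> modulo \<open>q\<close> is at least 2, is chosen to be a primitive
  \<open>m\<close>-th root of unity.\<close>

lemma dchar_separates:
  assumes q: "q > 0" and a: "coprime a q" "\<not> [a = 1] (mod q)"
  obtains X where "dchar q X" "X a \<noteq> 1"
proof -
  define H where "H = {n. [n = 1] (mod q)}"
  have H: "unit_subgroup q H"
    unfolding unit_subgroup_def H_def
  proof (intro conjI ballI allI impI; clarsimp)
    show "[m * n = Suc 0] (mod q)" if "[m = Suc 0] (mod q)" "[n = Suc 0] (mod q)" for m n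
      using cong_mult[OF that] by simp
    show "[n = Suc 0] (mod q)" if "[m = Suc 0] (mod q)" "[m = n] (mod q)" for m n
      by (rule cong_trans[OF cong_sym[OF that(2)] that(1)])
    show "coprime n q" if "[n = Suc 0] (mod q)" for n
      using that cong_imp_coprime[OF cong_sym[OF that]] by simp
  qed
  have X: "subgroup_char q H (\<lambda>_. 1)" by (simp add: subgroup_char_def)
  obtain m where m: "m > 0" "a ^ m \<in> H" "\<And>i. 0 < i \<Longrightarrow> i < m \<Longrightarrow> a ^ i \<notin> H"
    using least_power_in_subgroup[OF H a(1) q] by blast
  have "a \<notin> H" using a by (simp add: H_def)
  then have m2: "m \<noteq> 1" using m(2) by (metis power_one_right)
  define w where "w = cis (2 * pi / real m)"
  have wm: "w ^ m = 1" using m(1) by (simp add: w_def Complex.DeMoivre)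
  have "w \<noteq> 1"
  proof
    assume "w = 1"
    then have "cis (2 * pi * real 1 / real m) = 1" by (simp add: w_def)
    then have "cis (2 * pi * real 1 / real m) = cis (2 * pi * real 0 / real m)" by simp
    moreover have "inj_on (\<lambda>k. cis (2 * pi * real k / real m)) {..<m}"
      using Complex.bij_betw_roots_unity[OF m(1)] by (auto simp: bij_betw_def)
    ultimately have "(1::nat) = 0" using m(1) m2 by (auto dest!: inj_onD[where x = 1 and y = 0])
    then show False by simp
  qed
  obtain H' X' where H': "unit_subgroup q H'" "subgroup_char q H' X'" "a \<in> H'" "X' a = w"
    using unit_subgroup_char_extend[OF q H X a(1) m wm] by blast
  obtain Y where Y: "dchar q Y" "\<And>n. n \<in> H' \<Longrightarrow> Y n = X' n"
    using subgroup_char_extend_all[OF q H'(1,2)] by blast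
  show ?thesis using that[OF Y(1)] Y(2)[OF H'(3)] H'(4) \<open>w \<noteq> 1\<close> by simp
qed

lemma dchar_power: "dchar q X \<Longrightarrow> X (n ^ i) = X n ^ i"
  by (induction i) (auto simp: dchar_def)

lemma dchar_root_of_unity:
  assumes "dchar q X" "coprime n q" shows "X n ^ totient q = 1"
proof -
  have "[n ^ totient q = 1] (mod q)" using assms(2) by (rule euler_theorem)
  then have "X (n ^ totient q) = X 1" using assms(1) unfolding dchar_def by blast
  then show ?thesis using dchar_power[OF assms(1)] assms(1) by (simp add: dchar_def)
qed

lemma dchar_norm:
  assumes q: "q > 0" and X: "dchar q X"
  shows "X n = 0 \<or> norm (X n) = 1"
proof (cases "coprime n q")
  case True
  then have "norm (X n) ^ totient q = 1" using dchar_root_of_unity[OF X True] by (metis norm_one norm_power)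
  then show ?thesis using q power_eq_imp_eq_base[of "norm (X n)" "totient q" 1] by simp
qed (use X in \<open>auto simp: dchar_def\<close>)

lemma dchar_norm_le: "q > 0 \<Longrightarrow> dchar q X \<Longrightarrow> norm (X n) \<le> 1"
  using dchar_norm[of q X n] by auto

lemma dchar_mod: "dchar q X \<Longrightarrow> X (n mod q) = X n"
  unfolding dchar_def by (metis cong_mod_left cong_refl)

lemma finite_dchars:
  assumes q: "q > 0"
  shows "finite {X. dchar q X}"
proof -
  define R where "R = insert 0 {z::complex. z ^ totient q = 1}"
  have "finite {z::complex. z ^ totient q = 1}" using q by (intro finite_roots_unity) (simp add: Suc_le_eq)
  then have fin: "finite (PiE {..<q} (\<lambda>_. R))" by (intro finite_PiE) (auto simp: R_def)
  have "inj_on (\<lambda>X. restrict X {..<q}) {X. dchar q X}"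
  proof (rule inj_onI, rule ext)
    fix X Y and n :: nat
    assume XY: "X \<in> {X. dchar q X}" "Y \<in> {X. dchar q X}" "restrict X {..<q} = restrict Y {..<q}"
    have "X (n mod q) = restrict X {..<q} (n mod q)" "Y (n mod q) = restrict Y {..<q} (n mod q)" using q by auto
    then show "X n = Y n" using XY dchar_mod by (metis mem_Collect_eq)
  qed
  moreover have "(\<lambda>X. restrict X {..<q}) ` {X. dchar q X} \<subseteq> PiE {..<q} (\<lambda>_. R)"
  proof (intro image_subsetI)
    fix X assume X: "X \<in> {X. dchar q X}"
    have "X n \<in> R" for n
      using X dchar_root_of_unity[of q X n] by (cases "coprime n q") (auto simp: R_def dchar_def)
    then show "restrict X {..<q} \<in> PiE {..<q} (\<lambda>_. R)" by auto
  qed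
  ultimately show ?thesis using fin by (meson finite_imageD finite_subset)
qed

lemma pchar_dchar: "q > 0 \<Longrightarrow> dchar q (pchar q)"
  unfolding dchar_def pchar_def by (auto dest: cong_imp_coprime cong_imp_coprime[OF cong_sym])

lemma dchar_mult: "dchar q X \<Longrightarrow> dchar q Y \<Longrightarrow> dchar q (\<lambda>n. X n * Y n)"
  unfolding dchar_def by (auto simp: mult_ac)

lemma dchar_inverse:
  assumes q: "q > 0" and "dchar q X"
  shows "dchar q (\<lambda>n. inverse (X n))"
  using assms unfolding dchar_def by auto

text \<open>For a unit \<open>n\<close> other than 1, multiplication by a character \<open>Y\<close>
  with \<open>Y n \<noteq> 1\<close> permutes the characters and multiplies the sum by
  \<open>Y n\<close>.\<close>

lemma sum_dchars:
  assumes q: "q > 0"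
  shows "(\<Sum>X | dchar q X. X n) = (if [n = 1] (mod q) then of_nat (card {X. dchar q X}) else 0)"
proof (cases "[n = 1] (mod q)")
  case True
  then have "X n = 1" if "dchar q X" for X using that unfolding dchar_def by metis
  then have "(\<Sum>X | dchar q X. X n) = (\<Sum>X | dchar q X. 1)" by (intro sum.cong) auto
  then show ?thesis using True by simp
next
  case False
  show ?thesis
  proof (cases "coprime n q")
    case nc: False
    then have "(\<Sum>X | dchar q X. X n) = 0" by (intro sum.neutral) (auto simp: dchar_def)
    then show ?thesis using False by simp
  next
    case True
    obtain Y where Y: "dchar q Y" "Y n \<noteq> 1" using dchar_separates[OF q True False] .
    have nz: "Y m \<noteq> 0 \<longleftrightarrow> coprime m q" for m using Y by (simp add: dchar_def)
    have inv: "(\<lambda>m. inverse (Y m) * (Y m * X m)) = X" "(\<lambda>m. Y m * (inverse (Y m) * X m)) = X" if "dchar q X" for X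
    proof -
      have "inverse (Y m) * (Y m * X m) = X m \<and> Y m * (inverse (Y m) * X m) = X m" for m
        using nz[of m] that by (cases "Y m = 0") (auto simp: dchar_def)
      then show "(\<lambda>m. inverse (Y m) * (Y m * X m)) = X" "(\<lambda>m. Y m * (inverse (Y m) * X m)) = X" by auto
    qed
    have "(\<Sum>X | dchar q X. X n) = (\<Sum>X | dchar q X. Y n * X n)"
      by (rule sum.reindex_bij_witness[of _ "\<lambda>X m. Y m * X m" "\<lambda>X m. inverse (Y m) * X m"])
         (use inv True nz in \<open>auto intro!: dchar_mult dchar_inverse Y q\<close>)
    also have "\<dots> = Y n * (\<Sum>X | dchar q X. X n)" by (simp add: sum_distrib_left)
    finally have "(1 - Y n) * (\<Sum>X | dchar q X. X n) = 0" by (simp add: algebra_simps)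
    then show ?thesis using Y(2) False by simp
  qed
qed

lemma dchar_period_sum_eq_0:
  assumes q: "q > 0" and X: "dchar q X" "X \<noteq> pchar q"
  shows "(\<Sum>n<q. X n) = 0"
proof -
  obtain a where a: "X a \<noteq> pchar q a" using X(2) by (auto simp: fun_eq_iff)
  then have ca: "coprime a q" using X(1) by (auto simp: pchar_def dchar_def split: if_splits)
  then have Xa: "X a \<noteq> 1" using a by (simp add: pchar_def)
  obtain b where b: "[a * b = 1] (mod q)" using ca cong_solve_coprime_nat by auto
  have "(\<Sum>n<q. X n) = (\<Sum>n<q. X ((a * n) mod q))"
    by (rule sum.reindex_bij_witness[of _ "\<lambda>n. (a * n) mod q" "\<lambda>n. (b * n) mod q"])
       (use q b in \<open>auto simp: cong_def mod_mult_right_eq mod_mult_left_eq mult.assoc[symmetric] simp del: One_nat_def\<close>,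
        (metis mod_less mod_mult_left_eq mult.commute mult_1)+)
  also have "\<dots> = X a * (\<Sum>n<q. X n)"
    using X(1) by (simp add: dchar_mod sum_distrib_left) (simp add: dchar_def)
  finally have "(1 - X a) * (\<Sum>n<q. X n) = 0" by (simp add: algebra_simps)
  then show ?thesis using Xa by simp
qed

lemma sum_pchar: "q > 0 \<Longrightarrow> (\<Sum>n<q. pchar q n) = of_nat (totient q)"
proof (cases "q = 1")
  case False
  assume q: "q > 0"
  have "{n\<in>{..<q}. coprime n q} = totatives q"
  proof (intro equalityI subsetI)
    fix n assume n: "n \<in> {n\<in>{..<q}. coprime n q}"
    then have "n \<noteq> 0" using False by (auto intro: gr0I)
    then show "n \<in> totatives q" using n by (auto simp: in_totatives_iff)
  next
    fix n assume "n \<in> totatives q"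
    then show "n \<in> {n\<in>{..<q}. coprime n q}" using totatives_less[of n q] False q by (auto simp: in_totatives_iff)
  qed
  then show ?thesis unfolding pchar_def by (simp add: sum.If_cases totient_def Int_def)
qed (simp add: pchar_def)

text \<open>All characters are summed over a full period in both orders: one way only the principal
  character contributes, the other way only the residue 1.\<close>

lemma card_dchars:
  assumes q: "q > 0"
  shows "card {X. dchar q X} = totient q"
proof -
  have "(\<Sum>n<q. \<Sum>X | dchar q X. X n) = (\<Sum>X | dchar q X. \<Sum>n<q. X n)" by (rule sum.swap)
  also have "\<dots> = (\<Sum>X | dchar q X. if X = pchar q then of_nat (totient q) else 0)"
    by (intro sum.cong refl) (use dchar_period_sum_eq_0[OF q] sum_pchar[OF q] in auto)
  also have "\<dots> = of_nat (totient q)"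
    using finite_dchars[OF q] pchar_dchar[OF q] by (simp add: sum.delta)
  finally have 1: "(\<Sum>n<q. \<Sum>X | dchar q X. X n) = of_nat (totient q)" .
  \<comment> \<open>Written \<open>1 mod q\<close> so that it is the representative below
    \<open>q\<close> even for \<open>q = 1\<close>.\<close>
  have "(\<Sum>n<q. \<Sum>X | dchar q X. X n) = (\<Sum>n<q. if n = 1 mod q then of_nat (card {X. dchar q X}) else 0)"
    by (intro sum.cong refl) (auto simp: sum_dchars[OF q] cong_def)
  also have "\<dots> = of_nat (card {X. dchar q X})" using q by (simp add: sum.delta)
  finally have "complex_of_nat (card {X. dchar q X}) = of_nat (totient q)" using 1 by simp
  then show ?thesis by (simp only: of_nat_eq_iff)
qed

theorem dchar_orthogonality:
  assumes q: "q > 0"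
  shows "(\<Sum>X | dchar q X. X n) = (if [n = 1] (mod q) then of_nat (totient q) else 0)"
  using sum_dchars[OF q] card_dchars[OF q] by simp

text \<open>Complete periods cancel, and fewer than \<open>q\<close> terms remain.\<close>

lemma periodic_sum_zero_bounded:
  fixes c :: "nat \<Rightarrow> complex"
  assumes q: "q > 0" and per: "\<And>n. c (n + q) = c n" and c1: "\<And>n. norm (c n) \<le> 1" and z: "(\<Sum>n<q. c n) = 0"
  shows "norm (\<Sum>n\<in>{M<..N}. c n) \<le> real q"
proof -
  have block: "(\<Sum>n\<in>{a..<a+q}. c n) = 0" for a
  proof (induction a)
    case 0
    then show ?case using z by (simp add: lessThan_atLeast0)
  next
    case (Suc a)
    have "(\<Sum>n\<in>{Suc a..<Suc a+q}. c n) + c a = (\<Sum>n\<in>{a..<a+q}. c n) + c (a + q)"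
      using sum.atLeast_Suc_lessThan[of a "a + Suc q" c] sum.atLeastLessThan_Suc[of a "a + q" c] q
      by (simp add: add_ac)
    then show ?case using per[of a] Suc by simp
  qed
  have "norm (\<Sum>n\<in>{a..<a+m}. c n) \<le> real q" for a m
  proof (induction m arbitrary: a rule: less_induct)
    case (less m)
    show ?case
    proof (cases "m < q")
      case True
      have "norm (\<Sum>n\<in>{a..<a+m}. c n) \<le> (\<Sum>n\<in>{a..<a+m}. 1)" by (rule sum_norm_le) (rule c1)
      then show ?thesis using True by simp
    next
      case False
      have "(\<Sum>n\<in>{a..<a+m}. c n) = (\<Sum>n\<in>{a..<a+q}. c n) + (\<Sum>n\<in>{a+q..<(a+q)+(m-q)}. c n)"
        using False by (subst sum.atLeastLessThan_concat) auto
      then show ?thesis using block less.IH[of "m - q" "a + q"] q False by simp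
    qed
  qed
  from this[of "Suc M" "N - M"] show ?thesis
    by (cases "M \<le> N") (auto simp: atLeastLessThanSuc_atLeastAtMost atLeastSucAtMost_greaterThanAtMost)
qed

lemma dchar_bounded_sums:
  assumes q: "q > 0" and X: "dchar q X" "X \<noteq> pchar q"
  shows "norm (\<Sum>n\<in>{M<..N}. X n) \<le> real q"
proof (rule periodic_sum_zero_bounded[OF q])
  show "X (n + q) = X n" for n using dchar_mod[OF X(1), of "n + q"] dchar_mod[OF X(1), of n] by simp
qed (use dchar_norm_le[OF q X(1)] dchar_period_sum_eq_0[OF q X] in auto)

subsection \<open>Dirichlet convolution\<close>

definition dconv :: "(nat \<Rightarrow> real) \<Rightarrow> (nat \<Rightarrow> real) \<Rightarrow> nat \<Rightarrow> real" where
  "dconv a b n = (\<Sum>d | d dvd n. a d * b (n div d))"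

lemma dconv_pairs:
  assumes "n > 0"
  shows "dconv a b n = (\<Sum>(d,e) | d * e = n. a d * b e)"
  unfolding dconv_def
  by (rule sum.reindex_bij_witness[of _ fst "\<lambda>d. (d, n div d)"]) (use assms in auto)

lemma finite_factor_pairs: "n > 0 \<Longrightarrow> finite {(d,e). d * e = (n::nat)}"
  by (rule finite_subset[of _ "{..n} \<times> {..n}"]) auto

lemma dconv_comm:
  assumes "n > 0" shows "dconv a b n = dconv b a n"
  unfolding dconv_pairs[OF assms]
  by (rule sum.reindex_bij_witness[of _ "\<lambda>(d,e). (e,d)" "\<lambda>(d,e). (e,d)"]) (auto simp: mult.commute)

lemma dconv_assoc:
  assumes n: "n > 0" shows "dconv (dconv a b) c n = dconv a (dconv b c) n"
proof -
  define P where "P = (\<lambda>n::nat. {(d::nat,e::nat). d * e = n})"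
  have pairs: "dconv f g m = (\<Sum>p\<in>P m. f (fst p) * g (snd p))" if "m > 0" for f g m
    using dconv_pairs[OF that] by (simp add: P_def case_prod_unfold)
  have fin: "finite (P m)" if "m > 0" for m using finite_factor_pairs[OF that] by (simp add: P_def)
  have pos: "fst p > 0 \<and> snd p > 0" if "p \<in> P n" for p using that n by (auto simp: P_def)
  have "dconv (dconv a b) c n = (\<Sum>p\<in>P n. \<Sum>r\<in>P (fst p). a (fst r) * b (snd r) * c (snd p))"
    unfolding pairs[OF n] by (intro sum.cong refl) (simp add: pairs pos sum_distrib_right)
  also have "\<dots> = (\<Sum>(p,r)\<in>Sigma (P n) (\<lambda>p. P (fst p)). a (fst r) * b (snd r) * c (snd p))"
    by (rule sum.Sigma) (use fin n pos in auto)
  also have "\<dots> = (\<Sum>(p,r)\<in>Sigma (P n) (\<lambda>p. P (snd p)). a (fst p) * b (fst r) * c (snd r))"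
    by (rule sum.reindex_bij_witness[of _ "\<lambda>((x,v),(y,z)). ((x * y, z), (x, y))" "\<lambda>((u,z),(x,y)). ((x, y * z), (y, z))"])
       (auto simp: mult_ac P_def)
  also have "\<dots> = (\<Sum>p\<in>P n. \<Sum>r\<in>P (snd p). a (fst p) * b (fst r) * c (snd r))"
    by (rule sum.Sigma[symmetric]) (use fin n pos in auto)
  also have "\<dots> = dconv a (dconv b c) n"
    unfolding pairs[OF n] by (intro sum.cong refl) (simp add: pairs pos sum_distrib_left mult.assoc)
  finally show ?thesis .
qed

lemma dconv_cong:
  assumes "\<And>m. m > 0 \<Longrightarrow> m dvd n \<Longrightarrow> a m = a' m" "\<And>m. m > 0 \<Longrightarrow> m dvd n \<Longrightarrow> b m = b' m"
  shows "dconv a b n = dconv a' b' n"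
proof (cases "n = 0")
  case False
  show ?thesis unfolding dconv_def
  proof (intro sum.cong refl)
    fix d assume "d \<in> {d. d dvd n}"
    then obtain e where e: "n = d * e" by auto
    then have "d > 0" "e > 0" "n div d = e" using False by auto
    then show "a d * b (n div d) = a' d * b' (n div d)" using assms e by simp
  qed
qed (simp add: dconv_def)

lemma dconv_add: "dconv a (\<lambda>n. b n + c n) n = dconv a b n + dconv a c n"
  unfolding dconv_def by (simp add: algebra_simps sum.distrib)

text \<open>Here h plays the role of the logarithmic derivative of g, so nonnegativity of h forces that of g.\<close>

definition log_deriv :: "(nat \<Rightarrow> real) \<Rightarrow> (nat \<Rightarrow> real) \<Rightarrow> bool" where
  "log_deriv g h \<longleftrightarrow> (\<forall>n>0. g n * ln (real n) = dconv g h n)"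

lemma log_deriv_cmult:
  assumes "\<And>m n. c (m * n) = c m * c n"
  shows "log_deriv c (\<lambda>n. c n * mangoldt n)"
  unfolding log_deriv_def
proof (intro allI impI)
  fix n :: nat assume n: "n > 0"
  have "dconv c (\<lambda>n. c n * mangoldt n) n = (\<Sum>d | d dvd n. c n * mangoldt (n div d))"
    unfolding dconv_def
  proof (intro sum.cong refl)
    fix d assume "d \<in> {d. d dvd n}"
    then have "c n = c d * c (n div d)" using assms by (metis dvd_mult_div_cancel mem_Collect_eq)
    then show "c d * (c (n div d) * mangoldt (n div d)) = c n * mangoldt (n div d)" by simp
  qed
  then show "c n * ln (real n) = dconv c (\<lambda>n. c n * mangoldt n) n"
    using sum_mangoldt_codivisor[OF n, where 'a = real] by (simp flip: sum_distrib_left)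
qed

text \<open>Logarithmic derivatives of a product add. For the convolutions used in Siegel's theorem
  it therefore remains to check the sign of a multiple of \<open>mangoldt\<close>.\<close>

lemma log_deriv_dconv:
  assumes a: "log_deriv a ha" and c: "log_deriv c hc"
  shows "log_deriv (dconv a c) (\<lambda>n. ha n + hc n)"
  unfolding log_deriv_def
proof (intro allI impI)
  fix n :: nat assume n: "n > 0"
  have "dconv a c n * ln (real n) = (\<Sum>d | d dvd n. a d * ln (real d) * c (n div d) + a d * (c (n div d) * ln (real (n div d))))"
    unfolding dconv_def sum_distrib_right
  proof (intro sum.cong refl)
    fix d assume "d \<in> {d. d dvd n}"
    then obtain e where e: "n = d * e" by auto
    then show "a d * c (n div d) * ln (real n) = a d * ln (real d) * c (n div d) + a d * (c (n div d) * ln (real (n div d)))"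
      using n by (simp add: ln_mult algebra_simps)
  qed
  also have "\<dots> = dconv (\<lambda>m. a m * ln (real m)) c n + dconv a (\<lambda>m. c m * ln (real m)) n"
    by (simp add: dconv_def sum.distrib)
  also have "dconv (\<lambda>m. a m * ln (real m)) c n = dconv (dconv a ha) c n"
    using a by (intro dconv_cong) (auto simp: log_deriv_def)
  also have "\<dots> = dconv a (dconv ha c) n" by (rule dconv_assoc[OF n])
  also have "\<dots> = dconv a (dconv c ha) n" by (rule dconv_cong) (auto intro: dconv_comm)
  also have "\<dots> = dconv (dconv a c) ha n" by (rule dconv_assoc[OF n, symmetric])
  also have "dconv a (\<lambda>m. c m * ln (real m)) n = dconv a (dconv c hc) n"
    using c by (intro dconv_cong) (auto simp: log_deriv_def)
  also have "\<dots> = dconv (dconv a c) hc n" by (rule dconv_assoc[OF n, symmetric])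
  finally show "dconv a c n * ln (real n) = dconv (dconv a c) (\<lambda>n. ha n + hc n) n" by (simp add: dconv_add)
qed

lemma log_deriv_nonneg:
  assumes g: "log_deriv g h" and g1: "g 1 \<ge> 0" and h: "\<And>n. h n \<ge> 0" and h1: "h 1 = 0"
  shows "n > 0 \<Longrightarrow> g n \<ge> 0"
proof (induction n rule: less_induct)
  case (less n)
  show ?case
  proof (cases "n = 1")
    case False
    have "g n * ln (real n) = dconv g h n" using g less by (simp add: log_deriv_def)
    also have "\<dots> \<ge> 0" unfolding dconv_def
    proof (rule sum_nonneg)
      fix d assume d: "d \<in> {d. d dvd n}"
      show "0 \<le> g d * h (n div d)"
      \<comment> \<open>The divisor \<open>d = n\<close>, to which the induction hypothesis does not
        apply, contributes the factor \<open>h 1 = 0\<close>.\<close>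
      proof (cases "d = n")
        case True
        then show ?thesis using h1 less by simp
      next
        case False
        then have "d < n" "d > 0" using d less.prems False dvd_imp_le[of d n] dvd_pos_nat[of n d] by auto
        then show ?thesis using less.IH h by simp
      qed
    qed
    finally have "g n * ln (real n) \<ge> 0" .
    moreover have "ln (real n) > 0" using less False by simp
    ultimately show ?thesis by (simp add: zero_le_mult_iff)
  qed (use g1 in simp)
qed

lemma dconv_1: "dconv a b 1 = a 1 * b 1"
  by (simp add: dconv_def)

subsection \<open>The hyperbola method\<close>

lemma sum_dconv_pairs:
  fixes N :: nat
  shows "(\<Sum>n=1..N. f n * dconv a c n) = (\<Sum>(m,d)\<in>{(m,d). 1 \<le> m \<and> 1 \<le> d \<and> m * d \<le> N}. f (m * d) * (a m * c d))"
proof -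
  have "(\<Sum>n=1..N. f n * dconv a c n) = (\<Sum>n=1..N. \<Sum>d | d dvd n. f n * (a d * c (n div d)))"
    by (simp add: dconv_def sum_distrib_left)
  also have "\<dots> = (\<Sum>(n,d)\<in>Sigma {1..N} (\<lambda>n. {d. d dvd n}). f n * (a d * c (n div d)))"
    by (subst sum.Sigma) auto
  also have "\<dots> = (\<Sum>(m,d)\<in>{(m,d). 1 \<le> m \<and> 1 \<le> d \<and> m * d \<le> N}. f (m * d) * (a m * c d))"
    by (rule sum.reindex_bij_witness[of _ "\<lambda>(m,d). (m * d, m)" "\<lambda>(n,d). (d, n div d)"])
       (auto simp: Suc_le_eq elim!: dvdE)
  finally show ?thesis .
qed

lemma floor_div_sum_set: "x \<ge> 0 \<Longrightarrow> d \<ge> 1 \<Longrightarrow> {m::nat. 1 \<le> m \<and> m * d \<le> nat \<lfloor>x\<rfloor>} = {1..nat \<lfloor>x / real d\<rfloor>}"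
proof -
  assume x: "x \<ge> 0" and d: "d \<ge> 1"
  have eq: "m * d \<le> nat \<lfloor>x\<rfloor> \<longleftrightarrow> m \<le> nat \<lfloor>x / real d\<rfloor>" for m
  proof -
    have "m * d \<le> nat \<lfloor>x\<rfloor> \<longleftrightarrow> real (m * d) \<le> x" using x by (simp add: le_nat_floor le_nat_iff le_floor_iff)
    also have "\<dots> \<longleftrightarrow> real m \<le> x / real d" using d by (simp add: field_simps)
    also have "\<dots> \<longleftrightarrow> m \<le> nat \<lfloor>x / real d\<rfloor>" using x by (simp add: le_nat_iff le_floor_iff)
    finally show ?thesis .
  qed
  show ?thesis by (simp only: eq set_eq_iff mem_Collect_eq atLeastAtMost_iff) simp
qed

lemma abel_powr_tail:
  fixes c :: "nat \<Rightarrow> real"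
  assumes th: "th > 0" and c: "\<And>M N. \<bar>\<Sum>n\<in>{M<..N}. c n\<bar> \<le> q"
  shows "\<bar>\<Sum>n\<in>{M<..N}. c n * real n powr (- th)\<bar> \<le> q * real (Suc M) powr (- th)"
proof (cases "M < N")
  case True
  have q0: "q \<ge> 0" using c[of 0 0] by simp
  have mono: "real (Suc n) powr (- th) \<le> real n powr (- th)" if "n > M" for n
    using that th by (intro powr_mono2') auto
  have tel: "(\<Sum>n\<in>{M<..<N}. norm (real n powr (- th) - real (Suc n) powr (- th))) = real (Suc M) powr (- th) - real N powr (- th)"
    using Suc_leI[OF True]
  proof (induction N rule: dec_induct)
    case base
    have "{M<..<Suc M} = {}" by auto
    then show ?case by (simp only: sum.empty diff_self)
  next
    case (step n)
    have "{M<..<Suc n} = insert n {M<..<n}" using step by auto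
    then show ?case using step mono[of n] by simp
  qed
  have "norm (\<Sum>n\<in>{M<..N}. c n * real n powr (- th)) \<le>
    q * (norm (real N powr (- th)) + (\<Sum>n\<in>{M<..<N}. norm (real n powr (- th) - real (Suc n) powr (- th))))"
    by (rule abel_sum_bound) (use c in simp)
  then show ?thesis unfolding tel by simp
next
  case False
  have q0: "q \<ge> 0" using c[of 0 0] by simp
  then show ?thesis using False by simp
qed

text \<open>The L-function on the real axis, also for \<open>0 < th \<le> 1\<close>, where
  convergence is conditional and rests on bounded partial sums of \<open>c\<close>.\<close>

definition Lr :: "(nat \<Rightarrow> real) \<Rightarrow> real \<Rightarrow> real" where
  "Lr c th = (\<Sum>n. c n * real n powr (- th))"

lemma Lr_sums:
  fixes c :: "nat \<Rightarrow> real"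
  assumes th: "th > 0" and c: "\<And>M N. \<bar>\<Sum>n\<in>{M<..N}. c n\<bar> \<le> q"
  shows "(\<lambda>n. c n * real n powr (- th)) sums Lr c th"
proof -
  have "summable (\<lambda>n. c n * real n powr (- th))"
  proof (rule summable_Cauchy'[where g = "\<lambda>m. q * real m powr (- th)"])
    show "\<forall>\<^sub>F m in sequentially. \<forall>n\<ge>m. norm (\<Sum>n\<in>{m..<n}. c n * real n powr (- th)) \<le> q * real m powr (- th)"
      using eventually_ge_at_top[of 1]
    proof eventually_elim
      case (elim m)
      show ?case
      proof (intro allI impI)
        fix n assume "m \<le> n"
        have "{m..<n} = {m - 1<..n - 1}" using elim by auto
        then show "norm (\<Sum>n\<in>{m..<n}. c n * real n powr (- th)) \<le> q * real m powr (- th)"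
          using abel_powr_tail[OF th c, of "m - 1" "n - 1"] elim by simp
      qed
    qed
    have "(\<lambda>m. q * real m powr (- th)) \<longlonglongrightarrow> q * 0"
      using th by (intro tendsto_mult tendsto_const tendsto_neg_powr filterlim_real_sequentially) auto
    then show "(\<lambda>m. q * real m powr (- th)) \<longlonglongrightarrow> 0" by simp
  qed
  then show ?thesis unfolding Lr_def by (rule summable_sums)
qed

lemma Lr_tail:
  fixes c :: "nat \<Rightarrow> real"
  assumes th: "th > 0" and c: "\<And>M N. \<bar>\<Sum>n\<in>{M<..N}. c n\<bar> \<le> q"
  shows "\<bar>Lr c th - (\<Sum>n=1..N. c n * real n powr (- th))\<bar> \<le> q * real (Suc N) powr (- th)"
proof -
  have lim: "(\<lambda>M. (\<Sum>n=1..M. c n * real n powr (- th)) - (\<Sum>n=1..N. c n * real n powr (- th))) \<longlonglongrightarrow>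
    Lr c th - (\<Sum>n=1..N. c n * real n powr (- th))"
    by (intro tendsto_diff tendsto_const sums_from_1 Lr_sums[OF th c]) simp
  show ?thesis
  proof (rule Lim_bounded[OF tendsto_rabs[OF lim], of N], intro allI impI)
    fix M assume "M \<ge> N"
    then have "(\<Sum>n=1..M. c n * real n powr (- th)) - (\<Sum>n=1..N. c n * real n powr (- th)) = (\<Sum>n\<in>{N<..M}. c n * real n powr (- th))"
      using sum_split_at[of N M "\<lambda>n. c n * real n powr (- th)"] by simp
    then show "\<bar>(\<Sum>n=1..M. c n * real n powr (- th)) - (\<Sum>n=1..N. c n * real n powr (- th))\<bar> \<le> q * real (Suc N) powr (- th)"
      using abel_powr_tail[OF th c, of N M] by simp
  qed
qed

lemma Lr_abs_le:
  fixes c :: "nat \<Rightarrow> real"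
  assumes th: "th > 0" and c: "\<And>M N. \<bar>\<Sum>n\<in>{M<..N}. c n\<bar> \<le> q"
  shows "\<bar>Lr c th\<bar> \<le> q"
  using Lr_tail[OF th c, of 0] by simp

text \<open>The first \<open>q\<close> terms are estimated trivially, and the rest contributes at
  most 1 by partial summation; \<open>real q powr ep / ep\<close> stands in for a logarithm of
  \<open>q\<close>.\<close>

lemma Lr_1_le:
  fixes c :: "nat \<Rightarrow> real"
  assumes ep: "0 < ep" "ep \<le> 1" and q: "q \<ge> 1" and c: "\<And>M N. \<bar>\<Sum>n\<in>{M<..N}. c n\<bar> \<le> real q" and c1: "\<And>n. \<bar>c n\<bar> \<le> 1"
  shows "\<bar>Lr c 1\<bar> \<le> 2 / ep * real q powr ep"
proof -
  have "\<bar>\<Sum>n=1..q. c n * real n powr (- 1)\<bar> \<le> (\<Sum>n=1..q. real n powr (ep - 1))"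
  proof (rule order_trans[OF sum_abs], rule sum_mono)
    fix n assume n: "n \<in> {1..q}"
    have "\<bar>c n * real n powr (- 1)\<bar> \<le> 1 * real n powr (- 1)" unfolding abs_mult using c1[of n] by (intro mult_mono) auto
    also have "\<dots> = real n powr (- 1)" by (rule mult_1)
    also have "\<dots> \<le> real n powr (ep - 1)" using n ep by (intro powr_mono) auto
    finally show "\<bar>c n * real n powr (- 1)\<bar> \<le> real n powr (ep - 1)" .
  qed
  also have "\<dots> \<le> real q powr ep / ep" by (rule sum_powr_head[OF ep])
  finally have 1: "\<bar>\<Sum>n=1..q. c n * real n powr (- 1)\<bar> \<le> real q powr ep / ep" .
  have "real q * real (Suc q) powr (- 1) \<le> 1" using q by (simp add: powr_minus_divide)
  also have "1 \<le> real q powr ep / ep"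
  proof -
    have "1 \<le> real q powr ep" using q ep by (simp add: ge_one_powr_ge_zero)
    then show ?thesis using ep by (simp add: field_simps)
  qed
  finally have "\<bar>Lr c 1 - (\<Sum>n=1..q. c n * real n powr (- 1))\<bar> \<le> real q powr ep / ep"
    using Lr_tail[of 1 c "real q" q] c by simp
  with 1 show ?thesis by simp
qed

text \<open>In Siegel's theorem \<open>be\<close> is a point just to the left of 1. The constant
  term in the asymptotics of these sums is a product of values at \<open>be\<close>, whose sign or
  vanishing decides the argument.\<close>

definition wsum :: "real \<Rightarrow> (nat \<Rightarrow> real) \<Rightarrow> real \<Rightarrow> real" where
  "wsum be a x = (\<Sum>n=1..nat \<lfloor>x\<rfloor>. a n * real n powr (- be))"

lemma sqrt_floor:
  fixes x :: real
  assumes "x \<ge> 1"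
  defines "Y \<equiv> nat \<lfloor>sqrt x\<rfloor>"
  shows "Y \<ge> 1" "real Y \<le> sqrt x" "sqrt x \<le> real (Suc Y)" "sqrt x < real (Suc Y)"
proof -
  have s: "sqrt x \<ge> 1" using assms by simp
  then show "Y \<ge> 1" "real Y \<le> sqrt x" "sqrt x \<le> real (Suc Y)" "sqrt x < real (Suc Y)"
    unfolding Y_def by linarith+
qed

lemma hyperbola_split:
  fixes a c :: "nat \<Rightarrow> real"
  assumes x: "x \<ge> 1"
  defines "Y \<equiv> nat \<lfloor>sqrt x\<rfloor>"
  shows "wsum be (dconv a c) x = (\<Sum>d=1..Y. c d * real d powr (- be) * wsum be a (x / real d)) +
    (\<Sum>m=1..Y. a m * real m powr (- be) * (\<Sum>d\<in>{Y<..nat \<lfloor>x / real m\<rfloor>}. c d * real d powr (- be)))"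
proof -
  let ?N = "nat \<lfloor>x\<rfloor>" and ?t = "\<lambda>(m,d). (real (m * d) powr (- be)) * (a m * c d)"
  let ?P = "{(m::nat,d::nat). 1 \<le> m \<and> 1 \<le> d \<and> m * d \<le> ?N}"
  let ?P1 = "{(m,d). (m,d) \<in> ?P \<and> d \<le> Y}" and ?P2 = "{(m,d). (m,d) \<in> ?P \<and> d > Y}"
  have sq: "Y \<ge> 1" "real Y \<le> sqrt x" "sqrt x < real (Suc Y)" using sqrt_floor[OF x] by (auto simp: Y_def)
  have fin: "finite ?P"
  proof (rule finite_subset)
    show "?P \<subseteq> {..?N} \<times> {..?N}"
    proof clarify
      fix m d :: nat assume h: "1 \<le> m" "1 \<le> d" "m * d \<le> ?N"
      have "m \<le> m * d" "d \<le> m * d" using h by auto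
      from le_trans[OF this(1) h(3)] le_trans[OF this(2) h(3)] show "m \<in> {..?N} \<and> d \<in> {..?N}" by simp
    qed
  qed simp
  have "wsum be (dconv a c) x = (\<Sum>n=1..?N. real n powr (- be) * dconv a c n)"
    by (simp add: wsum_def mult.commute)
  also have "\<dots> = (\<Sum>p\<in>?P. ?t p)" unfolding sum_dconv_pairs by (rule sum.cong) auto
  also have "?P = ?P1 \<union> ?P2" by auto
  also have "(\<Sum>p\<in>?P1 \<union> ?P2. ?t p) = (\<Sum>p\<in>?P1. ?t p) + (\<Sum>p\<in>?P2. ?t p)"
    by (rule sum.union_disjoint) (auto intro: finite_subset[OF _ fin])
  also have "(\<Sum>p\<in>?P1. ?t p) = (\<Sum>(d,m)\<in>Sigma {1..Y} (\<lambda>d. {m. 1 \<le> m \<and> m * d \<le> ?N}). ?t (m,d))"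
    by (rule sum.reindex_bij_witness[of _ "\<lambda>(d,m). (m,d)" "\<lambda>(m,d). (d,m)"]) auto
  also have "\<dots> = (\<Sum>d=1..Y. \<Sum>m | 1 \<le> m \<and> m * d \<le> ?N. ?t (m,d))"
    by (subst sum.Sigma) (auto simp: floor_div_sum_set x order_trans[OF zero_le_one x] simp del: One_nat_def)
  also have "\<dots> = (\<Sum>d=1..Y. c d * real d powr (- be) * wsum be a (x / real d))"
  proof (intro sum.cong refl)
    fix d assume d: "d \<in> {1..Y}"
    have "(\<Sum>m | 1 \<le> m \<and> m * d \<le> ?N. ?t (m,d)) = (\<Sum>m=1..nat \<lfloor>x / real d\<rfloor>. ?t (m,d))"
      using floor_div_sum_set[of x d] x d by simp
    also have "\<dots> = c d * real d powr (- be) * wsum be a (x / real d)"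
      unfolding wsum_def sum_distrib_left by (intro sum.cong refl) (simp add: powr_mult)
    finally show "(\<Sum>m | 1 \<le> m \<and> m * d \<le> ?N. ?t (m,d)) = c d * real d powr (- be) * wsum be a (x / real d)" .
  qed
  \<comment> \<open>If \<open>d > Y\<close>, then \<open>m * d \<le> x\<close> forces
    \<open>m < sqrt x\<close> and hence \<open>m \<le> Y\<close>, so that both outer sums have the
    same range.\<close>
  also have "(\<Sum>p\<in>?P2. ?t p) = (\<Sum>(m,d)\<in>Sigma {1..Y} (\<lambda>m. {Y<..nat \<lfloor>x / real m\<rfloor>}). ?t (m,d))"
  proof (rule sum.cong)
    show "?P2 = Sigma {1..Y} (\<lambda>m. {Y<..nat \<lfloor>x / real m\<rfloor>})"
    proof (intro equalityI subsetI)
      fix p assume p: "p \<in> ?P2"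
      obtain m d where md: "p = (m,d)" by (cases p)
      have h: "1 \<le> m" "1 \<le> d" "m * d \<le> ?N" "d > Y" using p md by auto
      have "real (m * d) \<le> x" using h(3) x by (simp add: le_nat_iff le_floor_iff)
      moreover have "real m * sqrt x < real m * real d" using h sq(3) by (intro mult_strict_left_mono) auto
      ultimately have "real m * sqrt x < sqrt x * sqrt x" using x by simp
      then have "real m < sqrt x"
        by (rule mult_right_less_imp_less) (use x in simp)
      then have "m \<le> Y" using sq(3) by linarith
      moreover have "d \<in> {d. 1 \<le> d \<and> d * m \<le> ?N}" using h by (simp add: mult.commute)
      then have "d \<le> nat \<lfloor>x / real m\<rfloor>" using floor_div_sum_set[of x m] x h by auto
      ultimately show "p \<in> Sigma {1..Y} (\<lambda>m. {Y<..nat \<lfloor>x / real m\<rfloor>})" using h md by auto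
    next
      fix p assume p: "p \<in> Sigma {1..Y} (\<lambda>m. {Y<..nat \<lfloor>x / real m\<rfloor>})"
      obtain m d where md: "p = (m,d)" by (cases p)
      have h: "1 \<le> m" "m \<le> Y" "Y < d" "d \<le> nat \<lfloor>x / real m\<rfloor>" using p md by auto
      have "{d. 1 \<le> d \<and> d * m \<le> ?N} = {1..nat \<lfloor>x / real m\<rfloor>}"
        by (rule floor_div_sum_set) (use x h in auto)
      moreover have "d \<in> {1..nat \<lfloor>x / real m\<rfloor>}" using h by auto
      ultimately have "d \<in> {d. 1 \<le> d \<and> d * m \<le> ?N}" by (simp only:)
      then have "d * m \<le> ?N" by simp
      then show "p \<in> ?P2" using h md by (auto simp: mult.commute)
    qed
  qed auto
  also have "\<dots> = (\<Sum>m=1..Y. \<Sum>d\<in>{Y<..nat \<lfloor>x / real m\<rfloor>}. ?t (m,d))"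
    by (subst sum.Sigma) auto
  also have "\<dots> = (\<Sum>m=1..Y. a m * real m powr (- be) * (\<Sum>d\<in>{Y<..nat \<lfloor>x / real m\<rfloor>}. c d * real d powr (- be)))"
    unfolding sum_distrib_left by (intro sum.cong refl) (simp add: powr_mult)
  finally show ?thesis .
qed

lemma wsum_dconv:
  assumes x: "x \<ge> 1"
  shows "wsum be (dconv a c) x = (\<Sum>d=1..nat \<lfloor>x\<rfloor>. c d * real d powr (- be) * wsum be a (x / real d))"
proof -
  let ?N = "nat \<lfloor>x\<rfloor>" and ?t = "\<lambda>(m,d). (real (m * d) powr (- be)) * (a m * c d)"
  let ?P = "{(m::nat,d::nat). 1 \<le> m \<and> 1 \<le> d \<and> m * d \<le> ?N}"
  have "wsum be (dconv a c) x = (\<Sum>n=1..?N. real n powr (- be) * dconv a c n)"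
    by (simp add: wsum_def mult.commute)
  also have "\<dots> = (\<Sum>p\<in>?P. ?t p)" unfolding sum_dconv_pairs by (rule sum.cong) auto
  also have "\<dots> = (\<Sum>(d,m)\<in>Sigma {1..?N} (\<lambda>d. {m. 1 \<le> m \<and> m * d \<le> ?N}). ?t (m,d))"
  proof (rule sum.reindex_bij_witness[of _ "\<lambda>(d,m). (m,d)" "\<lambda>(m,d). (d,m)"])
    fix p assume "p \<in> ?P"
    then obtain m d where md: "p = (m,d)" "1 \<le> m" "1 \<le> d" "m * d \<le> ?N" by auto
    then have "d \<le> m * d" by auto
    from le_trans[OF this md(4)] show "(case p of (m,d) \<Rightarrow> (d,m)) \<in> Sigma {1..?N} (\<lambda>d. {m. 1 \<le> m \<and> m * d \<le> ?N})"
      using md by auto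
  qed auto
  also have "\<dots> = (\<Sum>d=1..?N. \<Sum>m | 1 \<le> m \<and> m * d \<le> ?N. ?t (m,d))"
    by (subst sum.Sigma) (auto simp: floor_div_sum_set x order_trans[OF zero_le_one x] simp del: One_nat_def)
  also have "\<dots> = (\<Sum>d=1..?N. c d * real d powr (- be) * wsum be a (x / real d))"
  proof (intro sum.cong refl)
    fix d assume d: "d \<in> {1..?N}"
    have "(\<Sum>m | 1 \<le> m \<and> m * d \<le> ?N. ?t (m,d)) = (\<Sum>m=1..nat \<lfloor>x / real d\<rfloor>. ?t (m,d))"
      using floor_div_sum_set[of x d] x d by simp
    also have "\<dots> = c d * real d powr (- be) * wsum be a (x / real d)"
      unfolding wsum_def sum_distrib_left by (intro sum.cong refl) (simp add: powr_mult)
    finally show "(\<Sum>m | 1 \<le> m \<and> m * d \<le> ?N. ?t (m,d)) = c d * real d powr (- be) * wsum be a (x / real d)" .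
  qed
  finally show ?thesis .
qed

text \<open>Convolution with a bounded function costs a factor \<open>x powr (1 - be)\<close>; with
  \<open>be\<close> close to 1 a few such steps are affordable.\<close>

lemma wsum_abs_dconv_le:
  assumes be: "0 < be" "be < 1" and ka: "ka \<ge> 0" and B0: "B \<ge> 0" and c1: "\<And>n. \<bar>c n\<bar> \<le> 1"
    and B: "\<And>x. x \<ge> 1 \<Longrightarrow> wsum be (\<lambda>n. \<bar>a n\<bar>) x \<le> B * x powr ka" and x: "x \<ge> 1"
  shows "wsum be (\<lambda>n. \<bar>dconv a c n\<bar>) x \<le> B / (1 - be) * x powr (ka + (1 - be))"
proof -
  have "wsum be (\<lambda>n. \<bar>dconv a c n\<bar>) x \<le> wsum be (dconv (\<lambda>n. \<bar>a n\<bar>) (\<lambda>_. 1)) x"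
    unfolding wsum_def
  proof (intro sum_mono mult_right_mono)
    fix n show "\<bar>dconv a c n\<bar> \<le> dconv (\<lambda>n. \<bar>a n\<bar>) (\<lambda>_. 1) n"
      unfolding dconv_def using c1 by (intro order_trans[OF sum_abs] sum_mono) (auto simp: abs_mult mult_left_le)
  qed auto
  also have "\<dots> = (\<Sum>d=1..nat \<lfloor>x\<rfloor>. 1 * real d powr (- be) * wsum be (\<lambda>n. \<bar>a n\<bar>) (x / real d))"
    by (rule wsum_dconv[OF x])
  also have "\<dots> \<le> (\<Sum>d=1..nat \<lfloor>x\<rfloor>. real d powr ((1 - be) - 1) * (B * x powr ka))"
  proof (intro sum_mono)
    fix d assume d: "d \<in> {1..nat \<lfloor>x\<rfloor>}"
    then have d1: "1 \<le> real d" and dx: "real d \<le> x" using x by (auto simp: le_nat_iff le_floor_iff)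
    then have "wsum be (\<lambda>n. \<bar>a n\<bar>) (x / real d) \<le> B * (x / real d) powr ka" by (intro B) (simp add: field_simps)
    also have "(x / real d) powr ka \<le> x powr ka"
      using d1 x ka by (intro powr_mono2) (auto simp: field_simps mult_le_cancel_left1)
    finally have "wsum be (\<lambda>n. \<bar>a n\<bar>) (x / real d) \<le> B * x powr ka" using B0 by (simp add: mult_left_mono)
    then show "1 * real d powr (- be) * wsum be (\<lambda>n. \<bar>a n\<bar>) (x / real d) \<le> real d powr ((1 - be) - 1) * (B * x powr ka)"
      by (simp add: mult_left_mono)
  qed
  also have "\<dots> = B * x powr ka * (\<Sum>d=1..nat \<lfloor>x\<rfloor>. real d powr ((1 - be) - 1))"
    by (simp add: sum_distrib_left mult_ac)
  also have "\<dots> \<le> B * x powr ka * (x powr (1 - be) / (1 - be))"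
  proof (intro mult_left_mono)
    have "(\<Sum>d=1..nat \<lfloor>x\<rfloor>. real d powr ((1 - be) - 1)) \<le> real (nat \<lfloor>x\<rfloor>) powr (1 - be) / (1 - be)"
      by (rule sum_powr_head) (use be in auto)
    also have "\<dots> \<le> x powr (1 - be) / (1 - be)" using be x by (intro divide_right_mono powr_mono2) auto
    finally show "(\<Sum>d=1..nat \<lfloor>x\<rfloor>. real d powr ((1 - be) - 1)) \<le> x powr (1 - be) / (1 - be)" .
  qed (use B0 in auto)
  also have "\<dots> = B / (1 - be) * x powr (ka + (1 - be))" by (simp add: powr_add)
  finally show ?thesis .
qed

lemma sqrt_powr: "x \<ge> 0 \<Longrightarrow> sqrt x powr a = x powr (a / 2)"
  using powr_powr[of x "1/2" a] by (simp add: powr_half_sqrt)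

text \<open>Convolving with \<open>c\<close> multiplies the leading coefficient by
  \<open>Lr c 1\<close> and the constant term by \<open>Lr c be\<close>, in a form that can be
  iterated. The three upper bounds on \<open>et'\<close> are the losses from truncating
  \<open>Lr c 1\<close> at \<open>sqrt x\<close>, from summing the error of \<open>a\<close> up to
  \<open>sqrt x\<close>, and from the part with \<open>d > sqrt x\<close>; truncating
  \<open>Lr c be\<close> costs no more than these.\<close>

lemma hyperbola_step:
  fixes a c :: "nat \<Rightarrow> real"
  assumes be: "1/2 \<le> be" "be < 1" and et: "0 < et" "et \<le> be" and K: "K \<ge> 0" and B0: "B \<ge> 0"
    and A: "\<And>x. x \<ge> 1 \<Longrightarrow> \<bar>wsum be a x - al * x powr (1 - be) / (1 - be) - z\<bar> \<le> K * x powr (- et)"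
    and B: "\<And>x. x \<ge> 1 \<Longrightarrow> wsum be (\<lambda>n. \<bar>a n\<bar>) x \<le> B * x powr ka"
    and c: "\<And>M N. \<bar>\<Sum>n\<in>{M<..N}. c n\<bar> \<le> q" and c1: "\<And>n. \<bar>c n\<bar> \<le> 1"
    and e: "et' \<le> be - 1/2" "et' \<le> (et - (1 - be)) / 2" "et' \<le> (be - ka) / 2" and x: "x \<ge> 1"
  shows "\<bar>wsum be (dconv a c) x - al * Lr c 1 * x powr (1 - be) / (1 - be) - z * Lr c be\<bar> \<le>
    (\<bar>al\<bar> * q / (1 - be) + \<bar>z\<bar> * q + K / et + q * B) * x powr (- et')"
proof -
  define Y where "Y = nat \<lfloor>sqrt x\<rfloor>"
  have sq: "Y \<ge> 1" "real Y \<le> sqrt x" "sqrt x \<le> real (Suc Y)" using sqrt_floor[OF x] by (auto simp: Y_def)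
  have q0: "q \<ge> 0" using c[of 0 0] by simp
  define E where "E = (\<lambda>d. wsum be a (x / real d) - al * (x / real d) powr (1 - be) / (1 - be) - z)"
  let ?S1 = "\<Sum>d=1..Y. c d * real d powr (- 1)" and ?Sb = "\<Sum>d=1..Y. c d * real d powr (- be)"
  let ?SE = "\<Sum>d=1..Y. c d * real d powr (- be) * E d"
  let ?T2 = "\<Sum>m=1..Y. a m * real m powr (- be) * (\<Sum>d\<in>{Y<..nat \<lfloor>x / real m\<rfloor>}. c d * real d powr (- be))"
  have T1: "(\<Sum>d=1..Y. c d * real d powr (- be) * wsum be a (x / real d)) =
    al * x powr (1 - be) / (1 - be) * ?S1 + z * ?Sb + ?SE"
  proof -
    have "(\<Sum>d=1..Y. c d * real d powr (- be) * wsum be a (x / real d)) =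
      (\<Sum>d=1..Y. al * x powr (1 - be) / (1 - be) * (c d * real d powr (- 1)) + z * (c d * real d powr (- be)) + c d * real d powr (- be) * E d)"
    proof (intro sum.cong refl)
      fix d assume d: "d \<in> {1..Y}"
      have "(x / real d) powr (1 - be) = x powr (1 - be) * real d powr (- (1 - be))"
        unfolding powr_minus_divide using x by (simp add: powr_divide)
      then have "real d powr (- be) * (x / real d) powr (1 - be) = x powr (1 - be) * (real d powr (- be) * real d powr (- (1 - be)))"
        by (simp only: mult_ac)
      also have "real d powr (- be) * real d powr (- (1 - be)) = real d powr (- 1)" by (simp flip: powr_add)
      finally have 1: "real d powr (- be) * (x / real d) powr (1 - be) = x powr (1 - be) * real d powr (- 1)" .
      have "c d * real d powr (- be) * wsum be a (x / real d) =
        c d * (real d powr (- be) * (x / real d) powr (1 - be)) * (al / (1 - be)) + z * (c d * real d powr (- be)) + c d * real d powr (- be) * E d"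
        by (simp add: E_def algebra_simps)
      then show "c d * real d powr (- be) * wsum be a (x / real d) =
        al * x powr (1 - be) / (1 - be) * (c d * real d powr (- 1)) + z * (c d * real d powr (- be)) + c d * real d powr (- be) * E d"
        unfolding 1 by (simp only: mult_ac times_divide_eq_right times_divide_eq_left)
    qed
    then show ?thesis by (simp only: sum.distrib sum_distrib_left)
  qed
  have tail: "q * real (Suc Y) powr (- th) \<le> q * x powr (- (th / 2))" if "th > 0" for th
  proof -
    have "real (Suc Y) powr (- th) \<le> sqrt x powr (- th)" using sq x that by (intro powr_mono2') auto
    then show ?thesis using q0 x by (simp add: sqrt_powr mult_left_mono)
  qed
  have xm: "x powr b \<le> x powr (- et')" if "b \<le> - et'" for b using x that by (rule powr_mono[rotated])
  have 1: "\<bar>al * x powr (1 - be) / (1 - be) * (?S1 - Lr c 1)\<bar> \<le> \<bar>al\<bar> * q / (1 - be) * x powr (- et')"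
  proof -
    have "\<bar>?S1 - Lr c 1\<bar> \<le> q * x powr (- (1 / 2))"
      using Lr_tail[of 1 c q Y] c tail[of 1] by (simp add: abs_minus_commute)
    then have "\<bar>al * x powr (1 - be) / (1 - be) * (?S1 - Lr c 1)\<bar> \<le> \<bar>al\<bar> * x powr (1 - be) / (1 - be) * (q * x powr (- (1 / 2)))"
      unfolding abs_mult abs_divide using be by (intro mult_mono divide_right_mono) auto
    also have "\<dots> = \<bar>al\<bar> * q / (1 - be) * (x powr (1 - be) * x powr (- (1 / 2)))" by (simp add: mult_ac)
    also have "x powr (1 - be) * x powr (- (1 / 2)) = x powr (1 - be - 1/2)" by (simp flip: powr_add)
    also have "\<bar>al\<bar> * q / (1 - be) * x powr (1 - be - 1/2) \<le> \<bar>al\<bar> * q / (1 - be) * x powr (- et')"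
      using be q0 e by (intro mult_left_mono xm) auto
    finally show ?thesis .
  qed
  have 2: "\<bar>z * (?Sb - Lr c be)\<bar> \<le> \<bar>z\<bar> * q * x powr (- et')"
  proof -
    have "\<bar>?Sb - Lr c be\<bar> \<le> q * x powr (- (be / 2))"
      using Lr_tail[of be c q Y] c tail[of be] be by (simp add: abs_minus_commute)
    also have "\<dots> \<le> q * x powr (- et')" using q0 e et be by (intro mult_left_mono xm) (auto simp: field_simps)
    finally show ?thesis unfolding abs_mult by (simp add: mult_left_mono mult.assoc)
  qed
  have 3: "\<bar>?SE\<bar> \<le> K / et * x powr (- et')"
  proof -
    have "\<bar>?SE\<bar> \<le> (\<Sum>d=1..Y. K * x powr (- et) * real d powr ((1 + et - be) - 1))"
    proof (intro order_trans[OF sum_abs] sum_mono)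
      fix d assume d: "d \<in> {1..Y}"
      have "sqrt x \<le> x" using mult_left_mono[of 1 "sqrt x" "sqrt x"] x by simp
      then have "x / real d \<ge> 1" using d sq by (simp add: field_simps)
      then have "\<bar>E d\<bar> \<le> K * (x / real d) powr (- et)" unfolding E_def by (rule A)
      then have "\<bar>c d * real d powr (- be) * E d\<bar> \<le> 1 * real d powr (- be) * (K * (x / real d) powr (- et))"
        unfolding abs_mult using c1[of d] by (intro mult_mono) auto
      also have "(x / real d) powr (- et) = x powr (- et) * real d powr et"
        using d x by (simp add: powr_divide powr_minus field_simps)
      also have "1 * real d powr (- be) * (K * (x powr (- et) * real d powr et)) = K * x powr (- et) * (real d powr (- be) * real d powr et)"
        by simp
      also have "real d powr (- be) * real d powr et = real d powr ((1 + et - be) - 1)" by (simp flip: powr_add)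
      finally show "\<bar>c d * real d powr (- be) * E d\<bar> \<le> K * x powr (- et) * real d powr ((1 + et - be) - 1)" .
    qed
    also have "\<dots> \<le> K * x powr (- et) * (real Y powr (1 + et - be) / (1 + et - be))"
      unfolding sum_distrib_left[symmetric] using K be et by (intro mult_left_mono sum_powr_head) auto
    also have "\<dots> \<le> K * x powr (- et) * (sqrt x powr (1 + et - be) / et)"
      using K be et sq x by (intro mult_left_mono frac_le powr_mono2) auto
    also have "\<dots> = K / et * (x powr (- et) * x powr ((1 + et - be) / 2))" using x by (simp add: sqrt_powr)
    also have "x powr (- et) * x powr ((1 + et - be) / 2) = x powr (- et + (1 + et - be) / 2)" by (simp flip: powr_add)
    also have "K / et * x powr (- et + (1 + et - be) / 2) \<le> K / et * x powr (- et')"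
      using K et e by (intro mult_left_mono xm) (auto simp: field_simps)
    finally show ?thesis .
  qed
  have 4: "\<bar>?T2\<bar> \<le> q * B * x powr (- et')"
  proof -
    have "\<bar>?T2\<bar> \<le> (\<Sum>m=1..Y. \<bar>a m\<bar> * real m powr (- be) * (q * x powr (- (be / 2))))"
    proof (intro order_trans[OF sum_abs] sum_mono)
      fix m
      have "\<bar>\<Sum>d\<in>{Y<..nat \<lfloor>x / real m\<rfloor>}. c d * real d powr (- be)\<bar> \<le> q * x powr (- (be / 2))"
        by (rule order_trans[OF abel_powr_tail[OF _ c] tail]) (use be in auto)
      then show "\<bar>a m * real m powr (- be) * (\<Sum>d\<in>{Y<..nat \<lfloor>x / real m\<rfloor>}. c d * real d powr (- be))\<bar> \<le> \<bar>a m\<bar> * real m powr (- be) * (q * x powr (- (be / 2)))"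
        unfolding abs_mult by (intro mult_mono) auto
    qed
    also have "\<dots> = wsum be (\<lambda>n. \<bar>a n\<bar>) (sqrt x) * (q * x powr (- (be / 2)))"
      by (simp add: wsum_def Y_def sum_distrib_right)
    also have "\<dots> \<le> (B * sqrt x powr ka) * (q * x powr (- (be / 2)))"
      using x q0 by (intro mult_right_mono B) auto
    also have "\<dots> = q * B * (x powr (ka / 2) * x powr (- (be / 2)))" using x by (simp add: sqrt_powr)
    also have "x powr (ka / 2) * x powr (- (be / 2)) = x powr (ka / 2 - be / 2)" by (simp flip: powr_add)
    also have "q * B * x powr (ka / 2 - be / 2) \<le> q * B * x powr (- et')"
      using q0 B0 e by (intro mult_left_mono xm) (auto simp: field_simps)
    finally show ?thesis .
  qed
  have eq: "wsum be (dconv a c) x - al * Lr c 1 * x powr (1 - be) / (1 - be) - z * Lr c be =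
    al * x powr (1 - be) / (1 - be) * (?S1 - Lr c 1) + z * (?Sb - Lr c be) + ?SE + ?T2"
    unfolding hyperbola_split[OF x] Y_def[symmetric] T1 by (simp add: algebra_simps diff_divide_distrib)
  have tri: "\<bar>t + u + v + w\<bar> \<le> \<bar>t\<bar> + \<bar>u\<bar> + \<bar>v\<bar> + \<bar>w\<bar>" for t u v w :: real by linarith
  have "\<bar>wsum be (dconv a c) x - al * Lr c 1 * x powr (1 - be) / (1 - be) - z * Lr c be\<bar> \<le>
    \<bar>al * x powr (1 - be) / (1 - be) * (?S1 - Lr c 1)\<bar> + \<bar>z * (?Sb - Lr c be)\<bar> + \<bar>?SE\<bar> + \<bar>?T2\<bar>" unfolding eq by (rule tri)
  also have "\<dots> \<le> (\<bar>al\<bar> * q / (1 - be) + \<bar>z\<bar> * q + K / et + q * B) * x powr (- et')"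
    unfolding distrib_right by (intro add_mono 1 2 3 4)
  finally show ?thesis .
qed

text \<open>Here \<open>z\<close> is zeta at \<open>be\<close>, found as the limit of a decreasing
  sequence with an increasing companion. The bounds make \<open>z\<close> negative, and the first
  case of Siegel's theorem relies on this sign.\<close>

lemma wsum_one:
  assumes be: "0 < be" "be < 1"
  obtains z where "- 1 / (1 - be) \<le> z" "z \<le> 1 - 1 / (1 - be)"
    "\<And>x. x \<ge> 1 \<Longrightarrow> \<bar>wsum be (\<lambda>_. 1) x - 1 * x powr (1 - be) / (1 - be) - z\<bar> \<le> 4 * x powr (- be)"
proof -
  define e where "e = 1 - be"
  have e: "0 < e" "e < 1" "- be = e - 1" using be by (auto simp: e_def)
  define D where "D = (\<lambda>n::nat. (\<Sum>m=1..n. real m powr (- be)) - real n powr e / e)"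
  have step: "D (Suc n) \<le> D n" "D n - real n powr (- be) \<le> D (Suc n) - real (Suc n) powr (- be)" if n: "n \<ge> 1" for n
  proof -
    obtain xi where xi: "real n < xi" "xi < real n + 1" "(real n + 1) powr e - real n powr e = e * xi powr (e - 1)"
      using powr_diff_mvt[of "real n" e] n by auto
    have "(real n + 1) powr (e - 1) \<le> xi powr (e - 1)" "xi powr (e - 1) \<le> real n powr (e - 1)"
      using xi n e by (auto intro!: powr_mono2')
    moreover have "(real n + 1) powr e / e - real n powr e / e = xi powr (e - 1)"
      using xi(3) e by (simp add: field_simps)
    ultimately show "D (Suc n) \<le> D n" "D n - real n powr (- be) \<le> D (Suc n) - real (Suc n) powr (- be)"
      unfolding D_def e(3) by (simp_all add: add.commute[of 1])
  qed
  have dec: "decseq (\<lambda>n. D (Suc n))" by (rule decseq_SucI) (use step in auto)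
  have inc: "incseq (\<lambda>n. D (Suc n) - real (Suc n) powr (- be))" 
    by (rule incseq_SucI) (rule step(2), simp)
  have D1: "D 1 = 1 - 1 / e" by (simp add: D_def)
  have low: "- 1 / e \<le> D (Suc n) - real (Suc n) powr (- be)" for n
    using incseqD[OF inc, of 0 n] D1 by simp
  have "\<forall>n. - 1 / e \<le> D (Suc n)"
  proof
    fix n show "- 1 / e \<le> D (Suc n)" using low[of n] powr_ge_zero[of "real (Suc n)" "- be"] by linarith
  qed
  then obtain z where z: "(\<lambda>n. D (Suc n)) \<longlonglongrightarrow> z" "\<And>n. z \<le> D (Suc n)"
    using decseq_convergent[OF dec] by blast
  have "(\<lambda>n. real n powr (- be)) \<longlonglongrightarrow> 0" using be by (intro tendsto_neg_powr filterlim_real_sequentially) auto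
  from tendsto_diff[OF z(1) LIMSEQ_Suc[OF this]] have lim: "(\<lambda>n. D (Suc n) - real (Suc n) powr (- be)) \<longlonglongrightarrow> z" by simp
  have zE: "D (Suc n) - real (Suc n) powr (- be) \<le> z" for n by (rule incseq_le[OF inc lim])
  show ?thesis
  proof (rule that[of z])
    show "- 1 / (1 - be) \<le> z" using low[of 0] zE[of 0] by (simp add: e_def)
    show "z \<le> 1 - 1 / (1 - be)" using z(2)[of 0] D1 by (simp add: e_def)
    fix x :: real assume x: "x \<ge> 1"
    define n where "n = nat \<lfloor>x\<rfloor>"
    have n: "n \<ge> 1" "real n \<le> x" "x \<le> real n + 1" unfolding n_def using x by linarith+
    then have n2: "x / 2 \<le> real n" by linarith
    obtain k where k: "n = Suc k" using n by (cases n) auto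
    have a: "\<bar>D n - z\<bar> \<le> real n powr (- be)" using zE[of k] z(2)[of k] unfolding k by linarith
    have b: "\<bar>real n powr e - x powr e\<bar> \<le> e * real n powr (- be)"
    proof (cases "real n = x")
      case False
      then have lt: "real n < x" using n by simp
      have "\<exists>xi>real n. xi < x \<and> x powr e - real n powr e = (x - real n) * (e * xi powr (e - 1))"
        using lt n by (intro MVT2) (auto intro!: derivative_eq_intros)
      then obtain xi where xi: "xi > real n" "xi < x" "x powr e - real n powr e = (x - real n) * (e * xi powr (e - 1))" by blast
      have "xi powr (e - 1) \<le> real n powr (- be)" unfolding e(3) using xi n e by (intro powr_mono2') auto
      then have "(x - real n) * (e * xi powr (e - 1)) \<le> 1 * (e * real n powr (- be))"
        using n e by (intro mult_mono mult_left_mono) auto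
      moreover have "real n powr e \<le> x powr e" using n e by (intro powr_mono2) auto
      ultimately show ?thesis using xi(3) by simp
    qed (use e in simp)
    have b': "\<bar>real n powr e / e - x powr e / e\<bar> \<le> real n powr (- be)"
      using b e(1) by (simp add: pos_divide_le_eq mult.commute flip: diff_divide_distrib)
    have "real n powr (- be) \<le> (x / 2) powr (- be)" using n2 x be by (intro powr_mono2') auto
    also have "\<dots> = 2 powr be * x powr (- be)" using x by (simp add: powr_divide powr_minus field_simps)
    also have "\<dots> \<le> 2 * x powr (- be)" using powr_mono[of be 1 2] be by (intro mult_right_mono) auto
    finally have c: "real n powr (- be) \<le> 2 * x powr (- be)" .
    have "wsum be (\<lambda>_. 1) x - 1 * x powr (1 - be) / (1 - be) - z = (D n - z) + (real n powr e / e - x powr e / e)"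
      by (simp add: wsum_def D_def n_def e_def)
    then show "\<bar>wsum be (\<lambda>_. 1) x - 1 * x powr (1 - be) / (1 - be) - z\<bar> \<le> 4 * x powr (- be)"
      using a b' c by linarith
  qed
qed

lemma wsum_one_le:
  assumes "0 < be" "be < 1" "x \<ge> 1"
  shows "wsum be (\<lambda>_. \<bar>1\<bar>) x \<le> 1 / (1 - be) * x powr (1 - be)"
proof -
  have "wsum be (\<lambda>_. \<bar>1\<bar>) x = (\<Sum>d=1..nat \<lfloor>x\<rfloor>. real d powr ((1 - be) - 1))" by (simp add: wsum_def)
  also have "\<dots> \<le> real (nat \<lfloor>x\<rfloor>) powr (1 - be) / (1 - be)" by (rule sum_powr_head) (use assms in auto)
  also have "\<dots> \<le> x powr (1 - be) / (1 - be)" using assms by (intro divide_right_mono powr_mono2) auto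
  finally show ?thesis by simp
qed

subsection \<open>Sums over divisors\<close>

lemma sum_divisors_coprime:
  fixes f :: "nat \<Rightarrow> 'a::comm_monoid_add"
  assumes ab: "coprime a b" "a > 0" "b > 0"
  shows "(\<Sum>d | d dvd a * b. f d) = (\<Sum>d | d dvd a. \<Sum>e | e dvd b. f (d * e))"
proof -
  have inj: "inj_on (\<lambda>(d,e). d * e) ({d. d dvd a} \<times> {e. e dvd b})"
  proof (rule inj_onI, clarsimp)
    fix d e d' e' assume h: "d dvd a" "e dvd b" "d' dvd a" "e' dvd b" "d * e = d' * e'"
    have "coprime d e'" "coprime d' e" using h ab(1) by (meson coprime_divisors)+
    moreover have "d dvd d' * e'" "d' dvd d * e" using h(5) by (metis dvd_triv_left)+
    ultimately have "d dvd d'" "d' dvd d" by (auto simp: coprime_dvd_mult_left_iff)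
    then have "d = d'" by (rule dvd_antisym)
    moreover have "d > 0" using h(1) ab(2) by (auto intro: gr0I)
    ultimately show "d = d' \<and> e = e'" using h(5) by simp
  qed
  have img: "(\<lambda>(d,e). d * e) ` ({d. d dvd a} \<times> {e. e dvd b}) = {d. d dvd a * b}"
  proof (intro equalityI subsetI)
    fix n assume "n \<in> {d. d dvd a * b}"
    then obtain d e where "n = d * e" "d dvd a" "e dvd b" using division_decomp by blast
    then show "n \<in> (\<lambda>(d,e). d * e) ` ({d. d dvd a} \<times> {e. e dvd b})" by auto
  qed (auto intro: mult_dvd_mono)
  have "(\<Sum>d | d dvd a * b. f d) = (\<Sum>(d,e)\<in>{d. d dvd a} \<times> {e. e dvd b}. f (d * e))"
    unfolding img[symmetric] by (subst sum.reindex[OF inj]) (simp add: case_prod_unfold)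
  then show ?thesis by (simp add: sum.cartesian_product)
qed

lemma sum_divisors_prime_power:
  fixes f :: "nat \<Rightarrow> 'a::comm_monoid_add"
  assumes "prime p"
  shows "(\<Sum>d | d dvd p ^ k. f d) = (\<Sum>i\<le>k. f (p ^ i))"
proof -
  have "{d. d dvd p ^ k} = (\<lambda>i. p ^ i) ` {..k}" using divides_primepow_nat[OF assms] by auto
  moreover have "inj_on (\<lambda>i. p ^ i) {..k}" using prime_gt_1_nat[OF assms] by (auto intro!: inj_onI)
  ultimately show ?thesis by (simp add: sum.reindex)
qed

lemma prime_power_decompose:
  fixes n :: nat
  assumes "n > 0" "prime p" "p dvd n"
  obtains k m where "n = p ^ k * m" "k > 0" "\<not> p dvd m" "m < n" "m > 0" "k = multiplicity p n" "coprime (p ^ k) m"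
proof -
  have "\<not> is_unit p" "n \<noteq> 0" using assms by (auto simp: not_prime_unit)
  then obtain m where m: "n = p ^ multiplicity p n * m" "\<not> p dvd m" using multiplicity_decompose' by metis
  define k where "k = multiplicity p n"
  have k: "k > 0" using assms by (simp add: k_def prime_multiplicity_gt_zero_iff)
  have m0: "m > 0" using assms m by (auto intro: gr0I)
  have "p ^ k > 1" by (rule one_less_power[OF prime_gt_1_nat[OF assms(2)] k])
  then have "1 * m < p ^ k * m" using m0 by (intro mult_strict_right_mono) auto
  then have "m < n" using m by (simp add: k_def)
  moreover have "coprime (p ^ k) m" using m(2) assms(2) by (simp add: prime_imp_coprime)
  ultimately show ?thesis using that m k m0 unfolding k_def by metis
qed

lemma card_prime_factors_le:
  fixes n :: nat
  assumes "n > 0" shows "2 ^ card (prime_factors n) \<le> n"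
proof -
  have "2 ^ card (prime_factors n) = (\<Prod>p\<in>prime_factors n. 2 :: nat)" by simp
  also have "\<dots> \<le> (\<Prod>p\<in>prime_factors n. p ^ multiplicity p n)"
  proof (rule prod_mono)
    fix p assume p: "p \<in> prime_factors n"
    then have "prime p" "multiplicity p n > 0" by (auto simp: prime_factors_multiplicity)
    then have "2 \<le> p" "p \<le> p ^ multiplicity p n" using prime_ge_2_nat[of p] self_le_power[of p "multiplicity p n"] by auto
    then show "0 \<le> (2::nat) \<and> 2 \<le> p ^ multiplicity p n" by simp
  qed
  also have "\<dots> = n" using prime_factorization_nat[OF assms] by simp
  finally show ?thesis .
qed

text \<open>The largest of \<open>n\<close> distinct integers above 1 is at least
  \<open>n + 1\<close>, and the resulting bounds for the factors telescope.\<close>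

lemma prod_one_minus_inverse_ge:
  fixes P :: "nat set"
  assumes "finite P" "\<And>p. p \<in> P \<Longrightarrow> p \<ge> 2"
  shows "(\<Prod>p\<in>P. 1 - 1 / real p) \<ge> 1 / (real (card P) + 1)"
  using assms
proof (induction P rule: finite_linorder_max_induct)
  case (insert b A)
  have "A \<subseteq> {2..<b}" using insert by auto
  then have "card A \<le> card {2..<b}" by (intro card_mono) auto
  then have "card A + 2 \<le> b" using insert.prems[of b] by simp
  then have "1 - 1 / real b \<ge> 1 - 1 / (real (card A) + 2)"
    by (intro diff_left_mono divide_left_mono) auto
  then have "(1 - 1 / (real (card A) + 2)) * (1 / (real (card A) + 1)) \<le> (1 - 1 / real b) * (\<Prod>p\<in>A. 1 - 1 / real p)"
  proof (intro mult_mono)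
    have "b \<ge> 2" using insert.prems by simp
    then show "0 \<le> 1 - 1 / real b" by simp
  qed (use insert in auto)
  moreover have "(1 - 1 / (real (card A) + 2)) * (1 / (real (card A) + 1)) = 1 / (real (card A) + 2)"
    by (simp add: field_simps)
  moreover have "b \<notin> A" using insert by auto
  ultimately show ?case using insert by (simp add: add_ac)
qed simp

subsection \<open>Real characters\<close>

definition rchar :: "nat \<Rightarrow> (nat \<Rightarrow> real) \<Rightarrow> bool" where
  "rchar q c \<longleftrightarrow> q > 0 \<and> dchar q (\<lambda>n. complex_of_real (c n)) \<and> (\<lambda>n. complex_of_real (c n)) \<noteq> pchar q"

lemma rchar_mult: "rchar q c \<Longrightarrow> c (m * n) = c m * c n"
proof -
  assume "rchar q c"
  then have "complex_of_real (c (m * n)) = of_real (c m * c n)" by (simp add: rchar_def dchar_def)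
  then show ?thesis by (simp only: of_real_eq_iff)
qed

lemma rchar_1: "rchar q c \<Longrightarrow> c 1 = 1"
  by (simp add: rchar_def dchar_def)

lemma rchar_values:
  assumes "rchar q c" shows "c n = 0 \<or> c n = 1 \<or> c n = -1"
  using dchar_norm[of q "\<lambda>n. complex_of_real (c n)" n] assms by (auto simp: rchar_def abs_if split: if_splits)

lemma rchar_abs_le: "rchar q c \<Longrightarrow> \<bar>c n\<bar> \<le> 1"
  using rchar_values[of q c n] by auto

lemma rchar_power: "rchar q c \<Longrightarrow> c (n ^ i) = c n ^ i"
  by (induction i) (auto simp: rchar_mult rchar_1 simp del: One_nat_def intro: rchar_1[unfolded One_nat_def])

lemma rchar_bounded_sums:
  assumes "rchar q c" shows "\<bar>\<Sum>n\<in>{M<..N}. c n\<bar> \<le> real q"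
proof -
  have "norm (\<Sum>n\<in>{M<..N}. complex_of_real (c n)) \<le> real q"
    using assms by (intro dchar_bounded_sums) (auto simp: rchar_def)
  then show ?thesis by (simp flip: of_real_sum)
qed

lemma dconv_one_eq: "n > 0 \<Longrightarrow> dconv (\<lambda>_. 1) c n = (\<Sum>d | d dvd n. c d)"
  using dconv_comm[of n "\<lambda>_. 1" c] by (simp add: dconv_def)

text \<open>By multiplicativity only \<open>p ^ (2 * k)\<close> matters, where the sum of the powers
  \<open>c p ^ i\<close> has an odd number of terms and is at least 1 even for
  \<open>c p = - 1\<close>.\<close>

lemma dconv_one_square_ge_1:
  assumes c: "rchar q c"
  shows "m > 0 \<Longrightarrow> dconv (\<lambda>_. 1) c (m ^ 2) \<ge> 1"
proof (induction m rule: less_induct)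
  case (less m)
  show ?case
  proof (cases "m = 1")
    case True
    then show ?thesis using rchar_1[OF c] by (simp add: dconv_def)
  next
    case False
    then obtain p where p: "prime p" "p dvd m" using prime_factor_nat by blast
    obtain k n where n: "m = p ^ k * n" "n < m" "n > 0" "coprime (p ^ k) n"
      using prime_power_decompose[OF less.prems p] by metis
    have p0: "p > 0" using p prime_gt_0_nat by simp
    have sq: "m ^ 2 = p ^ (2 * k) * n ^ 2" by (simp add: n(1) power_mult_distrib power_mult mult.commute)
    have cop: "coprime (p ^ (2 * k)) (n ^ 2)" using n(4) by (cases "k = 0") (auto simp: coprime_power_left_iff coprime_power_right_iff)
    have IH: "dconv (\<lambda>_. 1) c (n ^ 2) \<ge> 1" by (rule less.IH[OF n(2,3)])
    have "dconv (\<lambda>_. 1) c (m ^ 2) = (\<Sum>d | d dvd p ^ (2 * k) * n ^ 2. c d)"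
      unfolding sq[symmetric] by (rule dconv_one_eq) (use less.prems in simp)
    also have "\<dots> = (\<Sum>d | d dvd p ^ (2 * k). \<Sum>e | e dvd n ^ 2. c (d * e))"
      by (rule sum_divisors_coprime[OF cop]) (use p0 n in auto)
    also have "\<dots> = (\<Sum>d | d dvd p ^ (2 * k). c d) * (\<Sum>e | e dvd n ^ 2. c e)"
      by (simp add: rchar_mult[OF c] sum_product)
    also have "(\<Sum>d | d dvd p ^ (2 * k). c d) = (\<Sum>i\<le>2 * k. c p ^ i)"
      using sum_divisors_prime_power[OF p(1), of c "2 * k"] by (simp add: rchar_power[OF c])
    also have "(\<Sum>e | e dvd n ^ 2. c e) = dconv (\<lambda>_. 1) c (n ^ 2)" using dconv_one_eq[of "n ^ 2" c] n by simp
    finally have eq: "dconv (\<lambda>_. 1) c (m ^ 2) = (\<Sum>i\<le>2 * k. c p ^ i) * dconv (\<lambda>_. 1) c (n ^ 2)" .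
    have "(\<Sum>i\<le>2 * k. c p ^ i) \<ge> 1"
    proof -
      have "(\<Sum>i\<le>2 * k. (-1) ^ i) = (1::real)" by (induction k) auto
      moreover have "(\<Sum>i\<le>2 * k. 0 ^ i) = (1::real)" by (induction k) auto
      ultimately show ?thesis using rchar_values[OF c, of p] by auto
    qed
    then show ?thesis unfolding eq using IH mult_mono[of 1 "\<Sum>i\<le>2 * k. c p ^ i" 1 "dconv (\<lambda>_. 1) c (n ^ 2)"] by simp
  qed
qed

lemma log_deriv_one: "log_deriv (\<lambda>_. 1) (\<lambda>n. mangoldt n)"
  using log_deriv_cmult[of "\<lambda>_. 1"] by simp

lemma dconv_one_nonneg:
  assumes c: "rchar q c" and n: "n > 0"
  shows "dconv (\<lambda>_. 1) c n \<ge> 0"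
proof (rule log_deriv_nonneg[OF log_deriv_dconv[OF log_deriv_one log_deriv_cmult[OF rchar_mult[OF c]]] _ _ _ n])
  show "dconv (\<lambda>_. 1) c 1 \<ge> 0" using rchar_1[OF c] by (simp add: dconv_1 del: One_nat_def)
  show "mangoldt m + c m * mangoldt m \<ge> 0" for m
  proof -
    have "(1 + c m) * mangoldt m \<ge> 0" using rchar_abs_le[OF c, of m] mangoldt_nonneg[of m] by (intro mult_nonneg_nonneg) auto
    then show ?thesis by (simp add: algebra_simps)
  qed
qed simp

text \<open>The logarithmic derivative of the fourfold convolution has the coefficients
  \<open>(1 + c1 n) * (1 + c2 n) * mangoldt n\<close>.\<close>

lemma quad_dconv_nonneg:
  assumes c1: "rchar q1 c1" and c2: "rchar q2 c2" and n: "n > 0"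
  shows "dconv (dconv (dconv (\<lambda>_. 1) c1) c2) (\<lambda>n. c1 n * c2 n) n \<ge> 0"
proof -
  have "log_deriv (\<lambda>n. c1 n * c2 n) (\<lambda>n. (c1 n * c2 n) * mangoldt n)"
    by (rule log_deriv_cmult) (simp add: rchar_mult[OF c1] rchar_mult[OF c2])
  note ld = log_deriv_dconv[OF log_deriv_dconv[OF log_deriv_dconv[OF log_deriv_one
    log_deriv_cmult[OF rchar_mult[OF c1]]] log_deriv_cmult[OF rchar_mult[OF c2]]] this]
  show ?thesis
  proof (rule log_deriv_nonneg[OF ld _ _ _ n])
    show "dconv (dconv (dconv (\<lambda>_. 1) c1) c2) (\<lambda>n. c1 n * c2 n) 1 \<ge> 0"
      using rchar_1[OF c1] rchar_1[OF c2] by (simp add: dconv_1 del: One_nat_def)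
    show "mangoldt m + c1 m * mangoldt m + c2 m * mangoldt m + c1 m * c2 m * mangoldt m \<ge> 0" for m
    proof -
      have "(1 + c1 m) * (1 + c2 m) * mangoldt m \<ge> 0"
        using rchar_abs_le[OF c1, of m] rchar_abs_le[OF c2, of m] mangoldt_nonneg[of m] by (intro mult_nonneg_nonneg) auto
      then show ?thesis by (simp add: algebra_simps)
    qed
  qed simp
qed

lemma wsum_ge_1:
  assumes "\<And>n. n > 0 \<Longrightarrow> f n \<ge> 0" "f 1 = 1" "x \<ge> 1"
  shows "wsum be f x \<ge> 1"
proof -
  have "1 \<in> {1..nat \<lfloor>x\<rfloor>}" using assms(3) by (auto simp: le_nat_iff)
  then have "(\<Sum>n\<in>{1}. f n * real n powr (- be)) \<le> wsum be f x"
    unfolding wsum_def by (intro sum_mono2) (auto intro!: mult_nonneg_nonneg assms(1))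
  then show ?thesis using assms(2) by simp
qed

lemma Lr_continuous:
  assumes c: "rchar q c"
  shows "continuous_on {1/2..2} (Lr c)"
proof (rule uniform_limit_theorem)
  show "uniform_limit {1/2..2} (\<lambda>N th. \<Sum>n=1..N. c n * real n powr (- th)) (Lr c) sequentially"
  proof (rule uniform_limitI)
    fix e :: real assume e: "e > 0"
    have "(\<lambda>N. real q * real N powr (- (1/2))) \<longlonglongrightarrow> real q * 0"
      by (intro tendsto_mult tendsto_const tendsto_neg_powr filterlim_real_sequentially) auto
    then have "(\<lambda>N. real q * real N powr (- (1/2))) \<longlonglongrightarrow> 0" by simp
    from order_tendstoD(2)[OF this e]
    show "\<forall>\<^sub>F N in sequentially. \<forall>th\<in>{1/2..2}. dist (\<Sum>n=1..N. c n * real n powr (- th)) (Lr c th) < e"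
      using eventually_ge_at_top[of 1]
    proof eventually_elim
      case (elim N)
      show ?case
      proof
        fix th :: real assume th: "th \<in> {1/2..2}"
        have "\<bar>Lr c th - (\<Sum>n=1..N. c n * real n powr (- th))\<bar> \<le> real q * real (Suc N) powr (- th)"
          by (rule Lr_tail[OF _ rchar_bounded_sums[OF c]]) (use th in auto)
        also have "\<dots> \<le> real q * real N powr (- (1/2))"
        proof (intro mult_left_mono)
          have "real (Suc N) powr (- th) \<le> real (Suc N) powr (- (1/2))" using th by (intro powr_mono) auto
          also have "\<dots> \<le> real N powr (- (1/2))" using elim by (intro powr_mono2') auto
          finally show "real (Suc N) powr (- th) \<le> real N powr (- (1/2))" .
        qed simp
        finally show "dist (\<Sum>n=1..N. c n * real n powr (- th)) (Lr c th) < e"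
          using elim by (simp add: dist_real_def abs_minus_commute)
      qed
    qed
  qed
  show "\<forall>\<^sub>F N in sequentially. continuous_on {1/2..2} (\<lambda>th. \<Sum>n=1..N. c n * real n powr (- th))"
    by (intro always_eventually allI continuous_on_sum continuous_intros) auto
qed simp

lemma Lr_tendsto_1:
  assumes c: "rchar q c" shows "(Lr c \<longlongrightarrow> Lr c 1) (at_right 1)"
proof -
  have "isCont (Lr c) 1"
    using Lr_continuous[OF c] by (intro continuous_on_interior[of "{1/2..2}"]) (auto simp: interior_atLeastAtMost_real)
  then show ?thesis by (simp add: isCont_def filterlim_at_split)
qed

lemma ds_real:
  assumes c: "\<And>n. \<bar>c n\<bar> \<le> 1" and sg: "sg > 1"
  shows "ds (\<lambda>n. complex_of_real (c n)) (of_real sg) = of_real (Lr c sg)"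
proof -
  have t: "complex_of_real (c n) * of_nat n powr (- of_real sg) = of_real (c n * real n powr (- sg))" for n
    by (cases "n = 0") (auto simp: powr_of_real[symmetric])
  have "summable (\<lambda>n. norm (complex_of_real (c n) * of_nat n powr (- of_real sg)))"
    by (rule ds_summable_norm[where B = 1 and j = 0]) (use c sg in auto)
  then have "summable (\<lambda>n. complex_of_real (c n * real n powr (- sg)))"
    unfolding t by (rule summable_norm_cancel)
  then have "summable (\<lambda>n. c n * real n powr (- sg))" by (simp only: summable_of_real_iff)
  then show ?thesis unfolding ds_def Lr_def t by (rule suminf_of_real[symmetric])
qed

text \<open>The partial Euler products are nonnegative, and multiplied by \<open>Lr c sg\<close>
  they tend to 1.\<close>

lemma Lr_pos:
  assumes c: "rchar q c" and sg: "sg > 1" shows "Lr c sg > 0"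
proof -
  let ?P = "\<lambda>N. \<Prod>p | prime p \<and> p \<le> N. 1 - c p * real p powr (- sg)"
  have "(\<lambda>N. (\<Prod>p | prime p \<and> p \<le> N. 1 - complex_of_real (c p) * of_nat p powr (- of_real sg)) * ds (\<lambda>n. complex_of_real (c n)) (of_real sg)) \<longlonglongrightarrow> 1"
    by (rule ds_euler) (use rchar_abs_le[OF c] rchar_mult[OF c] rchar_1[OF c] sg in auto)
  moreover have "1 - complex_of_real (c p) * of_nat p powr (- of_real sg) = of_real (1 - c p * real p powr (- sg))" for p
    by (cases "p = 0") (auto simp: powr_of_real[symmetric])
  ultimately have "(\<lambda>N. complex_of_real (?P N * Lr c sg)) \<longlonglongrightarrow> of_real 1"
    using ds_real[OF rchar_abs_le[OF c] sg] by (simp only: of_real_prod of_real_mult of_real_1)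
  then have lim: "(\<lambda>N. ?P N * Lr c sg) \<longlonglongrightarrow> 1" by (simp only: tendsto_of_real_iff)
  have pos: "?P N \<ge> 0" for N
  proof (rule prod_nonneg)
    fix p assume "p \<in> {p. prime p \<and> p \<le> N}"
    then have "real p \<ge> 1" using prime_ge_1_nat[of p] by simp
    then have "real p powr (- sg) \<le> real p powr 0" using sg by (intro powr_mono) auto
    also have "\<dots> = 1" using \<open>real p \<ge> 1\<close> by simp
    finally have "\<bar>c p * real p powr (- sg)\<bar> \<le> 1 * 1"
      unfolding abs_mult using rchar_abs_le[OF c, of p] by (intro mult_mono) auto
    then show "0 \<le> 1 - c p * real p powr (- sg)" by simp
  qed
  show ?thesis
  proof (rule ccontr)
    assume "\<not> Lr c sg > 0"
    then have "?P N * Lr c sg \<le> 0" for N using pos[of N] by (simp add: mult_le_0_iff)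
    then have "1 \<le> (0::real)" by (intro Lim_bounded[OF lim]) auto
    then show False by simp
  qed
qed

lemma Lr_1_nonneg:
  assumes c: "rchar q c" shows "Lr c 1 \<ge> 0"
proof (rule tendsto_lowerbound[OF Lr_tendsto_1[OF c]])
  show "\<forall>\<^sub>F sg in at_right 1. 0 \<le> Lr c sg"
    using eventually_at_right_less[of 1] by eventually_elim (use Lr_pos[OF c] in \<open>auto intro: less_imp_le\<close>)
qed simp

text \<open>If \<open>Lr c 1 = 0\<close>, the hyperbola method with weight
  \<open>n powr (- (1/2))\<close> bounds the sums of the nonnegative
  \<open>dconv (\<lambda>_. 1) c\<close>, whereas the squares alone contribute a harmonic
  series.\<close>

lemma Lr_1_pos:
  assumes c: "rchar q c" shows "Lr c 1 > 0"
proof (rule ccontr)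
  assume "\<not> Lr c 1 > 0"
  then have L0: "Lr c 1 = 0" using Lr_1_nonneg[OF c] by simp
  obtain z where z: "\<And>x. x \<ge> 1 \<Longrightarrow> \<bar>wsum (1/2) (\<lambda>_. 1) x - 1 * x powr (1 - 1/2) / (1 - 1/2) - z\<bar> \<le> 4 * x powr (- (1/2))"
    using wsum_one[of "1/2"] by auto
  define T where "T = (\<bar>1\<bar> * real q / (1 - 1/2) + \<bar>z\<bar> * real q + 4 / (1/2) + real q * (1 / (1 - 1/2))) + \<bar>z * Lr c (1/2)\<bar>"
  have up: "wsum (1/2) (dconv (\<lambda>_. 1) c) x \<le> T" if x: "x \<ge> 1" for x
  proof -
    \<comment> \<open>At \<open>be = 1/2\<close> the largest admissible \<open>et'\<close> is 0; a
      bounded error is all that is wanted.\<close>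
    have "\<bar>wsum (1/2) (dconv (\<lambda>_. 1) c) x - 1 * Lr c 1 * x powr (1 - 1/2) / (1 - 1/2) - z * Lr c (1/2)\<bar> \<le>
      (\<bar>1\<bar> * real q / (1 - 1/2) + \<bar>z\<bar> * real q + 4 / (1/2) + real q * (1 / (1 - 1/2))) * x powr (- 0)"
      by (rule hyperbola_step[where ka = "1 - 1/2", OF _ _ _ _ _ _ z wsum_one_le rchar_bounded_sums[OF c] rchar_abs_le[OF c]]) (use x in auto)
    then have "wsum (1/2) (dconv (\<lambda>_. 1) c) x - z * Lr c (1/2) \<le>
      (\<bar>1\<bar> * real q / (1 - 1/2) + \<bar>z\<bar> * real q + 4 / (1/2) + real q * (1 / (1 - 1/2)))"
      using L0 x by (simp add: abs_le_iff)
    then show ?thesis using abs_ge_self[of "z * Lr c (1/2)"] unfolding T_def by linarith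
  qed
  have low: "ln (real M + 1) \<le> T" if M: "M \<ge> 1" for M :: nat
  proof -
    have "ln (real M + 1) \<le> harm M" by (rule ln_le_harm)
    also have "\<dots> = (\<Sum>m=1..M. 1 * real (m ^ 2) powr (- (1/2)))"
      unfolding harm_def
    proof (intro sum.cong refl)
      fix m assume "m \<in> {1..M}"
      have "real (m ^ 2) = real m powr 2" by simp
      then have "real (m ^ 2) powr (- (1/2)) = real m powr (2 * - (1/2))" by (simp only: powr_powr)
      also have "\<dots> = inverse (real m)" by (simp add: powr_minus)
      finally show "inverse (real m) = 1 * real (m ^ 2) powr (- (1/2))" by simp
    qed
    also have "\<dots> \<le> (\<Sum>m=1..M. dconv (\<lambda>_. 1) c (m ^ 2) * real (m ^ 2) powr (- (1/2)))"
      by (intro sum_mono mult_right_mono dconv_one_square_ge_1[OF c]) auto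
    also have "\<dots> = (\<Sum>n\<in>(\<lambda>m. m ^ 2) ` {1..M}. dconv (\<lambda>_. 1) c n * real n powr (- (1/2)))"
      by (subst sum.reindex) (auto intro!: inj_onI)
    also have "\<dots> \<le> (\<Sum>n=1..M ^ 2. dconv (\<lambda>_. 1) c n * real n powr (- (1/2)))"
      by (intro sum_mono2) (auto intro!: mult_nonneg_nonneg dconv_one_nonneg[OF c] power_mono simp: Suc_le_eq)
    also have "\<dots> = wsum (1/2) (dconv (\<lambda>_. 1) c) (real (M ^ 2))"
      unfolding wsum_def by (simp only: floor_of_nat nat_int)
    also have "\<dots> \<le> T" by (rule up) (use M in simp)
    finally show ?thesis .
  qed
  obtain M :: nat where M: "exp T \<le> real M" using real_arch_simple by blast
  then have M1: "M \<ge> 1" using exp_gt_zero[of T] by (cases M) auto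
  have "ln (exp T) < ln (real M + 1)" using M by (subst ln_less_cancel_iff) auto
  then have "T < ln (real M + 1)" by simp
  then show False using low[OF M1] by simp
qed

lemma rchar_product:
  assumes c1: "rchar q1 c1" and c2: "rchar q2 c2" and np: "(\<lambda>n. complex_of_real (c1 n * c2 n)) \<noteq> pchar (q1 * q2)"
  shows "rchar (q1 * q2) (\<lambda>n. c1 n * c2 n)"
proof -
  have 1: "dchar q1 (\<lambda>n. complex_of_real (c1 n))" "dchar q2 (\<lambda>n. complex_of_real (c2 n))" "q1 > 0" "q2 > 0"
    using c1 c2 by (auto simp: rchar_def)
  have "dchar (q1 * q2) (\<lambda>n. complex_of_real (c1 n * c2 n))"
    unfolding dchar_def
  proof (intro conjI allI impI)
    show "complex_of_real (c1 1 * c2 1) = 1" using rchar_1[OF c1] rchar_1[OF c2] by simp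
    show "complex_of_real (c1 (m * n) * c2 (m * n)) = of_real (c1 m * c2 m) * of_real (c1 n * c2 n)" for m n
      by (simp add: rchar_mult[OF c1] rchar_mult[OF c2])
    show "complex_of_real (c1 m * c2 m) = of_real (c1 n * c2 n)" if "[m = n] (mod q1 * q2)" for m n
    proof -
      have "[m = n] (mod q1)" "[m = n] (mod q2)" using that cong_modulus_mult_nat[of m n q1 q2] cong_modulus_mult_nat[of m n q2 q1]
        by (auto simp: mult.commute)
      then have "complex_of_real (c1 m) = of_real (c1 n)" "complex_of_real (c2 m) = of_real (c2 n)"
        using 1(1,2) unfolding dchar_def by blast+
      then show ?thesis by simp
    qed
    show "complex_of_real (c1 n * c2 n) \<noteq> 0 \<longleftrightarrow> coprime n (q1 * q2)" for n
      using 1(1,2) by (auto simp: dchar_def coprime_mult_right_iff)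
  qed
  then show ?thesis using np 1 by (simp add: rchar_def)
qed

text \<open>If the product of two real characters is principal, then their L-functions differ only in the Euler factors at
  primes dividing the moduli.\<close>

lemma Lr_1_degenerate:
  assumes c1: "rchar q1 c1" and c2: "rchar q2 c2" and pr: "(\<lambda>n. complex_of_real (c1 n * c2 n)) = pchar (q1 * q2)"
  shows "Lr c1 1 / (real (card (prime_factors (q1 * q2))) + 1) \<le> 2 ^ card (prime_factors q1) * Lr c2 1"
proof -
  have q: "q1 > 0" "q2 > 0" using c1 c2 by (auto simp: rchar_def)
  define P where "P = prime_factors (q1 * q2)"
  have P: "finite P" "\<And>p. p \<in> P \<Longrightarrow> prime p" by (auto simp: P_def)
  have eq: "(\<Prod>p\<in>P. 1 - c1 p * real p powr (- sg)) * Lr c1 sg = (\<Prod>p\<in>P. 1 - c2 p * real p powr (- sg)) * Lr c2 sg" if sg: "sg > 1" for sg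
  proof -
    have gen: "infsum (\<lambda>n. complex_of_real (c n) * of_nat n powr (- of_real sg)) (sifted P) =
      of_real ((\<Prod>p\<in>P. 1 - c p * real p powr (- sg)) * Lr c sg)" if c: "rchar q c" for q c
    proof -
      let ?f = "\<lambda>n. complex_of_real (c n) * of_nat n powr (- of_real sg)"
      have t: "1 - ?f p = of_real (1 - c p * real p powr (- sg))" for p
        by (cases "p = 0") (auto simp: powr_of_real[symmetric])
      have "infsum ?f (sifted P) = (\<Prod>p\<in>P. 1 - ?f p) * suminf ?f"
      proof (rule infsum_sifted[OF _ _ P])
        show "?f (m * n) = ?f m * ?f n" for m n by (simp only: rchar_mult[OF c] of_nat_mult_powr of_real_mult mult_ac)
        show "summable (\<lambda>n. norm (?f n))"
          by (rule ds_summable_norm[where B = 1 and j = 0]) (use rchar_abs_le[OF c] sg in auto)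
      qed
      also have "suminf ?f = of_real (Lr c sg)" using ds_real[OF rchar_abs_le[OF c] sg] by (simp add: ds_def)
      finally show ?thesis unfolding t by (simp only: of_real_prod of_real_mult)
    qed
    have "infsum (\<lambda>n. complex_of_real (c1 n) * of_nat n powr (- of_real sg)) (sifted P) =
      infsum (\<lambda>n. complex_of_real (c2 n) * of_nat n powr (- of_real sg)) (sifted P)"
    proof (rule infsum_cong)
      fix n assume n: "n \<in> sifted P"
      have "c1 n = c2 n"
      proof -
        have "coprime n (q1 * q2)"
        proof (rule ccontr)
          assume "\<not> coprime n (q1 * q2)"
          then obtain p where "prime p" "p dvd n" "p dvd q1 * q2"
            by (metis coprime_iff_gcd_eq_1 gcd_nat.bounded_iff prime_factor_nat)
          then have "p \<in> P" using q by (auto simp: P_def prime_factors_dvd)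
          then show False using n \<open>p dvd n\<close> by (auto simp: sifted_def)
        qed
        then have "complex_of_real (c1 n * c2 n) = 1" using fun_cong[OF pr, of n] by (simp add: pchar_def)
        then have "c1 n * c2 n = 1" by (simp only: of_real_eq_1_iff)
        then show ?thesis using rchar_values[OF c1, of n] rchar_values[OF c2, of n] by auto
      qed
      then show "complex_of_real (c1 n) * of_nat n powr (- of_real sg) = complex_of_real (c2 n) * of_nat n powr (- of_real sg)" by simp
    qed
    then show ?thesis unfolding gen[OF c1] gen[OF c2] by (simp only: of_real_eq_iff)
  qed
  have b: "\<bar>c p * real p powr (- sg)\<bar> \<le> 1 / real p" if "sg > 1" "p \<in> P" "rchar q c" for sg p q c
  proof -
    have p1: "real p \<ge> 1" using that P prime_ge_1_nat[of p] by simp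
    have "real p powr (- sg) \<le> real p powr (- 1)" using p1 that(1) by (intro powr_mono) auto
    then have "\<bar>c p * real p powr (- sg)\<bar> \<le> 1 * real p powr (- 1)"
      unfolding abs_mult using rchar_abs_le[OF that(3), of p] by (intro mult_mono) (auto simp del: powr_minus)
    then show ?thesis using p1 by (simp add: powr_minus_divide)
  qed
  have main: "Lr c1 sg / (real (card P) + 1) \<le> 2 ^ card (prime_factors q1) * Lr c2 sg" if sg: "sg > 1" for sg
  proof -
    have "1 / (real (card P) + 1) \<le> (\<Prod>p\<in>P. 1 - 1 / real p)"
      by (rule prod_one_minus_inverse_ge) (use P prime_ge_2_nat in auto)
    also have "\<dots> \<le> (\<Prod>p\<in>P. 1 - c1 p * real p powr (- sg))"
    proof (rule prod_mono)
      fix p assume p: "p \<in> P"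
      have "real p \<ge> 1" using P(2)[OF p] prime_ge_1_nat[of p] by simp
      then show "0 \<le> 1 - 1 / real p \<and> 1 - 1 / real p \<le> 1 - c1 p * real p powr (- sg)"
        using b[OF sg p c1] by (auto simp: abs_le_iff)
    qed
    finally have "Lr c1 sg * (1 / (real (card P) + 1)) \<le> Lr c1 sg * (\<Prod>p\<in>P. 1 - c1 p * real p powr (- sg))"
      using Lr_pos[OF c1 sg] by (intro mult_left_mono) auto
    also have "\<dots> = (\<Prod>p\<in>P. 1 - c2 p * real p powr (- sg)) * Lr c2 sg" using eq[OF sg] by (simp add: mult.commute)
    also have "\<dots> \<le> 2 ^ card (prime_factors q1) * Lr c2 sg"
    proof (intro mult_right_mono)
      \<comment> \<open>\<open>c2\<close> vanishes at the primes dividing \<open>q2\<close>, so only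
        primes dividing \<open>q1\<close> can produce a factor above 1. The power of 2 thus depends
        on \<open>q1\<close> alone, which is fixed when the lemma is applied.\<close>
      have "(\<Prod>p\<in>P. 1 - c2 p * real p powr (- sg)) \<le> (\<Prod>p\<in>P. if p \<in> prime_factors q1 then 2 else 1)"
      proof (rule prod_mono)
        fix p assume p: "p \<in> P"
        have p1: "real p \<ge> 1" using P(2)[OF p] prime_ge_1_nat[of p] by simp
        have ip: "1 / real p \<le> 1" using p1 by simp
        have "c2 p = 0" if "p \<notin> prime_factors q1"
        proof -
          have "p dvd q1 * q2" "prime p" using p by (auto simp: P_def)
          then have "p dvd q2" using that q by (auto simp: prime_dvd_mult_iff prime_factors_dvd)
          then have "\<not> coprime p q2" using \<open>prime p\<close> by (metis coprime_absorb_left not_prime_unit)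
          then have "complex_of_real (c2 p) = 0" using c2 by (auto simp: rchar_def dchar_def)
          then show ?thesis by simp
        qed
        then show "0 \<le> 1 - c2 p * real p powr (- sg) \<and> 1 - c2 p * real p powr (- sg) \<le> (if p \<in> prime_factors q1 then 2 else 1)"
          using b[OF sg p c2] ip by (auto simp: abs_le_iff)
      qed
      also have "\<dots> = 2 ^ card (P \<inter> prime_factors q1)" using P(1) by (simp add: prod.If_cases)
      also have "\<dots> \<le> 2 ^ card (prime_factors q1)" by (intro power_increasing card_mono) auto
      finally show "(\<Prod>p\<in>P. 1 - c2 p * real p powr (- sg)) \<le> 2 ^ card (prime_factors q1)" .
    qed (use Lr_pos[OF c2 sg] in simp)
    finally show ?thesis by simp
  qed
  show ?thesis unfolding P_def[symmetric]
  proof (rule tendsto_le)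
    show "((\<lambda>sg. 2 ^ card (prime_factors q1) * Lr c2 sg) \<longlongrightarrow> 2 ^ card (prime_factors q1) * Lr c2 1) (at_right 1)"
      by (intro tendsto_intros Lr_tendsto_1[OF c2])
    show "((\<lambda>sg. Lr c1 sg / (real (card P) + 1)) \<longlongrightarrow> Lr c1 1 / (real (card P) + 1)) (at_right 1)"
      by (intro tendsto_intros Lr_tendsto_1[OF c1]) auto
    show "\<forall>\<^sub>F sg in at_right 1. Lr c1 sg / (real (card P) + 1) \<le> 2 ^ card (prime_factors q1) * Lr c2 sg"
      using eventually_at_right_less[of 1] by eventually_elim (use main in auto)
  qed simp
qed

subsection \<open>Siegel's theorem\<close>

text \<open>\<open>x\<close> is chosen so that the error term equals 1/2, and the main term has to
  account for the other half.\<close>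

lemma lower_bound_from_sum:
  fixes e et T R :: real
  assumes e: "e > 0" "et > 0" and T: "T \<ge> 1/2"
    and h: "\<And>x. x \<ge> 1 \<Longrightarrow> 1 \<le> R * x powr e / e + T * x powr (- et)"
  shows "R \<ge> e / 2 * (2 * T) powr (- (e / et))"
proof -
  define x where "x = (2 * T) powr (1 / et)"
  have x1: "x \<ge> 1" unfolding x_def using T e by (intro ge_one_powr_ge_zero) auto
  have "x powr (- et) = (2 * T) powr (- 1)" using e by (simp add: x_def powr_powr)
  then have 1: "T * x powr (- et) = 1/2" using T by (simp add: powr_minus_divide)
  have 2: "x powr e = (2 * T) powr (e / et)" by (simp add: x_def powr_powr)
  have "1/2 \<le> R * (2 * T) powr (e / et) / e" using h[OF x1] unfolding 1 2 by linarith
  moreover have "(2 * T) powr (e / et) > 0" using T by simp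
  ultimately have "e / 2 / (2 * T) powr (e / et) \<le> R" using e by (simp add: field_simps)
  then show ?thesis by (simp add: powr_minus_divide)
qed

text \<open>If no real character is negative at \<^term>\<open>1 - e\<close>, the hyperbola method for \<open>1 * c\<close> suffices;
  otherwise a character with a zero close to 1 repels the zeros of all others.\<close>

lemma siegel_case_A:
  assumes e: "0 < e" "e \<le> 1/100" and pos: "\<And>q c. rchar q c \<Longrightarrow> Lr c (1 - e) \<ge> 0"
  obtains C where "C > 0" "\<And>q c. rchar q c \<Longrightarrow> Lr c 1 \<ge> C * real q powr (- (5 / 2 * e))"
proof -
  obtain z where z: "- 1 / (1 - (1 - e)) \<le> z" "z \<le> 1 - 1 / (1 - (1 - e))"
    "\<And>x. x \<ge> 1 \<Longrightarrow> \<bar>wsum (1 - e) (\<lambda>_. 1) x - 1 * x powr (1 - (1 - e)) / (1 - (1 - e)) - z\<bar> \<le> 4 * x powr (- (1 - e))"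
    using wsum_one[of "1 - e"] e by auto
  have "1 / e \<ge> 1" "- 1 / e \<le> z" "z \<le> 1 - 1 / e" using z(1,2) e by auto
  then have z0: "z \<le> 0" "\<bar>z\<bar> \<le> 1 / e" by linarith+
  define T where "T = 3 / e + 5"
  have T: "T \<ge> 1/2" using e by (simp add: T_def)
  show ?thesis
  proof (rule that[of "e / 2 * (2 * T) powr (- (5 / 2 * e))"])
    show "e / 2 * (2 * T) powr (- (5 / 2 * e)) > 0" using e T by simp
    fix q c assume c: "rchar q c"
    have q: "real q \<ge> 1" using c by (simp add: rchar_def Suc_le_eq)
    have "1 \<le> Lr c 1 * x powr e / e + (T * real q) * x powr (- (2/5))" if x: "x \<ge> 1" for x
    proof -
      let ?K = "\<bar>1\<bar> * real q / (1 - (1 - e)) + \<bar>z\<bar> * real q + 4 / (1 - e) + real q * (1 / (1 - (1 - e)))"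
      \<comment> \<open>All three limits on the exponent equal \<open>1/2 - e\<close> here;
        \<open>2/5\<close> is a convenient value below them and leads to the final exponent
        \<open>e / (2/5)\<close>.\<close>
      have "\<bar>wsum (1 - e) (dconv (\<lambda>_. 1) c) x - 1 * Lr c 1 * x powr (1 - (1 - e)) / (1 - (1 - e)) - z * Lr c (1 - e)\<bar>
        \<le> ?K * x powr (- (2/5))"
        by (rule hyperbola_step[where ka = "1 - (1 - e)", OF _ _ _ _ _ _ z(3) wsum_one_le rchar_bounded_sums[OF c] rchar_abs_le[OF c]])
           (use x e in auto)
      moreover have "wsum (1 - e) (dconv (\<lambda>_. 1) c) x \<ge> 1"
        by (rule wsum_ge_1[OF dconv_one_nonneg[OF c] _ x]) (use rchar_1[OF c] in \<open>auto simp: dconv_1 simp del: One_nat_def\<close>)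
      moreover have "z * Lr c (1 - e) \<le> 0" using z0(1) pos[OF c] by (simp add: mult_le_0_iff)
      moreover have "?K * x powr (- (2/5)) \<le> (T * real q) * x powr (- (2/5))"
      proof (intro mult_right_mono)
        have "\<bar>z\<bar> * real q \<le> 1 / e * real q" using z0(2) by (intro mult_right_mono) auto
        moreover have "4 / (1 - e) \<le> 5 * real q"
        proof -
          have "4 / (1 - e) \<le> 5" using e by (simp add: field_simps)
          then show ?thesis using q by linarith
        qed
        moreover have "T * real q = 3 * (1 / e * real q) + 5 * real q" by (simp add: T_def algebra_simps)
        moreover have "?K = 1 / e * real q + \<bar>z\<bar> * real q + 4 / (1 - e) + 1 / e * real q" by simp
        ultimately show "?K \<le> T * real q" by linarith
      qed simp
      ultimately show ?thesis by (simp add: abs_le_iff)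
    qed
    then have "Lr c 1 \<ge> e / 2 * (2 * (T * real q)) powr (- (e / (2/5)))"
      by (intro lower_bound_from_sum) (use e T q mult_mono[of "1/2" T 1 "real q"] in auto)
    also have "(2 * (T * real q)) powr (- (e / (2/5))) = (2 * T) powr (- (5 / 2 * e)) * real q powr (- (5 / 2 * e))"
    proof -
      have "(2 * (T * real q)) powr (- (e / (2/5))) = (2 * T * real q) powr (- (5 / 2 * e))"
        by (rule arg_cong2[where f = "(powr)"]) auto
      then show ?thesis using T q by (subst (asm) powr_mult) auto
    qed
    finally show "Lr c 1 \<ge> e / 2 * (2 * T) powr (- (5 / 2 * e)) * real q powr (- (5 / 2 * e))" by simp
  qed
qed

text \<open>The zero of \<open>c1\<close> annihilates the constant term in the first convolution,
  and it stays 0 in the next two. There remains a lower bound for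
  \<open>Lr c1 1 * Lr c 1 * Lr c2 1\<close>, with \<open>c2\<close> the product of \<open>c1\<close>
  and \<open>c\<close>, in which everything belonging to \<open>c1\<close> counts as
  constant.\<close>

lemma siegel_case_B:
  assumes e: "0 < e" "e \<le> 1/100" and c1: "rchar q1 c1" and zero: "Lr c1 (1 - e) = 0" and de: "0 < de" "de \<le> 1"
  obtains C where "C > 0" "\<And>q c. rchar q c \<Longrightarrow> Lr c 1 \<ge> C * real q powr (- (25 * e + de))"
proof -
  let ?be = "1 - e"
  have b: "1 - ?be = e" by simp
  obtain z where z: "\<And>x. x \<ge> 1 \<Longrightarrow> \<bar>wsum ?be (\<lambda>_. 1) x - 1 * x powr (1 - ?be) / (1 - ?be) - z\<bar> \<le> 4 * x powr (- ?be)"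
    using wsum_one[of ?be] e by auto
  define al where "al = Lr c1 1"
  have al: "al > 0" unfolding al_def by (rule Lr_1_pos[OF c1])
  have q1: "real q1 \<ge> 1" using c1 by (simp add: rchar_def Suc_le_eq)
  let ?a1 = "dconv (\<lambda>_. 1) c1"
  define K1 where "K1 = \<bar>1\<bar> * real q1 / (1 - ?be) + \<bar>z\<bar> * real q1 + 4 / ?be + real q1 * (1 / (1 - ?be))"
  define B1 where "B1 = 1 / (1 - ?be) / (1 - ?be)"
  have K1: "K1 \<ge> 0" and B1: "B1 \<ge> 0" using e by (auto simp: K1_def B1_def)
  have s1: "\<bar>wsum ?be ?a1 x - al * x powr (1 - ?be) / (1 - ?be) - 0\<bar> \<le> K1 * x powr (- (2/5))" if x: "x \<ge> 1" for x
  proof -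
    have "\<bar>wsum ?be ?a1 x - 1 * Lr c1 1 * x powr (1 - ?be) / (1 - ?be) - z * Lr c1 ?be\<bar> \<le> K1 * x powr (- (2/5))"
      unfolding K1_def
      by (rule hyperbola_step[where ka = "1 - ?be", OF _ _ _ _ _ _ z wsum_one_le rchar_bounded_sums[OF c1] rchar_abs_le[OF c1]])
         (use x e in auto)
    then show ?thesis using zero by (simp add: al_def)
  qed
  have b1: "wsum ?be (\<lambda>n. \<bar>?a1 n\<bar>) x \<le> B1 * x powr (e + e)" if x: "x \<ge> 1" for x
    using wsum_abs_dconv_le[where be = ?be and ka = e and B = "1 / (1 - ?be)" and a = "\<lambda>_. 1", OF _ _ _ _ rchar_abs_le[OF c1] _ x]
      wsum_one_le[of ?be] e by (simp add: B1_def)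
  define Q where "Q = real q1"
  \<comment> \<open>\<open>T\<close> is the part of the final error constant that is independent of
    \<open>q\<close>; the remaining factor will be \<open>q ^ 2\<close>.\<close>
  define T where "T = al / e * (Q / e) + (al / e + K1 / (2/5) + B1) / (9/50) + Q * (B1 / e) + 1"
  have T: "T \<ge> 1/2" using e al K1 B1 q1 by (simp add: T_def Q_def add_nonneg_nonneg)
  define D where "D = e / 2 * (2 * T) powr (- (25/2 * e)) / (al * (2 / de * Q powr de))"
  have D: "D > 0" using e T al de q1 by (simp add: D_def Q_def)
  obtain C0 where C0: "C0 \<ge> 1" "\<And>x::real. x \<ge> 1 \<Longrightarrow> ln x ^ 1 \<le> C0 * x powr de"
    using ln_power_le_powr[OF de(1)] by blast
  define F where "F = al / (2 ^ card (prime_factors q1) * ((C0 * Q powr de / ln 2) + 1))"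
  have F: "F > 0" unfolding F_def using al C0 q1 by (intro divide_pos_pos mult_pos_pos add_nonneg_pos) auto
  show ?thesis
  proof (rule that[of "min D F"])
    show "min D F > 0" using D F by simp
    fix q c assume c: "rchar q c"
    have q: "real q \<ge> 1" using c by (simp add: rchar_def Suc_le_eq)
    show "Lr c 1 \<ge> min D F * real q powr (- (25 * e + de))"
    proof (cases "(\<lambda>n. complex_of_real (c1 n * c n)) = pchar (q1 * q)")
      case True
      let ?w = "card (prime_factors (q1 * q))"
      have "2 ^ ?w \<le> q1 * q" by (rule card_prime_factors_le) (use q q1 in auto)
      then have "(2::real) ^ ?w \<le> real (q1 * q)" by (metis of_nat_le_iff of_nat_numeral of_nat_power)
      then have "ln ((2::real) ^ ?w) \<le> ln (real (q1 * q))" by (subst ln_le_cancel_iff) (use q q1 in auto)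
      then have "real ?w * ln 2 \<le> ln (real (q1 * q))" by (simp add: ln_realpow)
      also have "\<dots> \<le> C0 * real (q1 * q) powr de" using C0(2)[of "real (q1 * q)"] q q1 mult_mono[of 1 "real q1" 1 "real q"] by simp
      also have "\<dots> = C0 * Q powr de * real q powr de" by (simp add: Q_def powr_mult)
      finally have w: "real ?w \<le> C0 * Q powr de / ln 2 * real q powr de" by (simp add: field_simps)
      have "1 \<le> real q powr de" using q de by (simp add: ge_one_powr_ge_zero)
      then have w': "real ?w + 1 \<le> (C0 * Q powr de / ln 2 + 1) * real q powr de" using w by (simp add: distrib_right)
      have "al / (real ?w + 1) \<le> 2 ^ card (prime_factors q1) * Lr c 1"
        using Lr_1_degenerate[OF c1 c True] by (simp add: al_def)
      moreover have "al / ((C0 * Q powr de / ln 2 + 1) * real q powr de) \<le> al / (real ?w + 1)"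
        using w' al C0 q1 q by (intro divide_left_mono mult_pos_pos) (auto simp: add_nonneg_pos)
      ultimately have "al / ((C0 * Q powr de / ln 2 + 1) * real q powr de) \<le> 2 ^ card (prime_factors q1) * Lr c 1" by linarith
      then have "al / ((C0 * Q powr de / ln 2 + 1) * real q powr de) / 2 ^ card (prime_factors q1) \<le> Lr c 1"
        by (subst pos_divide_le_eq) (simp_all add: mult.commute)
      also have "al / ((C0 * Q powr de / ln 2 + 1) * real q powr de) / 2 ^ card (prime_factors q1) = F * real q powr (- de)"
        by (simp add: F_def powr_minus_divide mult_ac)
      finally have "F * real q powr (- de) \<le> Lr c 1" .
      moreover have "min D F * real q powr (- (25 * e + de)) \<le> F * real q powr (- de)"
        using F D q e by (intro mult_mono powr_mono) auto
      ultimately show ?thesis by linarith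
    next
      case False
      define c2 where "c2 = (\<lambda>n. c1 n * c n)"
      have c2: "rchar (q1 * q) c2" unfolding c2_def by (rule rchar_product[OF c1 c False])
      let ?a2 = "dconv ?a1 c" and ?a3 = "dconv (dconv ?a1 c) c2"
      define K2 where "K2 = \<bar>al\<bar> * real q / (1 - ?be) + \<bar>0\<bar> * real q + K1 / (2/5) + real q * B1"
      \<comment> \<open>The exponents \<open>2/5\<close>, \<open>9/50\<close>, \<open>2/25\<close>
        of the three steps each lie a little below \<open>(et - e) / 2\<close>, where
        \<open>et\<close> is the preceding exponent and \<open>e \<le> 1/100\<close>.\<close>
      have s2: "\<bar>wsum ?be ?a2 x - al * Lr c 1 * x powr (1 - ?be) / (1 - ?be) - 0 * Lr c ?be\<bar> \<le> K2 * x powr (- (9/50))" if x: "x \<ge> 1" for x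
        unfolding K2_def
        by (rule hyperbola_step[where ka = "e + e", OF _ _ _ _ K1 B1 s1 b1 rchar_bounded_sums[OF c] rchar_abs_le[OF c]])
           (use x e in auto)
      then have s2': "\<bar>wsum ?be ?a2 x - (al * Lr c 1) * x powr (1 - ?be) / (1 - ?be) - 0\<bar> \<le> K2 * x powr (- (9/50))" if "x \<ge> 1" for x
        using that by simp
      have b2: "wsum ?be (\<lambda>n. \<bar>?a2 n\<bar>) x \<le> B1 / e * x powr (e + e + e)" if x: "x \<ge> 1" for x
        using wsum_abs_dconv_le[where be = ?be and ka = "e + e" and B = B1 and a = ?a1, OF _ _ _ B1 rchar_abs_le[OF c] b1 x] e by simp
      have K2: "K2 \<ge> 0" using K1 B1 e by (simp add: K2_def)
      define K3 where "K3 = \<bar>al * Lr c 1\<bar> * real (q1 * q) / (1 - ?be) + \<bar>0\<bar> * real (q1 * q) + K2 / (9/50) + real (q1 * q) * (B1 / e)"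
      have s3: "\<bar>wsum ?be ?a3 x - al * Lr c 1 * Lr c2 1 * x powr (1 - ?be) / (1 - ?be) - 0 * Lr c2 ?be\<bar> \<le> K3 * x powr (- (2/25))" if x: "x \<ge> 1" for x
        unfolding K3_def
        by (rule hyperbola_step[where ka = "e + e + e", OF _ _ _ _ K2 _ s2' b2 rchar_bounded_sums[OF c2] rchar_abs_le[OF c2]])
           (use x e B1 in auto)
      have L: "0 < Lr c 1" "Lr c 1 \<le> real q" using Lr_1_pos[OF c] Lr_abs_le[OF _ rchar_bounded_sums[OF c], of 1] by auto
      have qq: "real q \<le> real q ^ 2" "1 \<le> real q ^ 2" using q self_le_power[of "real q" 2] one_le_power[OF q, of 2] by auto
      \<comment> \<open>One factor \<open>q\<close> comes from the modulus of \<open>c2\<close> and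
        the other from the trivial bound \<open>Lr c 1 \<le> q\<close>.\<close>
      have K3: "K3 \<le> T * real q ^ 2"
      proof -
        have "K2 \<le> (al / e + K1 / (2/5) + B1) * real q"
        proof -
          have "K1 / (2/5) * 1 \<le> K1 / (2/5) * real q" using K1 q by (intro mult_left_mono) auto
          then show ?thesis using al by (simp add: K2_def algebra_simps)
        qed
        also have "\<dots> \<le> (al / e + K1 / (2/5) + B1) * real q ^ 2" using al e K1 B1 qq by (intro mult_left_mono) auto
        finally have "K2 / (9/50) \<le> (al / e + K1 / (2/5) + B1) * real q ^ 2 / (9/50)" by (rule divide_right_mono) simp
        then have 2: "K2 / (9/50) \<le> (al / e + K1 / (2/5) + B1) / (9/50) * real q ^ 2" by (simp only: times_divide_eq_left)
        have "al * Lr c 1 * (Q * real q) \<le> al * real q * (Q * real q)" using al L q1 by (intro mult_right_mono mult_left_mono) (auto simp: Q_def)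
        then have "\<bar>al * Lr c 1\<bar> * real (q1 * q) / (1 - ?be) \<le> al * Q / e * real q ^ 2"
          using al L e by (simp add: Q_def power2_eq_square divide_right_mono mult_ac abs_mult)
        also have "\<dots> \<le> al / e * (Q / e) * real q ^ 2"
        proof (intro mult_right_mono)
          have "al * Q / e * 1 \<le> al * Q / e * (1 / e)" using al e q1 by (intro mult_left_mono) (auto simp: Q_def)
          then show "al * Q / e \<le> al / e * (Q / e)" by simp
        qed simp
        finally have 1: "\<bar>al * Lr c 1\<bar> * real (q1 * q) / (1 - ?be) \<le> al / e * (Q / e) * real q ^ 2" .
        have "real (q1 * q) * (B1 / e) \<le> Q * (B1 / e) * real q ^ 2"
          using mult_left_mono[OF qq(1), of "Q * (B1 / e)"] B1 e q1 by (simp add: Q_def mult_ac)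
        note 3 = this
        have "K3 \<le> (al / e * (Q / e) + (al / e + K1 / (2/5) + B1) / (9/50) + Q * (B1 / e)) * real q ^ 2"
          unfolding K3_def distrib_right abs_zero mult_zero_left add_0_right by (intro add_mono 1 2 3)
        also have "\<dots> \<le> T * real q ^ 2" by (intro mult_right_mono) (auto simp: T_def)
        finally show ?thesis .
      qed
      have "1 \<le> (al * Lr c 1 * Lr c2 1) * x powr e / e + (T * real q ^ 2) * x powr (- (2/25))" if x: "x \<ge> 1" for x
      proof -
        have "wsum ?be ?a3 x \<ge> 1"
          by (rule wsum_ge_1[OF _ _ x]) (use quad_dconv_nonneg[OF c1 c] rchar_1[OF c1] rchar_1[OF c] in \<open>auto simp: c2_def dconv_1 simp del: One_nat_def\<close>)
        moreover have "K3 * x powr (- (2/25)) \<le> (T * real q ^ 2) * x powr (- (2/25))" by (intro mult_right_mono K3) simp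
        ultimately show ?thesis using s3[OF x] by (simp add: abs_le_iff)
      qed
      then have "e / 2 * (2 * (T * real q ^ 2)) powr (- (e / (2/25))) \<le> al * Lr c 1 * Lr c2 1"
        by (intro lower_bound_from_sum) (use e T qq mult_mono[of "1/2" T 1 "real q ^ 2"] in auto)
      also have "(2 * (T * real q ^ 2)) powr (- (e / (2/25))) = (2 * T) powr (- (25/2 * e)) * (real q ^ 2) powr (- (25/2 * e))"
      proof -
        have "(2 * (T * real q ^ 2)) powr (- (e / (2/25))) = (2 * T * real q ^ 2) powr (- (25/2 * e))"
          by (rule arg_cong2[where f = "(powr)"]) auto
        then show ?thesis using T q by (subst (asm) powr_mult) auto
      qed
      also have "(real q ^ 2) powr (- (25/2 * e)) = real q powr (- (25 * e))"
      proof -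
        have "real q ^ 2 = real q powr 2" by simp
        then have "(real q ^ 2) powr (- (25/2 * e)) = real q powr (2 * - (25/2 * e))" by (simp only: powr_powr)
        then show ?thesis by simp
      qed
      also have "al * Lr c 1 * Lr c2 1 \<le> al * Lr c 1 * (2 / de * (Q * real q) powr de)"
      proof (intro mult_left_mono)
        have "\<bar>Lr c2 1\<bar> \<le> 2 / de * real (q1 * q) powr de"
          by (rule Lr_1_le[OF de _ rchar_bounded_sums[OF c2] rchar_abs_le[OF c2]]) (use c2 in \<open>simp add: rchar_def Suc_le_eq\<close>)
        then show "Lr c2 1 \<le> 2 / de * (Q * real q) powr de" by (simp add: Q_def)
      qed (use al L in auto)
      also have "\<dots> = Lr c 1 * (al * (2 / de * Q powr de) * real q powr de)" using q by (simp add: powr_mult Q_def)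
      finally have "e / 2 * (2 * T) powr (- (25/2 * e)) * real q powr (- (25 * e)) \<le> Lr c 1 * (al * (2 / de * Q powr de) * real q powr de)"
        by simp
      then have "e / 2 * (2 * T) powr (- (25/2 * e)) * real q powr (- (25 * e)) / (al * (2 / de * Q powr de) * real q powr de) \<le> Lr c 1"
      proof -
        assume "e / 2 * (2 * T) powr (- (25/2 * e)) * real q powr (- (25 * e)) \<le> Lr c 1 * (al * (2 / de * Q powr de) * real q powr de)"
        moreover have "al * (2 / de * Q powr de) * real q powr de > 0" using al de q q1 by (simp add: Q_def)
        ultimately show ?thesis by (simp only: pos_divide_le_eq)
      qed
      also have "e / 2 * (2 * T) powr (- (25/2 * e)) * real q powr (- (25 * e)) / (al * (2 / de * Q powr de) * real q powr de)
        = D * (real q powr (- (25 * e)) * real q powr (- de))"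
        by (simp add: D_def powr_minus_divide)
      also have "real q powr (- (25 * e)) * real q powr (- de) = real q powr (- (25 * e + de))" by (simp flip: powr_add)
      finally have "D * real q powr (- (25 * e + de)) \<le> Lr c 1" .
      moreover have "min D F * real q powr (- (25 * e + de)) \<le> D * real q powr (- (25 * e + de))" by (intro mult_right_mono) auto
      ultimately show ?thesis by linarith
    qed
  qed
qed

text \<open>Which of the two cases occurs is left undecided, and in the second the constant depends
  on an unspecified \<open>q1\<close> and \<open>c1\<close>; this is the source of ineffectivity. A
  negative value at \<open>1 - e0\<close> yields a zero between \<open>1 - e0\<close> and 1, because
  \<open>Lr c1 1\<close> is positive.\<close>

theorem siegel:
  fixes ep :: real
  assumes "ep > 0"
  obtains C where "C > 0" "\<And>q c. rchar q c \<Longrightarrow> Lr c 1 \<ge> C * real q powr (- ep)"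
proof -
  \<comment> \<open>The second case needs \<open>25 * e \<le> ep / 2\<close>; the other half of
    \<open>ep\<close> goes to \<open>de\<close>.\<close>
  define e0 where "e0 = min (ep / 50) (1/100)"
  have e0: "0 < e0" "e0 \<le> 1/100" "e0 \<le> ep / 50" using assms by (auto simp: e0_def)
  have weaken: "C * real q powr (- ep) \<le> C * real q powr (- a)" if "C > 0" "rchar q c" "a \<le> ep" for C a q c
    using that by (intro mult_left_mono powr_mono) (auto simp: rchar_def Suc_le_eq)
  show ?thesis
  proof (cases "\<forall>q c. rchar q c \<longrightarrow> Lr c (1 - e0) \<ge> 0")
    case True
    then obtain C where "C > 0" "\<And>q c. rchar q c \<Longrightarrow> Lr c 1 \<ge> C * real q powr (- (5 / 2 * e0))"
      using siegel_case_A[OF e0(1,2)] by blast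
    note C = this
    show ?thesis
    proof (rule that[OF C(1)])
      fix q c assume c: "rchar q c"
      show "Lr c 1 \<ge> C * real q powr (- ep)"
        by (rule order_trans[OF weaken[OF C(1) c] C(2)[OF c]]) (use e0 assms in simp)
    qed
  next
    case False
    then obtain q1 c1 where c1: "rchar q1 c1" and neg: "Lr c1 (1 - e0) < 0" by (auto simp: not_le)
    have "continuous_on {1 - e0..1} (Lr c1)"
      by (rule continuous_on_subset[OF Lr_continuous[OF c1]]) (use e0 in auto)
    then obtain be where be: "1 - e0 \<le> be" "be \<le> 1" "Lr c1 be = 0"
      using IVT'[of "Lr c1" "1 - e0" 0 1] neg Lr_1_nonneg[OF c1] e0 by auto
    have "be \<noteq> 1" using be(3) Lr_1_pos[OF c1] by auto
    define e where "e = 1 - be"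
    have e: "0 < e" "e \<le> 1/100" "e \<le> ep / 50" "Lr c1 (1 - e) = 0" using be \<open>be \<noteq> 1\<close> e0 by (auto simp: e_def)
    define de where "de = min (ep / 2) 1"
    have de: "0 < de" "de \<le> 1" "de \<le> ep / 2" using assms by (auto simp: de_def)
    obtain C where "C > 0" "\<And>q c. rchar q c \<Longrightarrow> Lr c 1 \<ge> C * real q powr (- (25 * e + de))"
      using siegel_case_B[OF e(1,2) c1 e(4) de(1,2)] by blast
    note C = this
    show ?thesis
    proof (rule that[OF C(1)])
      fix q c assume c: "rchar q c"
      show "Lr c 1 \<ge> C * real q powr (- ep)"
        by (rule order_trans[OF weaken[OF C(1) c] C(2)[OF c]]) (use e de in simp)
    qed
  qed
qed

subsection \<open>Lower bounds for L-functions\<close>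

lemma ds_add:
  assumes a: "\<And>n. norm (a n) \<le> A * ln (real n) ^ i" and b: "\<And>n. norm (b n) \<le> B * ln (real n) ^ j" and s: "Re s > 1"
  shows "ds (\<lambda>n. a n + b n) s = ds a s + ds b s"
  unfolding ds_def distrib_right
  by (rule suminf_add[symmetric]) (rule summable_norm_cancel, rule ds_summable_norm[OF a s] ds_summable_norm[OF b s])+

lemma ds_cmult:
  assumes a: "\<And>n. norm (a n) \<le> A * ln (real n) ^ i" and s: "Re s > 1"
  shows "ds (\<lambda>n. k * a n) s = k * ds a s"
  unfolding ds_def mult.assoc
  by (rule suminf_mult) (rule summable_norm_cancel[OF ds_summable_norm[OF a s]])

lemma ds_norm_le_zeta:
  assumes a: "\<And>n. norm (a n) \<le> 1" and s: "Re s > 1"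
  shows "norm (ds a s) \<le> norm (zeta (of_real (Re s)))"
proof -
  have t: "(1::complex) * of_nat n powr (- of_real (Re s)) = of_real (real n powr (- Re s))" for n
    by (cases "n = 0") (auto simp: powr_of_real[symmetric])
  have sa: "summable (\<lambda>n. norm (a n * of_nat n powr (- s)))"
    by (rule ds_summable_norm[where B = 1 and j = 0]) (use a s in auto)
  have "summable (\<lambda>n. norm ((1::complex) * of_nat n powr (- of_real (Re s))))"
    by (rule ds_summable_norm[where B = 1 and j = 0]) (use s in auto)
  then have s1: "summable (\<lambda>n. real n powr (- Re s))" unfolding t by simp
  have "norm (ds a s) \<le> (\<Sum>n. norm (a n * of_nat n powr (- s)))" unfolding ds_def by (rule summable_norm[OF sa])
  also have "\<dots> \<le> (\<Sum>n. real n powr (- Re s))"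
    by (rule suminf_le[OF _ sa s1]) (use a in \<open>auto simp: norm_mult norm_of_nat_powr mult_left_le_one_le\<close>)
  also have "\<dots> \<le> norm (complex_of_real (\<Sum>n. real n powr (- Re s)))" by simp
  also have "complex_of_real (\<Sum>n. real n powr (- Re s)) = zeta (of_real (Re s))"
    unfolding ds_def t by (rule suminf_of_real[OF s1])
  finally show ?thesis .
qed

lemma powr_mono_base: "0 < a \<Longrightarrow> a \<le> b \<Longrightarrow> 0 \<le> e \<Longrightarrow> a powr e \<le> (b::real) powr e"
  by (intro powr_mono2) auto

lemma zeta_real_bound:
  obtains C where "C \<ge> 1" "\<And>sg. 1 < sg \<Longrightarrow> sg \<le> 2 \<Longrightarrow> norm (zeta (of_real sg)) \<le> C / (sg - 1)"
proof -
  obtain C where C: "C \<ge> 1" "\<And>s. \<lbrakk>1 < Re s; Re s \<le> 2\<rbrakk> \<Longrightarrow>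
     norm (ds (\<lambda>n. of_real (ln (real n) ^ 0)) s - fact 0 / (s - 1) ^ Suc 0) \<le> C * ht s powr (1/2)"
    using ds_log_minus_pole[of "1/2" 0] by auto
  show ?thesis
  proof (rule that[of "1 + C * 2 powr (1/2)"])
    show "1 + C * 2 powr (1/2) \<ge> 1" using C by simp
    fix sg :: real assume sg: "1 < sg" "sg \<le> 2"
    have "norm (zeta (of_real sg) - 1 / (of_real sg - 1)) \<le> C * 2 powr (1/2)"
      using C(2)[of "of_real sg"] sg by simp
    then have "norm (zeta (of_real sg)) \<le> norm (1 / (complex_of_real sg - 1)) + C * 2 powr (1/2)"
      using norm_triangle_ineq2[of "zeta (of_real sg)" "1 / (complex_of_real sg - 1)"] by linarith
    also have "norm (1 / (complex_of_real sg - 1)) = 1 / (sg - 1)"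
    proof -
      have "1 / (complex_of_real sg - 1) = of_real (1 / (sg - 1))" by simp
      then show ?thesis using sg by (simp only: norm_of_real) simp
    qed
    also have "C * 2 powr (1/2) \<le> C * 2 powr (1/2) / (sg - 1)" using sg C by (simp add: field_simps mult_left_le)
    finally show "norm (zeta (of_real sg)) \<le> (1 + C * 2 powr (1/2)) / (sg - 1)" by (simp add: add_divide_distrib)
  qed
qed

text \<open>From \<open>1 + et\<close> on, the 3-4-1 inequality gives a lower bound
  \<open>2 * et * D\<close>. Moving from there to a point nearer to the line changes
  \<open>ds X\<close> by at most \<open>et * D\<close>, so half of the bound survives all the way to
  \<open>Re s = 1\<close>.\<close>

lemma lower_bound_341:
  fixes X :: "nat \<Rightarrow> complex"
  assumes mult: "\<And>m n. X (m * n) = X m * X n" and X1: "X 1 = 1" and v: "\<And>n. X n = 0 \<or> norm (X n) = 1"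
    and C: "C \<ge> 1" "\<And>sg. 1 < sg \<Longrightarrow> sg \<le> 2 \<Longrightarrow> norm (zeta (of_real sg)) \<le> C / (sg - 1)"
    and M: "M \<ge> 1" "\<And>sg. 1 < sg \<Longrightarrow> sg \<le> 2 \<Longrightarrow> norm (ds (\<lambda>n. X n ^ 2) (Complex sg (2 * t))) \<le> M"
    and D: "D \<ge> 1" "\<And>sg. 1 < sg \<Longrightarrow> sg \<le> 2 \<Longrightarrow> norm (ds (\<lambda>n. X n * of_real (ln (real n))) (Complex sg t)) \<le> D"
    and sg: "1 < sg" "sg \<le> 2"
  shows "norm (ds X (Complex sg t)) \<ge> 1 / (16 * C ^ 3 * D ^ 3 * M)"
proof -
  \<comment> \<open>Solves \<open>et ^ 3 / (C ^ 3 * M) = (2 * et * D) ^ 4\<close>; the left-hand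
    side is what the 3-4-1 inequality yields for the fourth power at \<open>1 + et\<close>.\<close>
  define et where "et = 1 / (16 * D ^ 4 * C ^ 3 * M)"
  have et: "0 < et" "et \<le> 1/16"
  proof -
    have "1 \<le> D ^ 4 * C ^ 3 * M" using C D M by (simp add: one_le_mult_iff mult_ge1_I one_le_power)
    then have "16 * 1 \<le> 16 * (D ^ 4 * C ^ 3 * M)" by (intro mult_left_mono) auto
    then show "0 < et" "et \<le> 1/16" unfolding et_def by (auto simp: field_simps mult.assoc)
  qed
  have big: "norm (ds X (Complex sg t)) \<ge> 2 * et * D" if s: "1 + et \<le> sg" "sg \<le> 2" for sg
  proof -
    have s1: "1 < sg" using s et by simp
    have "1 \<le> norm (zeta (of_real sg)) ^ 3 * norm (ds X (Complex sg t)) ^ 4 * norm (ds (\<lambda>n. X n ^ 2) (Complex sg (2 * t)))"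
      by (rule three_four_one[OF mult X1 v s1])
    also have "\<dots> \<le> (C / et) ^ 3 * norm (ds X (Complex sg t)) ^ 4 * M"
    proof (intro mult_mono power_mono M(2)[OF s1 s(2)])
      show "norm (zeta (of_real sg)) \<le> C / et"
        by (rule order_trans[OF C(2)[OF s1 s(2)]]) (use s et C in \<open>auto intro!: divide_left_mono\<close>)
    qed (use C et M in auto)
    finally have "et ^ 3 / (C ^ 3 * M) \<le> norm (ds X (Complex sg t)) ^ 4"
      using C M et by (simp add: power_divide field_simps)
    moreover have "(2 * et * D) ^ 4 = et ^ 3 / (C ^ 3 * M)"
    proof -
      have "(2 * et * D) ^ 4 = et ^ 3 * (16 * et * D ^ 4)" by (simp add: power_mult_distrib eval_nat_numeral)
      also have "16 * et * D ^ 4 = 1 / (C ^ 3 * M)" using D by (simp add: et_def)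
      finally show ?thesis by simp
    qed
    ultimately have "(2 * et * D) ^ 4 \<le> norm (ds X (Complex sg t)) ^ 4" by simp
    then show ?thesis by (rule power_le_imp_le_base[of _ 3, simplified]) simp
  qed
  have X1b: "norm (X n) \<le> 1" for n using v[of n] by auto
  have "norm (ds X (Complex sg t)) \<ge> et * D"
  proof (cases "1 + et \<le> sg")
    case True
    have "et * D \<le> 2 * et * D" using et D by simp
    then show ?thesis using big[OF True sg(2)] by linarith
  next
    case False
    let ?S = "closed_segment (Complex sg t) (Complex (1 + et) t)"
    have seg: "Im z = t \<and> 1 < Re z \<and> Re z \<le> 2" if zS: "z \<in> ?S" for z
    proof -
      obtain u where u: "0 \<le> u" "u \<le> 1" "z = (1 - u) *\<^sub>R Complex sg t + u *\<^sub>R Complex (1 + et) t"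
        using zS by (auto simp: in_segment)
      have "Re z = sg + u * (1 + et - sg)" "Im z = t" unfolding u(3) by (simp_all add: algebra_simps)
      moreover have "0 \<le> u * (1 + et - sg)" "u * (1 + et - sg) \<le> 1 * (1 + et - sg)"
        using u False by (auto intro!: mult_right_mono)
      ultimately show ?thesis using sg et by simp
    qed
    have "norm (ds X (Complex sg t) - ds X (Complex (1 + et) t)) \<le> D * norm (Complex sg t - Complex (1 + et) t)"
    proof (rule field_differentiable_bound[of ?S _ "\<lambda>z. - ds (\<lambda>n. X n * of_real (ln (real n))) z"])
      fix z assume z: "z \<in> ?S"
      show "(ds X has_field_derivative - ds (\<lambda>n. X n * of_real (ln (real n))) z) (at z within ?S)"
        by (rule has_field_derivative_at_within, rule ds_has_field_derivative[where B = 1 and j = 0])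
           (use seg[OF z] X1b in auto)
      have "z = Complex (Re z) t" using seg[OF z] by (simp add: complex_eq_iff)
      then show "norm (- ds (\<lambda>n. X n * of_real (ln (real n))) z) \<le> D" using D(2)[of "Re z"] seg[OF z] by simp
    qed auto
    also have "norm (Complex sg t - Complex (1 + et) t) = 1 + et - sg"
    proof -
      have "Complex sg t - Complex (1 + et) t = complex_of_real (sg - (1 + et))" by (simp add: complex_eq_iff)
      then show ?thesis using False by (simp only: norm_of_real)
    qed
    also have "D * (1 + et - sg) \<le> D * et" using D sg by (intro mult_left_mono) auto
    finally have "norm (ds X (Complex (1 + et) t)) - D * et \<le> norm (ds X (Complex sg t))"
      using norm_triangle_ineq2[of "ds X (Complex (1 + et) t)" "ds X (Complex sg t)"] by (simp add: norm_minus_commute)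
    then show ?thesis using big[of "1 + et"] et by (simp add: mult.commute)
  qed
  moreover have "et * D = 1 / (16 * C ^ 3 * D ^ 3 * M)" using D by (simp add: et_def eval_nat_numeral)
  ultimately show ?thesis by simp
qed

text \<open>The series at \<open>2 * t\<close> is bounded by zeta as well, and the fourth root of
  the 3-4-1 inequality becomes a bound by the inverse of zeta. It holds at every height, at distance
  \<open>et\<close> from the line.\<close>

lemma lower_bound_far:
  fixes X :: "nat \<Rightarrow> complex"
  assumes mult: "\<And>m n. X (m * n) = X m * X n" and X1: "X 1 = 1" and v: "\<And>n. X n = 0 \<or> norm (X n) = 1"
    and C: "C \<ge> 1" "\<And>sg. 1 < sg \<Longrightarrow> sg \<le> 2 \<Longrightarrow> norm (zeta (of_real sg)) \<le> C / (sg - 1)"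
    and sg: "1 + et \<le> sg" "sg \<le> 2" "et > 0"
  shows "norm (ds X (Complex sg t)) \<ge> et / C"
proof -
  have s1: "1 < sg" using sg by simp
  let ?Z = "norm (zeta (of_real sg))"
  have Z: "?Z \<le> C / et"
    by (rule order_trans[OF C(2)[OF s1 sg(2)]]) (use sg C in \<open>auto intro!: divide_left_mono\<close>)
  have n2: "norm (X n ^ 2) \<le> 1" for n using v[of n] by (auto simp: norm_power)
  have "1 \<le> ?Z ^ 3 * norm (ds X (Complex sg t)) ^ 4 * norm (ds (\<lambda>n. X n ^ 2) (Complex sg (2 * t)))"
    by (rule three_four_one[OF mult X1 v s1])
  also have "\<dots> \<le> (C / et) ^ 3 * norm (ds X (Complex sg t)) ^ 4 * (C / et)"
  proof (intro mult_mono power_mono Z)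
    show "norm (ds (\<lambda>n. X n ^ 2) (Complex sg (2 * t))) \<le> C / et"
      using ds_norm_le_zeta[where a = "\<lambda>n. X n ^ 2", OF n2, of "Complex sg (2 * t)"] s1 Z by simp
  qed (use C sg in auto)
  also have "\<dots> = ((C / et) * norm (ds X (Complex sg t))) ^ 4"
  proof -
    have "a ^ 3 * b ^ 4 * a = (a * b) ^ 4" for a b :: real
      by (simp add: power_mult_distrib power3_eq_cube power4_eq_xxxx mult_ac)
    then show ?thesis .
  qed
  finally have "1 ^ 4 \<le> ((C / et) * norm (ds X (Complex sg t))) ^ 4" by simp
  then have "1 \<le> (C / et) * norm (ds X (Complex sg t))"
    by (rule power_le_imp_le_base[of _ 3, simplified]) (use C sg in auto)
  then show ?thesis using C sg by (simp add: field_simps)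
qed

lemma zeta_bounds:
  fixes ep :: real and j :: nat
  assumes ep: "ep > 0" "ep \<le> 1/2"
  obtains C where "C \<ge> 1" "\<And>s. \<lbrakk>1 < Re s; Re s \<le> 2\<rbrakk> \<Longrightarrow>
     norm (ds (\<lambda>n. of_real (ln (real n) ^ j)) s) \<le> fact j / norm (s - 1) ^ Suc j + C * ht s powr ep"
proof -
  obtain C where C: "C \<ge> 1" "\<And>s. \<lbrakk>1 < Re s; Re s \<le> 2\<rbrakk> \<Longrightarrow>
     norm (ds (\<lambda>n. of_real (ln (real n) ^ j)) s - fact j / (s - 1) ^ Suc j) \<le> C * ht s powr ep"
    using ds_log_minus_pole[OF ep, of j] by blast
  show ?thesis
  proof (rule that[OF C(1)])
    fix s assume s: "1 < Re s" "Re s \<le> 2"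
    have "norm (fact j / (s - 1) ^ Suc j) = fact j / norm (s - 1) ^ Suc j" by (simp add: norm_divide norm_power norm_mult)
    then show "norm (ds (\<lambda>n. of_real (ln (real n) ^ j)) s) \<le> fact j / norm (s - 1) ^ Suc j + C * ht s powr ep"
      using C(2)[OF s] norm_triangle_ineq2[of "ds (\<lambda>n. of_real (ln (real n) ^ j)) s" "fact j / (s - 1) ^ Suc j"] by linarith
  qed
qed

text \<open>The principal character differs from the constant \<open>totient q / q\<close> by a
  periodic sequence of mean value 0, to which the bound for oscillating coefficients applies. This
  keeps the estimate uniform in \<open>q\<close>, with no product over the primes dividing
  \<open>q\<close>.\<close>

lemma pchar_bound:
  fixes ep :: real
  assumes ep: "ep > 0" "ep \<le> 1/2"
  obtains C where "C \<ge> 1" "\<And>q s. \<lbrakk>q > 0; 1 < Re s; Re s \<le> 2\<rbrakk> \<Longrightarrow>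
     norm (ds (pchar q) s) \<le> 1 / norm (s - 1) + C * (real q * ht s) powr ep"
proof -
  obtain C1 where C1: "C1 \<ge> 1" "\<And>s. \<lbrakk>1 < Re s; Re s \<le> 2\<rbrakk> \<Longrightarrow>
     norm (ds (\<lambda>n. of_real (ln (real n) ^ 0)) s) \<le> fact 0 / norm (s - 1) ^ Suc 0 + C1 * ht s powr ep"
    using zeta_bounds[OF ep, of 0] by blast
  obtain C2 where C2: "C2 \<ge> 1" "\<And>c q s. \<lbrakk>q \<ge> 1; \<And>n. norm (c n) \<le> 1; \<And>M N. norm (\<Sum>n\<in>{M<..N}. c n) \<le> q; 1 < Re s; Re s \<le> 2\<rbrakk> \<Longrightarrow>
     norm (ds (\<lambda>n. c n * of_real (ln (real n) ^ 0)) s) \<le> C2 * (q * ht s) powr ep"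
    using ds_log_bounded_sums[OF ep, of 0] by blast
  show ?thesis
  proof (rule that[of "C1 + C2"])
    show "C1 + C2 \<ge> 1" using C1 C2 by simp
    fix q :: nat and s :: complex assume q: "q > 0" and s: "1 < Re s" "Re s \<le> 2"
    define r where "r = real (totient q) / real q"
    have r: "0 \<le> r" "r \<le> 1" using q totient_le[of q] by (auto simp: r_def)
    define c where "c = (\<lambda>n. pchar q n - of_real r)"
    have c1: "norm (c n) \<le> 1" for n
    proof -
      have "c n = of_real ((if coprime n q then 1 else 0) - r)" by (simp add: c_def pchar_def)
      then have "norm (c n) = \<bar>(if coprime n q then 1 else 0) - r\<bar>" by (simp only: norm_of_real)
      then show ?thesis using r by auto
    qed
    have cq: "norm (\<Sum>n\<in>{M<..N}. c n) \<le> real q" for M N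
    proof (rule periodic_sum_zero_bounded[OF q _ c1])
      show "c (n + q) = c n" for n
        using dchar_mod[OF pchar_dchar[OF q], of "n + q"] dchar_mod[OF pchar_dchar[OF q], of n] by (simp add: c_def)
      show "(\<Sum>n<q. c n) = 0" using sum_pchar[OF q] q by (simp add: c_def sum_subtractf r_def)
    qed
    have "ds (pchar q) s = ds (\<lambda>n. c n + of_real r * 1) s" by (simp add: c_def)
    also have "\<dots> = ds c s + ds (\<lambda>n. of_real r * 1) s"
      by (rule ds_add[where A = 1 and i = 0 and B = r and j = 0]) (use c1 r s in auto)
    also have "ds (\<lambda>n. of_real r * 1) s = of_real r * zeta s"
      by (rule ds_cmult[where A = 1 and i = 0]) (use s in auto)
    finally have "norm (ds (pchar q) s) \<le> norm (ds c s) + r * norm (zeta s)"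
      using norm_triangle_ineq[of "ds c s" "of_real r * zeta s"] r by (simp add: norm_mult)
    also have "norm (ds c s) \<le> C2 * (real q * ht s) powr ep"
      using C2(2)[of "real q" c s] q c1 cq s by simp
    also have "r * norm (zeta s) \<le> 1 * norm (zeta s)" using r by (intro mult_right_mono) auto
    also have "norm (zeta s) \<le> 1 / norm (s - 1) + C1 * ht s powr ep" using C1(2)[OF s] by simp
    also have "ht s powr ep \<le> (real q * ht s) powr ep"
    proof (rule powr_mono_base)
      show "\<bar>Im s\<bar> + 2 \<le> real q * ht s" using q mult_right_mono[of 1 "real q" "\<bar>Im s\<bar> + 2"] by simp
    qed (use ep in auto)
    finally show "norm (ds (pchar q) s) \<le> 1 / norm (s - 1) + (C1 + C2) * (real q * ht s) powr ep"
      using C1 by (simp add: algebra_simps)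
  qed
qed

lemma real_dchar:
  assumes q: "q > 0" and X: "dchar q X" "X \<noteq> pchar q" and sq: "(\<lambda>n. X n ^ 2) = pchar q"
  obtains c where "rchar q c" "X = (\<lambda>n. complex_of_real (c n))"
proof -
  have "X n = of_real (Re (X n))" for n
  proof -
    have "X n ^ 2 = 0 \<or> X n ^ 2 = 1" using fun_cong[OF sq, of n] by (auto simp: pchar_def)
    then have "X n = 0 \<or> X n = 1 \<or> X n = -1" by (auto simp: power2_eq_1_iff)
    then show ?thesis by auto
  qed
  then have eq: "X = (\<lambda>n. complex_of_real (Re (X n)))" by auto
  show ?thesis by (rule that[OF _ eq]) (use q X eq in \<open>auto simp: rchar_def\<close>)
qed

text \<open>The mean value inequality is applied between \<open>s\<close> and \<open>sg > 1\<close>,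
  and then \<open>sg\<close> tends to 1: the value at 1 is available only as the conditionally
  convergent \<open>Lr c 1\<close>.\<close>

lemma real_L_near_1:
  assumes c: "rchar q c" and C: "C \<ge> 0"
    and D: "\<And>s. \<lbrakk>1 < Re s; Re s \<le> 2; \<bar>Im s\<bar> \<le> 1\<rbrakk> \<Longrightarrow> norm (ds (\<lambda>n. complex_of_real (c n) * of_real (ln (real n))) s) \<le> C"
    and s: "1 < Re s" "Re s \<le> 2" "\<bar>Im s\<bar> \<le> 1"
  shows "norm (ds (\<lambda>n. complex_of_real (c n)) s) \<ge> Lr c 1 - C * norm (s - 1)"
proof -
  let ?L = "ds (\<lambda>n. complex_of_real (c n))"
  let ?S = "{z. 1 < Re z} \<inter> {z. Re z \<le> 2} \<inter> ({z. Im z \<le> 1} \<inter> {z. Im z \<ge> -1})"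
  have conv: "convex ?S"
    by (intro convex_Int convex_halfspace_Re_gt convex_halfspace_Re_le convex_halfspace_Im_le convex_halfspace_Im_ge)
  have b: "Lr c sg \<le> norm (?L s) + C * norm (s - of_real sg)" if sg: "1 < sg" "sg \<le> 2" for sg
  proof -
    have "norm (?L s - ?L (of_real sg)) \<le> C * norm (s - of_real sg)"
    proof (rule field_differentiable_bound[OF conv])
      fix z assume z: "z \<in> ?S"
      show "(?L has_field_derivative - ds (\<lambda>n. complex_of_real (c n) * of_real (ln (real n))) z) (at z within ?S)"
        by (rule has_field_derivative_at_within, rule ds_has_field_derivative[where B = 1 and j = 0])
           (use z rchar_abs_le[OF c] in auto)
      show "norm (- ds (\<lambda>n. complex_of_real (c n) * of_real (ln (real n))) z) \<le> C" using D[of z] z by auto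
    qed (use s sg in auto)
    moreover have "norm (?L (of_real sg)) = \<bar>Lr c sg\<bar>" using ds_real[OF rchar_abs_le[OF c] sg(1)] by simp
    ultimately show ?thesis using norm_triangle_ineq2[of "?L (of_real sg)" "?L s"] by (simp add: norm_minus_commute)
  qed
  have "Lr c 1 \<le> norm (?L s) + C * norm (s - of_real 1)"
  proof (rule tendsto_le[OF _ _ Lr_tendsto_1[OF c]])
    show "((\<lambda>sg. norm (?L s) + C * norm (s - of_real sg)) \<longlongrightarrow> norm (?L s) + C * norm (s - of_real 1)) (at_right 1)"
      by (intro tendsto_intros)
    have "\<forall>\<^sub>F sg in at_right 1. sg \<in> {1<..<2::real}" by (rule eventually_at_right_real) simp
    then show "\<forall>\<^sub>F sg in at_right 1. Lr c sg \<le> norm (?L s) + C * norm (s - of_real sg)"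
      by eventually_elim (use b in auto)
  qed simp
  then show ?thesis by simp
qed

text \<open>The series of \<open>X^2\<close> at \<open>2 t\<close>, which the 3-4-1 inequality has
  to bound, can be large only if \<open>X\<close> is real and \<open>t\<close> is small. For such
  \<open>s\<close> the bound by zeta is enough unless \<open>s\<close> is within about
  \<open>q^(-2 de)\<close> of 1, and there Siegel's theorem takes over: the derivative is too small
  to use up more than half of its bound.\<close>

theorem L_lower_bound:
  fixes ep :: real
  assumes ep: "ep > 0" "ep \<le> 1/2"
  obtains K where "K > 0" "\<And>q X s. \<lbrakk>q > 0; dchar q X; X \<noteq> pchar q; 1 < Re s; Re s \<le> 2\<rbrakk> \<Longrightarrow>
     norm (ds X s) \<ge> K * (real q * ht s) powr (- ep)"
proof -
  \<comment> \<open>In the bound \<open>D\<close> enters cubed with exponent \<open>de\<close>, and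
    \<open>M\<close> with exponent \<open>2 * de\<close>, together \<open>5 * de\<close>.\<close>
  define de where "de = ep / 5"
  have de: "de > 0" "de \<le> 1/2" using ep by (auto simp: de_def)
  obtain C where C: "C \<ge> 1" "\<And>sg. 1 < sg \<Longrightarrow> sg \<le> 2 \<Longrightarrow> norm (zeta (of_real sg)) \<le> C / (sg - 1)"
    using zeta_real_bound by blast
  obtain C0 where C0: "C0 \<ge> 1" "\<And>c q s. \<lbrakk>q \<ge> 1; \<And>n. norm (c n) \<le> 1; \<And>M N. norm (\<Sum>n\<in>{M<..N}. c n) \<le> q; 1 < Re s; Re s \<le> 2\<rbrakk> \<Longrightarrow>
     norm (ds (\<lambda>n. c n * of_real (ln (real n) ^ 0)) s) \<le> C0 * (q * ht s) powr de"
    using ds_log_bounded_sums[OF de, of 0] by blast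
  obtain C1 where C1: "C1 \<ge> 1" "\<And>c q s. \<lbrakk>q \<ge> 1; \<And>n. norm (c n) \<le> 1; \<And>M N. norm (\<Sum>n\<in>{M<..N}. c n) \<le> q; 1 < Re s; Re s \<le> 2\<rbrakk> \<Longrightarrow>
     norm (ds (\<lambda>n. c n * of_real (ln (real n) ^ 1)) s) \<le> C1 * (q * ht s) powr de"
    using ds_log_bounded_sums[OF de, of 1] by blast
  obtain Cp where Cp: "Cp \<ge> 1" "\<And>q s. \<lbrakk>q > 0; 1 < Re s; Re s \<le> 2\<rbrakk> \<Longrightarrow>
     norm (ds (pchar q) s) \<le> 1 / norm (s - 1) + Cp * (real q * ht s) powr de"
    using pchar_bound[OF de] by blast
  obtain Cs where Cs: "Cs > 0" "\<And>q c. rchar q c \<Longrightarrow> Lr c 1 \<ge> Cs * real q powr (- de)"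
    using siegel[OF de(1)] by blast
  define Cs' where "Cs' = min Cs 1"
  have Cs': "Cs' > 0" "Cs' \<le> 1" "\<And>q c. rchar q c \<Longrightarrow> Lr c 1 \<ge> Cs' * real q powr (- de)"
  proof -
    show "Cs' > 0" "Cs' \<le> 1" using Cs by (auto simp: Cs'_def)
    fix q c assume c: "rchar q c"
    have "Cs' * real q powr (- de) \<le> Cs * real q powr (- de)" by (intro mult_right_mono) (auto simp: Cs'_def)
    then show "Lr c 1 \<ge> Cs' * real q powr (- de)" using Cs(2)[OF c] by linarith
  qed
  \<comment> \<open>Within distance \<open>2 * ta\<close> of 1 the change is at most
    \<open>C1 * (3 * q^de) * (2 * ta)\<close>; this \<open>k\<close> makes it half of Siegel's
    bound.\<close>
  define k where "k = Cs' / (12 * C1)"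
  have k: "k > 0" "k \<le> 1/12" using Cs' C1 by (auto simp: k_def field_simps)
  define Mc where "Mc = 2 * C0 + 1 / k + 2 * Cp"
  have "1 / k \<ge> 0" using k by simp
  then have Mc: "Mc \<ge> 1" using C0(1) Cp(1) unfolding Mc_def by linarith
  define K where "K = min (1 / (16 * C ^ 3 * C1 ^ 3 * Mc)) (min (k / C) (Cs' / 2))"
  have K: "K > 0" using C C1 Mc k Cs' by (auto simp: K_def)
  show ?thesis
  proof (rule that[OF K])
    fix q X s assume q: "q > 0" and X: "dchar q X" "X \<noteq> pchar q" and s: "1 < Re s" "Re s \<le> 2"
    define t where "t = Im s"
    define Q where "Q = real q * (\<bar>t\<bar> + 2)"
    have q1: "real q \<ge> 1" using q by simp
    have Q: "Q \<ge> 1" "real q \<le> Q" using mult_mono[of 1 "real q" 1 "\<bar>t\<bar> + 2"] mult_left_mono[of 1 "\<bar>t\<bar> + 2" "real q"] q1 by (auto simp: Q_def)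
    have Qe: "Q powr (- ep) \<le> Q powr (- a)" if "a \<le> ep" for a using Q that by (intro powr_mono) auto
    have se: "s = Complex (Re s) t" by (simp add: t_def complex_eq_iff)
    have mult: "\<And>m n. X (m * n) = X m * X n" and X1: "X 1 = 1" using X by (auto simp: dchar_def)
    note v = dchar_norm[OF q X(1)] and bd = dchar_norm_le[OF q X(1)]
    have D: "norm (ds (\<lambda>n. X n * of_real (ln (real n))) (Complex sg u)) \<le> C1 * (real q * (\<bar>u\<bar> + 2)) powr de" if "1 < sg" "sg \<le> 2" for sg u
      using C1(2)[of "real q" X "Complex sg u", OF q1 bd dchar_bounded_sums[OF q X]] that by simp
    have Q2: "(real q * (\<bar>2 * t\<bar> + 2)) powr de \<le> 2 * Q powr de"
    proof -
      have "(real q * (\<bar>2 * t\<bar> + 2)) powr de \<le> (2 * Q) powr de"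
      proof (rule powr_mono_base)
        show "0 < real q * (\<bar>2 * t\<bar> + 2)" using q1 by (intro mult_pos_pos) auto
        have "real q * (\<bar>2 * t\<bar> + 2) \<le> real q * (2 * (\<bar>t\<bar> + 2))" using q1 by (intro mult_left_mono) auto
        then show "real q * (\<bar>2 * t\<bar> + 2) \<le> 2 * Q" unfolding Q_def by (simp only: mult.left_commute)
      qed (use de in simp)
      also have "\<dots> = 2 powr de * Q powr de" using Q by (simp add: powr_mult)
      also have "2 powr de \<le> 2 powr (1::real)" using de by (intro powr_mono) auto
      finally show ?thesis by (simp add: mult_right_mono)
    qed
    have gen: "norm (ds X s) \<ge> K * Q powr (- ep)"
      if M: "\<And>sg. 1 < sg \<Longrightarrow> sg \<le> 2 \<Longrightarrow> norm (ds (\<lambda>n. X n ^ 2) (Complex sg (2 * t))) \<le> Mc * Q powr (2 * de)"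
    proof -
      have "norm (ds X (Complex (Re s) t)) \<ge> 1 / (16 * C ^ 3 * (C1 * Q powr de) ^ 3 * (Mc * Q powr (2 * de)))"
      proof (rule lower_bound_341[OF mult X1 v C _ M _ _ s])
        show "1 \<le> Mc * Q powr (2 * de)" using Mc Q de mult_mono[of 1 Mc 1 "Q powr (2 * de)"] by (simp add: ge_one_powr_ge_zero)
        show "1 \<le> C1 * Q powr de" using C1 Q de mult_mono[of 1 C1 1 "Q powr de"] by (simp add: ge_one_powr_ge_zero)
        show "norm (ds (\<lambda>n. X n * of_real (ln (real n))) (Complex sg t)) \<le> C1 * Q powr de" if "1 < sg" "sg \<le> 2" for sg
          using D[OF that, of t] by (simp add: Q_def)
      qed
      also have "1 / (16 * C ^ 3 * (C1 * Q powr de) ^ 3 * (Mc * Q powr (2 * de))) = 1 / (16 * C ^ 3 * C1 ^ 3 * Mc) * Q powr (- ep)"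
      proof -
        have "(Q powr de) ^ 3 * Q powr (2 * de) = Q powr ep"
          using Q by (simp add: de_def powr_power flip: powr_add)
        then have "16 * C ^ 3 * (C1 * Q powr de) ^ 3 * (Mc * Q powr (2 * de)) = 16 * C ^ 3 * C1 ^ 3 * Mc * Q powr ep"
          by (simp add: power_mult_distrib mult_ac)
        then show ?thesis by (simp add: powr_minus_divide)
      qed
      finally have "1 / (16 * C ^ 3 * C1 ^ 3 * Mc) * Q powr (- ep) \<le> norm (ds X s)" unfolding se[symmetric] .
      moreover have "K * Q powr (- ep) \<le> 1 / (16 * C ^ 3 * C1 ^ 3 * Mc) * Q powr (- ep)"
        by (intro mult_right_mono) (auto simp: K_def)
      ultimately show ?thesis by linarith
    qed
    have Q12: "Q powr de \<le> Q powr (2 * de)" using Q de by (intro powr_mono) auto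
    have "norm (ds X s) \<ge> K * Q powr (- ep)"
    proof (cases "(\<lambda>n. X n ^ 2) = pchar q")
      case False
      have X2: "dchar q (\<lambda>n. X n ^ 2)" using dchar_mult[OF X(1) X(1)] by (simp add: power2_eq_square)
      show ?thesis
      proof (rule gen)
        fix sg :: real assume sg: "1 < sg" "sg \<le> 2"
        have "norm (ds (\<lambda>n. X n ^ 2) (Complex sg (2 * t))) \<le> C0 * (real q * (\<bar>2 * t\<bar> + 2)) powr de"
          using C0(2)[of "real q" "\<lambda>n. X n ^ 2" "Complex sg (2 * t)", OF q1 dchar_norm_le[OF q X2] dchar_bounded_sums[OF q X2 False]] sg by simp
        also have "\<dots> \<le> C0 * (2 * Q powr de)" using C0 Q2 by (intro mult_left_mono) auto
        also have "\<dots> \<le> C0 * (2 * Q powr (2 * de))" using C0 Q12 by (intro mult_left_mono) auto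
        also have "\<dots> = (2 * C0) * Q powr (2 * de)" by simp
        also have "\<dots> \<le> Mc * Q powr (2 * de)" using k Cp by (intro mult_right_mono) (auto simp: Mc_def)
        finally show "norm (ds (\<lambda>n. X n ^ 2) (Complex sg (2 * t))) \<le> Mc * Q powr (2 * de)" .
      qed
    next
      case True
      define ta where "ta = k * real q powr (- (2 * de))"
      have qd: "real q powr (- (2 * de)) \<le> 1" using q1 de powr_mono[of "- (2 * de)" 0 "real q"] by simp
      have ta: "ta > 0" "ta \<le> 1/12" using k q1 qd mult_mono[of k "1/12" "real q powr (- (2 * de))" 1] by (auto simp: ta_def)
      show ?thesis
      proof (cases "\<bar>t\<bar> \<ge> ta")
        case big: True
        show ?thesis
        proof (rule gen)
          fix sg :: real assume sg: "1 < sg" "sg \<le> 2"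
          have "norm (ds (\<lambda>n. X n ^ 2) (Complex sg (2 * t))) \<le> 1 / norm (Complex sg (2 * t) - 1) + Cp * (real q * (\<bar>2 * t\<bar> + 2)) powr de"
            using Cp(2)[OF q, of "Complex sg (2 * t)"] sg unfolding True by simp
          also have "1 / norm (Complex sg (2 * t) - 1) \<le> 1 / ta"
          proof (intro divide_left_mono)
            have "\<bar>Im (Complex sg (2 * t) - 1)\<bar> \<le> norm (Complex sg (2 * t) - 1)" by (rule abs_Im_le_cmod)
            then show "ta \<le> norm (Complex sg (2 * t) - 1)" using big ta by simp
            then show "0 < norm (Complex sg (2 * t) - 1) * ta" using ta by (intro mult_pos_pos) linarith+
          qed simp
          also have "1 / ta = 1 / k * real q powr (2 * de)" by (simp add: ta_def powr_minus_divide)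
          also have "\<dots> \<le> 1 / k * Q powr (2 * de)" using k Q q1 de by (intro mult_left_mono powr_mono_base) auto
          also have "Cp * (real q * (\<bar>2 * t\<bar> + 2)) powr de \<le> Cp * (2 * Q powr (2 * de))"
            using Cp Q2 Q12 by (intro mult_left_mono) auto
          finally have "norm (ds (\<lambda>n. X n ^ 2) (Complex sg (2 * t))) \<le> (1 / k + 2 * Cp) * Q powr (2 * de)"
            by (simp add: algebra_simps)
          also have "\<dots> \<le> Mc * Q powr (2 * de)" using C0 by (intro mult_right_mono) (auto simp: Mc_def)
          finally show "norm (ds (\<lambda>n. X n ^ 2) (Complex sg (2 * t))) \<le> Mc * Q powr (2 * de)" .
        qed
      next
        case small: False
        obtain c where c: "rchar q c" "X = (\<lambda>n. complex_of_real (c n))" by (rule real_dchar[OF q X True])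
        show ?thesis
        proof (cases "1 + ta \<le> Re s")
          case far: True
          have "norm (ds X (Complex (Re s) t)) \<ge> ta / C" by (rule lower_bound_far[OF mult X1 v C far s(2) ta(1)])
          then have "k / C * real q powr (- (2 * de)) \<le> norm (ds X s)" unfolding se[symmetric] by (simp add: ta_def)
          moreover have "k / C * Q powr (- (2 * de)) \<le> k / C * real q powr (- (2 * de))"
            using k C q1 Q de by (intro mult_left_mono powr_mono2') auto
          moreover have "K * Q powr (- ep) \<le> k / C * Q powr (- (2 * de))"
            using k C de ep by (intro mult_mono Qe) (auto simp: K_def de_def)
          ultimately show ?thesis by linarith
        next
          case near: False
          have "norm (ds (\<lambda>n. complex_of_real (c n)) s) \<ge> Lr c 1 - C1 * (real q * 3) powr de * norm (s - 1)"
          proof (rule real_L_near_1[OF c(1)])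
            fix z assume z: "1 < Re z" "Re z \<le> 2" "\<bar>Im z\<bar> \<le> 1"
            have "norm (ds (\<lambda>n. X n * of_real (ln (real n))) (Complex (Re z) (Im z))) \<le> C1 * (real q * ht z) powr de"
              by (rule D[OF z(1,2)])
            also have "\<dots> \<le> C1 * (real q * 3) powr de"
              using C1 z q1 de by (intro mult_left_mono powr_mono_base mult_left_mono) (auto intro!: mult_pos_pos)
            finally show "norm (ds (\<lambda>n. complex_of_real (c n) * of_real (ln (real n))) z) \<le> C1 * (real q * 3) powr de"
              using c(2) by simp
          qed (use C1 s small ta in \<open>auto simp: t_def\<close>)
          moreover have "C1 * (real q * 3) powr de * norm (s - 1) \<le> Cs' * real q powr (- de) / 2"
          proof -
            have "norm (s - 1) \<le> \<bar>Re (s - 1)\<bar> + \<bar>Im (s - 1)\<bar>" by (rule cmod_le)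
            then have "norm (s - 1) \<le> 2 * ta" using s near small by (simp add: t_def)
            moreover have "(real q * 3) powr de \<le> 3 * real q powr de"
              using q1 de powr_mono[of de 1 3] by (simp add: powr_mult mult.commute mult_right_mono)
            ultimately have "C1 * (real q * 3) powr de * norm (s - 1) \<le> C1 * (3 * real q powr de) * (2 * ta)"
              using C1 ta by (intro mult_mono) auto
            also have "\<dots> = Cs' / 2 * (real q powr de * real q powr (- (2 * de)))" using C1 by (simp add: ta_def k_def)
            also have "real q powr de * real q powr (- (2 * de)) = real q powr (- de)" by (simp flip: powr_add)
            finally show ?thesis by simp
          qed
          ultimately have "Cs' / 2 * real q powr (- de) \<le> norm (ds X s)"
            using Cs'(3)[OF c(1)] c(2) by simp
          moreover have "Cs' / 2 * Q powr (- de) \<le> Cs' / 2 * real q powr (- de)"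
            using Cs' q1 Q de by (intro mult_left_mono powr_mono2') auto
          moreover have "K * Q powr (- ep) \<le> Cs' / 2 * Q powr (- de)"
          proof (intro mult_mono Qe)
            show "K \<le> Cs' / 2" unfolding K_def by (intro min.coboundedI2 order_refl)
          qed (use Cs' de ep in \<open>auto simp: de_def\<close>)
          ultimately show ?thesis by linarith
        qed
      qed
    qed
    then show "norm (ds X s) \<ge> K * (real q * ht s) powr (- ep)" by (simp add: Q_def t_def)
  qed
qed

text \<open>The factor \<open>1 + norm (s - 1)\<close> has the size of \<open>s - 1\<close> at large
  height and does not degenerate at the pole; it will be the scale \<open>W\<close> of the
  recursion. Near 1 the pole itself provides the bound.\<close>

theorem zeta_lower_bound:
  fixes ep :: real
  assumes ep: "ep > 0" "ep \<le> 1/2"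
  obtains K where "K > 0" "\<And>s. \<lbrakk>1 < Re s; Re s \<le> 2\<rbrakk> \<Longrightarrow>
     norm ((s - 1) * zeta s) \<ge> K * (1 + norm (s - 1)) * ht s powr (- ep)"
proof -
  \<comment> \<open>Three factors from the derivative and one from zeta at \<open>2 t\<close>:
    \<open>4 * de = ep\<close>.\<close>
  define de where "de = ep / 4"
  have de: "de > 0" "de \<le> 1/2" using ep by (auto simp: de_def)
  obtain C where C: "C \<ge> 1" "\<And>sg. 1 < sg \<Longrightarrow> sg \<le> 2 \<Longrightarrow> norm (zeta (of_real sg)) \<le> C / (sg - 1)"
    using zeta_real_bound by blast
  obtain Cz where Cz: "Cz \<ge> 1" "\<And>s. \<lbrakk>1 < Re s; Re s \<le> 2\<rbrakk> \<Longrightarrow>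
     norm (ds (\<lambda>n. of_real (ln (real n) ^ 0)) s - fact 0 / (s - 1) ^ Suc 0) \<le> Cz * ht s powr de"
    using ds_log_minus_pole[OF de, of 0] by blast
  obtain C0 where C0: "C0 \<ge> 1" "\<And>s. \<lbrakk>1 < Re s; Re s \<le> 2\<rbrakk> \<Longrightarrow>
     norm (ds (\<lambda>n. of_real (ln (real n) ^ 0)) s) \<le> fact 0 / norm (s - 1) ^ Suc 0 + C0 * ht s powr de"
    using zeta_bounds[OF de, of 0] by blast
  obtain C1 where C1: "C1 \<ge> 1" "\<And>s. \<lbrakk>1 < Re s; Re s \<le> 2\<rbrakk> \<Longrightarrow>
     norm (ds (\<lambda>n. of_real (ln (real n) ^ 1)) s) \<le> fact 1 / norm (s - 1) ^ Suc 1 + C1 * ht s powr de"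
    using zeta_bounds[OF de, of 1] by blast
  \<comment> \<open>Close to the pole \<open>norm ((s - 1) * zeta s - 1)\<close> is then at most
    \<open>2 * ta * (3 * Cz) = 1/2\<close>.\<close>
  define ta where "ta = 1 / (12 * Cz)"
  have ta: "ta > 0" "ta \<le> 1/12" using Cz by (auto simp: ta_def field_simps)
  define Dc where "Dc = 1 / ta ^ 2 + C1"
  define Mc where "Mc = 1 / ta + 2 * C0"
  have "1 / ta \<ge> 0" "1 / ta ^ 2 \<ge> 0" using ta by auto
  then have Dc: "Dc \<ge> 1" and Mc: "Mc \<ge> 1" using C1(1) C0(1) unfolding Dc_def Mc_def by linarith+
  define K where "K = min (1/6) (min (ta / (1 + ta) * (1 / (16 * C ^ 3 * Dc ^ 3 * Mc))) (ta * (ta / C) / 3))"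
  have K: "K > 0" using C Dc Mc ta by (auto simp: K_def)
  show ?thesis
  proof (rule that[OF K])
    fix s assume s: "1 < Re s" "Re s \<le> 2"
    define t where "t = Im s"
    define Q where "Q = \<bar>t\<bar> + 2"
    define w where "w = s - 1"
    have Q: "Q \<ge> 1" "Q \<ge> 2" by (auto simp: Q_def)
    have Qe: "Q powr (- ep) \<le> 1" using Q ep powr_mono[of "- ep" 0 Q] by simp
    have se: "s = Complex (Re s) t" by (simp add: t_def complex_eq_iff)
    have it: "\<bar>t\<bar> \<le> norm w" using abs_Im_le_cmod[of w] by (simp add: w_def t_def)
    have rw: "norm w \<le> (Re s - 1) + \<bar>t\<bar>" using cmod_le[of w] s by (simp add: w_def t_def)
    have "norm (w * zeta s) \<ge> K * (1 + norm w) * Q powr (- ep)"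
    proof (cases "\<bar>t\<bar> \<ge> ta")
      case True
      have far: "norm (Complex sg u - 1) \<ge> ta" if "\<bar>u\<bar> \<ge> ta" for sg u
        using abs_Im_le_cmod[of "Complex sg u - 1"] that by simp
      have "norm (zeta (Complex (Re s) t)) \<ge> 1 / (16 * C ^ 3 * (Dc * Q powr de) ^ 3 * (Mc * Q powr de))"
      proof (rule lower_bound_341[OF _ _ _ C _ _ _ _ s])
        have Q1: "Q powr de \<ge> 1" using Q de by (simp add: ge_one_powr_ge_zero)
        show "1 \<le> Mc * Q powr de" "1 \<le> Dc * Q powr de"
          using Mc Dc Q1 mult_mono[of 1 Mc 1 "Q powr de"] mult_mono[of 1 Dc 1 "Q powr de"] by auto
        fix sg :: real assume sg: "1 < sg" "sg \<le> 2"
        have a1: "norm (zeta (Complex sg (2 * t))) \<le> 1 / norm (Complex sg (2 * t) - 1) + C0 * (\<bar>2 * t\<bar> + 2) powr de"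
          using C0(2)[of "Complex sg (2 * t)"] sg by simp
        have "norm (Complex sg (2 * t) - 1) \<ge> ta" by (rule far) (use True ta in linarith)
        then have a2: "1 / norm (Complex sg (2 * t) - 1) \<le> 1 / ta" using ta by (intro divide_left_mono mult_pos_pos) linarith+
        have a3: "1 / ta * 1 \<le> 1 / ta * Q powr de" using ta Q1 by (intro mult_left_mono) auto
        have "(\<bar>2 * t\<bar> + 2) powr de \<le> 2 * Q powr de"
        proof -
          have "(\<bar>2 * t\<bar> + 2) powr de \<le> (2 * Q) powr de" using de by (intro powr_mono_base) (auto simp: Q_def)
          also have "\<dots> = 2 powr de * Q powr de" using Q by (simp add: powr_mult)
          also have "2 powr de \<le> 2 powr (1::real)" using de by (intro powr_mono) auto
          finally show ?thesis by (simp add: mult_right_mono)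
        qed
        then have a4: "C0 * (\<bar>2 * t\<bar> + 2) powr de \<le> C0 * (2 * Q powr de)" using C0 by (intro mult_left_mono) auto
        have "Mc * Q powr de = 1 / ta * Q powr de + C0 * (2 * Q powr de)" by (simp add: Mc_def algebra_simps)
        then have "norm (zeta (Complex sg (2 * t))) \<le> Mc * Q powr de" using a1 a2 a3 a4 by linarith
        then show "norm (ds (\<lambda>n. 1 ^ 2) (Complex sg (2 * t))) \<le> Mc * Q powr de" by simp
        have b1: "norm (ds (\<lambda>n. of_real (ln (real n))) (Complex sg t)) \<le> 1 / norm (Complex sg t - 1) ^ 2 + C1 * Q powr de"
          using C1(2)[of "Complex sg t"] sg by (simp add: Q_def power2_eq_square)
        have "norm (Complex sg t - 1) \<ge> ta" by (rule far) (use True in simp)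
        then have b2: "1 / norm (Complex sg t - 1) ^ 2 \<le> 1 / ta ^ 2"
          using ta by (intro divide_left_mono mult_pos_pos power_mono zero_less_power) linarith+
        have b3: "1 / ta ^ 2 * 1 \<le> 1 / ta ^ 2 * Q powr de" using ta Q1 by (intro mult_left_mono) auto
        have "Dc * Q powr de = 1 / ta ^ 2 * Q powr de + C1 * Q powr de" by (simp add: Dc_def algebra_simps)
        then have "norm (ds (\<lambda>n. of_real (ln (real n))) (Complex sg t)) \<le> Dc * Q powr de" using b1 b2 b3 by linarith
        then show "norm (ds (\<lambda>n. 1 * of_real (ln (real n))) (Complex sg t)) \<le> Dc * Q powr de" by simp
      qed auto
      also have "1 / (16 * C ^ 3 * (Dc * Q powr de) ^ 3 * (Mc * Q powr de)) = 1 / (16 * C ^ 3 * Dc ^ 3 * Mc) * Q powr (- ep)"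
      proof -
        have "(Q powr de) ^ 3 * Q powr de = Q powr ep" using Q by (simp add: de_def powr_power flip: powr_add)
        then have "16 * C ^ 3 * (Dc * Q powr de) ^ 3 * (Mc * Q powr de) = 16 * C ^ 3 * Dc ^ 3 * Mc * Q powr ep"
          by (simp add: power_mult_distrib mult_ac)
        then show ?thesis by (simp add: powr_minus_divide)
      qed
      finally have z: "1 / (16 * C ^ 3 * Dc ^ 3 * Mc) * Q powr (- ep) \<le> norm (zeta s)" unfolding se[symmetric] .
      have "ta / (1 + ta) * (1 + norm w) \<le> norm w" using it True ta by (simp add: field_simps)
      then have "(ta / (1 + ta) * (1 + norm w)) * (1 / (16 * C ^ 3 * Dc ^ 3 * Mc) * Q powr (- ep)) \<le> norm w * norm (zeta s)"
        using z ta C Dc Mc by (intro mult_mono) auto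
      moreover have "K * (1 + norm w) * Q powr (- ep) \<le> ta / (1 + ta) * (1 / (16 * C ^ 3 * Dc ^ 3 * Mc)) * (1 + norm w) * Q powr (- ep)"
        by (intro mult_right_mono) (auto simp: K_def)
      ultimately show ?thesis by (simp add: norm_mult mult_ac)
    next
      case small: False
      have Q3: "Q powr de \<le> 3"
      proof -
        have "Q powr de \<le> Q powr 1" using Q de by (intro powr_mono) auto
        also have "\<dots> \<le> 3" using small ta by (simp add: Q_def)
        finally show ?thesis .
      qed
      have nw: "norm w \<le> 2" using rw s small ta by linarith
      have nw0: "w \<noteq> 0" using s by (auto simp: w_def)
      show ?thesis
      proof (cases "1 + ta \<le> Re s")
        case True
        have "norm (zeta (Complex (Re s) t)) \<ge> ta / C" by (rule lower_bound_far[OF _ _ _ C True s(2) ta(1)]) auto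
        moreover have "norm w \<ge> Re s - 1" using complex_Re_le_cmod[of w] by (simp add: w_def)
        then have "norm w \<ge> ta" using True by linarith
        ultimately have "ta * (ta / C) \<le> norm w * norm (zeta s)"
          unfolding se[symmetric] using ta C by (intro mult_mono) auto
        moreover have "K * (1 + norm w) * Q powr (- ep) \<le> (ta * (ta / C) / 3) * 3 * 1"
          using nw Qe K ta C by (intro mult_mono) (auto simp: K_def)
        ultimately show ?thesis by (simp add: norm_mult)
      next
        case False
        have "norm w \<le> 2 * ta" using rw False small by linarith
        have "norm (zeta s - 1 / w) \<le> Cz * 3"
        proof -
          have "norm (zeta s - 1 / w) \<le> Cz * Q powr de" using Cz(2)[OF s] by (simp add: w_def Q_def t_def)
          also have "\<dots> \<le> Cz * 3" by (intro mult_left_mono Q3) (use Cz in simp)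
          finally show ?thesis .
        qed
        then have "norm w * norm (zeta s - 1 / w) \<le> (2 * ta) * (Cz * 3)"
          using \<open>norm w \<le> 2 * ta\<close> ta by (intro mult_mono) auto
        also have "\<dots> = 1/2" using Cz by (simp add: ta_def)
        also have "norm w * norm (zeta s - 1 / w) = norm (w * zeta s - 1)"
          using nw0 by (simp add: right_diff_distrib flip: norm_mult)
        finally have "norm (w * zeta s) \<ge> 1/2"
          using norm_triangle_ineq2[of 1 "w * zeta s"] by (simp add: norm_minus_commute)
        moreover have "K * (1 + norm w) * Q powr (- ep) \<le> 1/6 * 3 * 1"
          using nw Qe K by (intro mult_mono) (auto simp: K_def)
        ultimately show ?thesis by simp
      qed
    qed
    then show "norm ((s - 1) * zeta s) \<ge> K * (1 + norm (s - 1)) * ht s powr (- ep)"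
      by (simp add: Q_def t_def w_def)
  qed
qed

subsection \<open>Bounds for the derivatives of the logarithmic derivative\<close>

text \<open>\<open>U\<close> and \<open>V\<close> both carry \<open>Q powr ep\<close>, and the
  recursion raises their product to the power \<open>k + 1\<close>; the choice of \<open>ep\<close>
  makes the total exponent \<open>1/2\<close>.\<close>

lemma log_recursion_powr_bound:
  fixes ep U K :: real
  assumes ep: "ep = 1 / (4 * (real k + 1))" and U: "U \<ge> 1" and K: "K > 0"
  obtains C where "C \<ge> 1" "\<And>(E :: nat \<Rightarrow> complex) Y W Q. \<lbrakk>\<And>i. E (Suc i) = (\<Sum>j\<le>i. of_nat (i choose j) * (E j * Y (i - j)));
       \<And>j. j \<le> Suc k \<Longrightarrow> norm (E j) \<le> W * (U * Q powr ep); norm (E 0) \<ge> K * W * Q powr (- ep); W > 0; Q \<ge> 1\<rbrakk>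
      \<Longrightarrow> norm (Y k) \<le> C * Q powr (1/2)"
proof -
  define V where "V = max 1 (1 / K)"
  have V: "V \<ge> 1" "1 / V \<le> K" using K by (auto simp: V_def max_def field_simps)
  obtain c where c: "c \<ge> 1" "\<And>(E :: nat \<Rightarrow> complex) Y W U V. \<lbrakk>\<And>i. i \<le> k \<Longrightarrow> E (Suc i) = (\<Sum>j\<le>i. of_nat (i choose j) * (E j * Y (i - j)));
       \<And>j. j \<le> Suc k \<Longrightarrow> norm (E j) \<le> W * U; norm (E 0) \<ge> W / V; W > 0; U \<ge> 1; V \<ge> 1\<rbrakk>
      \<Longrightarrow> norm (Y k) \<le> c * (U * V) ^ Suc k"
    using log_recursion_bound[of k] by blast
  show ?thesis
  proof (rule that[of "c * (U * V) ^ Suc k"])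
    have "(U * V) ^ Suc k \<ge> 1" using U V mult_mono[of 1 U 1 V] by (intro one_le_power) simp
    then show "c * (U * V) ^ Suc k \<ge> 1" using c(1) mult_mono[of 1 c 1 "(U * V) ^ Suc k"] by simp
    fix E Y :: "nat \<Rightarrow> complex" and W Q :: real
    assume rec: "\<And>i. E (Suc i) = (\<Sum>j\<le>i. of_nat (i choose j) * (E j * Y (i - j)))"
      and E: "\<And>j. j \<le> Suc k \<Longrightarrow> norm (E j) \<le> W * (U * Q powr ep)" and E0: "norm (E 0) \<ge> K * W * Q powr (- ep)"
      and W: "W > 0" and Q: "Q \<ge> 1"
    have Qe: "Q powr ep \<ge> 1" using Q ep by (simp add: ge_one_powr_ge_zero)
    have "norm (Y k) \<le> c * ((U * Q powr ep) * (V * Q powr ep)) ^ Suc k"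
    proof (rule c(2)[OF rec E _ W])
      have "W / (V * Q powr ep) = 1 / V * W * Q powr (- ep)" by (simp add: powr_minus_divide)
      also have "\<dots> \<le> K * W * Q powr (- ep)" using V W by (intro mult_right_mono) auto
      finally show "W / (V * Q powr ep) \<le> norm (E 0)" using E0 by linarith
      show "1 \<le> U * Q powr ep" "1 \<le> V * Q powr ep"
        using mult_mono[of 1 U 1 "Q powr ep"] mult_mono[of 1 V 1 "Q powr ep"] U V Qe by auto
    qed
    also have "(U * Q powr ep) * (V * Q powr ep) = (U * V) * Q powr (2 * ep)" by (simp flip: powr_add)
    also have "c * ((U * V) * Q powr (2 * ep)) ^ Suc k = c * (U * V) ^ Suc k * Q powr (1/2)"
    proof -
      have "(Q powr (2 * ep)) ^ Suc k = Q powr (2 * ep * real (Suc k))" using Q by (simp add: powr_power mult.commute del: power_Suc)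
      also have "2 * ep * real (Suc k) = 1/2" by (simp add: ep field_simps)
      finally show ?thesis by (simp only: power_mult_distrib mult.assoc)
    qed
    finally show "norm (Y k) \<le> c * (U * V) ^ Suc k * Q powr (1/2)" .
  qed
qed

theorem mangoldt_dchar_bound:
  obtains C where "C \<ge> 1" "\<And>q X s. \<lbrakk>q > 0; dchar q X; X \<noteq> pchar q; 1 < Re s; Re s \<le> 2\<rbrakk> \<Longrightarrow>
     norm (ds (\<lambda>n. X n * mangoldt n * of_real (ln (real n) ^ k)) s) \<le> C * (real q * ht s) powr (1/2)"
proof -
  define ep where "ep = 1 / (4 * (real k + 1))"
  have ep: "ep > 0" "ep \<le> 1/2" by (auto simp: ep_def field_simps)
  define P where "P = (\<lambda>j C. C \<ge> 1 \<and> (\<forall>c q s. q \<ge> 1 \<longrightarrow> (\<forall>n. norm (c n) \<le> 1) \<longrightarrow> (\<forall>M N. norm (\<Sum>n\<in>{M<..N}. c n) \<le> q) \<longrightarrow> 1 < Re s \<longrightarrow> Re s \<le> 2 \<longrightarrow>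
     norm (ds (\<lambda>n. c n * of_real (ln (real n) ^ j)) s) \<le> C * (q * ht s) powr ep))"
  have "\<exists>C. P j C" for j
    unfolding P_def by (rule ds_log_bounded_sums[OF ep, of j]) blast
  then obtain Cu where PC: "\<And>j. P j (Cu j)" by metis
  have Cu: "\<And>j. Cu j \<ge> 1" "\<And>j c q s. \<lbrakk>q \<ge> 1; \<forall>n. norm (c n) \<le> 1; \<forall>M N. norm (\<Sum>n\<in>{M<..N}. c n) \<le> q; 1 < Re s; Re s \<le> 2\<rbrakk> \<Longrightarrow>
     norm (ds (\<lambda>n. c n * of_real (ln (real n) ^ j)) s) \<le> Cu j * (q * ht s) powr ep"
    using PC unfolding P_def by blast+
  \<comment> \<open>Only the orders \<open>j \<le> k + 1\<close> enter, so the sum of their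
    constants serves for all of them.\<close>
  define CU where "CU = (\<Sum>j\<le>Suc k. Cu j)"
  have CU: "Cu j \<le> CU" if "j \<le> Suc k" for j
    unfolding CU_def using that Cu(1) by (intro member_le_sum) (auto intro: order_trans[OF zero_le_one])
  have CU1: "CU \<ge> 1" using CU[of 0] Cu(1)[of 0] by simp
  obtain K where K: "K > 0" "\<And>q X s. \<lbrakk>q > 0; dchar q X; X \<noteq> pchar q; 1 < Re s; Re s \<le> 2\<rbrakk> \<Longrightarrow>
     norm (ds X s) \<ge> K * (real q * ht s) powr (- ep)"
    using L_lower_bound[OF ep] by blast
  obtain C where C: "C \<ge> 1" "\<And>(E :: nat \<Rightarrow> complex) Y W Q. \<lbrakk>\<And>i. E (Suc i) = (\<Sum>j\<le>i. of_nat (i choose j) * (E j * Y (i - j)));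
       \<And>j. j \<le> Suc k \<Longrightarrow> norm (E j) \<le> W * (CU * Q powr ep); norm (E 0) \<ge> K * W * Q powr (- ep); W > 0; Q \<ge> 1\<rbrakk>
      \<Longrightarrow> norm (Y k) \<le> C * Q powr (1/2)"
    using log_recursion_powr_bound[OF ep_def CU1 K(1)] by blast
  show ?thesis
  proof (rule that[OF C(1)])
    fix q X s assume q: "q > 0" and X: "dchar q X" "X \<noteq> pchar q" and s: "1 < Re s" "Re s \<le> 2"
    define Q where "Q = real q * ht s"
    have q1: "real q \<ge> 1" using q by simp
    have Q: "Q \<ge> 1" using mult_mono[of 1 "real q" 1 "\<bar>Im s\<bar> + 2"] q1 by (simp add: Q_def)
    have mult: "\<And>m n. X (m * n) = X m * X n" using X by (auto simp: dchar_def)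
    note bd = dchar_norm_le[OF q X(1)]
    define E where "E = (\<lambda>j. ds (\<lambda>n. X n * of_real (ln (real n) ^ j)) s)"
    define Y where "Y = (\<lambda>j. ds (\<lambda>n. X n * mangoldt n * of_real (ln (real n) ^ j)) s)"
    have "norm (Y k) \<le> C * Q powr (1/2)"
    proof (rule C(2)[where W = 1])
      show "E (Suc i) = (\<Sum>j\<le>i. of_nat (i choose j) * (E j * Y (i - j)))" for i
        unfolding E_def Y_def by (rule ds_log_recursion[OF mult bd s(1)])
      fix j assume j: "j \<le> Suc k"
      have "norm (E j) \<le> Cu j * Q powr ep"
        unfolding E_def Q_def by (rule Cu(2)) (use q1 bd dchar_bounded_sums[OF q X] s in auto)
      also have "\<dots> \<le> CU * Q powr ep" by (intro mult_right_mono CU j) simp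
      finally show "norm (E j) \<le> 1 * (CU * Q powr ep)" by simp
    next
      show "K * 1 * Q powr (- ep) \<le> norm (E 0)" using K(2)[OF q X s] by (simp add: E_def Q_def)
    qed (use Q in auto)
    then show "norm (ds (\<lambda>n. X n * mangoldt n * of_real (ln (real n) ^ k)) s) \<le> C * (real q * ht s) powr (1/2)"
      by (simp only: Y_def Q_def)
  qed
qed

text \<open>Multiplying zeta by \<open>s - 1\<close> turns the recursion for its derivatives into one without poles.\<close>

lemma pole_free_recursion:
  fixes D G :: "nat \<Rightarrow> complex" and w :: complex
  assumes rec: "\<And>k. D (Suc k) = (\<Sum>j\<le>k. of_nat (k choose j) * (D j * G (k - j)))" and w: "w \<noteq> 0"
  defines "E \<equiv> \<lambda>j. w * D j - of_nat j * D (j - 1)"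
  defines "Y \<equiv> \<lambda>k. G k - fact k / w ^ Suc k"
  shows "E (Suc k) = (\<Sum>j\<le>k. of_nat (k choose j) * (E j * Y (k - j)))"
proof -
  have a: "(\<Sum>j\<le>k. of_nat (k choose j) * (w * D j * G (k - j))) = w * D (Suc k)"
    unfolding rec sum_distrib_left by (intro sum.cong refl) (simp add: mult_ac)
  \<comment> \<open>The absorption rule \<open>j * (k choose j) = k * (k - 1 choose j - 1)\<close>
    reduces this to the recursion one order lower.\<close>
  have b: "(\<Sum>j\<le>k. of_nat (k choose j) * (of_nat j * D (j - 1) * G (k - j))) = of_nat k * D k"
  proof (cases k)
    case (Suc m)
    have "(\<Sum>j\<le>Suc m. of_nat (Suc m choose j) * (of_nat j * D (j - 1) * G (Suc m - j))) =
      (\<Sum>i\<le>m. of_nat (Suc m choose Suc i) * (of_nat (Suc i) * D i * G (m - i)))"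
      by (subst sum.atMost_Suc_shift) simp
    also have "\<dots> = (\<Sum>i\<le>m. of_nat (Suc m) * (of_nat (m choose i) * (D i * G (m - i))))"
    proof (intro sum.cong refl)
      fix i
      have "Suc i * (Suc m choose Suc i) = Suc m * (m choose i)" by (rule Suc_times_binomial)
      then have "of_nat (Suc i) * of_nat (Suc m choose Suc i) = (of_nat (Suc m) * of_nat (m choose i) :: complex)"
        by (simp only: of_nat_mult[symmetric])
      then show "of_nat (Suc m choose Suc i) * (of_nat (Suc i) * D i * G (m - i)) = of_nat (Suc m) * (of_nat (m choose i) * (D i * G (m - i)))"
        by (simp only: mult_ac) (metis mult.assoc mult.commute)
    qed
    also have "\<dots> = of_nat (Suc m) * D (Suc m)" unfolding rec by (rule sum_distrib_left[symmetric])
    finally show ?thesis by (simp only: Suc)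
  qed simp
  have c: "(\<Sum>j\<le>k. of_nat (k choose j) * (E j * (fact (k - j) / w ^ Suc (k - j)))) = D k"
  proof -
    \<comment> \<open>Closed form of the partial sums: of the two parts of \<open>E (Suc m)\<close>
      one cancels the previous value and the other is the next one.\<close>
    have "(\<Sum>j\<le>m. of_nat (k choose j) * (E j * (fact (k - j) / w ^ Suc (k - j)))) = fact k / fact m * D m / w ^ (k - m)" if "m \<le> k" for m
      using that
    proof (induction m)
      case 0
      then show ?case using w by (simp add: E_def)
    next
      case (Suc m)
      have bin: "of_nat (k choose Suc m) * fact (k - Suc m) = (fact k / fact (Suc m) :: complex)"
        using binomial_fact[OF Suc.prems, where 'a = complex] by (simp add: field_simps del: fact_Suc)
      have km: "k - m = Suc (k - Suc m)" using Suc.prems by simp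
      have "of_nat (k choose Suc m) * (E (Suc m) * (fact (k - Suc m) / w ^ Suc (k - Suc m))) =
        fact k / fact (Suc m) * E (Suc m) / w ^ Suc (k - Suc m)"
        unfolding bin[symmetric] by (simp add: field_simps)
      also have "\<dots> = fact k / fact (Suc m) * D (Suc m) / w ^ (k - Suc m) - fact k / fact m * D m / w ^ (k - m)"
      proof -
        have gen: "f / (n * F) * (w * a - n * b) / (w * P) = f / (n * F) * a / P - f / F * b / (w * P)"
          if "n \<noteq> 0" "F \<noteq> 0" "P \<noteq> 0" for f n F a b P :: complex using that w by (simp add: field_simps)
        show ?thesis unfolding km E_def fact_Suc[where 'a = complex] power_Suc diff_Suc_1
          by (rule gen) (use w in \<open>auto simp del: of_nat_Suc\<close>)
      qed
      finally show ?case using Suc by simp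
    qed
    from this[of k] show ?thesis by simp
  qed
  have "(\<Sum>j\<le>k. of_nat (k choose j) * (E j * Y (k - j))) =
    (\<Sum>j\<le>k. of_nat (k choose j) * (w * D j * G (k - j))) - (\<Sum>j\<le>k. of_nat (k choose j) * (of_nat j * D (j - 1) * G (k - j)))
    - (\<Sum>j\<le>k. of_nat (k choose j) * (E j * (fact (k - j) / w ^ Suc (k - j))))"
    unfolding sum_subtractf[symmetric] by (intro sum.cong refl) (simp only: Y_def E_def algebra_simps)
  also have "\<dots> = E (Suc k)" unfolding a b c by (simp add: E_def algebra_simps)
  finally show ?thesis by simp
qed

text \<open>The series of \<open>mangoldt\<close> and of 1, with the same power of the logarithm,
  have the same polar part \<open>fact k / (s - 1) ^ Suc k\<close>. Their difference is regular, so
  Perron's integral can be applied to it without a main term.\<close>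

theorem mangoldt_minus_one_bound:
  obtains C where "C \<ge> 1" "\<And>s. \<lbrakk>1 < Re s; Re s \<le> 2\<rbrakk> \<Longrightarrow>
     norm (ds (\<lambda>n. (mangoldt n - 1) * of_real (ln (real n) ^ k)) s) \<le> C * ht s powr (1/2)"
proof -
  define ep where "ep = 1 / (4 * (real k + 1))"
  have ep: "ep > 0" "ep \<le> 1/2" by (auto simp: ep_def field_simps)
  define P where "P = (\<lambda>j C. C \<ge> 1 \<and> (\<forall>s. 1 < Re s \<longrightarrow> Re s \<le> 2 \<longrightarrow>
     norm (ds (\<lambda>n. of_real (ln (real n) ^ j)) s - fact j / (s - 1) ^ Suc j) \<le> C * ht s powr ep))"
  have "\<exists>C. P j C" for j
    unfolding P_def by (rule ds_log_minus_pole[OF ep, of j]) blast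
  then obtain Cu where PC: "\<And>j. P j (Cu j)" by metis
  have Cu: "\<And>j. Cu j \<ge> 1" "\<And>j s. \<lbrakk>1 < Re s; Re s \<le> 2\<rbrakk> \<Longrightarrow>
     norm (ds (\<lambda>n. of_real (ln (real n) ^ j)) s - fact j / (s - 1) ^ Suc j) \<le> Cu j * ht s powr ep"
    using PC unfolding P_def by blast+
  define CS where "CS = (\<Sum>j\<le>Suc k. Cu j)"
  have CS: "Cu j \<le> CS" if "j \<le> Suc k" for j
    unfolding CS_def using that Cu(1) by (intro member_le_sum) (auto intro: order_trans[OF zero_le_one])
  have CS1: "CS \<ge> 1" using CS[of 0] Cu(1)[of 0] by simp
  define CU where "CU = 1 + (real k + 2) * CS"
  have CU1: "CU \<ge> 1" using CS1 by (simp add: CU_def)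
  have CUS: "CS \<le> CU" "(real k + 1) * CS \<le> CU"
    using mult_right_mono[of 1 "real k + 2" CS] CS1 by (auto simp: CU_def algebra_simps)
  obtain K where K: "K > 0" "\<And>s. \<lbrakk>1 < Re s; Re s \<le> 2\<rbrakk> \<Longrightarrow>
     norm ((s - 1) * zeta s) \<ge> K * (1 + norm (s - 1)) * ht s powr (- ep)"
    using zeta_lower_bound[OF ep] by blast
  obtain C where C: "C \<ge> 1" "\<And>(E :: nat \<Rightarrow> complex) Y W Q. \<lbrakk>\<And>i. E (Suc i) = (\<Sum>j\<le>i. of_nat (i choose j) * (E j * Y (i - j)));
       \<And>j. j \<le> Suc k \<Longrightarrow> norm (E j) \<le> W * (CU * Q powr ep); norm (E 0) \<ge> K * W * Q powr (- ep); W > 0; Q \<ge> 1\<rbrakk>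
      \<Longrightarrow> norm (Y k) \<le> C * Q powr (1/2)"
    using log_recursion_powr_bound[OF ep_def CU1 K(1)] by blast
  show ?thesis
  proof (rule that[of "C + CS"])
    show "C + CS \<ge> 1" using C(1) CS1 by simp
    fix s assume s: "1 < Re s" "Re s \<le> 2"
    define Q where "Q = \<bar>Im s\<bar> + 2"
    define w where "w = s - 1"
    have w0: "w \<noteq> 0" using s by (auto simp: w_def)
    have Q: "Q \<ge> 1" by (simp add: Q_def)
    have Qe: "Q powr ep \<ge> 1" using Q ep by (simp add: ge_one_powr_ge_zero)
    define D where "D = (\<lambda>j. ds (\<lambda>n. 1 * of_real (ln (real n) ^ j)) s)"
    define G where "G = (\<lambda>j. ds (\<lambda>n. 1 * mangoldt n * of_real (ln (real n) ^ j)) s)"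
    define E where "E = (\<lambda>j. w * D j - of_nat j * D (j - 1))"
    define Y where "Y = (\<lambda>j. G j - fact j / w ^ Suc j)"
    define r where "r = (\<lambda>j. D j - fact j / w ^ Suc j)"
    have r: "norm (r j) \<le> CS * Q powr ep" if "j \<le> Suc k" for j
    proof -
      have "norm (r j) \<le> Cu j * Q powr ep" using Cu(2)[OF s, of j] by (simp add: r_def D_def w_def Q_def)
      also have "\<dots> \<le> CS * Q powr ep" by (intro mult_right_mono CS that) simp
      finally show ?thesis .
    qed
    have Yk: "norm (Y k) \<le> C * Q powr (1/2)"
    proof (rule C(2)[where W = "1 + norm w"])
      show "E (Suc i) = (\<Sum>j\<le>i. of_nat (i choose j) * (E j * Y (i - j)))" for i
        unfolding E_def Y_def
        by (rule pole_free_recursion[OF _ w0]) (unfold D_def G_def, rule ds_log_recursion, use s in auto)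
      fix j assume j: "j \<le> Suc k"
      show "norm (E j) \<le> (1 + norm w) * (CU * Q powr ep)"
      proof (cases j)
        case 0
        have "E 0 = 1 + w * r 0" using w0 by (simp add: E_def r_def field_simps)
        then have "norm (E 0) \<le> 1 + norm w * norm (r 0)" using norm_triangle_ineq[of 1 "w * r 0"] by (simp add: norm_mult)
        also have "\<dots> \<le> 1 * Q powr ep + norm w * (CS * Q powr ep)" using Qe r[of 0] by (intro add_mono mult_left_mono) auto
        also have "\<dots> \<le> (1 + norm w) * (CU * Q powr ep)"
        proof -
          have "1 * Q powr ep \<le> CU * Q powr ep" "CS * Q powr ep \<le> CU * Q powr ep"
            by (intro mult_right_mono CU1 CUS; simp)+
          then have "1 * Q powr ep + norm w * (CS * Q powr ep) \<le> CU * Q powr ep + norm w * (CU * Q powr ep)"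
            by (intro add_mono mult_left_mono) auto
          then show ?thesis by (simp add: algebra_simps)
        qed
        finally show ?thesis using 0 by simp
      next
        case (Suc i)
        \<comment> \<open>The polar parts of \<open>w * D j\<close> and \<open>j * D (j - 1)\<close>
          coincide, which leaves the regular remainders.\<close>
        have "E j = w * r j - of_nat j * r i"
        proof -
          have "w * (fact j / w ^ Suc j) = of_nat j * (fact i / w ^ Suc i)" using w0 Suc by (simp add: field_simps)
          then show ?thesis by (simp add: E_def r_def Suc algebra_simps)
        qed
        then have "norm (E j) \<le> norm w * norm (r j) + real j * norm (r i)"
          using norm_triangle_ineq4[of "w * r j" "of_nat j * r i"] by (simp add: norm_mult)
        also have "\<dots> \<le> norm w * (CS * Q powr ep) + (real k + 1) * (CS * Q powr ep)"
          using j Suc CS1 by (intro add_mono mult_left_mono mult_mono r) auto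
        also have "\<dots> \<le> (1 + norm w) * (CU * Q powr ep)"
        proof -
          have "CS * Q powr ep \<le> CU * Q powr ep" "(real k + 1) * (CS * Q powr ep) \<le> CU * Q powr ep"
            unfolding mult.assoc[symmetric] by (intro mult_right_mono CUS; simp)+
          then have "norm w * (CS * Q powr ep) + (real k + 1) * (CS * Q powr ep) \<le> norm w * (CU * Q powr ep) + CU * Q powr ep"
            by (intro add_mono mult_left_mono) auto
          then show ?thesis by (simp add: algebra_simps)
        qed
        finally show ?thesis .
      qed
    next
      show "K * (1 + norm w) * Q powr (- ep) \<le> norm (E 0)" using K(2)[OF s] by (simp add: E_def D_def Q_def w_def)
      show "0 < 1 + norm w" by (simp add: add_pos_nonneg)
    qed (use Q in auto)
    have "norm (r k) \<le> CS * Q powr ep" by (rule r) simp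
    also have "\<dots> \<le> CS * Q powr (1/2)" using CS1 Q ep by (intro mult_left_mono powr_mono) auto
    finally have rk: "norm (r k) \<le> CS * Q powr (1/2)" .
    have "ds (\<lambda>n. (mangoldt n - 1) * of_real (ln (real n) ^ k)) s =
      ds (\<lambda>n. 1 * mangoldt n * of_real (ln (real n) ^ k) + - (1 * of_real (ln (real n) ^ k))) s"
      by (simp add: algebra_simps)
    also have "\<dots> = G k + ds (\<lambda>n. - (1 * of_real (ln (real n) ^ k))) s"
      unfolding G_def
    proof (rule ds_add[OF _ _ s(1)])
      show "norm (1 * mangoldt n * of_real (ln (real n) ^ k) :: complex) \<le> 1 * ln (real n) ^ Suc k" for n
        using norm_mangoldt_coeff_le[of "\<lambda>_. 1" n k] by simp
      show "norm (- (1 * of_real (ln (real n) ^ k)) :: complex) \<le> 1 * ln (real n) ^ k" for n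
        using norm_log_coeff_le[of "\<lambda>_. 1" n k] by simp
    qed
    also have "ds (\<lambda>n. - (1 * of_real (ln (real n) ^ k))) s = (- 1) * D k"
      unfolding D_def using ds_cmult[of "\<lambda>n. 1 * of_real (ln (real n) ^ k)" 1 k s "-1"] norm_log_coeff_le[of "\<lambda>_. 1" _ k] s by simp
    also have "G k + (- 1) * D k = Y k - r k" by (simp add: Y_def r_def)
    finally have "norm (ds (\<lambda>n. (mangoldt n - 1) * of_real (ln (real n) ^ k)) s) \<le> norm (Y k) + norm (r k)"
      using norm_triangle_ineq4[of "Y k" "r k"] by simp
    also have "\<dots> \<le> (C + CS) * Q powr (1/2)" unfolding distrib_right by (intro add_mono Yk rk)
    finally show "norm (ds (\<lambda>n. (mangoldt n - 1) * of_real (ln (real n) ^ k)) s) \<le> (C + CS) * ht s powr (1/2)"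
      by (simp only: Q_def)
  qed
qed

subsection \<open>A Perron formula\<close>

text \<open>For \<open>u \<le> 0\<close> the segment is replaced by the circular arc to its right,
  where \<open>exp (s * u)\<close> is at most \<open>exp (sg * u)\<close> in norm. With
  \<open>1 / s^2\<close>, unlike \<open>1 / s\<close>, arc length times maximum tends to 0.\<close>

lemma perron_right:
  fixes sg R u :: real
  assumes sg: "sg > 0" and R: "R > 0" and u: "u \<le> 0"
  shows "norm (contour_integral (linepath (Complex sg (-R)) (Complex sg R)) (\<lambda>s. exp (s * of_real u) / s ^ 2)) \<le> 2 * pi * exp (sg * u) / R"
proof -
  let ?f = "\<lambda>s::complex. exp (s * of_real u) / s ^ 2"
  define a where "a = Complex sg R"
  define rh where "rh = norm a"
  define th where "th = Arg a"
  have rh: "rh > 0" "R \<le> rh" using sg R abs_Im_le_cmod[of a] by (auto simp: rh_def a_def complex_eq_iff)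
  have th: "0 < th" "th < pi / 2" using sg R Arg_Re_pos[of a] Arg_lt_pi[of a] Arg_less_0[of a] Arg_eq_0[of a]
    by (auto simp: th_def a_def complex_is_Real_iff)
  have aeq: "a = of_real rh * exp (\<i> * of_real th)" using sg by (subst Arg_eq[of a]) (auto simp: rh_def th_def a_def complex_eq_iff)
  have costh: "rh * cos th = sg" using arg_cong[OF aeq, of Re] by (simp add: a_def Re_exp)
  have sinth: "rh * sin th = R" using arg_cong[OF aeq, of Im] by (simp add: a_def Im_exp)
  define g where "g = part_circlepath 0 rh (-th) th"
  have img: "Re z \<ge> sg \<and> norm z = rh" if zg: "z \<in> path_image g" for z
  proof -
    obtain x where x: "z = of_real rh * exp (\<i> * of_real x)" "-th \<le> x" "x \<le> th"
      using zg th by (auto simp: g_def path_image_part_circlepath)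
    have "cos th \<le> cos \<bar>x\<bar>" using x th by (intro cos_monotone_0_pi_le) auto
    then have "sg \<le> rh * cos x" using rh costh mult_left_mono[of "cos th" "cos x" rh] by (cases "x \<ge> 0") auto
    then show ?thesis using x rh by (simp add: Re_exp norm_mult)
  qed
  have ends: "pathstart g = Complex sg (-R)" "pathfinish g = Complex sg R"
    using costh sinth by (auto simp: g_def complex_eq_iff Re_exp Im_exp)
  let ?S = "{z::complex. Re z > 0}"
  have hol: "?f holomorphic_on ?S" by (intro holomorphic_intros) auto
  obtain F where F: "\<And>x. x \<in> ?S \<Longrightarrow> (F has_field_derivative ?f x) (at x within ?S)"
    using holomorphic_convex_primitive'[OF _ _ hol] convex_halfspace_Re_gt open_halfspace_Re_gt by blast
  have 1: "(?f has_contour_integral (F (pathfinish (linepath (Complex sg (-R)) (Complex sg R))) - F (pathstart (linepath (Complex sg (-R)) (Complex sg R))))) (linepath (Complex sg (-R)) (Complex sg R))"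
  proof (rule contour_integral_primitive[OF F])
    have "closed_segment (Complex sg (-R)) (Complex sg R) \<subseteq> ?S"
      using sg by (intro closed_segment_subset convex_halfspace_Re_gt) auto
    then show "path_image (linepath (Complex sg (-R)) (Complex sg R)) \<subseteq> ?S" by simp
  qed auto
  have 2: "(?f has_contour_integral (F (pathfinish g) - F (pathstart g))) g"
  proof (rule contour_integral_primitive[OF F])
    show "path_image g \<subseteq> ?S" using img sg by force
  qed (auto simp: g_def)
  have eq: "contour_integral (linepath (Complex sg (-R)) (Complex sg R)) ?f = contour_integral g ?f"
    using contour_integral_unique[OF 1] contour_integral_unique[OF 2] ends by simp
  have "norm (contour_integral g ?f) \<le> (exp (sg * u) / rh ^ 2) * rh * \<bar>th - (-th)\<bar>"
    unfolding g_def
  proof (rule contour_integral_bound_part_circlepath)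
    show "?f contour_integrable_on part_circlepath 0 rh (-th) th"
      using 2 has_contour_integral_integrable unfolding g_def by blast
    fix z assume "z \<in> path_image (part_circlepath 0 rh (-th) th)"
    then have z: "Re z \<ge> sg" "norm z = rh" using img unfolding g_def by blast+
    then have "Re z * u \<le> sg * u" using u by (intro mult_right_mono_neg)
    then show "norm (?f z) \<le> exp (sg * u) / rh ^ 2" using z by (simp add: norm_divide norm_power divide_right_mono)
  qed (use rh in auto)
  also have "\<dots> = 2 * th * exp (sg * u) / rh" using rh th by (simp add: power2_eq_square)
  also have "\<dots> \<le> 2 * pi * exp (sg * u) / R"
    using rh th R by (intro frac_le mult_right_mono) auto
  finally show ?thesis unfolding eq .
qed

text \<open>The arc to the left encloses the double pole at 0, where the residue is
  \<open>u\<close>. It is evaluated by primitives: the integrand is an entire function plus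
  \<open>1 / z^2\<close> plus \<open>u / z\<close>, and \<open>1 / z\<close> is integrated with one
  branch of the logarithm on the segment and another on the arc.\<close>

lemma perron_left:
  fixes sg R u :: real
  assumes sg: "sg > 0" and R: "R > 0" and u: "u \<ge> 0"
  shows "norm (contour_integral (linepath (Complex sg (-R)) (Complex sg R)) (\<lambda>s. exp (s * of_real u) / s ^ 2) - 2 * pi * \<i> * u) \<le> 2 * pi * exp (sg * u) / R"
proof -
  let ?f = "\<lambda>s::complex. exp (s * of_real u) / s ^ 2"
  define a where "a = Complex sg R"
  define b where "b = Complex sg (-R)"
  define rh where "rh = norm a"
  define th where "th = Arg a"
  have rh: "rh > 0" "R \<le> rh" using sg R abs_Im_le_cmod[of a] by (auto simp: rh_def a_def complex_eq_iff)
  have th: "0 < th" "th < pi / 2" using sg R Arg_Re_pos[of a] Arg_lt_pi[of a] Arg_less_0[of a] Arg_eq_0[of a]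
    by (auto simp: th_def a_def complex_is_Real_iff)
  have aeq: "a = of_real rh * exp (\<i> * of_real th)" using sg by (subst Arg_eq[of a]) (auto simp: rh_def th_def a_def complex_eq_iff)
  have costh: "rh * cos th = sg" using arg_cong[OF aeq, of Re] by (simp add: a_def Re_exp)
  have sinth: "rh * sin th = R" using arg_cong[OF aeq, of Im] by (simp add: a_def Im_exp)
  define g where "g = part_circlepath 0 rh th (2 * pi - th)"
  define l where "l = linepath b a"
  have img: "Re z \<le> sg \<and> norm z = rh \<and> - z \<notin> \<real>\<^sub>\<le>\<^sub>0" if zg: "z \<in> path_image g" for z
  proof -
    obtain x where x: "z = of_real rh * exp (\<i> * of_real x)" "th \<le> x" "x \<le> 2 * pi - th"
      using zg th by (auto simp: g_def path_image_part_circlepath)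
    have "cos x \<le> cos th"
    proof (cases "x \<le> pi")
      case True
      then show ?thesis using x th by (intro cos_monotone_0_pi_le) auto
    next
      case False
      have "cos x = cos (2 * pi - x)" by (simp add: cos_diff)
      also have "\<dots> \<le> cos th" using x th False by (intro cos_monotone_0_pi_le) auto
      finally show ?thesis .
    qed
    then have "rh * cos x \<le> sg" using rh costh mult_left_mono[of "cos x" "cos th" rh] by simp
    moreover have "- z \<notin> \<real>\<^sub>\<le>\<^sub>0"
    proof
      assume "- z \<in> \<real>\<^sub>\<le>\<^sub>0"
      then have "Im z = 0" "Re z \<ge> 0" by (auto simp: complex_nonpos_Reals_iff)
      then have "sin x = 0" "cos x \<ge> 0" using x rh by (auto simp: Re_exp Im_exp zero_le_mult_iff)
      moreover have "x > 0" "x < 2 * pi" using x th by auto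
      ultimately show False
        using sin_gt_zero[of x] sin_lt_zero[of x] cos_pi by (cases "x = pi") (auto simp: not_less_iff_gr_or_eq, linarith+)
    qed
    ultimately show ?thesis using x rh by (simp add: Re_exp norm_mult)
  qed
  have ends: "pathstart g = a" "pathfinish g = b"
  proof -
    show "pathstart g = a" using aeq by (simp add: g_def)
    have "exp (\<i> * of_real (2 * pi - th)) = exp (- (\<i> * of_real th))"
      by (simp add: right_diff_distrib exp_diff exp_minus mult_ac) (simp add: divide_inverse exp_minus)
    then show "pathfinish g = b" using costh sinth by (simp add: g_def b_def complex_eq_iff Re_exp Im_exp)
  qed
  have limg: "Re z = sg" if zl: "z \<in> path_image l" for z
  proof -
    obtain v where v: "z = (1 - v) *\<^sub>R b + v *\<^sub>R a" using zl by (auto simp: l_def in_segment)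
    show ?thesis unfolding v by (simp add: a_def b_def algebra_simps)
  qed
  have vg: "valid_path g" "valid_path l" by (auto simp: g_def l_def)
  have nz: "z \<noteq> 0" if "z \<in> path_image g \<or> z \<in> path_image l" for z
    using that img[of z] limg[of z] rh sg by auto
  \<comment> \<open>Two successive divided differences of the exponential at 0; \<open>h2\<close> is
    the entire part of the integrand.\<close>
  define h1 where "h1 = (\<lambda>z. if z = 0 then deriv (\<lambda>z::complex. exp (z * of_real u)) 0 else (exp (z * of_real u) - exp (0 * of_real u)) / (z - 0))"
  define h2 where "h2 = (\<lambda>z. if z = 0 then deriv h1 0 else (h1 z - h1 0) / (z - 0))"
  have "h1 holomorphic_on UNIV" unfolding h1_def by (rule pole_lemma) (auto intro!: holomorphic_intros)
  then have "h2 holomorphic_on UNIV" unfolding h2_def by (rule pole_lemma) auto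
  then obtain F where F: "\<And>x. x \<in> UNIV \<Longrightarrow> (F has_field_derivative h2 x) (at x within UNIV)"
    using holomorphic_convex_primitive'[of UNIV h2] by auto
  have "deriv (\<lambda>z::complex. exp (z * of_real u)) 0 = of_real u"
    by (rule DERIV_imp_deriv) (auto intro!: derivative_eq_intros)
  then have h2: "?f z = h2 z + 1 / z ^ 2 + of_real u * (1 / z)" if "z \<noteq> 0" for z
    using that by (simp add: h2_def h1_def power2_eq_square field_simps)
  have Fg: "(h2 has_contour_integral (F b - F a)) g" and Fl: "(h2 has_contour_integral (F a - F b)) l"
    using contour_integral_primitive[OF F vg(1)] contour_integral_primitive[OF F vg(2)] ends by (auto simp: l_def)
  have D2: "((\<lambda>z. - 1 / z) has_field_derivative 1 / z ^ 2) (at z within - {0})" if "z \<in> - {0}" for z :: complex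
    using that by (auto intro!: derivative_eq_intros simp: power2_eq_square)
  have Qg: "((\<lambda>z. 1 / z ^ 2) has_contour_integral (- 1 / b - - 1 / a)) g"
    using contour_integral_primitive[OF D2 vg(1)] nz ends by auto
  have Ql: "((\<lambda>z. 1 / z ^ 2) has_contour_integral (- 1 / a - - 1 / b)) l"
    using contour_integral_primitive[OF D2 vg(2)] nz by (auto simp: l_def)
  have Rl: "((\<lambda>z. 1 / z) has_contour_integral (Ln a - Ln b)) l"
  proof -
    have "((\<lambda>z. 1 / z) has_contour_integral (Ln (pathfinish l) - Ln (pathstart l))) l"
    proof (rule contour_integral_primitive[where S = "{z. Re z > 0}"])
      fix z :: complex assume "z \<in> {z. Re z > 0}"
      then have "z \<notin> \<real>\<^sub>\<le>\<^sub>0" by (auto simp: complex_nonpos_Reals_iff)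
      then show "(Ln has_field_derivative 1 / z) (at z within {z. Re z > 0})"
        using has_field_derivative_at_within[OF has_field_derivative_Ln] by (simp add: field_simps)
    qed (use vg limg sg in auto)
    then show ?thesis by (simp add: l_def)
  qed
  have Rg: "((\<lambda>z. 1 / z) has_contour_integral (Ln (- b) - Ln (- a))) g"
  proof -
    have "((\<lambda>z. 1 / z) has_contour_integral (Ln (- pathfinish g) - Ln (- pathstart g))) g"
    proof (rule contour_integral_primitive[where S = "{z. - z \<notin> \<real>\<^sub>\<le>\<^sub>0}" and f = "\<lambda>z. Ln (- z)"])
      fix z :: complex assume "z \<in> {z. - z \<notin> \<real>\<^sub>\<le>\<^sub>0}"
      then show "((\<lambda>z. Ln (- z)) has_field_derivative 1 / z) (at z within {z. - z \<notin> \<real>\<^sub>\<le>\<^sub>0})"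
        by (auto intro!: derivative_eq_intros simp: field_simps)
    qed (use vg img in auto)
    then show ?thesis by (simp add: ends)
  qed
  \<comment> \<open>\<open>Ln (- z) - Ln z\<close> is \<open>- pi * \<i>\<close> at
    \<open>a\<close>, above the real axis, and \<open>pi * \<i>\<close> at \<open>b\<close>, below
    it; the discrepancy is the full turn.\<close>
  have lns: "(Ln a - Ln b) + (Ln (- b) - Ln (- a)) = 2 * pi * \<i>"
    using Ln_minus[of a] Ln_minus[of b] sg R by (simp add: a_def b_def complex_eq_iff algebra_simps)
  have Sl: "(?f has_contour_integral ((F a - F b) + (- 1 / a - - 1 / b) + of_real u * (Ln a - Ln b))) l"
    by (rule has_contour_integral_eq[OF has_contour_integral_add[OF has_contour_integral_add[OF Fl Ql] has_contour_integral_lmul[OF Rl]]])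
       (use h2 nz in auto)
  have Sg: "(?f has_contour_integral ((F b - F a) + (- 1 / b - - 1 / a) + of_real u * (Ln (- b) - Ln (- a)))) g"
    by (rule has_contour_integral_eq[OF has_contour_integral_add[OF has_contour_integral_add[OF Fg Qg] has_contour_integral_lmul[OF Rg]]])
       (use h2 nz in auto)
  have "contour_integral l ?f + contour_integral g ?f = of_real u * ((Ln a - Ln b) + (Ln (- b) - Ln (- a)))"
    unfolding contour_integral_unique[OF Sl] contour_integral_unique[OF Sg] by (simp add: algebra_simps)
  then have eq: "contour_integral l ?f - 2 * pi * \<i> * u = - contour_integral g ?f" unfolding lns by (simp add: algebra_simps)
  have "norm (contour_integral g ?f) \<le> (exp (sg * u) / rh ^ 2) * rh * \<bar>(2 * pi - th) - th\<bar>"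
    unfolding g_def
  proof (rule contour_integral_bound_part_circlepath)
    show "?f contour_integrable_on part_circlepath 0 rh th (2 * pi - th)"
      using Sg has_contour_integral_integrable unfolding g_def by blast
    fix z assume "z \<in> path_image (part_circlepath 0 rh th (2 * pi - th))"
    then have z: "Re z \<le> sg" "norm z = rh" using img unfolding g_def by blast+
    then have "Re z * u \<le> sg * u" using u by (intro mult_right_mono)
    then show "norm (?f z) \<le> exp (sg * u) / rh ^ 2" using z by (simp add: norm_divide norm_power divide_right_mono)
  qed (use rh in auto)
  also have "\<dots> = (2 * pi - 2 * th) * exp (sg * u) / rh" using rh th by (simp add: power2_eq_square)
  also have "\<dots> \<le> 2 * pi * exp (sg * u) / R"
    using rh th R by (intro frac_le mult_right_mono) auto
  finally show ?thesis using eq by (simp add: l_def a_def b_def)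
qed

lemma perron_kernel:
  fixes sg R u :: real
  assumes "sg > 0" "R > 0"
  shows "norm (contour_integral (linepath (Complex sg (-R)) (Complex sg R)) (\<lambda>s. exp (s * of_real u) / s ^ 2) - 2 * pi * \<i> * max u 0) \<le> 2 * pi * exp (sg * u) / R"
  using perron_left[OF assms, of u] perron_right[OF assms, of u] by (cases "u \<ge> 0") (auto simp: max_def)

lemma integral_three_halves_bound:
  fixes R :: real
  assumes "R > 0"
  shows "(\<lambda>t. (1 + \<bar>t\<bar>) powr (- (3/2))) integrable_on {-R..R}" "integral {-R..R} (\<lambda>t. (1 + \<bar>t\<bar>) powr (- (3/2))) \<le> 4"
proof -
  let ?h = "\<lambda>t::real. (1 + \<bar>t\<bar>) powr (- (3/2))"
  have pos: "(?h has_integral (- 2 * (1 + R) powr (- (1/2)) - - 2 * (1 + 0) powr (- (1/2)))) {0..R}"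
  proof (rule fundamental_theorem_of_calculus)
    fix t :: real assume "t \<in> {0..R}"
    then show "((\<lambda>t. - 2 * (1 + t) powr (- (1/2))) has_vector_derivative ?h t) (at t within {0..R})"
      unfolding has_real_derivative_iff_has_vector_derivative[symmetric]
      by (auto intro!: derivative_eq_intros)
  qed (use assms in simp)
  have "((\<lambda>t. ?h (- t)) has_integral (- 2 * (1 + R) powr (- (1/2)) - - 2 * (1 + 0) powr (- (1/2)))) {-R..-0}"
    using pos by (subst has_integral_reflect_real) (use assms in auto)
  then have neg: "(?h has_integral (- 2 * (1 + R) powr (- (1/2)) - - 2 * (1 + 0) powr (- (1/2)))) {-R..0}" by simp
  have "(?h has_integral ((- 2 * (1 + R) powr (- (1/2)) - - 2 * (1 + 0) powr (- (1/2))) + (- 2 * (1 + R) powr (- (1/2)) - - 2 * (1 + 0) powr (- (1/2))))) {-R..R}"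
    by (rule has_integral_combine[OF _ _ neg pos]) (use assms in auto)
  then show "?h integrable_on {-R..R}" "integral {-R..R} ?h \<le> 4"
    by (auto simp: integral_unique has_integral_integrable)
qed

text \<open>The line stays at distance \<open>1 / ln x\<close> from 1 while its length goes to
  infinity, which removes the truncation error altogether. The integrand decays like
  \<open>\<bar>t\<bar> powr (- 3/2)\<close>, so no logarithm is lost.\<close>

lemma perron_sum_bound:
  fixes b :: "nat \<Rightarrow> complex" and M x :: real
  assumes b: "\<And>n. norm (b n) \<le> ln (real n) ^ j" and M: "M \<ge> 0"
    and F: "\<And>s. \<lbrakk>1 < Re s; Re s \<le> 2\<rbrakk> \<Longrightarrow> norm (ds b s) \<le> M * ht s powr (1/2)" and x: "x \<ge> 3"
  shows "norm (\<Sum>n=1..nat \<lfloor>x\<rfloor>. b n * of_real (ln (x / real n))) \<le> 16 * M * x"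
proof -
  have "ln 3 \<le> ln x" using x by (subst ln_le_cancel_iff) auto
  then have lnx: "ln x > 1" using ln3_gt_1 by linarith
  \<comment> \<open>This makes \<open>x powr sg\<close> equal to \<open>exp 1 * x\<close>;
    \<open>x \<ge> 3\<close> ensures \<open>sg \<le> 2\<close>.\<close>
  define sg where "sg = 1 + 1 / ln x"
  have sg: "1 < sg" "sg \<le> 2" using lnx by (auto simp: sg_def field_simps)
  have xsg: "x powr sg = exp 1 * x"
  proof -
    have "x powr sg = x powr 1 * x powr (1 / ln x)" by (simp add: sg_def powr_add)
    also have "x powr (1 / ln x) = exp 1" using x lnx by (simp add: powr_def)
    finally show ?thesis using x by simp
  qed
  have bB: "norm (b n) \<le> 1 * ln (real n) ^ j" for n using b by simp
  let ?t = "\<lambda>n s. b n * of_nat n powr (- s)"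
  have sn: "summable (\<lambda>n. norm (?t n (of_real sg)))" by (rule ds_summable_norm[OF bB]) (use sg in simp)
  have nrm: "norm (?t n s) = norm (?t n (of_real sg))" if "Re s = sg" for n s
    using that by (simp add: norm_mult norm_of_nat_powr)
  define S where "S = (\<Sum>n. norm (?t n (of_real sg)))"
  let ?T = "\<Sum>n=1..nat \<lfloor>x\<rfloor>. b n * of_real (ln (x / real n))"
  \<comment> \<open>\<open>S\<close> may be large, but it does not depend on \<open>R\<close> and is
    divided by it.\<close>
  have main: "2 * pi * norm ?T \<le> 12 * M * (exp 1 * x) + 2 * pi * (exp 1 * x) * S / R" if R: "R > 0" for R
  proof -
    define l where "l = linepath (Complex sg (-R)) (Complex sg R)"
    let ?f = "\<lambda>N s. (\<Sum>n=1..N. ?t n s) * exp (s * of_real (ln x)) / s ^ 2"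
    let ?g = "\<lambda>s. ds b s * exp (s * of_real (ln x)) / s ^ 2"
    have limg: "Re s = sg" if zl: "s \<in> path_image l" for s
    proof -
      obtain v where v: "s = (1 - v) *\<^sub>R Complex sg (-R) + v *\<^sub>R Complex sg R" using zl by (auto simp: l_def in_segment)
      show ?thesis unfolding v by (simp add: algebra_simps)
    qed
    have nz: "s \<noteq> 0" if "s \<in> path_image l" for s using limg[OF that] sg by auto
    have ci: "(\<lambda>s. exp (s * of_real u) / s ^ 2) contour_integrable_on l" for u
      unfolding l_def by (rule contour_integrable_continuous_linepath) (use nz in \<open>auto intro!: continuous_intros simp: l_def\<close>)
    have feq: "?f N s = (\<Sum>n=1..N. b n * (exp (s * of_real (ln (x / real n))) / s ^ 2))" for N s
    proof -
      have "of_nat n powr (- s) * exp (s * of_real (ln x)) = exp (s * of_real (ln (x / real n)))" if "n \<in> {1..N}" for n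
        using that x Ln_of_real[of "real n"] by (simp add: powr_def ln_div algebra_simps flip: exp_add)
      then show ?thesis by (simp add: sum_distrib_right sum_divide_distrib mult.assoc)
    qed
    have Ci: "?f N contour_integrable_on l" for N
      unfolding feq by (intro contour_integrable_sum contour_integrable_lmul ci) auto
    have Cf: "contour_integral l (?f N) = (\<Sum>n=1..N. b n * contour_integral l (\<lambda>s. exp (s * of_real (ln (x / real n))) / s ^ 2))" for N
      unfolding feq
      by (intro contour_integral_unique has_contour_integral_sum has_contour_integral_lmul has_contour_integral_integral ci) auto
    \<comment> \<open>Uniform convergence on the segment permits termwise integration.\<close>
    have ul: "uniform_limit (path_image l) ?f ?g sequentially"
    proof -
      have "uniform_limit (path_image l) (\<lambda>N s. \<Sum>n<N. ?t n s) (\<lambda>s. \<Sum>n. ?t n s) sequentially"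
      proof (rule Weierstrass_m_test[OF _ sn])
        fix n s assume "s \<in> path_image l"
        from nrm[OF limg[OF this], of n] show "norm (?t n s) \<le> norm (?t n (of_real sg))" by (rule eq_refl)
      qed
      then have "uniform_limit (path_image l) (\<lambda>N s. \<Sum>n<Suc N. ?t n s) (\<lambda>s. \<Sum>n. ?t n s) sequentially"
        by (rule filterlim_compose[OF _ filterlim_Suc, unfolded o_def])
      moreover have "(\<Sum>n<Suc N. ?t n s) = (\<Sum>n=1..N. ?t n s)" for N s
      proof -
        have "{..<Suc N} = insert 0 {1..N}" by auto
        then show ?thesis by simp
      qed
      ultimately have "uniform_limit (path_image l) (\<lambda>N s. \<Sum>n=1..N. ?t n s) (ds b) sequentially"
        by (simp add: ds_def[abs_def])
      moreover have "bounded ((\<lambda>s. exp (s * of_real (ln x)) / s ^ 2) ` path_image l)"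
        by (intro compact_imp_bounded compact_continuous_image continuous_intros)
           (use nz in \<open>auto simp: l_def\<close>)
      moreover have "bounded (ds b ` path_image l)"
      proof (rule boundedI)
        fix y assume "y \<in> ds b ` path_image l"
        then obtain s where s: "s \<in> path_image l" "y = ds b s" by auto
        have ns: "(\<lambda>n. norm (?t n s)) = (\<lambda>n. norm (?t n (of_real sg)))"
          by (rule ext) (rule nrm[OF limg[OF s(1)]])
        have "norm (ds b s) \<le> (\<Sum>n. norm (?t n s))" unfolding ds_def
          by (rule summable_norm) (unfold ns, rule sn)
        then show "norm y \<le> S" unfolding ns S_def s(2) .
      qed
      ultimately have "uniform_limit (path_image l) (\<lambda>N s. (\<Sum>n=1..N. ?t n s) * (exp (s * of_real (ln x)) / s ^ 2)) (\<lambda>s. ds b s * (exp (s * of_real (ln x)) / s ^ 2)) sequentially"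
        by (intro uniform_lim_mult uniform_limit_const)
      then show ?thesis by simp
    qed
    have vd: "norm (vector_derivative l (at t)) \<le> 2 * R" for t
    proof -
      have "Complex sg R - Complex sg (-R) = \<i> * of_real (2 * R)" by (simp add: complex_eq_iff)
      then show ?thesis using R by (simp add: l_def norm_mult)
    qed
    have gi: "?g contour_integrable_on l"
      and lim: "(\<lambda>N. contour_integral l (?f N)) \<longlonglongrightarrow> contour_integral l ?g"
      using contour_integral_uniform_limit[OF _ ul vd] Ci by (auto simp: l_def)
    have le: "norm (contour_integral l (?f N) - 2 * pi * \<i> * (\<Sum>n=1..N. b n * of_real (max (ln (x / real n)) 0))) \<le> 2 * pi * (exp 1 * x) * S / R" for N
    proof -
      have "norm (contour_integral l (?f N) - 2 * pi * \<i> * (\<Sum>n=1..N. b n * of_real (max (ln (x / real n)) 0)))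
        = norm (\<Sum>n=1..N. b n * (contour_integral l (\<lambda>s. exp (s * of_real (ln (x / real n))) / s ^ 2) - 2 * pi * \<i> * max (ln (x / real n)) 0))"
        unfolding Cf by (simp add: sum_subtractf sum_distrib_left algebra_simps)
      also have "\<dots> \<le> (\<Sum>n=1..N. norm (?t n (of_real sg)) * (2 * pi * x powr sg / R))"
      proof (rule sum_norm_le)
        fix n assume n: "n \<in> {1..N}"
        have "norm (b n * (contour_integral l (\<lambda>s. exp (s * of_real (ln (x / real n))) / s ^ 2) - 2 * pi * \<i> * max (ln (x / real n)) 0))
          \<le> norm (b n) * (2 * pi * exp (sg * ln (x / real n)) / R)"
          unfolding norm_mult[of "b n"] l_def using perron_kernel[of sg R "ln (x / real n)"] sg R by (intro mult_left_mono) auto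
        also have "exp (sg * ln (x / real n)) = x powr sg * real n powr (- sg)"
          using n x by (simp add: powr_def ln_div algebra_simps flip: exp_add)
        finally show "norm (b n * (contour_integral l (\<lambda>s. exp (s * of_real (ln (x / real n))) / s ^ 2) - 2 * pi * \<i> * max (ln (x / real n)) 0))
          \<le> norm (?t n (of_real sg)) * (2 * pi * x powr sg / R)" by (simp add: norm_mult norm_of_nat_powr mult_ac)
      qed
      also have "\<dots> = (\<Sum>n=1..N. norm (?t n (of_real sg))) * (2 * pi * x powr sg / R)" by (rule sum_distrib_right[symmetric])
      also have "\<dots> \<le> S * (2 * pi * x powr sg / R)"
        unfolding S_def using R by (intro mult_right_mono sum_le_suminf sn) auto
      finally show ?thesis unfolding xsg by (simp add: mult_ac)
    qed
    \<comment> \<open>Terms beyond \<open>x\<close> have kernel value 0, so the partial sums become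
      stationary and the limit in \<open>N\<close> can be taken.\<close>
    have Teq: "(\<Sum>n=1..N. b n * of_real (max (ln (x / real n)) 0)) = ?T" if "N \<ge> nat \<lfloor>x\<rfloor>" for N
    proof -
      have "(\<Sum>n=1..N. b n * of_real (max (ln (x / real n)) 0)) = (\<Sum>n=1..nat \<lfloor>x\<rfloor>. b n * of_real (max (ln (x / real n)) 0))"
      proof (rule sum.mono_neutral_right)
        show "\<forall>n\<in>{1..N} - {1..nat \<lfloor>x\<rfloor>}. b n * of_real (max (ln (x / real n)) 0) = 0"
        proof
          fix n assume n: "n \<in> {1..N} - {1..nat \<lfloor>x\<rfloor>}"
          then have "x < real n" using x by (auto simp: le_nat_iff le_floor_iff not_le)
          then have "ln (x / real n) \<le> 0" using x by (simp add: field_simps)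
          then show "b n * of_real (max (ln (x / real n)) 0) = 0" by simp
        qed
      qed (use that in auto)
      also have "\<dots> = ?T"
      proof (intro sum.cong refl)
        fix n assume n: "n \<in> {1..nat \<lfloor>x\<rfloor>}"
        then have "real n \<le> x" using x by (auto simp: le_nat_iff le_floor_iff)
        then have "ln (x / real n) \<ge> 0" using n by (simp add: field_simps)
        then show "b n * of_real (max (ln (x / real n)) 0) = b n * of_real (ln (x / real n))" by simp
      qed
      finally show ?thesis .
    qed
    have lim': "(\<lambda>N. norm (contour_integral l (?f N) - 2 * pi * \<i> * ?T)) \<longlonglongrightarrow> norm (contour_integral l ?g - 2 * pi * \<i> * ?T)"
      by (intro tendsto_intros lim)
    have diff: "norm (contour_integral l ?g - 2 * pi * \<i> * ?T) \<le> 2 * pi * (exp 1 * x) * S / R"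
    proof (rule Lim_bounded[OF lim', of "nat \<lfloor>x\<rfloor>"], intro allI impI)
      fix N assume N: "N \<ge> nat \<lfloor>x\<rfloor>"
      from le[of N] show "norm (contour_integral l (?f N) - 2 * pi * \<i> * ?T) \<le> 2 * pi * (exp 1 * x) * S / R" unfolding Teq[OF N] .
    qed
    have int: "contour_integral l ?g = \<i> * integral {-R..R} (\<lambda>t. ?g (Complex sg t))"
      unfolding l_def by (rule contour_integral_linepath_same_Re) (use R in auto)
    have "norm (integral {-R..R} (\<lambda>t. ?g (Complex sg t))) \<le> integral {-R..R} (\<lambda>t. 3 * M * (exp 1 * x) * (1 + \<bar>t\<bar>) powr (- (3/2)))"
    proof (rule integral_norm_bound_integral)
      obtain I where "(?g has_contour_integral I) l" using gi by (auto simp: contour_integrable_on_def)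
      then have "((\<lambda>t. ?g (Complex sg t)) has_integral (-\<i> * I)) {-R..R}"
        unfolding l_def by (subst (asm) has_contour_integral_linepath_same_Re_iff) (use R in auto)
      then show "(\<lambda>t. ?g (Complex sg t)) integrable_on {-R..R}" by (rule has_integral_integrable)
      show "(\<lambda>t. 3 * M * (exp 1 * x) * (1 + \<bar>t\<bar>) powr (- (3/2))) integrable_on {-R..R}"
        using integrable_cmul[OF integral_three_halves_bound(1)[OF R], of "3 * M * (exp 1 * x)"] by simp
      fix t assume "t \<in> {-R..R}"
      let ?a = "1 + \<bar>t\<bar>"
      have "norm (?g (Complex sg t)) = norm (ds b (Complex sg t)) * exp (sg * ln x) / norm (Complex sg t) ^ 2"
        by (simp add: norm_mult norm_divide norm_power)
      also have "exp (sg * ln x) = exp 1 * x" using xsg x by (simp add: powr_def)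
      also have "norm (ds b (Complex sg t)) * (exp 1 * x) / norm (Complex sg t) ^ 2 \<le> (M * (sqrt 2 * ?a powr (1/2))) * (exp 1 * x) / (?a ^ 2 / 2)"
      proof (intro frac_le mult_right_mono)
        have "norm (ds b (Complex sg t)) \<le> M * (\<bar>t\<bar> + 2) powr (1/2)" using F[of "Complex sg t"] sg by simp
        also have "(\<bar>t\<bar> + 2) powr (1/2) \<le> (2 * ?a) powr (1/2)" by (intro powr_mono2) auto
        also have "\<dots> = sqrt 2 * ?a powr (1/2)" by (subst powr_mult) (auto simp: powr_half_sqrt)
        finally show "norm (ds b (Complex sg t)) \<le> M * (sqrt 2 * ?a powr (1/2))" using M by (simp add: mult_left_mono)
        have "?a ^ 2 / 2 \<le> 1 + t ^ 2" using sum_squares_bound[of 1 "\<bar>t\<bar>"] by (simp add: power2_eq_square algebra_simps)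
        also have "\<dots> \<le> sg ^ 2 + t ^ 2" using sg by (simp add: power_mono one_le_power)
        also have "\<dots> = norm (Complex sg t) ^ 2" by (simp add: cmod_power2)
        finally show "?a ^ 2 / 2 \<le> norm (Complex sg t) ^ 2" .
      qed (use M x in auto)
      also have "\<dots> = 2 * sqrt 2 * M * (exp 1 * x) * (?a powr (1/2) / ?a ^ 2)" by simp
      also have "?a powr (1/2) / ?a ^ 2 = ?a powr (- (3/2))"
      proof -
        have "?a ^ 2 = ?a powr 2" by simp
        then have "?a powr (1/2) / ?a ^ 2 = ?a powr (1/2 - 2)" by (simp only: powr_diff)
        then show ?thesis by simp
      qed
      also have "2 * sqrt 2 * M * (exp 1 * x) * ?a powr (- (3/2)) \<le> 3 * M * (exp 1 * x) * ?a powr (- (3/2))"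
      proof (intro mult_right_mono)
        have "sqrt 2 \<le> sqrt ((3/2)^2)" by (intro real_sqrt_le_mono) (simp add: power2_eq_square)
        then show "2 * sqrt 2 \<le> (3::real)" by (simp only: real_sqrt_abs)
      qed (use M x in auto)
      finally show "norm (?g (Complex sg t)) \<le> 3 * M * (exp 1 * x) * ?a powr (- (3/2))" .
    qed
    also have "\<dots> = 3 * M * (exp 1 * x) * integral {-R..R} (\<lambda>t. (1 + \<bar>t\<bar>) powr (- (3/2)))" by simp
    also have "\<dots> \<le> 3 * M * (exp 1 * x) * 4"
      using M x by (intro mult_left_mono integral_three_halves_bound(2)[OF R]) auto
    finally have "norm (contour_integral l ?g) \<le> 12 * M * (exp 1 * x)" unfolding int by (simp add: norm_mult)
    moreover have "norm (2 * pi * \<i> * ?T) = 2 * pi * norm ?T" by (simp add: norm_mult)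
    ultimately show ?thesis
      using diff norm_triangle_ineq2[of "2 * pi * \<i> * ?T" "contour_integral l ?g"] by (simp add: norm_minus_commute)
  qed
  have lim: "((\<lambda>R. 12 * M * (exp 1 * x) + 2 * pi * (exp 1 * x) * S / R) \<longlongrightarrow> 12 * M * (exp 1 * x) + 0) at_top"
    by (intro tendsto_intros real_tendsto_divide_at_top[OF tendsto_const filterlim_ident])
  have "2 * pi * norm ?T \<le> 12 * M * (exp 1 * x) + 0"
  proof (rule tendsto_lowerbound[OF lim _ trivial_limit_at_top_linorder])
    show "\<forall>\<^sub>F R in at_top. 2 * pi * norm ?T \<le> 12 * M * (exp 1 * x) + 2 * pi * (exp 1 * x) * S / R"
      using eventually_gt_at_top[of 0] by (rule eventually_mono) (rule main)
  qed
  moreover have "6 * norm ?T \<le> 2 * pi * norm ?T" using pi_gt3 by (intro mult_right_mono) auto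
  moreover have "12 * M * (exp 1 * x) \<le> 12 * M * (3 * x)" using M x exp_le by (intro mult_left_mono mult_right_mono) auto
  moreover have "12 * M * (3 * x) \<le> 6 * (16 * M * x)" using M x by (simp add: mult_ac)
  ultimately show ?thesis by linarith
qed

section \<open>Removal of the smoothing and of the logarithmic weights\<close>

text \<open>The smoothed sums at \<open>N\<close> and at \<open>N * exp et\<close> differ by
  \<open>et\<close> times the sharp sum, up to the terms in between. After division by
  \<open>et\<close> the errors are about \<open>K * N / et\<close> and
  \<open>N * et * (ln N) ^ j\<close>; equating the powers of the logarithm gives
  \<open>et = ln N powr (- j / 2)\<close>.\<close>

lemma sum_bound_from_perron:
  fixes b :: "nat \<Rightarrow> complex" and K :: real
  assumes b: "\<And>n. norm (b n) \<le> ln (real n) ^ j" and K: "K \<ge> 0"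
    and T: "\<And>x. x \<ge> 3 \<Longrightarrow> norm (\<Sum>n=1..nat \<lfloor>x\<rfloor>. b n * of_real (ln (x / real n))) \<le> K * x" and N: "N \<ge> 3"
  shows "norm (\<Sum>n=1..N. b n) \<le> (4 * K + 2 * 2 ^ j) * real N * ln (real N) powr (real j / 2)"
proof -
  define L where "L = ln (real N)"
  have "ln 3 \<le> L" unfolding L_def using N by (subst ln_le_cancel_iff) auto
  then have L: "L > 1" "ln 3 \<le> L" using ln3_gt_1 by linarith+
  define et where "et = L powr (- (real j / 2))"
  have et: "0 < et" "et \<le> 1"
  proof -
    have "L powr (- (real j / 2)) \<le> L powr 0" using L by (intro powr_mono) auto
    then show "0 < et" "et \<le> 1" using L by (auto simp: et_def)
  qed
  \<comment> \<open>With this multiplicative step \<open>ln (y / n)\<close> is exactly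
    \<open>ln (N / n) + et\<close>.\<close>
  define y where "y = real N * exp et"
  have e2: "exp et \<le> 1 + 2 * et"
  proof -
    have "exp et \<le> 1 + et + et ^ 2" using et by (intro exp_bound) auto
    also have "et ^ 2 \<le> et" using et by (simp add: power2_eq_square mult_left_le)
    finally show ?thesis by simp
  qed
  have y: "real N \<le> y" "y \<le> 3 * real N" "y \<le> real N + 2 * et * real N" "y \<ge> 3"
  proof -
    have "1 \<le> exp et" using et by simp
    then show 1: "real N \<le> y" unfolding y_def using mult_left_mono[of 1 "exp et" "real N"] by simp
    then show "y \<ge> 3" using N by linarith
    show "y \<le> real N + 2 * et * real N" unfolding y_def using mult_left_mono[OF e2, of "real N"] by (simp add: algebra_simps)
    also have "\<dots> \<le> real N + 2 * real N" using et by (simp add: mult_left_le_one_le)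
    finally show "y \<le> 3 * real N" by simp
  qed
  let ?S = "\<Sum>n=1..N. b n"
  define N' where "N' = nat \<lfloor>y\<rfloor>"
  have N': "N \<le> N'" "real N' \<le> y" unfolding N'_def using y N by (auto simp: le_nat_iff le_floor_iff)
  have Ty: "norm (\<Sum>n=1..N'. b n * of_real (ln (y / real n))) \<le> K * y" using T[of y] y by (simp add: N'_def)
  have TN: "norm (\<Sum>n=1..N. b n * of_real (ln (real N / real n))) \<le> K * real N" using T[of "real N"] N by simp
  have split: "(\<Sum>n=1..N'. b n * of_real (ln (y / real n))) =
      (\<Sum>n=1..N. b n * of_real (ln (real N / real n))) + of_real et * ?S + (\<Sum>n\<in>{N<..N'}. b n * of_real (ln (y / real n)))"
  proof -
    have "(\<Sum>n=1..N. b n * of_real (ln (y / real n))) = (\<Sum>n=1..N. b n * of_real (ln (real N / real n)) + of_real et * b n)"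
    proof (intro sum.cong refl)
      fix n assume n: "n \<in> {1..N}"
      have "ln (y / real n) = ln (real N / real n) + et"
        using n N by (simp add: y_def ln_div ln_mult)
      then show "b n * of_real (ln (y / real n)) = b n * of_real (ln (real N / real n)) + of_real et * b n"
        by (simp add: algebra_simps)
    qed
    then show ?thesis using sum_split_at[OF N'(1), of "\<lambda>n. b n * of_real (ln (y / real n))"]
      by (simp add: sum.distrib sum_distrib_left)
  qed
  have tail: "norm (\<Sum>n\<in>{N<..N'}. b n * of_real (ln (y / real n))) \<le> (2 * et * real N) * ((2 * L) ^ j * et)"
  proof -
    have "norm (\<Sum>n\<in>{N<..N'}. b n * of_real (ln (y / real n))) \<le> (\<Sum>n\<in>{N<..N'}. (2 * L) ^ j * et)"
    proof (rule sum_norm_le)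
      fix n assume n: "n \<in> {N<..N'}"
      then have n1: "real N \<le> real n" "real n \<le> y" "real n > 0" using N' N by auto
      have "norm (b n) \<le> ln (real n) ^ j" by (rule b)
      also have "\<dots> \<le> (2 * L) ^ j"
      proof (intro power_mono)
        have "ln (real n) \<le> ln (3 * real N)" using n1 y by (subst ln_le_cancel_iff) auto
        also have "\<dots> = ln 3 + L" using N by (simp add: ln_mult L_def)
        finally show "ln (real n) \<le> 2 * L" using L by simp
        show "0 \<le> ln (real n)" using n1 N by simp
      qed
      finally have 1: "norm (b n) \<le> (2 * L) ^ j" .
      have "ln (y / real n) \<le> ln (exp et)"
        using n1 N by (subst ln_le_cancel_iff) (auto simp: y_def field_simps)
      moreover have "ln (y / real n) \<ge> 0" using n1 by (simp add: field_simps)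
      ultimately have 2: "norm (complex_of_real (ln (y / real n))) \<le> et" by simp
      show "norm (b n * of_real (ln (y / real n))) \<le> (2 * L) ^ j * et"
        unfolding norm_mult by (intro mult_mono 1 2) (use L in auto)
    qed
    also have "\<dots> = real (N' - N) * ((2 * L) ^ j * et)" by simp
    also have "\<dots> \<le> (2 * et * real N) * ((2 * L) ^ j * et)"
      using N' y L et by (intro mult_right_mono) (auto simp: of_nat_diff)
    finally show ?thesis .
  qed
  have "et * norm ?S = norm (of_real et * ?S)" using et by (simp add: norm_mult)
  also have "of_real et * ?S = (\<Sum>n=1..N'. b n * of_real (ln (y / real n))) - (\<Sum>n=1..N. b n * of_real (ln (real N / real n))) -
      (\<Sum>n\<in>{N<..N'}. b n * of_real (ln (y / real n)))" using split by simp
  also have "norm \<dots> \<le> K * y + K * real N + (2 * et * real N) * ((2 * L) ^ j * et)"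
    by (intro order_trans[OF norm_triangle_ineq4] add_mono Ty TN tail)
  also have "K * y + K * real N \<le> 4 * K * real N" using mult_left_mono[OF y(2) K] by simp
  finally have "et * norm ?S \<le> 4 * K * real N + (2 * et * real N) * ((2 * L) ^ j * et)" by simp
  then have "norm ?S \<le> (4 * K * real N + (2 * et * real N) * ((2 * L) ^ j * et)) / et" using et by (simp add: field_simps)
  also have "\<dots> = 4 * K * real N * (1 / et) + 2 * 2 ^ j * real N * (L ^ j * et)" using et by (simp add: field_simps power_mult_distrib)
  also have "1 / et = L powr (real j / 2)" by (simp add: et_def powr_minus_divide)
  also have "L ^ j * et = L powr (real j / 2)"
  proof -
    have "L ^ j * et = L powr real j * L powr (- (real j / 2))" using L by (simp add: et_def powr_realpow)
    also have "\<dots> = L powr (real j - real j / 2)" by (simp flip: powr_add)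
    finally show ?thesis by simp
  qed
  finally show ?thesis by (simp add: L_def algebra_simps)
qed

lemma ln_powr_le_sqrt:
  fixes h :: real
  assumes "h > 0"
  obtains C where "C \<ge> 1" "\<And>x::real. x \<ge> 1 \<Longrightarrow> ln x powr h \<le> C * sqrt x"
proof -
  define de where "de = 1 / (2 * h)"
  have de: "de > 0" using assms by (simp add: de_def)
  show ?thesis
  proof (rule that[of "max 1 ((1 / de) powr h)"])
    fix x :: real assume x: "x \<ge> 1"
    have "ln x \<le> x powr de / de" by (rule ln_powr_bound[OF x de])
    then have "ln x powr h \<le> (x powr de / de) powr h" using x assms by (intro powr_mono2) auto
    also have "\<dots> = (1 / de) powr h * x powr (de * h)" using de by (simp add: powr_divide powr_powr)
    also have "de * h = 1/2" using assms by (simp add: de_def)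
    also have "x powr (1/2) = sqrt x" using x by (simp add: powr_half_sqrt)
    also have "(1 / de) powr h * sqrt x \<le> max 1 ((1 / de) powr h) * sqrt x" using x by (intro mult_right_mono) auto
    finally show "ln x powr h \<le> max 1 ((1 / de) powr h) * sqrt x" .
  qed simp
qed

text \<open>Above \<open>sqrt N\<close> the logarithm is at least half of \<open>ln N\<close>, and
  below it there are too few terms to matter.\<close>

lemma sum_ln_powr_bound:
  fixes h :: real
  assumes h: "h > 0"
  obtains C where "C \<ge> 1" "\<And>N. N \<ge> 2 \<Longrightarrow> (\<Sum>n=2..N. ln (real n) powr (- h)) \<le> C * real N * ln (real N) powr (- h)"
proof -
  obtain C where C: "C \<ge> 1" "\<And>x::real. x \<ge> 1 \<Longrightarrow> ln x powr h \<le> C * sqrt x" using ln_powr_le_sqrt[OF h] by blast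
  have ln2: "0 < ln (2::real)" by simp
  define A where "A = ln 2 powr (- h)"
  have A: "A > 0" by (simp add: A_def)
  show ?thesis
  proof (rule that[of "A * C + 2 powr h"])
    have "2 powr h \<ge> 1" using h by (simp add: ge_one_powr_ge_zero)
    then show "A * C + 2 powr h \<ge> 1" using A C by (simp add: add_increasing)
    fix N :: nat assume N: "N \<ge> 2"
    define L where "L = ln (real N)"
    have L: "L > 0" using N by (simp add: L_def)
    define Y where "Y = nat \<lfloor>sqrt (real N)\<rfloor>"
    have sq: "real Y \<le> sqrt (real N)" "sqrt (real N) < real (Suc Y)" using sqrt_floor[of "real N"] N by (auto simp: Y_def)
    have "(\<Sum>n=2..N. ln (real n) powr (- h)) \<le> (\<Sum>n=2..N. (if n \<le> Y then A else 0) + 2 powr h * L powr (- h))"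
    proof (rule sum_mono)
      fix n assume n: "n \<in> {2..N}"
      show "ln (real n) powr (- h) \<le> (if n \<le> Y then A else 0) + 2 powr h * L powr (- h)"
      proof (cases "n \<le> Y")
        case True
        have "ln 2 \<le> ln (real n)" using n by (subst ln_le_cancel_iff) auto
        then have "ln (real n) powr (- h) \<le> A" unfolding A_def using h ln2 by (intro powr_mono2') auto
        then show ?thesis using True by (simp add: add_increasing2)
      next
        case False
        then have "sqrt (real N) \<le> real n" using sq by linarith
        then have "ln (sqrt (real N)) \<le> ln (real n)" using N n by (subst ln_le_cancel_iff) auto
        then have "L / 2 \<le> ln (real n)" using N by (simp add: ln_sqrt L_def)
        then have "ln (real n) powr (- h) \<le> (L / 2) powr (- h)" using L h by (intro powr_mono2') auto
        also have "\<dots> = 2 powr h * L powr (- h)" using L by (simp add: powr_divide powr_minus field_simps)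
        finally show ?thesis using False by simp
      qed
    qed
    also have "\<dots> = (\<Sum>n=2..N. if n \<le> Y then A else 0) + real (N - 1) * (2 powr h * L powr (- h))"
      by (simp add: sum.distrib)
    also have "\<dots> \<le> A * sqrt (real N) + real N * (2 powr h * L powr (- h))"
    proof (intro add_mono mult_right_mono)
      have "(\<Sum>n=2..N. if n \<le> Y then A else 0) \<le> (\<Sum>n=1..Y. A)"
        unfolding sum.inter_filter[symmetric, OF finite_atLeastAtMost] using A by (intro sum_mono2) auto
      also have "\<dots> \<le> A * sqrt (real N)" using sq A by (simp add: mult.commute)
      finally show "(\<Sum>n=2..N. if n \<le> Y then A else 0) \<le> A * sqrt (real N)" .
    qed auto
    also have "A * sqrt (real N) \<le> A * (C * real N * L powr (- h))"
    proof (intro mult_left_mono)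
      have "L powr h \<le> C * sqrt (real N)" using C(2)[of "real N"] N by (simp add: L_def)
      then have "sqrt (real N) * L powr h \<le> sqrt (real N) * (C * sqrt (real N))" by (intro mult_left_mono) auto
      also have "\<dots> = C * real N" by simp
      finally have "sqrt (real N) \<le> C * real N / L powr h" using L by (simp add: field_simps)
      then show "sqrt (real N) \<le> C * real N * L powr (- h)" by (simp add: powr_minus_divide)
    qed (use A in simp)
    finally show "(\<Sum>n=2..N. ln (real n) powr (- h)) \<le> (A * C + 2 powr h) * real N * ln (real N) powr (- h)"
      by (simp add: L_def algebra_simps)
  qed
qed

lemma ln_powr_diff:
  fixes m :: real
  assumes m: "m \<ge> 0" and n: "n \<ge> (2::nat)"
  shows "norm (complex_of_real (ln (real n) powr (- m)) - of_real (ln (real (Suc n)) powr (- m))) \<le> m * ln (real n) powr (- m - 1) / real n"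
proof -
  have "\<exists>z>real n. z < real n + 1 \<and> ln (real n + 1) powr (- m) - ln (real n) powr (- m) = (real n + 1 - real n) * (- m * ln z powr (- m - 1) * (1 / z))"
    using n by (intro MVT2) (auto intro!: derivative_eq_intros)
  then obtain z where z: "z > real n" "ln (real n + 1) powr (- m) - ln (real n) powr (- m) = - m * ln z powr (- m - 1) * (1 / z)" by auto
  have "norm (complex_of_real (ln (real n) powr (- m)) - of_real (ln (real (Suc n)) powr (- m))) = \<bar>ln (real n) powr (- m) - ln (real n + 1) powr (- m)\<bar>"
    by (simp only: of_real_diff[symmetric] norm_of_real) (simp add: add.commute)
  also have "\<dots> = m * (ln z powr (- m - 1) * (1 / z))" using z m n by (subst abs_minus_commute) (simp add: z(2) abs_mult)
  also have "\<dots> \<le> m * (ln (real n) powr (- m - 1) * (1 / real n))"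
  proof (intro mult_left_mono mult_mono)
    have "ln (real n) \<le> ln z" using z n by (subst ln_le_cancel_iff) auto
    then show "ln z powr (- m - 1) \<le> ln (real n) powr (- m - 1)" using n m by (intro powr_mono2') auto
    show "1 / z \<le> 1 / real n" using z n by (intro divide_left_mono) auto
  qed (use m z n in auto)
  finally show ?thesis by simp
qed

text \<open>In the partial summation against \<open>ln n powr (- m)\<close> the boundary term has
  the stated size, and the differences of the weights gain a further
  \<open>1 / (n ln n)\<close>.\<close>

lemma abel_log_weights:
  fixes a m :: real
  assumes a: "a \<ge> 0" and m: "m > a"
  obtains C where "C \<ge> 1" "\<And>(b :: nat \<Rightarrow> complex) K N. \<lbrakk>K \<ge> 0; \<And>n. n \<ge> 2 \<Longrightarrow> norm (\<Sum>i\<in>{1<..n}. b i) \<le> K * real n * ln (real n) powr a; N \<ge> 2\<rbrakk> \<Longrightarrow>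
    norm (\<Sum>n\<in>{1<..N}. b n * of_real (ln (real n) powr (- m))) \<le> C * K * real N * ln (real N) powr (a - m)"
proof -
  obtain C where C: "C \<ge> 1" "\<And>N. N \<ge> 2 \<Longrightarrow> (\<Sum>n=2..N. ln (real n) powr (- (m + 1 - a))) \<le> C * real N * ln (real N) powr (- (m + 1 - a))"
    using sum_ln_powr_bound[of "m + 1 - a"] m by auto
  show ?thesis
  proof (rule that[of "1 + m * C / ln 2"])
    show "1 + m * C / ln 2 \<ge> 1" using a m C by simp
    fix b :: "nat \<Rightarrow> complex" and K :: real and N :: nat
    assume K: "K \<ge> 0" and B: "\<And>n. n \<ge> 2 \<Longrightarrow> norm (\<Sum>i\<in>{1<..n}. b i) \<le> K * real n * ln (real n) powr a" and N: "N \<ge> 2"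
    define L where "L = ln (real N)"
    have L: "L \<ge> ln 2" unfolding L_def using N by (subst ln_le_cancel_iff) auto
    have L0: "L > 0" using L ln_gt_zero[of 2] by linarith
    let ?g = "\<lambda>n. complex_of_real (ln (real n) powr (- m))"
    have "norm (\<Sum>n\<in>{1<..N}. b n * ?g n) \<le> norm ((\<Sum>n\<in>{1<..N}. b n) * ?g N) + norm (\<Sum>n\<in>{1<..<N}. (\<Sum>i\<in>{1<..n}. b i) * (?g n - ?g (Suc n)))"
      using N by (subst abel_sum_identity) (auto intro: norm_triangle_ineq)
    also have "norm ((\<Sum>n\<in>{1<..N}. b n) * ?g N) \<le> K * real N * L powr a * L powr (- m)"
      unfolding norm_mult using B[OF N] by (intro mult_mono) (auto simp: L_def K)
    also have "K * real N * L powr a * L powr (- m) = K * real N * L powr (a - m)" by (simp add: powr_diff powr_minus field_simps)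
    also have "norm (\<Sum>n\<in>{1<..<N}. (\<Sum>i\<in>{1<..n}. b i) * (?g n - ?g (Suc n))) \<le> (\<Sum>n\<in>{1<..<N}. K * m * ln (real n) powr (- (m + 1 - a)))"
    proof (rule sum_norm_le)
      fix n assume "n \<in> {1<..<N}"
      then have n: "n \<ge> 2" by auto
      have "norm ((\<Sum>i\<in>{1<..n}. b i) * (?g n - ?g (Suc n))) \<le> (K * real n * ln (real n) powr a) * (m * ln (real n) powr (- m - 1) / real n)"
        unfolding norm_mult using B[OF n] ln_powr_diff[of m n] a m n K by (intro mult_mono) auto
      also have "\<dots> = K * m * (ln (real n) powr a * ln (real n) powr (- m - 1))" using n by simp
      also have "ln (real n) powr a * ln (real n) powr (- m - 1) = ln (real n) powr (- (m + 1 - a))"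
        by (simp add: algebra_simps flip: powr_add)
      finally show "norm ((\<Sum>i\<in>{1<..n}. b i) * (?g n - ?g (Suc n))) \<le> K * m * ln (real n) powr (- (m + 1 - a))" .
    qed
    also have "\<dots> = K * m * (\<Sum>n\<in>{1<..<N}. ln (real n) powr (- (m + 1 - a)))" by (simp only: sum_distrib_left)
    also have "\<dots> \<le> K * m * (\<Sum>n=2..N. ln (real n) powr (- (m + 1 - a)))"
      using K a m by (intro mult_left_mono sum_mono2) auto
    also have "\<dots> \<le> K * m * (C * real N * L powr (- (m + 1 - a)))"
      unfolding L_def using K a m by (intro mult_left_mono C(2) N) auto
    also have "L powr (- (m + 1 - a)) = L powr (a - m) * L powr (- 1)"
      by (simp only: powr_add[symmetric]) (simp add: algebra_simps)
    also have "L powr (- 1) = 1 / L" using L0 by (simp add: powr_minus_divide)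
    also have "K * m * (C * real N * (L powr (a - m) * (1 / L))) \<le> K * m * (C * real N * (L powr (a - m) * (1 / ln 2)))"
      using K a m C L L0 by (intro mult_left_mono divide_left_mono) auto
    finally show "norm (\<Sum>n\<in>{1<..N}. b n * ?g n) \<le> (1 + m * C / ln 2) * K * real N * ln (real N) powr (a - m)"
      by (simp add: L_def algebra_simps)
  qed
qed

subsection \<open>The Siegel-Walfisz theorem for the residue class 1\<close>

lemma weighted_sum_bound:
  obtains C where "C \<ge> 1" "\<And>(b :: nat \<Rightarrow> complex) M N. \<lbrakk>M \<ge> 1; \<And>n. norm (b n) \<le> ln (real n) ^ Suc k;
     \<And>s. \<lbrakk>1 < Re s; Re s \<le> 2\<rbrakk> \<Longrightarrow> norm (ds b s) \<le> M * ht s powr (1/2); N \<ge> 2\<rbrakk> \<Longrightarrow>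
     norm (\<Sum>n\<in>{1<..N}. b n * of_real (ln (real n) powr (- real (Suc k)))) \<le> C * M * real N * ln (real N) powr (- (real (Suc k) / 2))"
proof -
  define a where "a = real (Suc k) / 2"
  have a: "a \<ge> 0" "real (Suc k) > a" by (auto simp: a_def)
  obtain C where C: "C \<ge> 1" "\<And>(b :: nat \<Rightarrow> complex) K N. \<lbrakk>K \<ge> 0; \<And>n. n \<ge> 2 \<Longrightarrow> norm (\<Sum>i\<in>{1<..n}. b i) \<le> K * real n * ln (real n) powr a; N \<ge> 2\<rbrakk> \<Longrightarrow>
    norm (\<Sum>n\<in>{1<..N}. b n * of_real (ln (real n) powr (- real (Suc k)))) \<le> C * K * real N * ln (real N) powr (a - real (Suc k))"
    using abel_log_weights[OF a] by blast
  define D where "D = 64 + 2 * 2 ^ Suc k + ln 2 powr (- a)"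
  have D: "D \<ge> 1" unfolding D_def by (simp add: add_nonneg_nonneg add_increasing2)
  show ?thesis
  proof (rule that[of "C * D"])
    show "C * D \<ge> 1" using C D mult_mono[of 1 C 1 D] by simp
    fix b :: "nat \<Rightarrow> complex" and M :: real and N :: nat
    assume M: "M \<ge> 1" and b: "\<And>n. norm (b n) \<le> ln (real n) ^ Suc k"
      and F: "\<And>s. \<lbrakk>1 < Re s; Re s \<le> 2\<rbrakk> \<Longrightarrow> norm (ds b s) \<le> M * ht s powr (1/2)" and N: "N \<ge> 2"
    have M0: "M \<ge> 0" using M by simp
    have b1: "b 1 = 0" using b[of 1] by simp
    have DM: "D * M = 64 * M + 2 * 2 ^ Suc k * M + ln 2 powr (- a) * M" by (simp add: D_def algebra_simps)
    have p2: "(2::real) * 2 ^ Suc k * 1 \<le> 2 * 2 ^ Suc k * M" by (rule mult_left_mono[OF M]) simp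
    have pa: "ln 2 powr (- a) * 1 \<le> ln 2 powr (- a) * M" by (rule mult_left_mono[OF M]) simp
    have pa0: "ln 2 powr (- a) \<ge> 0" by simp
    have pk0: "(2::real) * 2 ^ Suc k \<ge> 0" by simp
    have B: "norm (\<Sum>i\<in>{1<..n}. b i) \<le> (D * M) * real n * ln (real n) powr a" if n: "n \<ge> 2" for n
    \<comment> \<open>The bound from Perron's formula starts at 3, where the logarithm exceeds 1;
      \<open>n = 2\<close> is treated directly.\<close>
    proof (cases "n \<ge> 3")
      case True
      have "(\<Sum>i=1..n. b i) = b 1 + (\<Sum>i\<in>{1<..n}. b i)" using n by (intro sum.head) auto
      then have "norm (\<Sum>i\<in>{1<..n}. b i) = norm (\<Sum>i=1..n. b i)" using b1 by simp
      also have "\<dots> \<le> (4 * (16 * M) + 2 * 2 ^ Suc k) * real n * ln (real n) powr (real (Suc k) / 2)"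
        by (rule sum_bound_from_perron[OF b _ perron_sum_bound[OF b M0 F] True]) (use M in auto)
      also have "\<dots> \<le> (D * M) * real n * ln (real n) powr (real (Suc k) / 2)"
        by (intro mult_right_mono) (use DM p2 pa pa0 in linarith, auto)
      finally show ?thesis by (simp add: a_def)
    next
      case False
      then have n2: "n = 2" using n by simp
      have "{1<..2::nat} = {2}" by auto
      then have "norm (\<Sum>i\<in>{1<..n}. b i) = norm (b 2)" by (simp add: n2)
      also have "\<dots> \<le> ln 2 ^ Suc k" using b[of 2] by simp
      also have "\<dots> \<le> 1" using ln_2_less_1 by (intro power_le_one) auto
      also have "1 = ln 2 powr (- a) * ln 2 powr a" by (simp flip: powr_add)
      also have "\<dots> \<le> (D * M) * ln 2 powr a" by (intro mult_right_mono) (use DM p2 pa pa0 pk0 M in linarith, simp)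
      also have "\<dots> \<le> 2 * ((D * M) * ln 2 powr a)" using D M by simp
      finally show ?thesis by (simp add: n2 mult_ac)
    qed
    have "norm (\<Sum>n\<in>{1<..N}. b n * of_real (ln (real n) powr (- real (Suc k)))) \<le> C * (D * M) * real N * ln (real N) powr (a - real (Suc k))"
      by (rule C(2)) (use B D M N in auto)
    also have "a - real (Suc k) = - (real (Suc k) / 2)" by (simp add: a_def field_simps)
    finally show "norm (\<Sum>n\<in>{1<..N}. b n * of_real (ln (real n) powr (- real (Suc k)))) \<le> C * D * M * real N * ln (real N) powr (- (real (Suc k) / 2))"
      by (simp add: mult_ac)
  qed
qed

text \<open>Equal to \<open>1 / i\<close> at the prime power \<open>p ^ i\<close> and 0 elsewhere,
  as in Riemann's weighted count of prime powers. Primes have weight 1, so sums of it count them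
  directly.\<close>

definition pweight :: "nat \<Rightarrow> real" where
  "pweight n = mangoldt n / ln (real n)"

text \<open>\<open>k + 1\<close> logarithms are divided out; half of them pay for the removal of the
  smoothing, and the other half is the saving.\<close>

lemma log_divided_sum_bound:
  fixes H :: real
  assumes H: "H > 0" and k: "k \<ge> 1" "real (Suc k) / 2 \<ge> H"
  obtains C where "C \<ge> 1" "\<And>(a :: nat \<Rightarrow> complex) M N. \<lbrakk>M \<ge> 1; \<And>n. n \<ge> 2 \<Longrightarrow> norm (a n) \<le> ln (real n);
     \<And>s. \<lbrakk>1 < Re s; Re s \<le> 2\<rbrakk> \<Longrightarrow> norm (ds (\<lambda>n. a n * of_real (ln (real n) ^ k)) s) \<le> M * ht s powr (1/2); N \<ge> 2\<rbrakk> \<Longrightarrow>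
     norm (\<Sum>n\<in>{1<..N}. a n / of_real (ln (real n))) \<le> C * M * real N * ln (real N) powr (- H)"
proof -
  define h where "h = real (Suc k) / 2"
  have h: "h \<ge> H" using k by (simp add: h_def)
  obtain C where C: "C \<ge> 1" "\<And>(b :: nat \<Rightarrow> complex) M N. \<lbrakk>M \<ge> 1; \<And>n. norm (b n) \<le> ln (real n) ^ Suc k;
     \<And>s. \<lbrakk>1 < Re s; Re s \<le> 2\<rbrakk> \<Longrightarrow> norm (ds b s) \<le> M * ht s powr (1/2); N \<ge> 2\<rbrakk> \<Longrightarrow>
     norm (\<Sum>n\<in>{1<..N}. b n * of_real (ln (real n) powr (- real (Suc k)))) \<le> C * M * real N * ln (real N) powr (- h)"
    using weighted_sum_bound[of k] unfolding h_def by blast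
  \<comment> \<open>\<open>ln N\<close> is below 1 at \<open>N = 2\<close>; this constant pays for
    lowering the exponent from \<open>h\<close> to \<open>H\<close> there.\<close>
  define c where "c = ln 2 powr (H - h)"
  have "1 \<le> c" unfolding c_def using powr_mono2'[of "H - h" "ln 2" 1] ln_2_less_1 h by simp
  show ?thesis
  proof (rule that[of "C * c"])
    show "C * c \<ge> 1" using C \<open>1 \<le> c\<close> by (simp add: mult_ge1_I)
    fix a :: "nat \<Rightarrow> complex" and M :: real and N :: nat
    assume M: "M \<ge> 1" and a: "\<And>n. n \<ge> 2 \<Longrightarrow> norm (a n) \<le> ln (real n)" and N: "N \<ge> 2"
      and F: "\<And>s. \<lbrakk>1 < Re s; Re s \<le> 2\<rbrakk> \<Longrightarrow> norm (ds (\<lambda>n. a n * of_real (ln (real n) ^ k)) s) \<le> M * ht s powr (1/2)"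
    let ?w = "\<lambda>n. of_real (ln (real n) powr (- real (Suc k))) :: complex"
    have "norm (a n * of_real (ln (real n) ^ k)) \<le> ln (real n) ^ Suc k" for n
    proof (cases "n \<ge> 2")
      case True
      then show ?thesis using a[OF True] by (simp add: norm_mult norm_power mult_right_mono)
    next
      \<comment> \<open>\<open>k \<ge> 1\<close> makes the weight \<open>ln n ^ k\<close> vanish at
        0 and 1, where nothing is assumed about \<open>a n\<close>; for
        \<open>mangoldt n - 1\<close> the value at 1 is not 0.\<close>
      case False
      then have "n = 0 \<or> n = 1" by auto
      then show ?thesis using k by (auto simp: zero_power)
    qed
    then have "norm (\<Sum>n\<in>{1<..N}. a n * of_real (ln (real n) ^ k) * ?w n) \<le> C * M * real N * ln (real N) powr (- h)"
      by (rule C(2)[OF M _ F N])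
    also have "(\<Sum>n\<in>{1<..N}. a n * of_real (ln (real n) ^ k) * ?w n) = (\<Sum>n\<in>{1<..N}. a n / of_real (ln (real n)))"
    proof (rule sum.cong)
      fix n assume "n \<in> {1<..N}"
      then have "ln (real n) > 0" by simp
      then have "ln (real n) ^ k * ln (real n) powr (- real (Suc k)) = 1 / ln (real n)"
        by (simp add: powr_minus powr_realpow field_simps del: of_nat_Suc)
      then have "of_real (ln (real n) ^ k) * ?w n = of_real (1 / ln (real n))" by (metis of_real_mult)
      then show "a n * of_real (ln (real n) ^ k) * ?w n = a n / of_real (ln (real n))" by (simp add: mult.assoc)
    qed simp
    also have "C * M * real N * ln (real N) powr (- h) \<le> C * M * real N * (c * ln (real N) powr (- H))"
    proof (rule mult_left_mono)
      have "ln 2 \<le> ln (real N)" using N by (subst ln_le_cancel_iff) auto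
      then have "ln (real N) powr (H - h) \<le> c" unfolding c_def using h by (intro powr_mono2') auto
      then have "ln (real N) powr (H - h) * ln (real N) powr (- H) \<le> c * ln (real N) powr (- H)" by (intro mult_right_mono) auto
      then show "ln (real N) powr (- h) \<le> c * ln (real N) powr (- H)" by (simp flip: powr_add)
    qed (use C M in simp)
    finally show "norm (\<Sum>n\<in>{1<..N}. a n / of_real (ln (real n))) \<le> C * c * M * real N * ln (real N) powr (- H)"
      by (simp add: mult_ac)
  qed
qed

lemma pweight_character_sum:
  fixes H :: real
  assumes H: "H > 0"
  obtains C where "C \<ge> 1" "\<And>q X N. \<lbrakk>q > 0; dchar q X; X \<noteq> pchar q; N \<ge> 2\<rbrakk> \<Longrightarrow>
     norm (\<Sum>n\<in>{1<..N}. X n * of_real (pweight n)) \<le> C * real q * real N * ln (real N) powr (- H)"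
proof -
  \<comment> \<open>Large enough for \<open>(k + 1) / 2 \<ge> H\<close>.\<close>
  define k where "k = Suc (nat \<lceil>2 * H\<rceil>)"
  have k: "k \<ge> 1" "real (Suc k) / 2 \<ge> H" using of_nat_ceiling[of "2 * H"] unfolding k_def by simp_all
  obtain C2 where C2: "C2 \<ge> 1" "\<And>(a :: nat \<Rightarrow> complex) M N. \<lbrakk>M \<ge> 1; \<And>n. n \<ge> 2 \<Longrightarrow> norm (a n) \<le> ln (real n);
     \<And>s. \<lbrakk>1 < Re s; Re s \<le> 2\<rbrakk> \<Longrightarrow> norm (ds (\<lambda>n. a n * of_real (ln (real n) ^ k)) s) \<le> M * ht s powr (1/2); N \<ge> 2\<rbrakk> \<Longrightarrow>
     norm (\<Sum>n\<in>{1<..N}. a n / of_real (ln (real n))) \<le> C2 * M * real N * ln (real N) powr (- H)"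
    using log_divided_sum_bound[OF H k] by blast
  obtain C1 where C1: "C1 \<ge> 1" "\<And>q X s. \<lbrakk>q > 0; dchar q X; X \<noteq> pchar q; 1 < Re s; Re s \<le> 2\<rbrakk> \<Longrightarrow>
     norm (ds (\<lambda>n. X n * mangoldt n * of_real (ln (real n) ^ k)) s) \<le> C1 * (real q * ht s) powr (1/2)"
    using mangoldt_dchar_bound by blast
  show ?thesis
  proof (rule that[of "C2 * C1"])
    show "C2 * C1 \<ge> 1" using C1 C2 by (simp add: mult_ge1_I)
    fix q X N assume q: "q > 0" and X: "dchar q X" "X \<noteq> pchar q" and N: "N \<ge> (2::nat)"
    have q1: "real q \<ge> 1" using q by simp
    have "norm (\<Sum>n\<in>{1<..N}. X n * mangoldt n / of_real (ln (real n))) \<le> C2 * (C1 * real q) * real N * ln (real N) powr (- H)"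
    proof (rule C2(2)[OF _ _ _ N])
      show "C1 * real q \<ge> 1" using C1 q1 by (simp add: mult_ge1_I)
      show "norm (X n * mangoldt n) \<le> ln (real n)" for n
        using norm_mangoldt_coeff_le[of X n 0] dchar_norm_le[OF q X(1)] by simp
      fix s assume s: "1 < Re s" "Re s \<le> 2"
      have "norm (ds (\<lambda>n. X n * mangoldt n * of_real (ln (real n) ^ k)) s) \<le> C1 * (real q * ht s) powr (1/2)" by (rule C1(2)[OF q X s])
      \<comment> \<open>The modulus enters as a square root; the weaker factor \<open>q\<close> is
        sufficient for moduli that are powers of a logarithm.\<close>
      also have "(real q * ht s) powr (1/2) = sqrt (real q) * ht s powr (1/2)"
        by (subst powr_mult) (auto simp: powr_half_sqrt)
      also have "C1 * \<dots> \<le> C1 * (real q * ht s powr (1/2))"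
        using C1 q1 by (intro mult_left_mono mult_right_mono) (auto simp: real_sqrt_le_iff intro!: real_le_lsqrt self_le_power)
      finally show "norm (ds (\<lambda>n. X n * mangoldt n * of_real (ln (real n) ^ k)) s) \<le> C1 * real q * ht s powr (1/2)" by (simp add: mult_ac)
    qed
    then show "norm (\<Sum>n\<in>{1<..N}. X n * of_real (pweight n)) \<le> C2 * C1 * real q * real N * ln (real N) powr (- H)"
      by (simp add: pweight_def mult_ac)
  qed
qed

lemma pweight_sum:
  fixes H :: real
  assumes H: "H > 0"
  obtains C where "C \<ge> 1" "\<And>N. N \<ge> 2 \<Longrightarrow> \<bar>(\<Sum>n\<in>{1<..N}. pweight n) - (\<Sum>n\<in>{1<..N}. 1 / ln (real n))\<bar> \<le> C * real N * ln (real N) powr (- H)"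
proof -
  define k where "k = Suc (nat \<lceil>2 * H\<rceil>)"
  have k: "k \<ge> 1" "real (Suc k) / 2 \<ge> H" using of_nat_ceiling[of "2 * H"] unfolding k_def by simp_all
  obtain C2 where C2: "C2 \<ge> 1" "\<And>(a :: nat \<Rightarrow> complex) M N. \<lbrakk>M \<ge> 1; \<And>n. n \<ge> 2 \<Longrightarrow> norm (a n) \<le> ln (real n);
     \<And>s. \<lbrakk>1 < Re s; Re s \<le> 2\<rbrakk> \<Longrightarrow> norm (ds (\<lambda>n. a n * of_real (ln (real n) ^ k)) s) \<le> M * ht s powr (1/2); N \<ge> 2\<rbrakk> \<Longrightarrow>
     norm (\<Sum>n\<in>{1<..N}. a n / of_real (ln (real n))) \<le> C2 * M * real N * ln (real N) powr (- H)"
    using log_divided_sum_bound[OF H k] by blast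
  obtain C1 where C1: "C1 \<ge> 1" "\<And>s. \<lbrakk>1 < Re s; Re s \<le> 2\<rbrakk> \<Longrightarrow>
     norm (ds (\<lambda>n. (mangoldt n - 1) * of_real (ln (real n) ^ k)) s) \<le> C1 * ht s powr (1/2)"
    using mangoldt_minus_one_bound by blast
  show ?thesis
  proof (rule that[of "C2 * C1"])
    show "C2 * C1 \<ge> 1" using C1 C2 by (simp add: mult_ge1_I)
    fix N assume N: "N \<ge> (2::nat)"
    have "norm (mangoldt n - 1 :: complex) \<le> ln (real n)" if n: "n \<ge> 2" for n
    proof -
      have "norm (mangoldt n - 1 :: complex) = \<bar>mangoldt n - 1\<bar>"
        by (metis norm_of_real of_real_1 of_real_diff of_real_mangoldt)
      moreover have "mangoldt n \<le> ln (real n)" "0 \<le> (mangoldt n::real)" using mangoldt_le[of n] mangoldt_nonneg n by auto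
      moreover have "1 - mangoldt n \<le> ln (real n)"
      \<comment> \<open>Only at \<open>n = 2\<close> is \<open>ln n\<close> below 1, and there
        \<open>1 - ln 2 \<le> ln 2\<close>.\<close>
      proof (cases "n = 2")
        case True
        then show ?thesis using ln2_ge_two_thirds by simp
      next
        case False
        then have "ln 3 \<le> ln (real n)" using n by (subst ln_le_cancel_iff) auto
        then show ?thesis using ln3_gt_1 mangoldt_nonneg[of n] by linarith
      qed
      ultimately show ?thesis by linarith
    qed
    then have "norm (\<Sum>n\<in>{1<..N}. (mangoldt n - 1) / complex_of_real (ln (real n))) \<le> C2 * C1 * real N * ln (real N) powr (- H)"
      by (rule C2(2)[OF C1(1) _ C1(2) N])
    also have "(\<Sum>n\<in>{1<..N}. (mangoldt n - 1) / complex_of_real (ln (real n))) = of_real ((\<Sum>n\<in>{1<..N}. pweight n) - (\<Sum>n\<in>{1<..N}. 1 / ln (real n)))"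
      unfolding sum_subtractf[symmetric] of_real_sum by (rule sum.cong) (simp_all add: pweight_def diff_divide_distrib)
    finally show "\<bar>(\<Sum>n\<in>{1<..N}. pweight n) - (\<Sum>n\<in>{1<..N}. 1 / ln (real n))\<bar> \<le> C2 * C1 * real N * ln (real N) powr (- H)"
      by (simp only: norm_of_real)
  qed
qed

lemma pweight_bounds: "0 \<le> pweight n" "pweight n \<le> 1"
proof -
  show "0 \<le> pweight n"
    by (cases "n = 0") (auto simp: pweight_def mangoldt_nonneg intro!: divide_nonneg_nonneg)
  show "pweight n \<le> 1"
  proof (cases "n \<ge> 2")
    case True
    then show ?thesis using mangoldt_le[of n] by (auto simp: pweight_def divide_le_eq_1)
  next
    case False
    then have "n = 0 \<or> n = 1" by auto
    then show ?thesis by (auto simp: pweight_def)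
  qed
qed

lemma pweight_prime: "prime p \<Longrightarrow> pweight p = 1"
  using prime_gt_1_nat[of p] by (simp add: pweight_def)

lemma pweight_nonzeroE:
  assumes "pweight n \<noteq> 0"
  obtains p i where "prime p" "i > 0" "n = p ^ i"
  using assms by (auto simp: pweight_def mangoldt_def primepow_def split: if_splits)

text \<open>The exponents are at most \<open>2 * ln N\<close>, as \<open>ln 2 \<ge> 1/2\<close>. It
  is applied to proper prime powers, with bases up to \<open>sqrt N\<close>, and to prime powers not
  coprime to \<open>q\<close>, with bases up to \<open>q\<close>.\<close>

lemma card_prime_powers_le:
  fixes A B N :: nat
  assumes N: "N \<ge> 2" and S: "\<And>n. n \<in> S \<Longrightarrow> n \<le> N \<and> (\<exists>p i. prime p \<and> i > 0 \<and> n = p ^ i \<and> p \<le> B)"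
  shows "real (card S) \<le> real B * (2 * ln (real N))"
proof -
  have lnN: "ln (real N) \<ge> 0" using N by simp
  define K where "K = nat \<lfloor>2 * ln (real N)\<rfloor>"
  have "S \<subseteq> (\<lambda>(p,i). p ^ i) ` ({1..B} \<times> {1..K})"
  proof
    fix n assume "n \<in> S"
    then obtain p i where *: "n \<le> N" "prime p" "i > 0" "n = p ^ i" "p \<le> B" using S by blast
    have "2 ^ i \<le> p ^ i" using prime_ge_2_nat[OF *(2)] by (intro power_mono) auto
    then have "2 ^ i \<le> N" using * by linarith
    then have "(2::real) ^ i \<le> real N" by (metis of_nat_le_iff of_nat_numeral of_nat_power)
    then have "ln ((2::real) ^ i) \<le> ln (real N)" using N by (subst ln_le_cancel_iff) auto
    then have "real i * ln 2 \<le> ln (real N)" by (simp add: ln_realpow)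
    moreover have "real i * (1/2) \<le> real i * ln 2" using ln2_ge_two_thirds by (intro mult_left_mono) auto
    ultimately have "real i \<le> 2 * ln (real N)" by simp
    then have "i \<le> K" unfolding K_def using lnN by (simp add: le_nat_iff le_floor_iff)
    moreover have "p \<ge> 1" using prime_ge_2_nat[OF *(2)] by simp
    ultimately show "n \<in> (\<lambda>(p,i). p ^ i) ` ({1..B} \<times> {1..K})" using * by auto
  qed
  then have "card S \<le> card ({1..B} \<times> {1..K})" by (rule surj_card_le[rotated]) auto
  then have "real (card S) \<le> real B * real K" by (simp flip: of_nat_mult)
  also have "real K \<le> 2 * ln (real N)" unfolding K_def using lnN by linarith
  finally show ?thesis by (simp add: mult_left_mono)
qed

section \<open>The logarithmic integral\<close>

lemma inverse_ln_integrable: "a \<ge> 2 \<Longrightarrow> (\<lambda>t::real. 1 / ln t) integrable_on {a..b}"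
  by (rule integrable_continuous_real) (auto intro!: continuous_intros)

lemma Li_step:
  assumes "2 \<le> a" "a \<le> b"
  shows "Li b - Li a = integral {a..b} (\<lambda>t. 1 / ln t)"
  using Henstock_Kurzweil_Integration.integral_combine[of 2 a b "\<lambda>t. 1 / ln t"] assms inverse_ln_integrable[of 2 b]
  unfolding Li_def by simp

lemma Li_diff_bounds:
  assumes "2 \<le> a" "a \<le> b"
  shows "(b - a) / ln b \<le> Li b - Li a" "Li b - Li a \<le> (b - a) / ln a"
proof -
  have l: "ln a > 0" using assms by simp
  have "integral {a..b} (\<lambda>t. 1 / ln b) \<le> integral {a..b} (\<lambda>t. 1 / ln t)"
    using assms by (intro integral_le inverse_ln_integrable) (auto intro!: divide_left_mono)
  then show "(b - a) / ln b \<le> Li b - Li a" using assms Li_step[OF assms] by simp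
  have "integral {a..b} (\<lambda>t. 1 / ln t) \<le> integral {a..b} (\<lambda>t. 1 / ln a)"
    using assms l by (intro integral_le inverse_ln_integrable) (auto intro!: divide_left_mono)
  then show "Li b - Li a \<le> (b - a) / ln a" using assms Li_step[OF assms] by simp
qed

lemma Li_bounds:
  assumes "x \<ge> 2"
  shows "0 \<le> Li x" "Li x \<le> 2 * x"
proof -
  have L2: "Li 2 = 0" by (simp add: Li_def)
  have "0 \<le> (x - 2) / ln x" using assms by simp
  then show "0 \<le> Li x" using Li_diff_bounds(1)[of 2 x] assms L2 by linarith
  have "1 / ln 2 \<le> (2::real)" using ln2_ge_two_thirds by (simp add: field_simps)
  then have "(x - 2) * (1 / ln 2) \<le> (x - 2) * 2" using assms by (intro mult_left_mono) auto
  then show "Li x \<le> 2 * x" using Li_diff_bounds(2)[of 2 x] assms L2 by simp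
qed

lemma sum_inverse_ln_Li:
  assumes x: "x \<ge> 2"
  shows "\<bar>(\<Sum>n\<in>{1<..nat \<lfloor>x\<rfloor>}. 1 / ln (real n)) - Li x\<bar> \<le> 4"
proof -
  have c: "1 / ln 2 \<le> (2::real)" using ln2_ge_two_thirds by (simp add: field_simps)
  have c0: "1 / ln 2 \<ge> (0::real)" by simp
  have *: "Li (real N) + 1 / ln (real N) \<le> (\<Sum>n\<in>{1<..N}. 1 / ln (real n)) \<and> (\<Sum>n\<in>{1<..N}. 1 / ln (real n)) \<le> Li (real N) + 1 / ln 2" if "N \<ge> 2" for N
    using that
  proof (induction N rule: dec_induct)
    case base
    have "{1<..2::nat} = {2}" by auto
    then show ?case by (simp add: Li_def)
  next
    case (step n)
    have e: "{1<..Suc n} = insert (Suc n) {1<..n}" using step.hyps by auto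
    have "(\<Sum>i\<in>{1<..Suc n}. 1 / ln (real i)) = 1 / ln (real (Suc n)) + (\<Sum>i\<in>{1<..n}. 1 / ln (real i))" unfolding e by simp
    moreover have "1 / ln (real (Suc n)) \<le> Li (real (Suc n)) - Li (real n)" "Li (real (Suc n)) - Li (real n) \<le> 1 / ln (real n)"
      using Li_diff_bounds[of "real n" "real (Suc n)"] step.hyps by auto
    ultimately show ?case using step.IH by linarith
  qed
  define N where "N = nat \<lfloor>x\<rfloor>"
  have N: "N \<ge> 2" "real N \<le> x" "x < real N + 1" unfolding N_def using x by linarith+
  have "0 \<le> (x - real N) / ln x" using x N by simp
  then have l1: "0 \<le> Li x - Li (real N)" using Li_diff_bounds(1)[of "real N" x] N by linarith
  have "ln 2 \<le> ln (real N)" using N by (subst ln_le_cancel_iff) auto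
  then have "(x - real N) / ln (real N) \<le> 1 / ln 2" using N by (intro frac_le) auto
  then have l2: "Li x - Li (real N) \<le> 1 / ln 2" using Li_diff_bounds(2)[of "real N" x] N by linarith
  have "1 / ln (real N) \<ge> 0" using N by simp
  then show ?thesis using *[OF N(1)] l1 l2 c unfolding N_def[symmetric] by linarith
qed

text \<open>Orthogonality for the residue class 1 involves no conjugate characters. The nonprincipal
  characters share one error bound, so their number cancels against \<open>totient q\<close>; the
  principal one differs from the sum over all \<open>n\<close> by the prime powers not coprime to
  \<open>q\<close>.\<close>

theorem primes_cong_1_count:
  fixes H :: real
  assumes H: "H > 0"
  obtains C where "C \<ge> 1" "\<And>q x. \<lbrakk>q > 0; x \<ge> 2\<rbrakk> \<Longrightarrow>
    \<bar>real (card {p \<in> primes_upto x. [p = 1] (mod q)}) - Li x / real (totient q)\<bar> \<le> C * real q * (x / ln x powr H)"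
proof -
  obtain C1 where C1: "C1 \<ge> 1" "\<And>q X N. \<lbrakk>q > 0; dchar q X; X \<noteq> pchar q; N \<ge> 2\<rbrakk> \<Longrightarrow>
     norm (\<Sum>n\<in>{1<..N}. X n * of_real (pweight n)) \<le> C1 * real q * real N * ln (real N) powr (- H)"
    using pweight_character_sum[OF H] by blast
  obtain C2 where C2: "C2 \<ge> 1" "\<And>N. N \<ge> 2 \<Longrightarrow> \<bar>(\<Sum>n\<in>{1<..N}. pweight n) - (\<Sum>n\<in>{1<..N}. 1 / ln (real n))\<bar> \<le> C2 * real N * ln (real N) powr (- H)"
    using pweight_sum[OF H] by blast
  have H1: "H + 1 > 0" using H by simp
  obtain C3 where C3: "C3 \<ge> 1" "\<And>x::real. x \<ge> 1 \<Longrightarrow> ln x powr (H + 1) \<le> C3 * sqrt x" using ln_powr_le_sqrt[OF H1] by blast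
  obtain C4 where C4: "C4 \<ge> 1" "\<And>x::real. x \<ge> 1 \<Longrightarrow> ln x powr H \<le> C4 * sqrt x" using ln_powr_le_sqrt[OF H] by blast
  define C where "C = C1 * 2 powr H + 2 * C3 + C2 * 2 powr H + 4 * C4 + 2 * C3"
  show ?thesis
  proof (rule that[of C])
    have "C1 * 2 powr H \<ge> 0" "C2 * 2 powr H \<ge> 0" using C1 C2 by auto
    then show "C \<ge> 1" unfolding C_def using C3 C4 by linarith
    fix q :: nat and x :: real assume q: "q > 0" and x: "x \<ge> 2"
    define N where "N = nat \<lfloor>x\<rfloor>"
    have N: "N \<ge> 2" "real N \<le> x" "x < real N + 1" unfolding N_def using x by linarith+
    have NI: "real n \<le> x \<longleftrightarrow> n \<le> N" for n unfolding N_def using x by (simp add: le_nat_iff le_floor_iff)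
    define Y where "Y = x / ln x powr H"
    define R where "R = real N * ln (real N) powr (- H)"
    have lx: "ln x > 0" using x by simp
    have lN: "ln (real N) > 0" using N by simp
    have lNx: "ln (real N) \<le> ln x" using N by simp
    have Y0: "Y \<ge> 0" using x by (simp add: Y_def)
    have R0: "R \<ge> 0" by (simp add: R_def)
    have q1: "real q \<ge> 1" using q by simp
    \<comment> \<open>Passing from \<open>N\<close> back to \<open>x\<close> costs only a constant,
      because \<open>x < N + 1 \<le> N * N\<close>.\<close>
    have RY: "R \<le> 2 powr H * Y"
    proof -
      have "real N + 1 \<le> real N * real N" using N mult_mono[of 2 "real N" "real N" "real N"] by linarith
      then have "ln x \<le> ln (real N * real N)" using x N by (subst ln_le_cancel_iff) auto
      also have "\<dots> = 2 * ln (real N)" using N by (simp add: ln_mult)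
      finally have "ln x / 2 \<le> ln (real N)" by simp
      then have "ln (real N) powr (- H) \<le> (ln x / 2) powr (- H)" using lx H by (intro powr_mono2') auto
      also have "\<dots> = 2 powr H * ln x powr (- H)" using lx by (simp add: powr_divide powr_minus field_simps)
      finally have "R \<le> x * (2 powr H * ln x powr (- H))" unfolding R_def using N x by (intro mult_mono) auto
      then show ?thesis by (simp add: Y_def powr_minus field_simps)
    qed
    have sY: "sqrt x * ln x \<le> C3 * Y"
    proof -
      have "sqrt x * ln x powr (H + 1) \<le> sqrt x * (C3 * sqrt x)" using C3(2)[of x] x by (intro mult_left_mono) auto
      then have "sqrt x * ln x powr (H + 1) \<le> C3 * x" using x by (simp add: mult_ac)
      then show ?thesis using lx by (simp add: Y_def powr_add field_simps)
    qed
    have oY: "1 \<le> C4 * Y"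
    proof -
      have "ln x powr H \<le> C4 * sqrt x" using C4(2)[of x] x by simp
      also have "sqrt x \<le> x" using x by (intro real_le_lsqrt) (auto simp: power2_eq_square)
      finally have "ln x powr H \<le> C4 * x" using C4 by (simp add: mult_left_mono)
      then show ?thesis using lx by (simp add: Y_def field_simps)
    qed
    have "1 * ln x \<le> sqrt x * ln x" using x lx by (intro mult_right_mono) auto
    then have lY: "ln (real N) \<le> C3 * Y" using sY lNx by linarith
    define P where "P = {p \<in> primes_upto x. [p = 1] (mod q)}"
    define A where "A = {n \<in> {1<..N}. [n = 1] (mod q)}"
    have finA: "finite A" by (simp add: A_def)
    have PA: "P \<subseteq> A" unfolding P_def A_def primes_upto_def using NI prime_gt_1_nat by auto
    define S1 where "S1 = (\<Sum>n\<in>A. pweight n)"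
    have S1a: "real (card P) \<le> S1" "S1 - real (card P) \<le> 2 * C3 * Y"
    proof -
      have "(\<Sum>n\<in>P. pweight n) = (\<Sum>n\<in>P. 1)" by (rule sum.cong) (auto simp: P_def primes_upto_def pweight_prime)
      then have cP: "(\<Sum>n\<in>P. pweight n) = real (card P)" by simp
      have split: "S1 = (\<Sum>n\<in>A - P. pweight n) + real (card P)"
        unfolding S1_def cP[symmetric] by (rule sum.subset_diff[OF PA finA])
      show "real (card P) \<le> S1" unfolding split using pweight_bounds by (simp add: sum_nonneg)
      define B where "B = {n\<in>A - P. pweight n \<noteq> 0}"
      have "(\<Sum>n\<in>A - P. pweight n) = (\<Sum>n\<in>B. pweight n)" by (rule sum.mono_neutral_right) (auto simp: B_def finA)
      also have "\<dots> \<le> (\<Sum>n\<in>B. 1)" by (intro sum_mono pweight_bounds)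
      also have "\<dots> = real (card B)" by simp
      also have "\<dots> \<le> real (nat \<lfloor>sqrt (real N)\<rfloor>) * (2 * ln (real N))"
      proof (rule card_prime_powers_le[OF N(1)])
        fix n assume n: "n \<in> B"
        then obtain p i where pi: "prime p" "i > 0" "n = p ^ i" unfolding B_def by (auto elim!: pweight_nonzeroE)
        have "i \<noteq> 1"
        proof
          assume "i = 1"
          then show False using n pi NI by (auto simp: B_def A_def P_def primes_upto_def)
        qed
        then have "p ^ 2 \<le> p ^ i" using pi prime_gt_0_nat[OF pi(1)] by (intro power_increasing) auto
        moreover have nN: "n \<le> N" using n by (auto simp: B_def A_def)
        ultimately have "(real p)\<^sup>2 \<le> real N" using pi by (metis le_trans of_nat_le_iff of_nat_power)
        then have "real p \<le> sqrt (real N)" by (intro real_le_rsqrt) auto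
        then have "p \<le> nat \<lfloor>sqrt (real N)\<rfloor>" by (simp add: le_nat_iff le_floor_iff)
        then show "n \<le> N \<and> (\<exists>p i. prime p \<and> i > 0 \<and> n = p ^ i \<and> p \<le> nat \<lfloor>sqrt (real N)\<rfloor>)" using nN pi by blast
      qed
      also have "\<dots> \<le> sqrt x * (2 * ln x)"
      proof (intro mult_mono)
        have "real (nat \<lfloor>sqrt (real N)\<rfloor>) \<le> sqrt (real N)" by simp
        also have "\<dots> \<le> sqrt x" using N by simp
        finally show "real (nat \<lfloor>sqrt (real N)\<rfloor>) \<le> sqrt x" .
      qed (use lNx lN x in auto)
      also have "\<dots> \<le> 2 * C3 * Y" using sY by simp
      finally show "S1 - real (card P) \<le> 2 * C3 * Y" unfolding split by simp
    qed
    let ?T = "\<lambda>X. \<Sum>n\<in>{1<..N}. X n * complex_of_real (pweight n)"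
    have dec: "of_real (real (totient q) * S1) = (\<Sum>X | dchar q X. ?T X)"
    proof -
      have "(\<Sum>X | dchar q X. ?T X) = (\<Sum>n\<in>{1<..N}. (\<Sum>X | dchar q X. X n) * of_real (pweight n))"
        unfolding sum_distrib_right by (rule sum.swap)
      also have "\<dots> = (\<Sum>n\<in>{1<..N}. if [n = 1] (mod q) then of_real (real (totient q) * pweight n) else 0)"
        by (rule sum.cong) (auto simp: dchar_orthogonality[OF q])
      also have "\<dots> = (\<Sum>n\<in>A. of_real (real (totient q) * pweight n))" unfolding A_def by (rule sum.inter_filter[symmetric]) simp
      finally show ?thesis unfolding S1_def sum_distrib_left of_real_sum by simp
    qed
    define S0 where "S0 = (\<Sum>n\<in>{n\<in>{1<..N}. coprime n q}. pweight n)"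
    have T0: "?T (pchar q) = of_real S0"
    proof -
      have "?T (pchar q) = (\<Sum>n\<in>{1<..N}. if coprime n q then of_real (pweight n) else 0)"
        by (rule sum.cong) (auto simp: pchar_def)
      also have "\<dots> = (\<Sum>n\<in>{n\<in>{1<..N}. coprime n q}. of_real (pweight n))" by (rule sum.inter_filter[symmetric]) simp
      finally show ?thesis unfolding S0_def by simp
    qed
    have S0a: "S0 \<le> (\<Sum>n\<in>{1<..N}. pweight n)" "(\<Sum>n\<in>{1<..N}. pweight n) - S0 \<le> real q * (2 * ln (real N))"
    proof -
      have split: "(\<Sum>n\<in>{1<..N}. pweight n) = (\<Sum>n\<in>{1<..N} - {n\<in>{1<..N}. coprime n q}. pweight n) + S0"
        unfolding S0_def by (rule sum.subset_diff) auto
      show "S0 \<le> (\<Sum>n\<in>{1<..N}. pweight n)" unfolding split using pweight_bounds by (simp add: sum_nonneg)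
      define B where "B = {n\<in>{1<..N}. \<not> coprime n q \<and> pweight n \<noteq> 0}"
      have "(\<Sum>n\<in>{1<..N} - {n\<in>{1<..N}. coprime n q}. pweight n) = (\<Sum>n\<in>B. pweight n)"
        by (rule sum.mono_neutral_right) (auto simp: B_def)
      also have "\<dots> \<le> (\<Sum>n\<in>B. 1)" by (intro sum_mono pweight_bounds)
      also have "\<dots> = real (card B)" by simp
      also have "\<dots> \<le> real q * (2 * ln (real N))"
      proof (rule card_prime_powers_le[OF N(1)])
        fix n assume n: "n \<in> B"
        then obtain p i where pi: "prime p" "i > 0" "n = p ^ i" unfolding B_def by (auto elim!: pweight_nonzeroE)
        have "\<not> coprime (p ^ i) q" using n pi by (auto simp: B_def)
        then have "p dvd q" using pi prime_imp_coprime[of p q] by auto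
        then have "p \<le> q" using q by (auto dest: dvd_imp_le)
        then show "n \<le> N \<and> (\<exists>p i. prime p \<and> i > 0 \<and> n = p ^ i \<and> p \<le> q)" using n pi by (auto simp: B_def)
      qed
      finally show "(\<Sum>n\<in>{1<..N}. pweight n) - S0 \<le> real q * (2 * ln (real N))" unfolding split by simp
    qed
    define ph where "ph = real (totient q)"
    have ph: "ph \<ge> 1" using q by (simp add: ph_def Suc_le_eq)
    have main: "\<bar>ph * S1 - S0\<bar> \<le> ph * (C1 * real q * R)"
    proof -
      have "of_real (ph * S1 - S0) = (\<Sum>X \<in> {X. dchar q X} - {pchar q}. ?T X)"
        using sum.remove[OF finite_dchars[OF q], of "pchar q" ?T] pchar_dchar[OF q] dec T0 by (simp add: ph_def)
      then have "\<bar>ph * S1 - S0\<bar> = norm (\<Sum>X \<in> {X. dchar q X} - {pchar q}. ?T X)" by (metis norm_of_real)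
      also have "\<dots> \<le> (\<Sum>X \<in> {X. dchar q X} - {pchar q}. C1 * real q * R)"
      proof (rule sum_norm_le)
        fix X assume "X \<in> {X. dchar q X} - {pchar q}"
        then show "norm (?T X) \<le> C1 * real q * R" using C1(2)[OF q _ _ N(1), of X] by (auto simp: R_def mult_ac)
      qed
      also have "\<dots> = real (card ({X. dchar q X} - {pchar q})) * (C1 * real q * R)" by simp
      also have "\<dots> \<le> ph * (C1 * real q * R)"
      proof (rule mult_right_mono)
        have "card ({X. dchar q X} - {pchar q}) \<le> card {X. dchar q X}" by (intro card_mono finite_dchars[OF q]) auto
        then show "real (card ({X. dchar q X} - {pchar q})) \<le> ph" by (simp add: card_dchars[OF q] ph_def)
      qed (use C1 R0 in auto)
      finally show ?thesis .
    qed
    have S0L: "\<bar>S0 - Li x\<bar> \<le> C2 * R + 4 + real q * (2 * ln (real N))"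
      using S0a C2(2)[OF N(1)] sum_inverse_ln_Li[OF x] unfolding N_def[symmetric] R_def mult.assoc by linarith
    have "S1 - Li x / ph = (ph * S1 - Li x) / ph" using ph by (simp add: diff_divide_distrib)
    then have "\<bar>S1 - Li x / ph\<bar> = \<bar>ph * S1 - Li x\<bar> / ph" using ph by (simp add: abs_divide)
    also have "\<dots> \<le> (ph * (C1 * real q * R) + (C2 * R + 4 + real q * (2 * ln (real N)))) / ph"
      using main S0L ph by (intro divide_right_mono) linarith+
    also have "\<dots> = C1 * real q * R + (C2 * R + 4 + real q * (2 * ln (real N))) / ph" using ph by (simp add: add_divide_distrib)
    also have "(C2 * R + 4 + real q * (2 * ln (real N))) / ph \<le> (C2 * R + 4 + real q * (2 * ln (real N))) / 1"
      using ph C2 R0 lN by (intro divide_left_mono) auto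
    finally have S1L: "\<bar>S1 - Li x / ph\<bar> \<le> C1 * real q * R + (C2 * R + 4 + real q * (2 * ln (real N)))" by simp
    have b1: "C1 * real q * R \<le> C1 * real q * (2 powr H * Y)" using C1 RY by (intro mult_left_mono) auto
    have b2: "C2 * R \<le> C2 * (2 powr H * Y)" using C2 RY by (intro mult_left_mono) auto
    have b3: "real q * (2 * ln (real N)) \<le> real q * (2 * (C3 * Y))" using lY by (intro mult_left_mono) auto
    have b4: "1 * E \<le> real q * E" if "E \<ge> 0" for E using q1 that by (rule mult_right_mono)
    have "C2 * (2 powr H * Y) \<le> real q * (C2 * (2 powr H * Y))" "4 * (C4 * Y) \<le> real q * (4 * (C4 * Y))" "2 * C3 * Y \<le> real q * (2 * C3 * Y)"
      using b4[of "C2 * (2 powr H * Y)"] b4[of "4 * (C4 * Y)"] b4[of "2 * C3 * Y"] C2 C3 C4 Y0 by auto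
    moreover have "C * real q * Y = C1 * real q * (2 powr H * Y) + real q * (2 * (C3 * Y)) + real q * (C2 * (2 powr H * Y)) + real q * (4 * (C4 * Y)) + real q * (2 * C3 * Y)"
      by (simp add: C_def algebra_simps)
    ultimately have "\<bar>real (card P) - Li x / ph\<bar> \<le> C * real q * Y" using S1L S1a b1 b2 b3 oY by linarith
    then show "\<bar>real (card {p \<in> primes_upto x. [p = 1] (mod q)}) - Li x / real (totient q)\<bar> \<le> C * real q * (x / ln x powr H)"
      unfolding P_def Y_def ph_def .
  qed
qed

subsection \<open>Ramanujan sums\<close>

text \<open>The value at \<open>q^a\<close> of a Ramanujan sum whose second argument has exact exponent \<open>v\<close> at \<open>q\<close>.\<close>

definition rloc :: "nat \<Rightarrow> nat \<Rightarrow> nat \<Rightarrow> real" where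
  "rloc q v a = (if a = 0 then 1 else if a \<le> v then real q ^ (a - 1) * (real q - 1) else if a = Suc v then - (real q ^ v) else 0)"

definition rprod :: "nat \<Rightarrow> nat \<Rightarrow> real" where
  "rprod k n = (\<Prod>q\<in>prime_factors n. rloc q (multiplicity q k) (multiplicity q n))"

text \<open>This telescoping sum is the prime power case of the identity that the Ramanujan sums
  over the divisors of \<open>n\<close> add up to \<open>n\<close> if \<open>n\<close> divides
  \<open>k\<close> and to 0 otherwise; it determines \<open>rloc\<close>.\<close>

lemma rloc_sum: "(\<Sum>i\<le>a. rloc q v i) = (if a \<le> v then real q ^ a else 0)"
proof (induction a)
  case (Suc a)
  then show ?case by (cases "Suc a \<le> v") (auto simp: rloc_def algebra_simps)
qed (simp add: rloc_def)

lemma rprod_prime_power_mult: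
  assumes p: "prime p" and e: "e > 0" "\<not> p dvd e"
  shows "rprod k (p ^ i * e) = rloc p (multiplicity p k) i * rprod k e"
proof (cases "i = 0")
  case True
  then show ?thesis by (simp add: rloc_def)
next
  case False
  have pe: "p \<notin> prime_factors e" using e by auto
  have pf: "prime_factors (p ^ i * e) = insert p (prime_factors e)"
    using False p e by (subst prime_factors_product) (auto simp: prime_factors_power prime_prime_factors)
  have mp: "multiplicity p (p ^ i * e) = i"
    using p e by (subst prime_elem_multiplicity_mult_distrib) (auto simp: not_dvd_imp_multiplicity_0 prime_gt_0_nat)
  have mq: "multiplicity q (p ^ i * e) = multiplicity q e" if "q \<in> prime_factors e" for q
  proof -
    have q: "prime q" "q \<noteq> p" using that pe by (auto simp: in_prime_factors_iff)
    then have "multiplicity q (p ^ i) = 0" using p by (simp add: multiplicity_distinct_prime_power)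
    then show ?thesis using p e q by (subst prime_elem_multiplicity_mult_distrib) (auto simp: prime_gt_0_nat)
  qed
  show ?thesis unfolding rprod_def pf using pe mp mq by (simp cong: prod.cong)
qed

lemma rprod_divisor_sum:
  assumes "n > 0" "k > 0"
  shows "(\<Sum>d | d dvd n. rprod k d) = (if n dvd k then real n else 0)"
  using assms
proof (induction n rule: less_induct)
  case (less n)
  show ?case
  proof (cases "n = 1")
    case True
    then show ?thesis by (simp add: rprod_def)
  next
    case False
    then obtain p where p: "prime p" "p dvd n" using prime_factor_nat by blast
    obtain a m where am: "n = p ^ a * m" "a > 0" "\<not> p dvd m" "m < n" "m > 0" "coprime (p ^ a) m"
      using prime_power_decompose[OF less.prems(1) p] by metis
    let ?v = "multiplicity p k"
    have "(\<Sum>d | d dvd n. rprod k d) = (\<Sum>d | d dvd p ^ a. \<Sum>e | e dvd m. rprod k (d * e))"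
      unfolding am(1) using am p by (intro sum_divisors_coprime) (auto simp: prime_gt_0_nat)
    also have "\<dots> = (\<Sum>i\<le>a. \<Sum>e | e dvd m. rprod k (p ^ i * e))" by (rule sum_divisors_prime_power[OF p(1)])
    also have "\<dots> = (\<Sum>i\<le>a. \<Sum>e | e dvd m. rloc p ?v i * rprod k e)"
    proof (intro sum.cong refl)
      fix i e assume "e \<in> {e. e dvd m}"
      then have "e > 0" "\<not> p dvd e" using am by (auto intro: dvd_trans dest: dvd_pos_nat)
      then show "rprod k (p ^ i * e) = rloc p ?v i * rprod k e" by (rule rprod_prime_power_mult[OF p(1)])
    qed
    also have "\<dots> = (\<Sum>i\<le>a. rloc p ?v i) * (\<Sum>e | e dvd m. rprod k e)" by (simp add: sum_product)
    also have "\<dots> = (if a \<le> ?v then real p ^ a else 0) * (if m dvd k then real m else 0)"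
      using less.IH[OF am(4,5) less.prems(2)] by (simp add: rloc_sum)
    also have "\<dots> = (if n dvd k then real n else 0)"
    proof -
      have "a \<le> ?v \<longleftrightarrow> p ^ a dvd k" using p less.prems by (subst power_dvd_iff_le_multiplicity) (auto simp: prime_gt_1_nat)
      moreover have "n dvd k \<longleftrightarrow> p ^ a dvd k \<and> m dvd k" unfolding am(1) using am(6) by (meson divides_mult dvd_mult_left dvd_mult_right)
      ultimately show ?thesis by (simp add: am(1))
    qed
    finally show ?thesis .
  qed
qed

lemma sum_roots_of_unity:
  assumes n: "n > (0::nat)"
  shows "(\<Sum>j=1..n. exp (2 * complex_of_real pi * \<i> * of_nat j * of_nat k / of_nat n)) = (if n dvd k then of_nat n else 0)"
proof -
  define w where "w = exp (2 * complex_of_real pi * \<i> * of_nat k / of_nat n)"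
  have wj: "exp (2 * complex_of_real pi * \<i> * of_nat j * of_nat k / of_nat n) = w ^ j" for j
    unfolding w_def by (simp add: exp_of_nat_mult[symmetric] mult_ac)
  have wn: "w ^ n = 1"
  proof -
    have "w ^ n = exp (2 * complex_of_real pi * \<i> * of_nat k)" using n by (simp add: wj[symmetric] mult_ac)
    also have "\<dots> = exp (complex_of_real (2 * real k * pi) * \<i>)" by (simp add: mult_ac)
    also have "\<dots> = 1" by (rule exp_integer_2pi[unfolded of_real_mult[symmetric]]) simp
    finally show ?thesis .
  qed
  have w1: "w = 1 \<longleftrightarrow> n dvd k"
  proof
    assume "n dvd k"
    then obtain m where "k = n * m" by blast
    then have "w = exp (complex_of_real (2 * real m * pi) * \<i>)" unfolding w_def using n by (simp add: mult_ac)
    also have "\<dots> = 1" by (rule exp_integer_2pi[unfolded of_real_mult[symmetric]]) simp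
    finally show "w = 1" .
  next
    assume "w = 1"
    then have "exp (complex_of_real (2 * pi * real k / real n) * \<i>) = 1" unfolding w_def by (simp add: mult_ac)
    then obtain m :: int where "2 * pi * real k / real n = of_int (2 * m) * pi" unfolding exp_eq_1 by auto
    then have "real k = of_int m * real n" using n by (simp add: field_simps)
    then have "int k = m * int n" by (metis of_int_eq_iff of_int_mult of_int_of_nat_eq)
    then have "int n dvd int k" by simp
    then show "n dvd k" by simp
  qed
  have "(\<Sum>j=1..n. w ^ j) = (\<Sum>j<n. w ^ Suc j)" by (rule sum.reindex_bij_witness[of _ Suc "\<lambda>j. j - 1"]) auto
  also have "\<dots> = w * (\<Sum>j<n. w ^ j)" by (simp add: sum_distrib_left)
  also have "\<dots> = (if n dvd k then of_nat n else 0)"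
  proof (cases "w = 1")
    case True
    then show ?thesis using w1 by simp
  next
    case False
    have "(\<Sum>j<n. w ^ j) = 0" using geometric_sum[OF False, of n] wn by simp
    then show ?thesis using w1 False by simp
  qed
  finally show ?thesis unfolding wj .
qed

text \<open>The fractions \<open>j / n\<close> with \<open>1 \<le> j \<le> n\<close> are sorted by
  their denominators in lowest terms.\<close>

lemma ramanujan_divisor_sum:
  assumes n: "n > 0"
  shows "(\<Sum>d | d dvd n. ramanujan_sum d k) = (if n dvd k then of_nat n else 0)"
proof -
  let ?e = "\<lambda>n j. exp (2 * complex_of_real pi * \<i> * of_nat j * of_nat k / of_nat n)"
  let ?C = "\<lambda>d::nat. {j. 1 \<le> j \<and> j \<le> d \<and> coprime j d}"
  have fin: "finite {d. d dvd n}" using n by (rule finite_divisors_nat)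
  have finC: "finite (?C d)" for d by (rule finite_subset[of _ "{..d}"]) (auto simp del: One_nat_def)
  have "(\<Sum>d | d dvd n. ramanujan_sum d k) = (\<Sum>(d,j)\<in>(SIGMA d:{d. d dvd n}. ?C d). ?e d j)"
    unfolding ramanujan_sum_def using fin finC by (subst sum.Sigma) auto
  also have "\<dots> = (\<Sum>j=1..n. ?e n j)"
  proof (rule sum.reindex_bij_witness[of _ "\<lambda>j. (n div gcd j n, j div gcd j n)" "\<lambda>(d,j). j * (n div d)"])
    fix a assume "a \<in> (SIGMA d:{d. d dvd n}. ?C d)"
    then obtain d j where a: "a = (d, j)" and d: "d dvd n" and j: "1 \<le> j" "j \<le> d" "coprime j d" by auto
    then obtain m where m: "n = d * m" by blast
    have d0: "d > 0" "m > 0" using n m by auto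
    have g: "gcd (j * m) (d * m) = m" using j by (simp add: gcd_mult_distrib_nat[symmetric] mult.commute[of _ m] coprime_imp_gcd_eq_1)
    show "(case a of (d, j) \<Rightarrow> j * (n div d)) \<in> {1..n}" using a m d0 j by auto
    show "(n div gcd (case a of (d, j) \<Rightarrow> j * (n div d)) n, (case a of (d, j) \<Rightarrow> j * (n div d)) div gcd (case a of (d, j) \<Rightarrow> j * (n div d)) n) = a"
      using a m d0 g by simp
    show "?e n (case a of (d, j) \<Rightarrow> j * (n div d)) = (case a of (d, j) \<Rightarrow> ?e d j)"
      using a m d0 by (simp add: field_simps)
  next
    fix j assume j: "j \<in> {1..n}"
    define g where "g = gcd j n"
    have g: "g > 0" "g dvd j" "g dvd n" using n by (auto simp: g_def)
    then obtain j' d where jd: "j = g * j'" "n = g * d" by blast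
    have d0: "d > 0" "j' > 0" using jd n j by (auto intro: Nat.gr0I)
    have "coprime (j div g) (n div g)" unfolding g_def using n by (intro div_gcd_coprime) auto
    then have cop: "coprime j' d" using jd g by simp
    show "(case (n div gcd j n, j div gcd j n) of (d, j) \<Rightarrow> j * (n div d)) = j"
      unfolding g_def[symmetric] using jd g d0 by simp
    show "(n div gcd j n, j div gcd j n) \<in> (SIGMA d:{d. d dvd n}. ?C d)"
      unfolding g_def[symmetric] using jd g d0 cop j by auto
  qed
  also have "\<dots> = (if n dvd k then of_nat n else 0)" by (rule sum_roots_of_unity[OF n])
  finally show ?thesis .
qed

text \<open>Both sides have the same sums over divisors; strong induction on \<open>n\<close> takes
  the place of Moebius inversion.\<close>

lemma ramanujan_sum_eq:
  assumes "n > 0" "k > 0"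
  shows "ramanujan_sum n k = of_real (rprod k n)"
  using assms
proof (induction n rule: less_induct)
  case (less n)
  have fin: "finite {d. d dvd n}" using less.prems by simp
  have IH: "ramanujan_sum d k = of_real (rprod k d)" if "d \<in> {d. d dvd n} - {n}" for d
    using that less.prems by (intro less.IH) (auto intro: dvd_pos_nat le_neq_implies_less dvd_imp_le)
  have "(\<Sum>d | d dvd n. ramanujan_sum d k) = (\<Sum>d | d dvd n. of_real (rprod k d))"
    using ramanujan_divisor_sum[OF less.prems(1), of k] rprod_divisor_sum[OF less.prems] by (simp flip: of_real_sum)
  moreover have "(\<Sum>d\<in>{d. d dvd n} - {n}. ramanujan_sum d k) = (\<Sum>d\<in>{d. d dvd n} - {n}. of_real (rprod k d))"
    by (intro sum.cong refl IH)
  ultimately show ?case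
    using sum.remove[OF fin, of n "\<lambda>d. ramanujan_sum d k"] sum.remove[OF fin, of n "\<lambda>d. of_real (rprod k d) :: complex"] by (simp del: of_real_sum)
qed

text \<open>For \<open>q\<close> not dividing \<open>k\<close> the local value at exponents 0, 1, 2,
  3, ... is 1, -1, 0, 0, ..., as for the Moebius function; the primes of \<open>k\<close> keep their
  own factors.\<close>

lemma rprod_mu_S:
  assumes n: "n > 0" and k: "k > 0"
  shows "rprod k n = mu_S (prime_factors k) n * (\<Prod>q\<in>prime_factors k. rloc q (multiplicity q k) (multiplicity q n))"
proof -
  let ?S = "prime_factors k"
  let ?h = "\<lambda>q. rloc q (multiplicity q k) (multiplicity q n)"
  have "rprod k n = prod ?h (prime_factors n \<inter> ?S) * prod ?h (prime_factors n - ?S)"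
    unfolding rprod_def by (rule prod.Int_Diff) simp
  also have "prod ?h (prime_factors n \<inter> ?S) = prod ?h ?S"
  proof (rule prod.mono_neutral_left)
    show "\<forall>q\<in>?S - prime_factors n \<inter> ?S. ?h q = 1"
    proof
      fix q assume "q \<in> ?S - prime_factors n \<inter> ?S"
      then have "\<not> q dvd n" using n by (auto simp: in_prime_factors_iff)
      then show "?h q = 1" by (simp add: not_dvd_imp_multiplicity_0 rloc_def)
    qed
  qed auto
  also have "prod ?h (prime_factors n - ?S) = mu_S ?S n"
  proof -
    have v0: "multiplicity q k = 0" if "q \<in> prime_factors n - ?S" for q
      using that k by (intro not_dvd_imp_multiplicity_0) (auto simp: in_prime_factors_iff)
    have m1: "multiplicity q n \<ge> 1" if "q \<in> prime_factors n" for q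
      using that by (metis One_nat_def Suc_leI prime_factors_multiplicity mem_Collect_eq)
    have sq: "q\<^sup>2 dvd n \<longleftrightarrow> multiplicity q n \<ge> 2" if "prime q" for q
      using that n by (subst power_dvd_iff_le_multiplicity) (auto simp: prime_gt_1_nat)
    have eq: "{q. prime q \<and> q dvd n \<and> q \<notin> ?S} = prime_factors n - ?S" using n by (auto simp: in_prime_factors_iff)
    show ?thesis
    proof (cases "S_squarefree ?S n")
      case True
      have "prod ?h (prime_factors n - ?S) = (\<Prod>q\<in>prime_factors n - ?S. - 1)"
      proof (rule prod.cong[OF refl])
        fix q assume q: "q \<in> prime_factors n - ?S"
        then have "\<not> q\<^sup>2 dvd n" "prime q" using True by (auto simp: S_squarefree_def in_prime_factors_iff)
        then have "multiplicity q n = 1" using sq[of q] m1[of q] q by auto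
        then show "?h q = - 1" using v0[OF q] by (simp add: rloc_def)
      qed
      then show ?thesis using True by (simp add: mu_S_def eq)
    next
      case False
      then obtain q where q: "prime q" "q \<notin> ?S" "q\<^sup>2 dvd n" by (auto simp: S_squarefree_def)
      have "q dvd n" using q(3) by (meson dvd_trans dvd_power zero_less_numeral)
      then have qn: "q \<in> prime_factors n - ?S" using q n by (auto simp: in_prime_factors_iff)
      have "multiplicity q n \<ge> 2" using sq[of q] q by simp
      then have "?h q = 0" using v0[OF qn] by (simp add: rloc_def)
      then have "prod ?h (prime_factors n - ?S) = 0" using qn by (intro prod_zero) auto
      then show ?thesis using False by (simp add: mu_S_def)
    qed
  qed
  finally show ?thesis by (simp add: mult.commute)
qed

text \<open>A product of local values, each zero beyond \<open>B q\<close>, becomes a finite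
  combination of indicators of exponent vectors, and the summation over primes can be carried out
  for one vector at a time.\<close>

lemma prod_eq_sum_over_values:
  fixes g :: "'a \<Rightarrow> nat \<Rightarrow> real" and a B :: "'a \<Rightarrow> nat"
  assumes S: "finite S" and g: "\<And>q i. q \<in> S \<Longrightarrow> i > B q \<Longrightarrow> g q i = 0"
  shows "(\<Prod>q\<in>S. g q (a q)) = (\<Sum>f\<in>(\<Pi>\<^sub>E q\<in>S. {..B q}). if \<forall>q\<in>S. a q = f q then \<Prod>q\<in>S. g q (f q) else 0)"
proof -
  have "(\<Prod>q\<in>S. g q (a q)) = (\<Prod>q\<in>S. \<Sum>i\<le>B q. if a q = i then g q i else 0)"
    using g by (intro prod.cong refl) (auto simp: not_le)
  also have "\<dots> = (\<Sum>f\<in>(\<Pi>\<^sub>E q\<in>S. {..B q}). \<Prod>q\<in>S. if a q = f q then g q (f q) else 0)"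
    using S by (intro prod_sum_PiE) auto
  also have "\<dots> = (\<Sum>f\<in>(\<Pi>\<^sub>E q\<in>S. {..B q}). if \<forall>q\<in>S. a q = f q then \<Prod>q\<in>S. g q (f q) else 0)"
    using S by (intro sum.cong refl) (auto intro!: prod.cong prod_zero)
  finally show ?thesis .
qed

lemma finite_primes_upto: "finite (primes_upto x)"
proof (rule finite_subset)
  show "primes_upto x \<subseteq> {..nat \<lfloor>x\<rfloor>}" by (auto simp: primes_upto_def le_nat_iff le_floor_iff)
qed simp

section \<open>Odd powers under the conjecture\<close>

theorem ramanujan_sum_odd_power:
  assumes k: "k > 0" and conj: conjecture1 and j: "odd j"
  shows "(\<lambda>x. \<Sum>p\<in>primes_upto x. ramanujan_sum (p - 1) k ^ j) \<in> o[at_top](\<lambda>x. complex_of_real (prime_count x))"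
proof -
  define S where "S = prime_factors k"
  \<comment> \<open>With \<open>v\<close> the exponent of \<open>q\<close> in \<open>k\<close>,
    \<open>rloc\<close> vanishes from exponent \<open>v + 2\<close> on.\<close>
  define B where "B = (\<lambda>q. Suc (multiplicity q k))"
  define g where "g = (\<lambda>q i. rloc q (multiplicity q k) i ^ j)"
  define E where "E = (\<Pi>\<^sub>E q\<in>S. {..B q})"
  define es where "es = (\<lambda>f::nat\<Rightarrow>nat. map f (sorted_list_of_set S))"
  define F where "F = (\<lambda>f x. \<Sum>p | p \<in> primes_upto x \<and> nu_tuple S (p - 1) = es f. mu_S S (p - 1))"
  have S: "finite S" "\<And>q. q \<in> S \<Longrightarrow> prime q" by (auto simp: S_def)
  have nu: "nu_tuple S n = es f \<longleftrightarrow> (\<forall>q\<in>S. multiplicity q n = f q)" for n f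
    using S by (simp add: nu_tuple_def es_def)
  \<comment> \<open>The values of \<open>mu_S\<close> are -1, 0 and 1, so an odd power reproduces
    it; an even power would lose the sign.\<close>
  have odd: "mu_S S n ^ j = mu_S S n" for n using j by (auto simp: mu_S_def minus_one_power_iff odd_pos)
  have rp: "ramanujan_sum (p - 1) k ^ j = of_real (\<Sum>f\<in>E. (\<Prod>q\<in>S. g q (f q)) * (if nu_tuple S (p - 1) = es f then mu_S S (p - 1) else 0))"
    if "p \<in> primes_upto x" for p x
  proof -
    have p: "p - 1 > 0" using that prime_gt_1_nat by (auto simp: primes_upto_def)
    have "rprod k (p - 1) ^ j = mu_S S (p - 1) * (\<Prod>q\<in>S. g q (multiplicity q (p - 1)))"
      unfolding rprod_mu_S[OF p k] S_def[symmetric] power_mult_distrib odd g_def prod_power_distrib ..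
    also have "(\<Prod>q\<in>S. g q (multiplicity q (p - 1))) = (\<Sum>f\<in>E. if \<forall>q\<in>S. multiplicity q (p - 1) = f q then \<Prod>q\<in>S. g q (f q) else 0)"
      unfolding E_def using j by (intro prod_eq_sum_over_values S) (auto simp: g_def B_def rloc_def odd_pos)
    also have "mu_S S (p - 1) * \<dots> = (\<Sum>f\<in>E. (\<Prod>q\<in>S. g q (f q)) * (if nu_tuple S (p - 1) = es f then mu_S S (p - 1) else 0))"
      unfolding sum_distrib_left nu by (intro sum.cong) auto
    finally show ?thesis using ramanujan_sum_eq[OF p k] by (simp flip: of_real_power)
  qed
  have "(\<lambda>x. \<Sum>f\<in>E. (\<Prod>q\<in>S. g q (f q)) * F f x) \<in> o[at_top](prime_count)"
  proof (intro big_sum_in_smallo)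
    fix f
    have "F f \<in> o[at_top](prime_count)"
      unfolding F_def using conj S unfolding conjecture1_def by (auto simp: es_def)
    then show "(\<lambda>x. (\<Prod>q\<in>S. g q (f q)) * F f x) \<in> o[at_top](prime_count)" by simp
  qed
  moreover have "(\<Sum>p\<in>primes_upto x. ramanujan_sum (p - 1) k ^ j) = of_real (\<Sum>f\<in>E. (\<Prod>q\<in>S. g q (f q)) * F f x)" for x
  proof -
    have "(\<Sum>p\<in>primes_upto x. ramanujan_sum (p - 1) k ^ j) = of_real (\<Sum>p\<in>primes_upto x. \<Sum>f\<in>E. (\<Prod>q\<in>S. g q (f q)) * (if nu_tuple S (p - 1) = es f then mu_S S (p - 1) else 0))"
      unfolding of_real_sum[of _ "primes_upto x"] by (rule sum.cong[OF refl]) (rule rp)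
    also have "(\<Sum>p\<in>primes_upto x. \<Sum>f\<in>E. (\<Prod>q\<in>S. g q (f q)) * (if nu_tuple S (p - 1) = es f then mu_S S (p - 1) else 0))
       = (\<Sum>f\<in>E. (\<Prod>q\<in>S. g q (f q)) * (\<Sum>p\<in>primes_upto x. if nu_tuple S (p - 1) = es f then mu_S S (p - 1) else 0))"
      unfolding sum_distrib_left by (rule sum.swap)
    also have "\<dots> = (\<Sum>f\<in>E. (\<Prod>q\<in>S. g q (f q)) * F f x)"
      unfolding F_def sum.inter_filter[OF finite_primes_upto] ..
    finally show ?thesis .
  qed
  ultimately show ?thesis by (simp add: smallo_def del: of_real_sum of_real_mult)
qed

subsection \<open>Primes with prescribed factorization of their predecessor\<close>

definition sqf :: "nat set \<Rightarrow> nat set" where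
  "sqf P = {d. squarefree d \<and> prime_factors d \<subseteq> P}"

text \<open>The Moebius function of \<open>d\<close>, restricted to \<open>d\<close> without prime
  factors in \<open>S\<close>.\<close>

definition sqf_sign :: "nat set \<Rightarrow> nat \<Rightarrow> real" where
  "sqf_sign S d = (if squarefree d \<and> prime_factors d \<inter> S = {} then (- 1) ^ card (prime_factors d) else 0)"

text \<open>For squarefree \<open>d\<close> this is \<open>totient (d^2)\<close>; written as a
  product it matches the factors of Artin's constant.\<close>

definition sqf_weight :: "nat \<Rightarrow> real" where
  "sqf_weight d = (\<Prod>q\<in>prime_factors d. real q * (real q - 1))"

lemma prime_factorization_prod_primes:
  fixes T :: "nat set"
  assumes "finite T" "\<And>q. q \<in> T \<Longrightarrow> prime q"
  shows "prime_factorization (\<Prod>T) = mset_set T"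
proof -
  have "\<Prod>T = prod_mset (mset_set T)" by (simp add: prod_unfold_prod_mset)
  moreover have "prime_factorization (prod_mset (mset_set T)) = mset_set T"
    by (rule prime_factorization_prod_mset_primes) (use assms in auto)
  ultimately show ?thesis by simp
qed

lemma prod_primes_sqf:
  fixes T :: "nat set"
  assumes T: "finite T" "\<And>q. q \<in> T \<Longrightarrow> prime q"
  shows "prime_factors (\<Prod>T) = T" "squarefree (\<Prod>T)" "\<Prod>T > 0"
proof -
  note pf = prime_factorization_prod_primes[OF T]
  show "prime_factors (\<Prod>T) = T" using T by (simp add: pf)
  show pos: "\<Prod>T > 0" using T prime_gt_0_nat by (intro prod_pos) auto
  have "multiplicity p (\<Prod>T) \<le> 1" if "prime p" for p
    using that count_prime_factorization_prime[OF that, of "\<Prod>T"] T by (simp add: pf count_mset_set' split: if_splits)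
  then show "squarefree (\<Prod>T)" using pos by (simp add: squarefree_factorial_semiring'')
qed

lemma squarefree_prod_prime_factors:
  fixes d :: nat
  assumes "squarefree d"
  shows "\<Prod>(prime_factors d) = d"
proof -
  have d: "d \<noteq> 0" using assms by (metis not_squarefree_0)
  have "d = (\<Prod>p\<in>prime_factors d. p ^ multiplicity p d)" using d by (simp add: prime_factorization_nat)
  also have "\<dots> = \<Prod>(prime_factors d)"
    using assms d by (intro prod.cong refl) (auto simp: squarefree_factorial_semiring')
  finally show ?thesis by simp
qed

lemma sqf_eq_image:
  assumes P: "finite P" "\<And>q. q \<in> P \<Longrightarrow> prime q"
  shows "sqf P = (\<lambda>T. \<Prod>T) ` Pow P" "inj_on (\<lambda>T. \<Prod>T) (Pow P)"
proof -
  have T: "prime_factors (\<Prod>T) = T" "squarefree (\<Prod>T)" if "T \<subseteq> P" for T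
    using P that by (auto intro!: prod_primes_sqf dest: finite_subset)
  show "inj_on (\<lambda>T. \<Prod>T) (Pow P)" by (rule inj_on_inverseI[of _ prime_factors]) (simp add: T)
  show "sqf P = (\<lambda>T. \<Prod>T) ` Pow P"
  proof (intro equalityI subsetI)
    fix d assume "d \<in> sqf P"
    then show "d \<in> (\<lambda>T. \<Prod>T) ` Pow P"
      using squarefree_prod_prime_factors[of d] by (intro image_eqI[of _ _ "prime_factors d"]) (auto simp: sqf_def)
  qed (auto simp: sqf_def T)
qed

lemma finite_sqf: "finite P \<Longrightarrow> (\<And>q. q \<in> P \<Longrightarrow> prime q) \<Longrightarrow> finite (sqf P)"
  by (simp add: sqf_eq_image)

lemma prod_one_minus_expand:
  fixes G :: "nat \<Rightarrow> real"
  assumes P: "finite P" "\<And>q. q \<in> P \<Longrightarrow> prime q"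
  shows "(\<Prod>q\<in>P. 1 - G q) = (\<Sum>d\<in>sqf P. (- 1) ^ card (prime_factors d) * (\<Prod>q\<in>prime_factors d. G q))"
proof -
  have "(\<Prod>q\<in>P. 1 - G q) = (\<Prod>q\<in>P. - G q + 1)" by simp
  also have "\<dots> = (\<Sum>T\<in>Pow P. \<Prod>q\<in>T. - G q)" by (subst prod_add[OF P(1)]) simp
  also have "\<dots> = (\<Sum>T\<in>Pow P. (- 1) ^ card (prime_factors (\<Prod>T)) * (\<Prod>q\<in>prime_factors (\<Prod>T). G q))"
  proof (rule sum.cong[OF refl])
    fix T assume "T \<in> Pow P"
    then have "prime_factors (\<Prod>T) = T" using P by (intro prod_primes_sqf) (auto dest: finite_subset)
    then show "(\<Prod>q\<in>T. - G q) = (- 1) ^ card (prime_factors (\<Prod>T)) * (\<Prod>q\<in>prime_factors (\<Prod>T). G q)"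
      by (simp add: prod_uminus)
  qed
  also have "\<dots> = (\<Sum>d\<in>sqf P. (- 1) ^ card (prime_factors d) * (\<Prod>q\<in>prime_factors d. G q))"
    using sqf_eq_image[OF P] by (intro sum.reindex_bij_betw[of "\<lambda>T. \<Prod>T"]) (auto simp: bij_betw_def)
  finally show ?thesis .
qed

lemma prod_primes_square_dvd:
  fixes n :: nat
  assumes "finite T" "\<And>q. q \<in> T \<Longrightarrow> prime q" "\<And>q. q \<in> T \<Longrightarrow> q\<^sup>2 dvd n"
  shows "(\<Prod>T)\<^sup>2 dvd n"
  using assms
proof (induction T rule: finite_induct)
  case (insert q T)
  have "coprime (q\<^sup>2) ((\<Prod>T)\<^sup>2)"
    using insert by (intro coprime_power_left_iff[THEN iffD2] coprime_power_right_iff[THEN iffD2] disjI1 prod_coprime_right)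
      (auto intro!: primes_coprime)
  then have "q\<^sup>2 * (\<Prod>T)\<^sup>2 dvd n" using insert by (intro divides_mult) auto
  then show ?case using insert by (simp add: power_mult_distrib)
qed simp

text \<open>Inclusion-exclusion over the primes outside \<open>S\<close> whose squares divide
  \<open>n\<close>. The limit \<open>W\<close> may be any number from \<open>n\<close> on, so that
  one range of \<open>d\<close> serves for all primes up to \<open>x\<close> at once.\<close>

lemma S_squarefree_expand:
  assumes n: "n > 0" "n \<le> W"
  shows "(\<Sum>d=1..W. if d\<^sup>2 dvd n then sqf_sign S d else 0) = (if S_squarefree S n then 1 else 0)"
proof -
  define Q where "Q = {q. prime q \<and> q \<notin> S \<and> q\<^sup>2 dvd n}"
  have le: "d \<le> n" if "d\<^sup>2 dvd n" for d
  proof -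
    have "d * d \<le> n" using that n dvd_imp_le[of "d\<^sup>2" n] by (simp add: power2_eq_square)
    then show ?thesis by (cases "d = 0") (auto intro: order_trans[rotated])
  qed
  have "Q \<subseteq> {..n}" using le by (auto simp: Q_def)
  then have Q: "finite Q" "\<And>q. q \<in> Q \<Longrightarrow> prime q" by (auto simp: Q_def dest: finite_subset)
  have eq: "sqf Q = {d\<in>{1..W}. d\<^sup>2 dvd n \<and> squarefree d \<and> prime_factors d \<inter> S = {}}"
  proof (intro equalityI subsetI)
    fix d assume "d \<in> sqf Q"
    then have d: "squarefree d" "prime_factors d \<subseteq> Q" by (auto simp: sqf_def)
    have "(\<Prod>(prime_factors d))\<^sup>2 dvd n" using d by (intro prod_primes_square_dvd) (auto simp: Q_def)
    then have dn: "d\<^sup>2 dvd n" using squarefree_prod_prime_factors[OF d(1)] by simp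
    have "d > 0" using d(1) by (auto intro: Nat.gr0I)
    then show "d \<in> {d\<in>{1..W}. d\<^sup>2 dvd n \<and> squarefree d \<and> prime_factors d \<inter> S = {}}"
      using d dn le[OF dn] n by (auto simp: Q_def)
  next
    fix d assume d: "d \<in> {d\<in>{1..W}. d\<^sup>2 dvd n \<and> squarefree d \<and> prime_factors d \<inter> S = {}}"
    have "prime_factors d \<subseteq> Q"
    proof
      fix q assume q: "q \<in> prime_factors d"
      then have "q\<^sup>2 dvd d\<^sup>2" by (intro dvd_power_same) auto
      then show "q \<in> Q" using d q by (auto simp: Q_def intro: dvd_trans)
    qed
    then show "d \<in> sqf Q" using d by (auto simp: sqf_def)
  qed
  have "(\<Sum>d=1..W. if d\<^sup>2 dvd n then sqf_sign S d else 0) = (\<Sum>d\<in>sqf Q. (- 1) ^ card (prime_factors d))"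
    unfolding eq by (subst sum.inter_filter) (auto simp: sqf_sign_def intro!: sum.cong)
  also have "\<dots> = (\<Prod>q\<in>Q. 1 - 1)" using prod_one_minus_expand[OF Q, of "\<lambda>_. 1"] by simp
  also have "\<dots> = (if Q = {} then 1 else 0)" using Q by (auto simp: card_gt_0_iff)
  also have "Q = {} \<longleftrightarrow> S_squarefree S n" by (auto simp: Q_def S_squarefree_def)
  finally show ?thesis .
qed

lemma Suc_square_le_power2: "(real w + 1) ^ 2 \<le> 4 * 2 ^ w"
proof (induction w)
  case (Suc w)
  show ?case
  proof (cases "w \<ge> 2")
    case True
    then have "real w * real w \<ge> 2 * 2" by (intro mult_mono) auto
    then have "(real (Suc w) + 1) ^ 2 \<le> 2 * (real w + 1) ^ 2" by (simp add: power2_eq_square algebra_simps)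
    then show ?thesis using Suc.IH by simp
  next
    case False
    then have "w = 0 \<or> w = 1" by auto
    then show ?thesis by auto
  qed
qed simp

lemma sqf_weight_eq:
  assumes "squarefree d"
  shows "sqf_weight d = (real d)\<^sup>2 * (\<Prod>q\<in>prime_factors d. 1 - 1 / real q)"
proof -
  have "real d = real (\<Prod>(prime_factors d))" using squarefree_prod_prime_factors[OF assms] by simp
  then have "real d = (\<Prod>q\<in>prime_factors d. real q)" by simp
  then show ?thesis unfolding sqf_weight_def
    by (simp add: power2_eq_square flip: prod.distrib)
       (rule prod.cong, auto simp: field_simps)
qed

text \<open>\<open>totient (d^2)\<close> is \<open>d^2\<close> times the product of the
  \<open>1 - 1/q\<close>, which is at least \<open>1 / (w + 1)\<close> for \<open>w\<close> prime
  factors; and \<open>w + 1 \<le> 2 * sqrt d\<close>, because \<open>2 ^ w \<le> d\<close>. The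
  exponent \<open>3/2\<close> still gives a convergent series over \<open>d\<close>.\<close>

lemma sqf_weight_ge:
  assumes d: "squarefree d"
  shows "sqf_weight d \<ge> real d powr (3/2) / 2"
proof -
  have d0: "d > 0" using d by (auto intro: Nat.gr0I)
  define w where "w = card (prime_factors d)"
  have "2 ^ w \<le> d" unfolding w_def by (rule card_prime_factors_le[OF d0])
  then have w2: "(2::real) ^ w \<le> real d" by (metis of_nat_le_iff of_nat_numeral of_nat_power)
  have "real w + 1 \<le> 2 * sqrt (real d)"
  proof (rule power2_le_imp_le)
    show "(real w + 1)\<^sup>2 \<le> (2 * sqrt (real d))\<^sup>2"
    proof -
      have "(2 * sqrt (real d))\<^sup>2 = 4 * real d" by (simp add: power_mult_distrib)
      then show ?thesis using Suc_square_le_power2[of w] w2 by linarith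
    qed
  qed simp
  then have "1 / (2 * sqrt (real d)) \<le> 1 / (real w + 1)" using d0 by (intro divide_left_mono) auto
  also have "\<dots> \<le> (\<Prod>q\<in>prime_factors d. 1 - 1 / real q)"
    unfolding w_def by (rule prod_one_minus_inverse_ge) (auto intro: prime_ge_2_nat)
  finally have "(real d)\<^sup>2 * (1 / (2 * sqrt (real d))) \<le> sqf_weight d"
    unfolding sqf_weight_eq[OF d] by (intro mult_left_mono) auto
  moreover have "(real d)\<^sup>2 * (1 / (2 * sqrt (real d))) = real d powr (3/2) / 2"
  proof -
    have "real d powr (3/2) * sqrt (real d) = real d powr (3/2) * real d powr (1/2)" by (simp add: powr_half_sqrt)
    also have "\<dots> = real d powr 2" unfolding powr_add[symmetric] by simp
    also have "\<dots> = (real d)\<^sup>2" using d0 by (simp add: powr_numeral)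
    finally show ?thesis using d0 by (simp add: field_simps)
  qed
  ultimately show ?thesis by simp
qed

lemma totient_mult_square:
  assumes d: "squarefree d" and c: "coprime m d"
  shows "real (totient (m * d\<^sup>2)) = real (totient m) * sqf_weight d"
proof -
  have "totient (m * d\<^sup>2) = totient m * totient (d\<^sup>2)" using c by (intro totient_mult_coprime) simp
  moreover have "real (totient (d\<^sup>2)) = sqf_weight d"
    unfolding sqf_weight_eq[OF d] totient_formula2 by (simp add: prime_factors_power)
  ultimately show ?thesis by simp
qed

lemma sqf_sign_weight_bound:
  assumes "d > 0"
  shows "\<bar>sqf_sign S d / sqf_weight d\<bar> \<le> 2 * real d powr (- 1 - 1/2)"
proof (cases "squarefree d")
  case True
  have p: "real d powr (3/2) / 2 > 0" using assms by simp
  have "\<bar>sqf_sign S d\<bar> \<le> 1" by (simp add: sqf_sign_def)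
  then have "\<bar>sqf_sign S d / sqf_weight d\<bar> \<le> 1 / (real d powr (3/2) / 2)"
    using sqf_weight_ge[OF True] p unfolding abs_divide by (intro frac_le) auto
  also have "\<dots> = 2 * real d powr (- 1 - 1/2)" by (simp add: powr_minus_divide)
  finally show ?thesis .
qed (simp add: sqf_sign_def)

section \<open>Artin's constant and its truncated expansion\<close>

lemma artin_factor_bounds:
  assumes "prime (q::nat)"
  shows "1 - 1 / (real q * (real q - 1)) > 0" "1 / (real q * (real q - 1)) \<le> 2 / (real q)\<^sup>2"
proof -
  have q: "real q \<ge> 2" using prime_ge_2_nat[OF assms] by simp
  then have "real q * (real q - 1) \<ge> 2 * 1" by (intro mult_mono) auto
  then show "1 - 1 / (real q * (real q - 1)) > 0" by (simp add: field_simps)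
  have "real q * (real q / 2) \<le> real q * (real q - 1)" using q by (intro mult_left_mono) auto
  then have "1 / (real q * (real q - 1)) \<le> 1 / (real q * (real q / 2))" using q by (intro divide_left_mono) auto
  then show "1 / (real q * (real q - 1)) \<le> 2 / (real q)\<^sup>2" by (simp add: power2_eq_square)
qed

lemma artin_partial_products:
  assumes S: "finite S" "\<And>q. q \<in> S \<Longrightarrow> prime q"
  shows "(\<lambda>y. \<Prod>q | prime q \<and> q \<le> y \<and> q \<notin> S. 1 - 1 / (real q * (real q - 1)))
    \<longlonglongrightarrow> artin_constant / (\<Prod>q\<in>S. 1 - 1 / (real q * (real q - 1)))"
proof -
  define F where "F = (\<lambda>q::nat. if prime q then 1 - 1 / (real q * (real q - 1)) else 1)"
  have "summable (\<lambda>q. norm (F q - 1))"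
  proof (rule summable_comparison_test')
    show "summable (\<lambda>q. 2 * (1 / real q ^ 2))" using inverse_power_summable[of 2] by (intro summable_mult) (simp add: field_simps)
    fix q :: nat assume "q \<ge> 0"
    show "norm (norm (F q - 1)) \<le> 2 * (1 / real q ^ 2)"
      using artin_factor_bounds(2)[of q] prime_gt_1_nat[of q] by (auto simp: F_def)
  qed
  then have "convergent_prod F" by (intro abs_convergent_prod_imp_convergent_prod summable_imp_abs_convergent_prod)
  then have lim: "(\<lambda>y. \<Prod>q\<le>y. F q) \<longlonglongrightarrow> artin_constant"
    using convergent_prod_LIMSEQ unfolding artin_constant_def F_def by blast
  have FS: "(\<Prod>q\<in>S. 1 - 1 / (real q * (real q - 1))) = (\<Prod>q\<in>S. F q)" using S by (intro prod.cong) (auto simp: F_def)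
  have nz: "(\<Prod>q\<in>S. F q) \<noteq> 0"
  proof -
    have "F q \<noteq> 0" if "q \<in> S" for q using artin_factor_bounds(1)[OF S(2)[OF that]] S(2)[OF that] unfolding F_def by auto
    then show ?thesis using S by simp
  qed
  have "(\<Prod>q\<le>y. F q) / (\<Prod>q\<in>S. F q) = (\<Prod>q | prime q \<and> q \<le> y \<and> q \<notin> S. 1 - 1 / (real q * (real q - 1)))" if y: "y \<ge> Max (insert 0 S)" for y
  proof -
    have sub: "S \<subseteq> {..y}" using y S by auto
    have "(\<Prod>q\<le>y. F q) = (\<Prod>q\<in>{..y} - S. F q) * (\<Prod>q\<in>S. F q)" by (rule prod.subset_diff[OF sub]) simp
    moreover have "(\<Prod>q\<in>{..y} - S. F q) = (\<Prod>q | prime q \<and> q \<le> y \<and> q \<notin> S. F q)"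
      by (rule prod.mono_neutral_right) (auto simp: F_def)
    moreover have "\<dots> = (\<Prod>q | prime q \<and> q \<le> y \<and> q \<notin> S. 1 - 1 / (real q * (real q - 1)))"
      by (rule prod.cong) (auto simp: F_def)
    ultimately show ?thesis using nz by simp
  qed
  then have ev: "\<forall>\<^sub>F y in sequentially. (\<Prod>q\<le>y. F q) / (\<Prod>q\<in>S. F q) = (\<Prod>q | prime q \<and> q \<le> y \<and> q \<notin> S. 1 - 1 / (real q * (real q - 1)))"
    using eventually_ge_at_top by (rule eventually_mono[rotated])
  have "(\<lambda>y. (\<Prod>q\<le>y. F q) / (\<Prod>q\<in>S. F q)) \<longlonglongrightarrow> artin_constant / (\<Prod>q\<in>S. F q)"
    using nz by (intro tendsto_divide lim tendsto_const)
  then show ?thesis unfolding FS using tendsto_cong[OF ev] by simp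
qed

text \<open>The products over primes up to \<open>y\<close> have finite expansions over squarefree
  \<open>d\<close>, which contain all relevant \<open>d \<le> D\<close> as soon as
  \<open>y \<ge> D\<close>; the other terms lie in the tail of a convergent series, uniformly in
  \<open>y\<close>.\<close>

lemma artin_approx:
  assumes S: "finite S" "\<And>q. q \<in> S \<Longrightarrow> prime q" and D: "D \<ge> 1"
  shows "\<bar>artin_constant / (\<Prod>q\<in>S. 1 - 1 / (real q * (real q - 1))) - (\<Sum>d=1..D. sqf_sign S d / sqf_weight d)\<bar> \<le> 4 * real D powr (- (1/2))"
proof (rule tendsto_upperbound)
  let ?a = "\<lambda>d. sqf_sign S d / sqf_weight d"
  let ?P = "\<lambda>y. \<Prod>q | prime q \<and> q \<le> y \<and> q \<notin> S. 1 - 1 / (real q * (real q - 1))"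
  show "(\<lambda>y. \<bar>?P y - (\<Sum>d=1..D. ?a d)\<bar>) \<longlonglongrightarrow> \<bar>artin_constant / (\<Prod>q\<in>S. 1 - 1 / (real q * (real q - 1))) - (\<Sum>d=1..D. ?a d)\<bar>"
    by (intro tendsto_rabs tendsto_diff tendsto_const artin_partial_products S)
  have "\<bar>?P y - (\<Sum>d=1..D. ?a d)\<bar> \<le> 4 * real D powr (- (1/2))" if y: "y \<ge> D" for y
  proof -
    define P where "P = {q. prime q \<and> q \<le> y \<and> q \<notin> S}"
    have P: "finite P" "\<And>q. q \<in> P \<Longrightarrow> prime q" by (auto simp: P_def)
    note fin = finite_sqf[OF P]
    have "?P y = (\<Sum>d\<in>sqf P. (- 1) ^ card (prime_factors d) * (\<Prod>q\<in>prime_factors d. 1 / (real q * (real q - 1))))"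
      unfolding P_def[symmetric] by (rule prod_one_minus_expand[OF P])
    also have "\<dots> = (\<Sum>d\<in>sqf P. ?a d)"
      by (rule sum.cong) (auto simp: sqf_def sqf_sign_def sqf_weight_def P_def prod_dividef)
    also have "\<dots> = (\<Sum>d\<in>sqf P \<inter> {1..D}. ?a d) + (\<Sum>d\<in>sqf P - {1..D}. ?a d)" by (rule sum.Int_Diff[OF fin])
    also have "(\<Sum>d\<in>sqf P \<inter> {1..D}. ?a d) = (\<Sum>d=1..D. ?a d)"
    proof (rule sum.mono_neutral_left)
      show "\<forall>d\<in>{1..D} - sqf P \<inter> {1..D}. ?a d = 0"
      proof
        fix d assume d: "d \<in> {1..D} - sqf P \<inter> {1..D}"
        show "?a d = 0"
        proof (cases "squarefree d \<and> prime_factors d \<inter> S = {}")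
          case True
          have "prime_factors d \<subseteq> P"
          proof
            fix q assume q: "q \<in> prime_factors d"
            then have "q \<le> d" using d by (auto intro!: dvd_imp_le simp: in_prime_factors_iff)
            then show "q \<in> P" using True q d y by (auto simp: P_def)
          qed
          then show ?thesis using True d by (auto simp: sqf_def)
        qed (auto simp: sqf_sign_def)
      qed
    qed auto
    finally have "\<bar>?P y - (\<Sum>d=1..D. ?a d)\<bar> = \<bar>\<Sum>d\<in>sqf P - {1..D}. ?a d\<bar>" by simp
    also have "\<dots> \<le> (\<Sum>d\<in>sqf P - {1..D}. 2 * real d powr (- 1 - 1/2))"
    proof (rule order_trans[OF sum_abs], rule sum_mono)
      fix d assume "d \<in> sqf P - {1..D}"
      then have "d > 0" by (auto simp: sqf_def intro: Nat.gr0I)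
      then show "\<bar>?a d\<bar> \<le> 2 * real d powr (- 1 - 1/2)" by (rule sqf_sign_weight_bound)
    qed
    also have "\<dots> \<le> (\<Sum>d\<in>{D<..Max (insert 0 (sqf P))}. 2 * real d powr (- 1 - 1/2))"
    proof (rule sum_mono2)
      show "sqf P - {1..D} \<subseteq> {D<..Max (insert 0 (sqf P))}"
      proof
        fix d assume d: "d \<in> sqf P - {1..D}"
        then have "d \<noteq> 0" unfolding sqf_def by (metis DiffD1 mem_Collect_eq not_squarefree_0)
        then show "d \<in> {D<..Max (insert 0 (sqf P))}" using d fin by auto
      qed
    qed auto
    also have "\<dots> = 2 * (\<Sum>d\<in>{D<..Max (insert 0 (sqf P))}. real d powr (- 1 - 1/2))" by (simp only: sum_distrib_left)
    also have "\<dots> \<le> 2 * (real D powr (- (1/2)) / (1/2))" using D by (intro mult_left_mono sum_powr_tail) auto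
    finally show ?thesis by simp
  qed
  then show "\<forall>\<^sub>F y in sequentially. \<bar>?P y - (\<Sum>d=1..D. ?a d)\<bar> \<le> 4 * real D powr (- (1/2))"
    using eventually_ge_at_top by (rule eventually_mono[rotated])
qed simp

text \<open>The Euler product over the primes outside \<open>S\<close>, as a quotient; the factors
  in the denominator are positive, the smallest being \<open>1/2\<close> at
  \<open>q = 2\<close>.\<close>

definition artin_outside :: "nat set \<Rightarrow> real" where
  "artin_outside S = artin_constant / (\<Prod>q\<in>S. 1 - 1 / (real q * (real q - 1)))"

lemma card_shifted_multiples_le:
  assumes a: "a > (0::nat)" and x: "x \<ge> 0"
  shows "real (card {p \<in> primes_upto x. a dvd p - 1}) \<le> x / real a"
proof -
  define K where "K = nat \<lfloor>x / real a\<rfloor>"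
  have "{p \<in> primes_upto x. a dvd p - 1} \<subseteq> (\<lambda>t. a * t + 1) ` {1..K}"
  proof
    fix p assume "p \<in> {p \<in> primes_upto x. a dvd p - 1}"
    then have p: "prime p" "real p \<le> x" "a dvd p - 1" by (auto simp: primes_upto_def)
    then obtain t where t: "p - 1 = a * t" by blast
    have p1: "p > 1" using p prime_gt_1_nat by blast
    then have pt: "p = a * t + 1" using t by simp
    \<comment> \<open>\<open>p > 1\<close> excludes \<open>t = 0\<close>, so the count has no
      additive constant. Such a constant would be fatal when summed over the many large
      \<open>d\<close>.\<close>
    have "t \<ge> 1" using pt p1 by (cases t) auto
    moreover have "real a * real t \<le> x" using p(2) unfolding pt by simp
    then have "real t \<le> x / real a" using a by (simp add: field_simps)
    then have "t \<le> K" using x by (simp add: K_def le_nat_iff le_floor_iff)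
    ultimately show "p \<in> (\<lambda>t. a * t + 1) ` {1..K}" using pt by auto
  qed
  then have "card {p \<in> primes_upto x. a dvd p - 1} \<le> card {1..K}" by (rule surj_card_le[rotated]) simp
  then have "real (card {p \<in> primes_upto x. a dvd p - 1}) \<le> real K" by simp
  also have "\<dots> \<le> x / real a" unfolding K_def using x by simp
  finally show ?thesis .
qed

text \<open>At the primes of \<open>S\<close> only divisibility by \<open>m\<close> is prescribed;
  exact exponents are obtained later by taking differences.\<close>

lemma squarefree_shifted_primes_count:
  fixes H :: real
  assumes S: "finite S" "\<And>q. q \<in> S \<Longrightarrow> prime q" and m: "m > 0" "prime_factors m \<subseteq> S" and H: "H > 0"
  obtains C where "C \<ge> 0" "\<And>x. x \<ge> 2 \<Longrightarrow> \<bar>real (card {p \<in> primes_upto x. m dvd p - 1 \<and> S_squarefree S (p - 1)})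
    - artin_outside S / real (totient m) * Li x\<bar> \<le> C * (x / ln x powr H)"
proof -
  \<comment> \<open>Summing the error over \<open>d \<le> D\<close> with moduli
    \<open>m * d^2\<close> costs \<open>D ^ 3\<close>, about \<open>L powr (6 * H)\<close>, so that
    \<open>7 * H\<close> leaves a saving of \<open>L powr H\<close>.\<close>
  have H7: "7 * H > 0" using H by simp
  obtain C1 where C1: "C1 \<ge> 1" "\<And>q x. \<lbrakk>q > 0; x \<ge> 2\<rbrakk> \<Longrightarrow>
    \<bar>real (card {p \<in> primes_upto x. [p = 1] (mod q)}) - Li x / real (totient q)\<bar> \<le> C1 * real q * (x / ln x powr (7 * H))"
    using primes_cong_1_count[OF H7] by blast
  \<comment> \<open>Compensates for rounding \<open>D\<close> up when \<open>L\<close> is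
    small.\<close>
  define K where "K = 1 + ln 2 powr (- (2 * H))"
  have K: "K \<ge> 0" by (simp add: K_def)
  show ?thesis
  proof (rule that[of "C1 * real m * K ^ 3 + 10"])
    show "C1 * real m * K ^ 3 + 10 \<ge> 0" using C1 K by simp
    fix x :: real assume x: "x \<ge> 2"
    define L where "L = ln x"
    have L2: "L \<ge> ln 2" unfolding L_def using x by (subst ln_le_cancel_iff) auto
    have L0: "L > 0" using L2 ln_gt_zero[of 2] by linarith
    \<comment> \<open>The \<open>d > D\<close> contribute about \<open>x * D powr (- (1/2))\<close>,
      and this has to be of order \<open>x * L powr (- H)\<close>.\<close>
    define D where "D = nat \<lceil>L powr (2 * H)\<rceil>"
    have Lp: "L powr (2 * H) > 0" using L0 by simp
    have D1: "D \<ge> 1" unfolding D_def using Lp by linarith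
    have DL: "real D \<ge> L powr (2 * H)" unfolding D_def by linarith
    have DK: "real D \<le> K * L powr (2 * H)"
    proof -
      have "real D \<le> L powr (2 * H) + 1" unfolding D_def using Lp by linarith
      also have "1 = ln 2 powr (- (2 * H)) * ln 2 powr (2 * H)" by (simp flip: powr_add)
      also have "\<dots> \<le> ln 2 powr (- (2 * H)) * L powr (2 * H)" using L2 H by (intro mult_left_mono powr_mono2) auto
      finally show ?thesis by (simp add: K_def algebra_simps)
    qed
    have Dh: "real D powr (- (1/2)) \<le> L powr (- H)"
    proof -
      have "real D powr (- (1/2)) \<le> (L powr (2 * H)) powr (- (1/2))" using Lp DL by (intro powr_mono2') auto
      then show ?thesis by (simp add: powr_powr)
    qed
    define N where "N = nat \<lfloor>x\<rfloor>"
    \<comment> \<open>At least every \<open>p - 1\<close> that occurs, and at least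
      \<open>D\<close>.\<close>
    define W where "W = D + N"
    define Pm where "Pm = {p \<in> primes_upto x. m dvd p - 1}"
    have finPm: "finite Pm" using finite_primes_upto[of x] by (simp add: Pm_def)
    define c where "c = (\<lambda>d. real (card {p \<in> Pm. d\<^sup>2 dvd p - 1}))"
    let ?s = "sqf_sign S"
    have count: "real (card {p \<in> primes_upto x. m dvd p - 1 \<and> S_squarefree S (p - 1)}) = (\<Sum>d=1..W. ?s d * c d)"
    proof -
      have "{p \<in> primes_upto x. m dvd p - 1 \<and> S_squarefree S (p - 1)} = {p \<in> Pm. S_squarefree S (p - 1)}" by (auto simp: Pm_def)
      then have "real (card {p \<in> primes_upto x. m dvd p - 1 \<and> S_squarefree S (p - 1)}) = (\<Sum>p\<in>{p \<in> Pm. S_squarefree S (p - 1)}. 1)" by simp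
      also have "\<dots> = (\<Sum>p\<in>Pm. if S_squarefree S (p - 1) then 1 else 0)" by (rule sum.inter_filter[OF finPm])
      also have "\<dots> = (\<Sum>p\<in>Pm. \<Sum>d=1..W. if d\<^sup>2 dvd p - 1 then ?s d else 0)"
      proof (rule sum.cong[OF refl])
        fix p assume "p \<in> Pm"
        then have p: "prime p" "real p \<le> x" by (auto simp: Pm_def primes_upto_def)
        then have "p \<le> N" unfolding N_def using x by (simp add: le_nat_iff le_floor_iff)
        then have "p - 1 \<le> W" "p - 1 > 0" using prime_gt_1_nat[OF p(1)] by (auto simp: W_def)
        then show "(if S_squarefree S (p - 1) then 1 else 0) = (\<Sum>d=1..W. if d\<^sup>2 dvd p - 1 then ?s d else 0)"
          by (subst S_squarefree_expand) auto
      qed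
      also have "\<dots> = (\<Sum>d=1..W. \<Sum>p\<in>Pm. if d\<^sup>2 dvd p - 1 then ?s d else 0)" by (rule sum.swap)
      also have "\<dots> = (\<Sum>d=1..W. ?s d * c d)"
        by (rule sum.cong[OF refl]) (simp add: c_def sum.inter_filter[OF finPm, symmetric])
      finally show ?thesis .
    qed
    have split: "(\<Sum>d=1..W. ?s d * c d) = (\<Sum>d=1..D. ?s d * c d) + (\<Sum>d\<in>{D<..W}. ?s d * c d)"
    proof -
      have "{1..W} = {1..D} \<union> {D<..W}" using D1 by (auto simp: W_def)
      moreover have "(\<Sum>d\<in>{1..D} \<union> {D<..W}. ?s d * c d) = (\<Sum>d=1..D. ?s d * c d) + (\<Sum>d\<in>{D<..W}. ?s d * c d)"
        by (rule sum.union_disjoint) auto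
      ultimately show ?thesis by simp
    qed
    have s1: "\<bar>?s d\<bar> \<le> 1" for d by (simp add: sqf_sign_def)
    have E2: "\<bar>\<Sum>d\<in>{D<..W}. ?s d * c d\<bar> \<le> 2 * (x * L powr (- H))"
    proof -
      have "\<bar>\<Sum>d\<in>{D<..W}. ?s d * c d\<bar> \<le> (\<Sum>d\<in>{D<..W}. x * real d powr (- 1 - 1/2))"
      proof (rule order_trans[OF sum_abs], rule sum_mono)
        fix d assume "d \<in> {D<..W}"
        then have d: "real d \<ge> 1" "d > 0" by auto
        have "c d \<le> real (card {p \<in> primes_upto x. d\<^sup>2 dvd p - 1})"
          unfolding c_def using finite_primes_upto by (intro of_nat_mono card_mono) (auto simp: Pm_def)
        also have "\<dots> \<le> x / real (d\<^sup>2)" using d x by (intro card_shifted_multiples_le) auto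
        also have "\<dots> = x * real d powr (- 2)" using d by (simp add: powr_minus powr_numeral divide_inverse)
        also have "\<dots> \<le> x * real d powr (- 1 - 1/2)" using d x by (intro mult_left_mono powr_mono) auto
        finally have "c d \<le> x * real d powr (- 1 - 1/2)" .
        moreover have "\<bar>?s d * c d\<bar> \<le> 1 * c d" unfolding abs_mult using s1[of d] by (intro mult_mono) (auto simp: c_def)
        ultimately show "\<bar>?s d * c d\<bar> \<le> x * real d powr (- 1 - 1/2)" by simp
      qed
      also have "\<dots> = x * (\<Sum>d\<in>{D<..W}. real d powr (- 1 - 1/2))" by (simp only: sum_distrib_left)
      also have "\<dots> \<le> x * (real D powr (- (1/2)) / (1/2))" using D1 x by (intro mult_left_mono sum_powr_tail) auto
      also have "\<dots> \<le> x * (L powr (- H) / (1/2))" using Dh x by (intro mult_left_mono divide_right_mono) auto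
      finally show ?thesis by simp
    qed
    define ph where "ph = real (totient m)"
    have ph: "ph \<ge> 1" using m by (simp add: ph_def Suc_le_eq)
    have E1: "\<bar>(\<Sum>d=1..D. ?s d * c d) - (\<Sum>d=1..D. ?s d / sqf_weight d) / ph * Li x\<bar> \<le> C1 * real m * K ^ 3 * (x * L powr (- H))"
    proof -
      have "\<bar>(\<Sum>d=1..D. ?s d * c d) - (\<Sum>d=1..D. ?s d / sqf_weight d) / ph * Li x\<bar> = \<bar>\<Sum>d=1..D. ?s d * c d - ?s d / sqf_weight d / ph * Li x\<bar>"
        by (simp add: sum_subtractf sum_divide_distrib sum_distrib_right)
      also have "\<dots> \<le> (\<Sum>d=1..D. C1 * (real m * (real D)\<^sup>2) * (x * L powr (- (7 * H))))"
      proof (rule order_trans[OF sum_abs], rule sum_mono)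
        fix d assume d: "d \<in> {1..D}"
        show "\<bar>?s d * c d - ?s d / sqf_weight d / ph * Li x\<bar> \<le> C1 * (real m * (real D)\<^sup>2) * (x * L powr (- (7 * H)))"
        proof (cases "squarefree d \<and> prime_factors d \<inter> S = {}")
          case False
          then have "?s d = 0" by (auto simp: sqf_sign_def)
          then show ?thesis using C1 x by simp
        next
          case True
          \<comment> \<open>The primes of \<open>m\<close> lie in \<open>S\<close> and those of
            \<open>d\<close> do not, so the two divisibility conditions merge into one congruence
            modulo \<open>m * d^2\<close>.\<close>
          have cop: "coprime m d"
          proof (rule ccontr)
            assume "\<not> coprime m d"
            then have "gcd m d \<noteq> 1" unfolding coprime_iff_gcd_eq_1 .
            then obtain q where "prime q" "q dvd gcd m d" using prime_factor_nat by blast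
            then have "q \<in> prime_factors m" "q \<in> prime_factors d" using m d by (auto simp: in_prime_factors_iff)
            then show False using True m by auto
          qed
          have "{p \<in> Pm. d\<^sup>2 dvd p - 1} = {p \<in> primes_upto x. [p = 1] (mod m * d\<^sup>2)}"
          proof -
            have "m dvd p - 1 \<and> d\<^sup>2 dvd p - 1 \<longleftrightarrow> [p = 1] (mod m * d\<^sup>2)" if "p \<in> primes_upto x" for p
            proof -
              have "p \<ge> 1" using that prime_ge_1_nat by (auto simp: primes_upto_def)
              then have "[p = 1] (mod m * d\<^sup>2) \<longleftrightarrow> m * d\<^sup>2 dvd p - 1" by (simp add: cong_altdef_nat)
              also have "\<dots> \<longleftrightarrow> m dvd p - 1 \<and> d\<^sup>2 dvd p - 1"
                using cop by (meson coprime_power_right_iff divides_mult dvd_mult_left dvd_mult_right)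
              finally show ?thesis by simp
            qed
            then show ?thesis by (auto simp: Pm_def)
          qed
          then have cd: "c d = real (card {p \<in> primes_upto x. [p = 1] (mod m * d\<^sup>2)})" by (simp add: c_def)
          have "?s d * c d - ?s d / sqf_weight d / ph * Li x = ?s d * (c d - Li x / (ph * sqf_weight d))" by (simp add: field_simps)
          then have "\<bar>?s d * c d - ?s d / sqf_weight d / ph * Li x\<bar> \<le> 1 * \<bar>c d - Li x / (ph * sqf_weight d)\<bar>"
            unfolding abs_mult[symmetric] by (simp only: abs_mult) (intro mult_right_mono s1, simp)
          also have "\<dots> \<le> C1 * real (m * d\<^sup>2) * (x / ln x powr (7 * H))"
            using C1(2)[of "m * d\<^sup>2" x] m d x True cop unfolding cd totient_mult_square[OF conjunct1[OF True] cop] ph_def by simp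
          also have "\<dots> \<le> C1 * (real m * (real D)\<^sup>2) * (x / ln x powr (7 * H))"
            using C1 d x by (intro mult_right_mono mult_left_mono) (auto intro!: mult_left_mono power_mono)
          also have "x / ln x powr (7 * H) = x * L powr (- (7 * H))" by (simp add: L_def powr_minus divide_inverse)
          finally show ?thesis .
        qed
      qed
      also have "\<dots> = C1 * real m * (real D) ^ 3 * (x * L powr (- (7 * H)))" by (simp add: power2_eq_square power3_eq_cube)
      also have "\<dots> \<le> C1 * real m * (K * L powr (2 * H)) ^ 3 * (x * L powr (- (7 * H)))"
        using C1 x DK by (intro mult_right_mono mult_left_mono power_mono) auto
      also have "(K * L powr (2 * H)) ^ 3 = K ^ 3 * L powr (6 * H)" using L0 by (simp add: power_mult_distrib powr_power)
      also have "C1 * real m * (K ^ 3 * L powr (6 * H)) * (x * L powr (- (7 * H))) = C1 * real m * K ^ 3 * (x * (L powr (6 * H) * L powr (- (7 * H))))"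
        by (simp add: mult_ac)
      also have "L powr (6 * H) * L powr (- (7 * H)) = L powr (- H)" by (simp flip: powr_add)
      finally show ?thesis .
    qed
    have E3: "\<bar>(\<Sum>d=1..D. ?s d / sqf_weight d) / ph * Li x - artin_outside S / ph * Li x\<bar> \<le> 8 * (x * L powr (- H))"
    proof -
      have "(\<Sum>d=1..D. ?s d / sqf_weight d) / ph * Li x - artin_outside S / ph * Li x = - (artin_outside S - (\<Sum>d=1..D. ?s d / sqf_weight d)) * (Li x / ph)"
        by (simp add: diff_divide_distrib algebra_simps)
      then have "\<bar>(\<Sum>d=1..D. ?s d / sqf_weight d) / ph * Li x - artin_outside S / ph * Li x\<bar> = \<bar>artin_outside S - (\<Sum>d=1..D. ?s d / sqf_weight d)\<bar> * \<bar>Li x / ph\<bar>"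
        by (simp only: abs_mult abs_minus_cancel)
      also have "\<dots> \<le> (4 * L powr (- H)) * (2 * x)"
      proof (intro mult_mono)
        show "\<bar>artin_outside S - (\<Sum>d=1..D. ?s d / sqf_weight d)\<bar> \<le> 4 * L powr (- H)"
          using artin_approx[OF S D1] Dh unfolding artin_outside_def by linarith
        have "Li x / ph \<le> Li x / 1" using Li_bounds[OF x] ph by (intro divide_left_mono) auto
        then show "\<bar>Li x / ph\<bar> \<le> 2 * x" using Li_bounds[OF x] ph by simp
      qed auto
      finally show ?thesis by (simp add: mult_ac)
    qed
    have tri: "\<bar>a + b - e\<bar> \<le> A + 10 * Y" if "\<bar>a - b'\<bar> \<le> A" "\<bar>b\<bar> \<le> 2 * Y" "\<bar>b' - e\<bar> \<le> 8 * Y" for a b b' e A Y :: real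
      using that by linarith
    have "\<bar>(\<Sum>d=1..W. ?s d * c d) - artin_outside S / ph * Li x\<bar> \<le> (C1 * real m * K ^ 3 + 10) * (x * L powr (- H))"
      unfolding split distrib_right by (rule tri[OF E1 E2 E3])
    then show "\<bar>real (card {p \<in> primes_upto x. m dvd p - 1 \<and> S_squarefree S (p - 1)}) - artin_outside S / real (totient m) * Li x\<bar> \<le> (C1 * real m * K ^ 3 + 10) * (x / ln x powr H)"
      unfolding count ph_def L_def by (simp add: powr_minus divide_inverse)
  qed
qed

section \<open>Prescribed exponents at the primes of \<open>S\<close>\<close>

lemma prod_diff_expand:
  fixes h :: "'a \<Rightarrow> nat \<Rightarrow> real" and f :: "'a \<Rightarrow> nat"
  assumes S: "finite S"
  shows "(\<Prod>q\<in>S. h q (f q) - h q (Suc (f q))) = (\<Sum>T\<in>Pow S. (- 1) ^ card T * (\<Prod>q\<in>S. h q (f q + of_bool (q \<in> T))))"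
proof -
  have "(\<Prod>q\<in>S. h q (f q) - h q (Suc (f q))) = (\<Prod>q\<in>S. - h q (Suc (f q)) + h q (f q))" by simp
  also have "\<dots> = (\<Sum>T\<in>Pow S. (\<Prod>q\<in>T. - h q (Suc (f q))) * (\<Prod>q\<in>S - T. h q (f q)))" by (rule prod_add[OF S])
  also have "\<dots> = (\<Sum>T\<in>Pow S. (- 1) ^ card T * (\<Prod>q\<in>S. h q (f q + of_bool (q \<in> T))))"
  proof (rule sum.cong[OF refl])
    fix T assume "T \<in> Pow S"
    then have "(\<Prod>q\<in>S. h q (f q + of_bool (q \<in> T))) = (\<Prod>q\<in>S - T. h q (f q + of_bool (q \<in> T))) * (\<Prod>q\<in>T. h q (f q + of_bool (q \<in> T)))"
      using S by (intro prod.subset_diff) auto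
    then show "(\<Prod>q\<in>T. - h q (Suc (f q))) * (\<Prod>q\<in>S - T. h q (f q)) = (- 1) ^ card T * (\<Prod>q\<in>S. h q (f q + of_bool (q \<in> T)))"
      by (simp add: prod_uminus)
  qed
  finally show ?thesis .
qed

lemma prime_powers_coprime_prod:
  fixes e :: "nat \<Rightarrow> nat"
  assumes "finite S" "\<And>q. q \<in> S \<Longrightarrow> prime q" "prime p" "p \<notin> S"
  shows "coprime (p ^ a) (\<Prod>q\<in>S. q ^ e q)"
  using assms by (intro prod_coprime_right) (auto intro!: primes_coprime simp: coprime_power_left_iff coprime_power_right_iff)

lemma totient_prod_prime_powers:
  fixes e :: "nat \<Rightarrow> nat"
  assumes "finite S" "\<And>q. q \<in> S \<Longrightarrow> prime q"
  shows "totient (\<Prod>q\<in>S. q ^ e q) = (\<Prod>q\<in>S. totient (q ^ e q))"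
  using assms
proof (induction S rule: finite_induct)
  case (insert p S)
  then show ?case using prime_powers_coprime_prod[of S p "e p" e] by (simp add: totient_mult_coprime)
qed simp

lemma prod_prime_powers_dvd_iff:
  fixes e :: "nat \<Rightarrow> nat"
  assumes "finite S" "\<And>q. q \<in> S \<Longrightarrow> prime q"
  shows "(\<Prod>q\<in>S. q ^ e q) dvd n \<longleftrightarrow> (\<forall>q\<in>S. q ^ e q dvd n)"
  using assms
proof (induction S rule: finite_induct)
  case (insert p S)
  have "p ^ e p * (\<Prod>q\<in>S. q ^ e q) dvd n \<longleftrightarrow> p ^ e p dvd n \<and> (\<Prod>q\<in>S. q ^ e q) dvd n"
    using prime_powers_coprime_prod[of S p "e p" e] insert by (meson divides_mult dvd_mult_left dvd_mult_right insertCI)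
  then show ?case using insert by simp
qed simp

text \<open>The density of the primes \<open>p\<close> for which \<open>q\<close> has exponent \<open>e\<close> in \<open>p - 1\<close>.\<close>

definition val_density :: "nat \<Rightarrow> nat \<Rightarrow> real" where
  "val_density q e = 1 / real (totient (q ^ e)) - 1 / real (totient (q ^ Suc e))"

text \<open>An exact exponent is a difference of two divisibility conditions. Expanding the product
  of these differences over \<open>S\<close> yields the moduli \<open>M T\<close>, and since
  \<open>totient\<close> is multiplicative the same expansion of the differences of
  \<open>1 / totient\<close> produces the densities.\<close>

lemma valuation_count:
  fixes H :: real and f :: "nat \<Rightarrow> nat"
  assumes S: "finite S" "\<And>q. q \<in> S \<Longrightarrow> prime q" and H: "H > 0"
  shows "\<exists>C\<ge>0. \<forall>x\<ge>2. \<bar>real (card {p \<in> primes_upto x. S_squarefree S (p - 1) \<and> (\<forall>q\<in>S. multiplicity q (p - 1) = f q)})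
    - artin_outside S * (\<Prod>q\<in>S. val_density q (f q)) * Li x\<bar> \<le> C * (x / ln x powr H)"
proof -
  define e where "e = (\<lambda>T q. f q + of_bool (q \<in> T))"
  define M where "M = (\<lambda>T. \<Prod>q\<in>S. q ^ e T q)"
  have Mpos: "M T > 0" for T unfolding M_def using S prime_gt_0_nat by (intro prod_pos) auto
  have Mpf: "prime_factors (M T) \<subseteq> S" for T
  proof
    fix p assume "p \<in> prime_factors (M T)"
    then have p: "prime p" "p dvd (\<Prod>q\<in>S. q ^ e T q)" by (auto simp: M_def)
    then obtain q where "q \<in> S" "p dvd q ^ e T q" using S by (auto simp: prime_dvd_prod_iff)
    then show "p \<in> S" using p S by (metis prime_dvd_power primes_dvd_imp_eq)
  qed
  define c where "c = (\<lambda>T x. real (card {p \<in> primes_upto x. M T dvd p - 1 \<and> S_squarefree S (p - 1)}))"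
  have "\<exists>C\<ge>0. \<forall>x\<ge>2. \<bar>c T x - artin_outside S / real (totient (M T)) * Li x\<bar> \<le> C * (x / ln x powr H)" for T
    unfolding c_def by (rule squarefree_shifted_primes_count[OF S Mpos[of T] Mpf[of T] H]) blast+
  then obtain C where C: "\<And>T. C T \<ge> 0" "\<And>T x. x \<ge> 2 \<Longrightarrow> \<bar>c T x - artin_outside S / real (totient (M T)) * Li x\<bar> \<le> C T * (x / ln x powr H)"
    by metis
  show ?thesis
  proof (intro exI[of _ "\<Sum>T\<in>Pow S. C T"] conjI allI impI)
    show "(\<Sum>T\<in>Pow S. C T) \<ge> 0" using C by (intro sum_nonneg) auto
    fix x :: real assume x: "x \<ge> 2"
    have ind: "(if \<forall>q\<in>S. multiplicity q n = f q then 1 else 0) = (\<Sum>T\<in>Pow S. (- 1) ^ card T * (if M T dvd n then 1 else (0::real)))" if n: "n > 0" for n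
    proof -
      define h where "h = (\<lambda>q i. if q ^ i dvd n then 1 else (0::real))"
      have hd: "h q (f q) - h q (Suc (f q)) = (if multiplicity q n = f q then 1 else 0)" if "q \<in> S" for q
      proof -
        have q: "q ^ i dvd n \<longleftrightarrow> i \<le> multiplicity q n" for i
          using S(2)[OF that] n by (subst power_dvd_iff_le_multiplicity) (auto simp: prime_gt_1_nat)
        show ?thesis unfolding h_def q by auto
      qed
      have "(if \<forall>q\<in>S. multiplicity q n = f q then 1 else 0) = (\<Prod>q\<in>S. h q (f q) - h q (Suc (f q)))"
        using S(1) by (auto simp: hd intro!: prod.neutral[symmetric] prod_zero[symmetric])
      also have "\<dots> = (\<Sum>T\<in>Pow S. (- 1) ^ card T * (\<Prod>q\<in>S. h q (e T q)))" unfolding e_def by (rule prod_diff_expand[OF S(1)])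
      also have "\<dots> = (\<Sum>T\<in>Pow S. (- 1) ^ card T * (if M T dvd n then 1 else 0))"
      proof (intro sum.cong refl arg_cong2[where f="(*)"])
        fix T
        have "M T dvd n \<longleftrightarrow> (\<forall>q\<in>S. q ^ e T q dvd n)" unfolding M_def by (rule prod_prime_powers_dvd_iff[OF S])
        then show "(\<Prod>q\<in>S. h q (e T q)) = (if M T dvd n then 1 else 0)"
          using S(1) by (auto simp: h_def)
      qed
      finally show ?thesis .
    qed
    let ?P = "{p \<in> primes_upto x. S_squarefree S (p - 1)}"
    have finP: "finite ?P" using finite_primes_upto by simp
    have "real (card {p \<in> primes_upto x. S_squarefree S (p - 1) \<and> (\<forall>q\<in>S. multiplicity q (p - 1) = f q)}) = (\<Sum>p\<in>{p\<in>?P. \<forall>q\<in>S. multiplicity q (p - 1) = f q}. 1)"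
      by (simp add: conj_assoc)
    also have "\<dots> = (\<Sum>p\<in>?P. if \<forall>q\<in>S. multiplicity q (p - 1) = f q then 1 else 0)" by (rule sum.inter_filter[OF finP])
    also have "\<dots> = (\<Sum>p\<in>?P. \<Sum>T\<in>Pow S. (- 1) ^ card T * (if M T dvd p - 1 then 1 else 0))"
    proof (rule sum.cong[OF refl])
      fix p assume "p \<in> ?P"
      then have "p - 1 > 0" using prime_gt_1_nat by (auto simp: primes_upto_def)
      then show "(if \<forall>q\<in>S. multiplicity q (p - 1) = f q then 1 else 0) = (\<Sum>T\<in>Pow S. (- 1) ^ card T * (if M T dvd p - 1 then 1 else (0::real)))"
        by (rule ind)
    qed
    also have "\<dots> = (\<Sum>T\<in>Pow S. (- 1) ^ card T * (\<Sum>p\<in>?P. if M T dvd p - 1 then 1 else 0))"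
      unfolding sum_distrib_left by (rule sum.swap)
    also have "\<dots> = (\<Sum>T\<in>Pow S. (- 1) ^ card T * c T x)"
    proof (intro sum.cong refl arg_cong2[where f="(*)"])
      fix T
      have "(\<Sum>p\<in>?P. if M T dvd p - 1 then 1 else 0) = (\<Sum>p\<in>{p\<in>?P. M T dvd p - 1}. 1 :: real)" by (rule sum.inter_filter[OF finP, symmetric])
      also have "{p\<in>?P. M T dvd p - 1} = {p \<in> primes_upto x. M T dvd p - 1 \<and> S_squarefree S (p - 1)}" by auto
      finally show "(\<Sum>p\<in>?P. if M T dvd p - 1 then 1 else 0) = c T x" by (simp add: c_def)
    qed
    finally have cnt: "real (card {p \<in> primes_upto x. S_squarefree S (p - 1) \<and> (\<forall>q\<in>S. multiplicity q (p - 1) = f q)}) = (\<Sum>T\<in>Pow S. (- 1) ^ card T * c T x)" .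
    have dens: "(\<Prod>q\<in>S. val_density q (f q)) = (\<Sum>T\<in>Pow S. (- 1) ^ card T * (1 / real (totient (M T))))"
      unfolding val_density_def prod_diff_expand[OF S(1), of "\<lambda>q i. 1 / real (totient (q ^ i))"]
      by (simp add: M_def e_def totient_prod_prime_powers[OF S] prod_dividef)
    have "\<bar>(\<Sum>T\<in>Pow S. (- 1) ^ card T * c T x) - artin_outside S * (\<Prod>q\<in>S. val_density q (f q)) * Li x\<bar>
       = \<bar>\<Sum>T\<in>Pow S. (- 1) ^ card T * (c T x - artin_outside S / real (totient (M T)) * Li x)\<bar>"
      unfolding dens by (simp add: sum_distrib_left sum_distrib_right sum_subtractf algebra_simps)
    also have "\<dots> \<le> (\<Sum>T\<in>Pow S. C T * (x / ln x powr H))"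
      by (rule order_trans[OF sum_abs], rule sum_mono) (use C(2)[OF x] in \<open>simp add: abs_mult power_abs\<close>)
    also have "\<dots> = (\<Sum>T\<in>Pow S. C T) * (x / ln x powr H)" by (simp only: sum_distrib_right)
    finally show "\<bar>real (card {p \<in> primes_upto x. S_squarefree S (p - 1) \<and> (\<forall>q\<in>S. multiplicity q (p - 1) = f q)})
    - artin_outside S * (\<Prod>q\<in>S. val_density q (f q)) * Li x\<bar> \<le> (\<Sum>T\<in>Pow S. C T) * (x / ln x powr H)" unfolding cnt .
  qed
qed

lemma val_density_values:
  assumes "prime q"
  shows "val_density q 0 = (real q - 2) / (real q - 1)" "val_density q (Suc i) = 1 / real q ^ Suc i"
proof -
  have q: "real q \<ge> 2" using prime_ge_2_nat[OF assms] by simp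
  have t: "real (totient (q ^ Suc i)) = real q ^ i * (real q - 1)" for i
    using totient_prime_power_Suc[OF assms, of i] prime_ge_1_nat[OF assms] by (simp add: of_nat_diff)
  show "val_density q 0 = (real q - 2) / (real q - 1)"
    using q t[of 0] by (simp add: val_density_def field_simps)
  show "val_density q (Suc i) = 1 / real q ^ Suc i"
  proof -
    have nz: "real q \<noteq> 0" "real q ^ i \<noteq> 0" "real q - 1 \<noteq> 0" using q by auto
    have "1 / (real q ^ i * (real q - 1)) = real q / (real q ^ Suc i * (real q - 1))" using nz by simp
    then have "val_density q (Suc i) = (real q - 1) / (real q ^ Suc i * (real q - 1))"
      unfolding val_density_def t by (simp only: diff_divide_distrib)
    also have "\<dots> = 1 / real q ^ Suc i" using nz by simp
    finally show ?thesis .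
  qed
qed

section \<open>Absolute moments of the Ramanujan sums\<close>

text \<open>With \<open>v\<close> the exponent of \<open>q\<close> in \<open>k\<close>, the terms
  for exponents \<open>1, ..., v\<close> form a geometric progression with ratio
  \<open>q powr (z - 1)\<close>, whence \<open>z \<noteq> 1\<close> and the denominator in
  \<open>local_factor\<close>; exponents 0 and \<open>v + 1\<close> are boundary terms. The Euler
  factor of Artin's constant is split off because \<open>artin_outside\<close> lacks it.\<close>

lemma local_density_sum:
  fixes z :: real
  assumes q: "prime q" and z: "z \<noteq> 1"
  shows "(\<Sum>i\<le>Suc (multiplicity q k). \<bar>rloc q (multiplicity q k) i\<bar> powr z * val_density q i) =
    (1 - 1 / (real q * (real q - 1))) * local_factor k z q"
proof -
  define v where "v = multiplicity q k"
  define Q where "Q = real q"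
  define r where "r = Q powr (z - 1)"
  define w where "w = (Q - 1) powr z"
  have Q: "Q \<ge> 2" using prime_ge_2_nat[OF q] by (simp add: Q_def)
  have r1: "r \<noteq> 1" unfolding r_def using Q z by (simp add: powr_eq_one_iff_gen)
  have Qz: "Q powr z = Q * r" unfolding r_def using Q powr_add[of Q 1 "z - 1"] by simp
  have Qi: "(Q ^ i) powr z = Q ^ i * r ^ i" for i
    by (induction i) (use Q in \<open>auto simp: powr_mult Qz\<close>)
  have t0: "\<bar>rloc q v 0\<bar> powr z * val_density q 0 = (Q - 2) / (Q - 1)"
    by (simp add: rloc_def val_density_values[OF q] Q_def)
  have ti: "\<bar>rloc q v (Suc i)\<bar> powr z * val_density q (Suc i) = w / Q * r ^ i" if "i < v" for i
  proof -
    have "\<bar>rloc q v (Suc i)\<bar> = Q ^ i * (Q - 1)" using that Q by (simp add: rloc_def Q_def)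
    then have "\<bar>rloc q v (Suc i)\<bar> powr z = Q ^ i * r ^ i * w" using Q by (simp add: powr_mult Qi w_def)
    then show ?thesis using Q by (simp add: val_density_values[OF q] Q_def[symmetric])
  qed
  have tv: "\<bar>rloc q v (Suc v)\<bar> powr z * val_density q (Suc v) = r ^ v / Q"
  proof -
    have "\<bar>rloc q v (Suc v)\<bar> = Q ^ v" using Q by (simp add: rloc_def Q_def)
    then show ?thesis using Q Qi[of v] by (simp add: val_density_values[OF q] Q_def[symmetric])
  qed
  have "(\<Sum>i\<le>Suc v. \<bar>rloc q v i\<bar> powr z * val_density q i) = (Q - 2) / (Q - 1) + (\<Sum>i<v. w / Q * r ^ i) + r ^ v / Q"
  proof -
    have "(\<Sum>i\<le>Suc v. \<bar>rloc q v i\<bar> powr z * val_density q i) = \<bar>rloc q v 0\<bar> powr z * val_density q 0 + (\<Sum>i\<le>v. \<bar>rloc q v (Suc i)\<bar> powr z * val_density q (Suc i))"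
      by (rule sum.atMost_Suc_shift)
    also have "(\<Sum>i\<le>v. \<bar>rloc q v (Suc i)\<bar> powr z * val_density q (Suc i)) = (\<Sum>i<v. \<bar>rloc q v (Suc i)\<bar> powr z * val_density q (Suc i)) + r ^ v / Q"
      using tv by (simp add: lessThan_Suc_atMost[symmetric])
    also have "(\<Sum>i<v. \<bar>rloc q v (Suc i)\<bar> powr z * val_density q (Suc i)) = (\<Sum>i<v. w / Q * r ^ i)"
      by (intro sum.cong refl ti) simp
    finally show ?thesis using t0 by simp
  qed
  also have "(\<Sum>i<v. w / Q * r ^ i) = w / Q * ((r ^ v - 1) / (r - 1))"
    unfolding sum_distrib_left[symmetric] using geometric_sum[OF r1] by simp
  \<comment> \<open>From here on it is algebra: \<open>Q^2 - Q - 1\<close> is the numerator of the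
    Euler factor and cancels.\<close>
  also have "(Q - 2) / (Q - 1) + w / Q * ((r ^ v - 1) / (r - 1)) + r ^ v / Q
     = (1 - 1 / (Q * (Q - 1))) * (1 + (r ^ v - 1) * (Q - 1) * (w + r - 1) / ((Q\<^sup>2 - Q - 1) * (r - 1)))"
  proof -
    have n1: "Q\<^sup>2 - Q - 1 \<noteq> 0"
    proof -
      have "Q * Q \<ge> 2 * Q" using Q by (intro mult_right_mono) auto
      then show ?thesis using Q unfolding power2_eq_square by linarith
    qed
    have n2: "Q \<noteq> 0" "Q - 1 \<noteq> 0" "r - 1 \<noteq> 0" using Q r1 by auto
    have a: "1 - 1 / (Q * (Q - 1)) = (Q\<^sup>2 - Q - 1) / (Q * (Q - 1))" using n2 by (simp add: field_simps power2_eq_square)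
    have dl: "a * (1 + b) = a + a * b" for a b :: real by (simp add: distrib_left)
    have wr: "w + r - 1 = w + (r - 1)" by simp
    have gen: "c / (Q * b) * (u * b * t / (c * s)) = u * t / (Q * s)" if "c \<noteq> 0" "b \<noteq> 0" for b c s t u :: real
      using that by simp
    have e1: "(1 - 1 / (Q * (Q - 1))) * (1 + (r ^ v - 1) * (Q - 1) * (w + r - 1) / ((Q\<^sup>2 - Q - 1) * (r - 1)))
      = (1 - 1 / (Q * (Q - 1))) + (r ^ v - 1) * (w + (r - 1)) / (Q * (r - 1))"
      unfolding dl wr a gen[OF n1 n2(2)] ..
    have e2: "(r ^ v - 1) * (w + (r - 1)) / (Q * (r - 1)) = w / Q * ((r ^ v - 1) / (r - 1)) + (r ^ v - 1) / Q"
      using n2 by (simp add: distrib_left add_divide_distrib)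
    have e3: "1 - 1 / (Q * (Q - 1)) = (Q - 2) / (Q - 1) + 1 / Q" using n2 by (simp add: field_simps)
    have e4: "(r ^ v - 1) / Q = r ^ v / Q - 1 / Q" by (rule diff_divide_distrib)
    show ?thesis using e1 e2 e3 e4 by linarith
  qed
  also have "r ^ v = Q powr (real v * (z - 1))" unfolding r_def using Q by (simp add: powr_powr mult.commute powr_realpow[symmetric, of "Q powr (z - 1)"])
  finally show ?thesis unfolding local_factor_def v_def Q_def r_def w_def .
qed

text \<open>The parameter \<open>z\<close> enters through finitely many weights, one for each
  exponent vector in \<open>E\<close>, while the counts \<open>N f x\<close> do not involve it. The
  error is therefore uniform on bounded ranges of \<open>z\<close>, also near
  \<open>z = 1\<close>.\<close>

theorem ramanujan_sum_moments:
  assumes k: "k > 0" and H: "H > 0" and Z: "Z > (0::real)"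
  shows "\<exists>C. \<forall>z x. 0 < z \<and> z \<le> Z \<and> z \<noteq> 1 \<and> x \<ge> 2 \<longrightarrow>
    \<bar>(\<Sum>p\<in>primes_upto x. cmod (ramanujan_sum (p - 1) k) powr z)
      - artin_constant * (\<Prod>q\<in>prime_factors k. local_factor k z q) * Li x\<bar> \<le> C * (x / ln x powr H)"
proof -
  define S where "S = prime_factors k"
  have S: "finite S" "\<And>q. q \<in> S \<Longrightarrow> prime q" by (auto simp: S_def)
  define E where "E = (\<Pi>\<^sub>E q\<in>S. {..Suc (multiplicity q k)})"
  have finE: "finite E" unfolding E_def using S by (intro finite_PiE) auto
  define R where "R = (\<lambda>q i. \<bar>rloc q (multiplicity q k) i\<bar>)"
  define N where "N = (\<lambda>f x. real (card {p \<in> primes_upto x. S_squarefree S (p - 1) \<and> (\<forall>q\<in>S. multiplicity q (p - 1) = f q)}))"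
  have "\<exists>C\<ge>0. \<forall>x\<ge>2. \<bar>N f x - artin_outside S * (\<Prod>q\<in>S. val_density q (f q)) * Li x\<bar> \<le> C * (x / ln x powr H)" for f
    unfolding N_def by (rule valuation_count[OF S H])
  then obtain C where C: "\<And>f. C f \<ge> 0" "\<And>f x. x \<ge> 2 \<Longrightarrow> \<bar>N f x - artin_outside S * (\<Prod>q\<in>S. val_density q (f q)) * Li x\<bar> \<le> C f * (x / ln x powr H)"
    by metis
  \<comment> \<open>Adding 1 makes the base at least 1, so that the power increases with the
    exponent and the value at \<open>Z\<close> dominates those at all
    \<open>z \<le> Z\<close>.\<close>
  define G where "G = (\<lambda>f. \<Prod>q\<in>S. (1 + R q (f q)) powr Z)"
  show ?thesis
  proof (intro exI[of _ "\<Sum>f\<in>E. G f * C f"] allI impI, elim conjE)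
    fix z x :: real assume z: "0 < z" "z \<le> Z" "z \<noteq> 1" and x: "x \<ge> 2"
    define g where "g = (\<lambda>q i. R q i powr z)"
    have R0: "R q i \<ge> 0" for q i by (simp add: R_def)
    have expd: "cmod (ramanujan_sum (p - 1) k) powr z = (\<Sum>f\<in>E. (\<Prod>q\<in>S. g q (f q)) * (if S_squarefree S (p - 1) \<and> (\<forall>q\<in>S. multiplicity q (p - 1) = f q) then 1 else 0))"
      if "p \<in> primes_upto x" for p
    proof -
      have p: "p - 1 > 0" using that prime_gt_1_nat by (auto simp: primes_upto_def)
      have mu: "\<bar>mu_S S n\<bar> powr z = (if S_squarefree S n then 1 else 0)" for n by (simp add: mu_S_def power_abs)
      have "cmod (ramanujan_sum (p - 1) k) = \<bar>mu_S S (p - 1)\<bar> * (\<Prod>q\<in>S. R q (multiplicity q (p - 1)))"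
        unfolding ramanujan_sum_eq[OF p k] norm_of_real rprod_mu_S[OF p k] abs_mult abs_prod R_def S_def ..
      then have "cmod (ramanujan_sum (p - 1) k) powr z = (if S_squarefree S (p - 1) then 1 else 0) * (\<Prod>q\<in>S. g q (multiplicity q (p - 1)))"
        unfolding g_def using R0 mu by (simp add: powr_mult prod_nonneg prod_powr_distrib)
      also have "(\<Prod>q\<in>S. g q (multiplicity q (p - 1))) = (\<Sum>f\<in>E. if \<forall>q\<in>S. multiplicity q (p - 1) = f q then \<Prod>q\<in>S. g q (f q) else 0)"
        unfolding E_def by (intro prod_eq_sum_over_values S) (auto simp: g_def R_def rloc_def)
      also have "(if S_squarefree S (p - 1) then 1 else 0) * \<dots> = (\<Sum>f\<in>E. (\<Prod>q\<in>S. g q (f q)) * (if S_squarefree S (p - 1) \<and> (\<forall>q\<in>S. multiplicity q (p - 1) = f q) then 1 else 0))"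
        unfolding sum_distrib_left by (intro sum.cong refl) auto
      finally show ?thesis .
    qed
    have "(\<Sum>p\<in>primes_upto x. cmod (ramanujan_sum (p - 1) k) powr z) = (\<Sum>p\<in>primes_upto x. \<Sum>f\<in>E. (\<Prod>q\<in>S. g q (f q)) * (if S_squarefree S (p - 1) \<and> (\<forall>q\<in>S. multiplicity q (p - 1) = f q) then 1 else 0))"
      by (rule sum.cong[OF refl]) (rule expd)
    also have "\<dots> = (\<Sum>f\<in>E. (\<Prod>q\<in>S. g q (f q)) * (\<Sum>p\<in>primes_upto x. if S_squarefree S (p - 1) \<and> (\<forall>q\<in>S. multiplicity q (p - 1) = f q) then 1 else 0))"
      unfolding sum_distrib_left by (rule sum.swap)
    also have "\<dots> = (\<Sum>f\<in>E. (\<Prod>q\<in>S. g q (f q)) * N f x)"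
      unfolding N_def by (simp add: sum.inter_filter[OF finite_primes_upto, symmetric])
    finally have lhs: "(\<Sum>p\<in>primes_upto x. cmod (ramanujan_sum (p - 1) k) powr z) = (\<Sum>f\<in>E. (\<Prod>q\<in>S. g q (f q)) * N f x)" .
    have "(\<Sum>f\<in>E. (\<Prod>q\<in>S. g q (f q)) * (\<Prod>q\<in>S. val_density q (f q))) = (\<Sum>f\<in>E. \<Prod>q\<in>S. g q (f q) * val_density q (f q))"
      by (simp add: prod.distrib)
    also have "\<dots> = (\<Prod>q\<in>S. \<Sum>i\<le>Suc (multiplicity q k). g q i * val_density q i)"
      unfolding E_def using S by (intro prod_sum_PiE[symmetric]) auto
    also have "\<dots> = (\<Prod>q\<in>S. (1 - 1 / (real q * (real q - 1))) * local_factor k z q)"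
      unfolding g_def R_def using S z by (intro prod.cong refl local_density_sum) auto
    finally have dens: "(\<Sum>f\<in>E. (\<Prod>q\<in>S. g q (f q)) * (\<Prod>q\<in>S. val_density q (f q))) = (\<Prod>q\<in>S. 1 - 1 / (real q * (real q - 1))) * (\<Prod>q\<in>S. local_factor k z q)"
      by (simp only: prod.distrib)
    have nz: "(\<Prod>q\<in>S. 1 - 1 / (real q * (real q - 1))) > 0" using S artin_factor_bounds(1) by (intro prod_pos) auto
    have rhs: "artin_constant * (\<Prod>q\<in>S. local_factor k z q) * Li x = (\<Sum>f\<in>E. (\<Prod>q\<in>S. g q (f q)) * (artin_outside S * (\<Prod>q\<in>S. val_density q (f q)) * Li x))"
    proof -
      have "(\<Sum>f\<in>E. (\<Prod>q\<in>S. g q (f q)) * (artin_outside S * (\<Prod>q\<in>S. val_density q (f q)) * Li x)) = artin_outside S * (\<Sum>f\<in>E. (\<Prod>q\<in>S. g q (f q)) * (\<Prod>q\<in>S. val_density q (f q))) * Li x"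
        unfolding sum_distrib_left sum_distrib_right by (rule sum.cong) (auto simp: mult_ac)
      also have "\<dots> = artin_constant * (\<Prod>q\<in>S. local_factor k z q) * Li x" unfolding dens artin_outside_def using nz by simp
      finally show ?thesis ..
    qed
    have gG: "0 \<le> (\<Prod>q\<in>S. g q (f q)) \<and> (\<Prod>q\<in>S. g q (f q)) \<le> G f" for f
    proof -
      have "g q i \<le> (1 + R q i) powr Z" for q i
      proof -
        have "g q i \<le> (1 + R q i) powr z" unfolding g_def using R0 z by (intro powr_mono2) auto
        also have "\<dots> \<le> (1 + R q i) powr Z" using R0 z by (intro powr_mono) auto
        finally show ?thesis .
      qed
      then show ?thesis unfolding G_def by (auto intro!: prod_nonneg prod_mono simp: g_def)
    qed
    have Y: "x / ln x powr H \<ge> 0" using x by simp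
    have "\<bar>(\<Sum>f\<in>E. (\<Prod>q\<in>S. g q (f q)) * N f x) - (\<Sum>f\<in>E. (\<Prod>q\<in>S. g q (f q)) * (artin_outside S * (\<Prod>q\<in>S. val_density q (f q)) * Li x))\<bar>
      = \<bar>\<Sum>f\<in>E. (\<Prod>q\<in>S. g q (f q)) * (N f x - artin_outside S * (\<Prod>q\<in>S. val_density q (f q)) * Li x)\<bar>"
      by (simp only: sum_subtractf right_diff_distrib)
    also have "\<dots> \<le> (\<Sum>f\<in>E. G f * (C f * (x / ln x powr H)))"
    proof (rule order_trans[OF sum_abs], rule sum_mono)
      fix f
      show "\<bar>(\<Prod>q\<in>S. g q (f q)) * (N f x - artin_outside S * (\<Prod>q\<in>S. val_density q (f q)) * Li x)\<bar> \<le> G f * (C f * (x / ln x powr H))"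
        unfolding abs_mult using gG[of f] C(2)[OF x, of f] by (intro mult_mono) auto
    qed
    also have "\<dots> = (\<Sum>f\<in>E. G f * C f) * (x / ln x powr H)" by (simp only: sum_distrib_right mult.assoc)
    finally show "\<bar>(\<Sum>p\<in>primes_upto x. cmod (ramanujan_sum (p - 1) k) powr z) - artin_constant * (\<Prod>q\<in>prime_factors k. local_factor k z q) * Li x\<bar> \<le> (\<Sum>f\<in>E. G f * C f) * (x / ln x powr H)"
      unfolding lhs S_def[symmetric] rhs .
  qed
qed

theorem theorem7:
  fixes k :: nat
  assumes "k \<ge> 1"
  shows "(\<forall>H Z :: real. H > 0 \<longrightarrow> Z > 0 \<longrightarrow>
            (\<exists>C. \<forall>z x. 0 < z \<and> z \<le> Z \<and> z \<noteq> 1 \<and> x \<ge> 2 \<longrightarrow>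
               \<bar>(\<Sum>p\<in>primes_upto x. cmod (ramanujan_sum (p - 1) k) powr z)
                 - artin_constant * (\<Prod>q\<in>prime_factors k. local_factor k z q) * Li x\<bar>
               \<le> C * (x / ln x powr H)))
       \<and> (conjecture1 \<longrightarrow>
            (\<forall>j :: nat. odd j \<longrightarrow>
               (\<lambda>x. \<Sum>p\<in>primes_upto x. ramanujan_sum (p - 1) k ^ j)
                 \<in> o[at_top](\<lambda>x. complex_of_real (prime_count x))))"
proof -
  have k: "k > 0" using assms by simp
  show ?thesis using ramanujan_sum_moments[OF k] ramanujan_sum_odd_power[OF k] by blast
qed

end
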